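(* Let $U$ be a smooth and bounded domain in $\mathbb{R}^n$, and let $\phi,\psi\in C^{0,1}(\overline{U})$ and $g\in C^{1,1}(\overline{U})$ satisfy $$\phi\le\psi\ \text{in } U\quad\text{and}\quad \phi\le g\le\psi\ \text{on }\partial U.$$ If $u$ is a minimizer of the energy functional $\int_U|\nabla v|^2\,dx$ over the set $$K_{\phi,\psi}=\{v\in H^1(U)\mid \phi\le v\le\psi\ \text{a.e. in }U,\ v=g\ \text{on }\partial U\},$$ then $u\in C^{0,1}(\overline{U})$.
   Context: Here $n\ge2$; $C^{0,1}(\overline{U})$ is the space of Lipschitz continuous functions on $\overline{U}$, $C^{1,1}(\overline U)$ the space of $C^1$ functions on $\overline U$ with Lipschitz gradient, and the boundary condition $v=g$ on $\partial U$ is understood in the sense of Sobolev traces. *)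

theory Defs
  imports "HOL-Analysis.Analysis"
begin

subsection \<open>Smooth functions, test functions, smooth domains\<close>

primrec C_k_on :: "nat \<Rightarrow> 'a::euclidean_space set \<Rightarrow> ('a \<Rightarrow> real) \<Rightarrow> bool" where
  "C_k_on 0 S f \<longleftrightarrow> continuous_on S f"
| "C_k_on (Suc k) S f \<longleftrightarrow> (\<forall>x\<in>S. f differentiable (at x)) \<and>
     (\<forall>b\<in>Basis. C_k_on k S (\<lambda>x. frechet_derivative f (at x) b))"

definition smooth :: "('a::euclidean_space \<Rightarrow> real) \<Rightarrow> bool" where
  "smooth f \<longleftrightarrow> (\<forall>k. C_k_on k UNIV f)"

definition test_function :: "'a::euclidean_space set \<Rightarrow> ('a \<Rightarrow> real) \<Rightarrow> bool" where
  "test_function U \<phi> \<longleftrightarrow> smooth \<phi> \<and>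
     compact (closure {x. \<phi> x \<noteq> 0}) \<and> closure {x. \<phi> x \<noteq> 0} \<subseteq> U"

text \<open>
  Near each boundary point, \<open>U\<close> lies strictly above the graph of a smooth function, where the
  vertical axis may be any direction \<open>e\<close>. The function \<open>\<gamma>\<close> is defined on the whole
  space, but is only evaluated at the projection of \<open>x\<close> to the hyperplane orthogonal to \<open>e\<close>.
\<close>
definition smooth_boundary :: "'a::euclidean_space set \<Rightarrow> bool" where
  "smooth_boundary U \<longleftrightarrow> (\<forall>x0\<in>frontier U. \<exists>r>0. \<exists>e \<gamma>. norm e = 1 \<and> smooth \<gamma> \<and>
     U \<inter> ball x0 r = {x \<in> ball x0 r. \<gamma> (x - (x \<bullet> e) *\<^sub>R e) < x \<bullet> e})"

definition smooth_bounded_domain :: "'a::euclidean_space set \<Rightarrow> bool" where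
  "smooth_bounded_domain U \<longleftrightarrow>
     open U \<and> connected U \<and> U \<noteq> {} \<and> bounded U \<and> smooth_boundary U"


subsection \<open>The spaces $C^{0,1}$ and $C^{1,1}$ on the closure\<close>

definition C01 :: "'a::euclidean_space set \<Rightarrow> ('a \<Rightarrow> real) set" where
  "C01 U = {f. \<exists>L. L-lipschitz_on (closure U) f}"

definition C11 :: "'a::euclidean_space set \<Rightarrow> ('a \<Rightarrow> real) set" where
  "C11 U = {f. continuous_on (closure U) f \<and>
     (\<exists>G L. (\<forall>x\<in>U. GDERIV f x :> G x) \<and> L-lipschitz_on (closure U) G)}"


subsection \<open>The Sobolev space $H^1$\<close>

text \<open>
  Elements of \<open>L2 U\<close> and \<open>H1 U\<close> are functions rather than equivalence classes; only
  their values almost everywhere in \<open>U\<close> matter.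
\<close>
definition L2 :: "'a::euclidean_space set \<Rightarrow> ('a \<Rightarrow> 'b::euclidean_space) set" where
  "L2 U = {f. f \<in> borel_measurable (lebesgue_on U) \<and>
     integrable (lebesgue_on U) (\<lambda>x. (norm (f x))\<^sup>2)}"

definition is_weak_gradient ::
    "'a::euclidean_space set \<Rightarrow> ('a \<Rightarrow> real) \<Rightarrow> ('a \<Rightarrow> 'a) \<Rightarrow> bool" where
  "is_weak_gradient U v G \<longleftrightarrow> (\<forall>\<phi>. test_function U \<phi> \<longrightarrow> (\<forall>b\<in>Basis.
     (\<integral>x. v x * frechet_derivative \<phi> (at x) b \<partial>lebesgue_on U) =
     - (\<integral>x. (G x \<bullet> b) * \<phi> x \<partial>lebesgue_on U)))"

definition H1 :: "'a::euclidean_space set \<Rightarrow> ('a \<Rightarrow> real) set" where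
  "H1 U = {v \<in> L2 U. \<exists>G\<in>L2 U. is_weak_gradient U v G}"

definition weak_gradient :: "'a::euclidean_space set \<Rightarrow> ('a \<Rightarrow> real) \<Rightarrow> 'a \<Rightarrow> 'a" where
  "weak_gradient U v = (SOME G. G \<in> L2 U \<and> is_weak_gradient U v G)"

definition energy :: "'a::euclidean_space set \<Rightarrow> ('a \<Rightarrow> real) \<Rightarrow> real" where
  "energy U v = (\<integral>x. (norm (weak_gradient U v x))\<^sup>2 \<partial>lebesgue_on U)"

definition H1_norm :: "'a::euclidean_space set \<Rightarrow> ('a \<Rightarrow> real) \<Rightarrow> real" where
  "H1_norm U v = sqrt ((\<integral>x. (v x)\<^sup>2 \<partial>lebesgue_on U) + energy U v)"


subsection \<open>Hausdorff measure\<close>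

text \<open>
  The definitions are meant for \<open>k \<ge> 1\<close>: for \<open>k = 0\<close> the empty set would get weight 1.
  The cover has to consist of bounded sets, as \<open>diameter\<close> is unspecified on unbounded sets.
  The normalisation makes the measure of dimension \<open>k\<close> agree with the \<open>k\<close>-dimensional area.
\<close>
definition hausdorff_pre :: "nat \<Rightarrow> real \<Rightarrow> 'a::metric_space set \<Rightarrow> ennreal" where
  "hausdorff_pre k \<delta> A =
     (INF C\<in>{C :: nat \<Rightarrow> 'a set. A \<subseteq> (\<Union>j. C j) \<and> (\<forall>j. bounded (C j) \<and> diameter (C j) \<le> \<delta>)}.
        \<Sum>j. ennreal (unit_ball_vol (real k) * (diameter (C j) / 2) ^ k))"

definition hausdorff_outer :: "nat \<Rightarrow> 'a::metric_space set \<Rightarrow> ennreal" where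
  "hausdorff_outer k A = (SUP \<delta>\<in>{0<..}. hausdorff_pre k \<delta> A)"

definition hausdorff_measure :: "nat \<Rightarrow> 'a::metric_space measure" where
  "hausdorff_measure k = measure_of UNIV (sets borel) (hausdorff_outer k)"

text \<open>
  Since \<open>measure_of\<close> is the zero measure when its last argument fails to be a measure, we
  show that \<open>hausdorff_outer\<close> is countably additive on Borel sets (Caratheodory's criterion).
\<close>

lemma hausdorff_pre_mono:
  assumes "A \<subseteq> B" shows "hausdorff_pre k \<delta> A \<le> hausdorff_pre k \<delta> B"
  unfolding hausdorff_pre_def using assms by (intro INF_superset_mono) auto

lemma hausdorff_pre_antimono:
  assumes "\<delta> \<le> \<epsilon>" shows "hausdorff_pre k \<epsilon> A \<le> hausdorff_pre k \<delta> A"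
  unfolding hausdorff_pre_def using assms by (intro INF_superset_mono) (auto intro: order_trans)

lemma hausdorff_outer_mono:
  assumes "A \<subseteq> B" shows "hausdorff_outer k A \<le> hausdorff_outer k B"
  unfolding hausdorff_outer_def using assms by (intro SUP_mono) (blast intro: hausdorff_pre_mono)

lemma hausdorff_outer_empty:
  assumes "k > 0" shows "hausdorff_outer k {} = 0"
proof -
  have "hausdorff_pre k \<delta> ({} :: 'a set) = 0" if "\<delta> > 0" for \<delta>
  proof -
    have "hausdorff_pre k \<delta> ({} :: 'a set)
        \<le> (\<Sum>j::nat. ennreal (unit_ball_vol (real k) * (diameter ({} :: 'a set) / 2) ^ k))"
      unfolding hausdorff_pre_def using that by (intro INF_lower) auto
    then show ?thesis using assms by (simp add: zero_power)
  qed
  then show ?thesis by (simp add: hausdorff_outer_def)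
qed

lemma hausdorff_pre_countably_subadditive:
  fixes A :: "nat \<Rightarrow> 'a::metric_space set"
  shows "hausdorff_pre k \<delta> (\<Union>i. A i) \<le> (\<Sum>i. hausdorff_pre k \<delta> (A i))"
proof (rule ennreal_le_epsilon)
  fix e :: real
  assume e: "0 < e" and fin: "(\<Sum>i. hausdorff_pre k \<delta> (A i)) < top"
  define w where "w = (\<lambda>C :: 'a set. ennreal (unit_ball_vol (real k) * (diameter C / 2) ^ k))"
  define adm where "adm = (\<lambda>B (C :: nat \<Rightarrow> 'a set).
    B \<subseteq> (\<Union>j. C j) \<and> (\<forall>j. bounded (C j) \<and> diameter (C j) \<le> \<delta>))"
  have pre: "hausdorff_pre k \<delta> B = (INF C\<in>{C. adm B C}. \<Sum>j. w (C j))" for B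
    by (simp add: hausdorff_pre_def adm_def w_def)
  have lt: "hausdorff_pre k \<delta> (A n) < hausdorff_pre k \<delta> (A n) + e * (1/2) ^ Suc n" for n
    using e fin by (auto simp add: less_top dest!: ennreal_suminf_lessD)
  have "\<exists>C. adm (A n) C \<and> (\<Sum>j. w (C j)) \<le> hausdorff_pre k \<delta> (A n) + e * (1/2) ^ Suc n" for n
    using lt[of n] unfolding pre by (auto simp: INF_less_iff intro: less_imp_le)
  then obtain C where C: "\<And>n. adm (A n) (C n)"
    and Cle: "\<And>n. (\<Sum>j. w (C n j)) \<le> hausdorff_pre k \<delta> (A n) + e * (1/2) ^ Suc n"
    by metis
  define D where "D = (\<lambda>i. case_prod C (prod_decode i))"
  have "(\<Union>i. A i) \<subseteq> (\<Union>j. D j)"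
  proof
    fix x assume "x \<in> (\<Union>i. A i)"
    then obtain i j where "x \<in> C i j" using C unfolding adm_def by blast
    then have "x \<in> D (prod_encode (i, j))" by (simp add: D_def)
    then show "x \<in> (\<Union>j. D j)" by blast
  qed
  then have "adm (\<Union>i. A i) D" using C by (auto simp: adm_def D_def split: prod.split)
  then have "hausdorff_pre k \<delta> (\<Union>i. A i) \<le> (\<Sum>i. w (D i))"
    unfolding pre by (intro INF_lower) auto
  also have "\<dots> = (\<Sum>i. (\<lambda>(m, n). w (C m n)) (prod_decode i))"
    by (intro arg_cong[where f = suminf]) (auto simp: D_def split: prod.split)
  also have "\<dots> = (\<Sum>n. \<Sum>j. w (C n j))" by (intro suminf_ennreal_2dimen) auto
  also have "\<dots> \<le> (\<Sum>n. hausdorff_pre k \<delta> (A n) + e * (1/2) ^ Suc n)"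
    by (intro suminf_le allI Cle) auto
  also have "\<dots> = (\<Sum>n. hausdorff_pre k \<delta> (A n)) + (\<Sum>n. ennreal e * ennreal ((1/2) ^ Suc n))"
    using e by (subst suminf_add[symmetric])
      (auto simp del: ennreal_suminf_cmult simp add: ennreal_mult[symmetric])
  also have "\<dots> = (\<Sum>n. hausdorff_pre k \<delta> (A n)) + e"
    unfolding ennreal_suminf_cmult
    by (subst suminf_ennreal_eq[OF zero_le_power power_half_series]) auto
  finally show "hausdorff_pre k \<delta> (\<Union>i. A i) \<le> (\<Sum>n. hausdorff_pre k \<delta> (A n)) + e" .
qed

lemma hausdorff_outer_countably_subadditive:
  "hausdorff_outer k (\<Union>i::nat. A i) \<le> (\<Sum>i. hausdorff_outer k (A i))"
  unfolding hausdorff_outer_def[of k "\<Union>i. A i"]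
proof (rule SUP_least)
  fix \<delta> :: real assume d: "\<delta> \<in> {0<..}"
  have "(\<Sum>i. hausdorff_pre k \<delta> (A i)) \<le> (\<Sum>i. hausdorff_outer k (A i))"
    unfolding hausdorff_outer_def using d by (intro suminf_le SUP_upper allI) auto
  then show "hausdorff_pre k \<delta> (\<Union>i. A i) \<le> (\<Sum>i. hausdorff_outer k (A i))"
    by (rule order_trans[OF hausdorff_pre_countably_subadditive])
qed

lemma outer_measure_space_hausdorff:
  "k > 0 \<Longrightarrow> outer_measure_space (Pow UNIV) (hausdorff_outer k)"
  by (auto simp: outer_measure_space_def positive_def increasing_def countably_subadditive_def
      hausdorff_outer_empty hausdorff_outer_mono hausdorff_outer_countably_subadditive)

lemma hausdorff_outer_subadditive:
  "k > 0 \<Longrightarrow> hausdorff_outer k (A \<union> B) \<le> hausdorff_outer k A + hausdorff_outer k B"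
proof -
  interpret sigma_algebra UNIV "Pow UNIV :: 'a set set" by (rule sigma_algebra_Pow)
  assume "k > 0"
  then have "subadditive (Pow UNIV :: 'a set set) (hausdorff_outer k)"
    using outer_measure_space_hausdorff countably_subadditive_subadditive
    unfolding outer_measure_space_def by blast
  then have "hausdorff_outer k (A \<union> (B - A)) \<le> hausdorff_outer k A + hausdorff_outer k (B - A)"
    by (rule subadditiveD) auto
  also have "\<dots> \<le> hausdorff_outer k A + hausdorff_outer k B"
    by (intro add_left_mono hausdorff_outer_mono) auto
  finally show ?thesis by (simp add: Un_Diff_cancel)
qed

lemma hausdorff_outer_separated:
  fixes A B :: "'a::metric_space set"
  assumes k: "k > 0" and d: "d > 0" and sep: "\<And>x y. x \<in> A \<Longrightarrow> y \<in> B \<Longrightarrow> d \<le> dist x y"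
  shows "hausdorff_outer k A + hausdorff_outer k B \<le> hausdorff_outer k (A \<union> B)"
proof -
  have pre: "hausdorff_pre k \<delta> A + hausdorff_pre k \<delta> B \<le> hausdorff_pre k \<delta> (A \<union> B)"
    if \<delta>: "0 < \<delta>" "\<delta> < d" for \<delta>
    unfolding hausdorff_pre_def[of k \<delta> "A \<union> B"]
  proof (rule INF_greatest)
    fix C :: "nat \<Rightarrow> 'a set"
    assume "C \<in> {C. A \<union> B \<subseteq> (\<Union>j. C j) \<and> (\<forall>j. bounded (C j) \<and> diameter (C j) \<le> \<delta>)}"
    then have cov: "A \<union> B \<subseteq> (\<Union>j. C j)" and bd: "\<And>j. bounded (C j)"
      and diam: "\<And>j. diameter (C j) \<le> \<delta>" by auto
    let ?w = "\<lambda>C :: 'a set. ennreal (unit_ball_vol (real k) * (diameter C / 2) ^ k)"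
    let ?P = "\<lambda>A j. if C j \<inter> A = {} then {} else C j"
    have P: "hausdorff_pre k \<delta> S \<le> (\<Sum>j. ?w (?P S j))" if S: "S \<subseteq> A \<union> B" for S
    proof -
      have "S \<subseteq> (\<Union>j. ?P S j)"
      proof
        fix x assume x: "x \<in> S"
        then obtain j where "x \<in> C j" using S cov by blast
        then have "x \<in> ?P S j" using x by auto
        then show "x \<in> (\<Union>j. ?P S j)" by blast
      qed
      then show ?thesis
        unfolding hausdorff_pre_def using bd diam \<delta> by (intro INF_lower) auto
    qed
    have "hausdorff_pre k \<delta> A + hausdorff_pre k \<delta> B
        \<le> (\<Sum>j. ?w (?P A j)) + (\<Sum>j. ?w (?P B j))"
      by (intro add_mono P) auto
    also have "\<dots> = (\<Sum>j. ?w (?P A j) + ?w (?P B j))" by (intro suminf_add) auto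
    also have "\<dots> \<le> (\<Sum>j. ?w (C j))"
    proof (intro suminf_le allI summableI)
      fix j
      have "C j \<inter> A = {} \<or> C j \<inter> B = {}"
      proof (rule ccontr)
        assume "\<not> ?thesis"
        then obtain x y where "x \<in> C j" "x \<in> A" "y \<in> C j" "y \<in> B" by auto
        with sep[of x y] diameter_bounded_bound[OF bd, of x j y] diam[of j] \<delta> show False by auto
      qed
      then show "?w (?P A j) + ?w (?P B j) \<le> ?w (C j)" using k by (auto simp: zero_power)
    qed
    finally show "hausdorff_pre k \<delta> A + hausdorff_pre k \<delta> B \<le> (\<Sum>j. ?w (C j))" .
  qed
  have "(SUP \<delta>\<in>{0<..}. hausdorff_pre k \<delta> A) + (SUP \<delta>\<in>{0<..}. hausdorff_pre k \<delta> B)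
      = (SUP \<delta>\<in>{0<..}. hausdorff_pre k \<delta> A + hausdorff_pre k \<delta> B)"
  proof (rule SUP_add_directed_ennreal[symmetric])
    fix i j :: real assume "i \<in> {0<..}" "j \<in> {0<..}"
    then show "\<exists>l\<in>{0<..}. hausdorff_pre k i A + hausdorff_pre k j B
        \<le> hausdorff_pre k l A + hausdorff_pre k l B"
      by (intro bexI[of _ "min i j"] add_mono hausdorff_pre_antimono) auto
  qed
  also have "\<dots> \<le> hausdorff_outer k (A \<union> B)"
  proof (rule SUP_least)
    fix i :: real assume i: "i \<in> {0<..}"
    let ?l = "min i (d / 2)"
    have "hausdorff_pre k i A + hausdorff_pre k i B \<le> hausdorff_pre k ?l A + hausdorff_pre k ?l B"
      by (intro add_mono hausdorff_pre_antimono) auto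
    also have "\<dots> \<le> hausdorff_pre k ?l (A \<union> B)" using i d by (intro pre) auto
    also have "\<dots> \<le> hausdorff_outer k (A \<union> B)"
      unfolding hausdorff_outer_def using i d by (intro SUP_upper) auto
    finally show "hausdorff_pre k i A + hausdorff_pre k i B \<le> hausdorff_outer k (A \<union> B)" .
  qed
  finally show ?thesis by (simp add: hausdorff_outer_def)
qed

lemma hausdorff_outer_separated_sum:
  fixes R :: "nat \<Rightarrow> 'a::metric_space set"
  assumes k: "k > 0"
    and sep: "\<And>j. \<exists>d>0. \<forall>i<j. \<forall>x\<in>R i. \<forall>y\<in>R j. d \<le> dist x y"
  shows "(\<Sum>i<n. hausdorff_outer k (R i)) \<le> hausdorff_outer k (\<Union>i<n. R i)"
proof (induction n)
  case 0 show ?case by simp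
next
  case (Suc n)
  obtain d where d: "d > 0" "\<And>i x y. i < n \<Longrightarrow> x \<in> R i \<Longrightarrow> y \<in> R n \<Longrightarrow> d \<le> dist x y"
    using sep[of n] by blast
  have "(\<Sum>i<Suc n. hausdorff_outer k (R i))
      \<le> hausdorff_outer k (\<Union>i<n. R i) + hausdorff_outer k (R n)"
    using Suc.IH by (simp add: add_right_mono)
  also have "\<dots> \<le> hausdorff_outer k ((\<Union>i<n. R i) \<union> R n)"
    by (rule hausdorff_outer_separated[OF k d(1)]) (use d(2) in auto)
  also have "(\<Union>i<n. R i) \<union> R n = (\<Union>i<Suc n. R i)" by (auto simp: less_Suc_eq)
  finally show ?case .
qed

lemma hausdorff_outer_closed_split:
  fixes A E :: "'a::metric_space set"
  assumes k: "k > 0" and A: "closed A"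
  shows "hausdorff_outer k (E \<inter> A) + hausdorff_outer k (E - A) \<le> hausdorff_outer k E"
proof (cases "A = {} \<or> hausdorff_outer k E = top")
  case True
  then show ?thesis using hausdorff_outer_empty[OF k] by auto
next
  case False
  then have ne: "A \<noteq> {}" and fin: "hausdorff_outer k E < top" by (auto simp: less_top)
  define t where "t = (\<lambda>n::nat. 1 / (real n + 1))"
  have t_pos: "t n > 0" for n by (simp add: t_def)
  have t_mono: "t m \<le> t n" if "n \<le> m" for m n using that by (simp add: t_def frac_le)
  have t_strict: "t (Suc n) < t n" for n by (simp add: t_def frac_less2)
  define En where "En = (\<lambda>n. {x \<in> E. t n \<le> infdist x A})"
  define R where "R = (\<lambda>n. {x \<in> E. t (Suc n) \<le> infdist x A \<and> infdist x A < t n})"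
  have dist: "a - b \<le> dist x y" if "a \<le> infdist x A" "infdist y A \<le> b" for x y a b
    using infdist_triangle[of x A y] that by linarith
  have sepR: "\<exists>d>0. \<forall>i<j. \<forall>x\<in>R (2 * i + p). \<forall>y\<in>R (2 * j + p). d \<le> dist x y" for p j
  proof (cases "j = 0")
    case True
    then show ?thesis by (intro exI[of _ 1]) auto
  next
    case False
    define m where "m = 2 * j + p - 1"
    have m: "2 * j + p = Suc m" using False by (simp add: m_def)
    have "t m - t (Suc m) \<le> dist x y"
      if i: "i < j" "x \<in> R (2 * i + p)" "y \<in> R (2 * j + p)" for i x y
    proof (rule dist)
      have "t m \<le> t (Suc (2 * i + p))" using i m by (intro t_mono) auto
      then show "t m \<le> infdist x A" using i(2) by (auto simp: R_def)
      show "infdist y A \<le> t (Suc m)" using i(3) unfolding m by (auto simp: R_def)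
    qed
    then show ?thesis using t_strict[of m] by (intro exI[of _ "t m - t (Suc m)"]) auto
  qed
  let ?f = "hausdorff_outer k"
  have half: "(\<Sum>i<n. ?f (R (2 * i + p))) \<le> ?f E" for n p
  proof -
    have "(\<Sum>i<n. ?f (R (2 * i + p))) \<le> ?f (\<Union>i<n. R (2 * i + p))"
      using hausdorff_outer_separated_sum[OF k, of "\<lambda>i. R (2 * i + p)"] sepR by blast
    also have "\<dots> \<le> ?f E" by (intro hausdorff_outer_mono) (auto simp: R_def)
    finally show ?thesis .
  qed
  have "(\<Sum>i<n. ?f (R i)) \<le> ?f E + ?f E" for n
  proof -
    have "(\<Sum>i<n. ?f (R i)) \<le> (\<Sum>i<2 * n. ?f (R i))" by (intro sum_mono2) auto
    also have "\<dots> = (\<Sum>i<n. ?f (R (2 * i + 0))) + (\<Sum>i<n. ?f (R (2 * i + 1)))"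
      by (induction n) (auto simp: ac_simps)
    also have "\<dots> \<le> ?f E + ?f E" by (intro add_mono half)
    finally show ?thesis .
  qed
  then have "(\<Sum>i. ?f (R i)) \<le> ?f E + ?f E" by (intro suminf_le_const) auto
  then have sum_fin: "(\<Sum>i. ?f (R i)) < top" using fin by (auto intro: le_less_trans)
  define r where "r = (\<lambda>i. enn2real (?f (R i)))"
  have "?f (R i) < top" for i
    using sum_fin by (rule ennreal_suminf_lessD)
  then have r: "?f (R i) = ennreal (r i)" for i by (simp add: r_def less_top)
  have r0: "0 \<le> r i" for i by (simp add: r_def)
  have sumr: "summable r" using sum_fin r0 unfolding r by (intro summable_suminf_not_top) auto
  show ?thesis
  proof (rule ennreal_le_epsilon)
    fix e :: real assume e: "0 < e"
    obtain N where N: "\<And>n. n \<ge> N \<Longrightarrow> norm (\<Sum>i. r (i + n)) < e"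
      using suminf_exist_split[OF e sumr] by blast
    have tail: "(\<Sum>i. ?f (R (i + N))) \<le> ennreal e"
    proof -
      have "summable (\<lambda>i. r (i + N))" using sumr by (simp add: summable_iff_shift)
      then have "(\<Sum>i. ?f (R (i + N))) = ennreal (\<Sum>i. r (i + N))"
        unfolding r using r0 by (intro suminf_ennreal2) auto
      also have "\<dots> \<le> ennreal e" using N[of N] by (intro ennreal_leI) auto
      finally show ?thesis .
    qed
    have cover: "E - A \<subseteq> En N \<union> (\<Union>i. R (i + N))"
    proof
      fix x assume x: "x \<in> E - A"
      then have pos: "infdist x A > 0"
        using in_closed_iff_infdist_zero[OF A ne] infdist_nonneg[of x A] by (auto simp: less_le)
      show "x \<in> En N \<union> (\<Union>i. R (i + N))"
      proof (cases "t N \<le> infdist x A")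
        case True then show ?thesis using x by (auto simp: En_def)
      next
        case False
        have "\<exists>m. t m \<le> infdist x A"
        proof -
          obtain m where "inverse (real (Suc m)) < infdist x A" using reals_Archimedean[OF pos] by blast
          then show ?thesis by (intro exI[of _ m]) (simp add: t_def inverse_eq_divide add.commute)
        qed
        define m where "m = (LEAST m. t m \<le> infdist x A)"
        have m: "t m \<le> infdist x A" unfolding m_def by (rule LeastI_ex) fact
        have "m > N"
        proof (rule ccontr)
          assume "\<not> m > N" then have "t N \<le> t m" by (intro t_mono) auto
          with m False show False by linarith
        qed
        then obtain i where i: "m = Suc (i + N)" by (metis less_iff_Suc_add add.commute add_Suc_right)
        have "\<not> t (i + N) \<le> infdist x A"
          using not_less_Least[of "i + N" "\<lambda>m. t m \<le> infdist x A"] i by (simp add: m_def)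
        then have "x \<in> R (i + N)" using x m i by (auto simp: R_def)
        then show ?thesis by blast
      qed
    qed
    have sepE: "?f (E \<inter> A) + ?f (En N) \<le> ?f ((E \<inter> A) \<union> En N)"
    proof (rule hausdorff_outer_separated[OF k t_pos[of N]])
      fix x y assume "x \<in> E \<inter> A" "y \<in> En N"
      then show "t N \<le> dist x y" using dist[of "t N" y x 0] by (auto simp: En_def dist_commute)
    qed
    have "?f (E - A) \<le> ?f (En N \<union> (\<Union>i. R (i + N)))" by (rule hausdorff_outer_mono[OF cover])
    also have "\<dots> \<le> ?f (En N) + ?f (\<Union>i. R (i + N))" by (rule hausdorff_outer_subadditive[OF k])
    also have "\<dots> \<le> ?f (En N) + ennreal e"
      by (intro add_left_mono order_trans[OF hausdorff_outer_countably_subadditive tail])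
    finally have "?f (E \<inter> A) + ?f (E - A) \<le> ?f (E \<inter> A) + (?f (En N) + ennreal e)"
      by (rule add_left_mono)
    also have "\<dots> \<le> ?f ((E \<inter> A) \<union> En N) + ennreal e"
      using sepE by (simp add: add.assoc[symmetric] add_right_mono)
    also have "\<dots> \<le> ?f E + ennreal e"
      by (intro add_right_mono hausdorff_outer_mono) (auto simp: En_def)
    finally show "?f (E \<inter> A) + ?f (E - A) \<le> ?f E + ennreal e" .
  qed
qed

lemma sets_hausdorff_measure [simp, measurable_cong]: "sets (hausdorff_measure k) = sets borel"
  unfolding hausdorff_measure_def by (rule sets.sets_measure_of_eq[of borel, unfolded space_borel])

lemma space_hausdorff_measure [simp]: "space (hausdorff_measure k) = UNIV"
  by (simp add: hausdorff_measure_def space_measure_of_conv)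

lemma emeasure_hausdorff_measure:
  fixes A :: "'a::metric_space set"
  assumes k: "k > 0" and A: "A \<in> sets borel"
  shows "emeasure (hausdorff_measure k) A = hausdorff_outer k A"
proof -
  let ?L = "lambda_system UNIV (Pow UNIV) (hausdorff_outer k) :: 'a set set"
  interpret P: sigma_algebra UNIV "Pow UNIV :: 'a set set" by (rule sigma_algebra_Pow)
  have L: "measure_space UNIV ?L (hausdorff_outer k)"
    by (rule P.caratheodory_lemma[OF outer_measure_space_hausdorff[OF k]])
  then interpret L: sigma_algebra UNIV ?L by (simp add: measure_space_def)
  have "Collect closed \<subseteq> ?L"
  proof safe
    fix S :: "'a set" assume S: "closed S"
    have "hausdorff_outer k (E \<inter> S) + hausdorff_outer k (E - S) = hausdorff_outer k E" for E
    proof (rule antisym[OF hausdorff_outer_closed_split[OF k S]])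
      show "hausdorff_outer k E \<le> hausdorff_outer k (E \<inter> S) + hausdorff_outer k (E - S)"
        using hausdorff_outer_subadditive[OF k, of "E \<inter> S" "E - S"] by (simp add: Int_Diff_Un)
    qed
    then show "S \<in> ?L" unfolding P.lambda_system_eq by blast
  qed
  then have "sigma_sets UNIV (Collect closed) \<subseteq> ?L" by (rule L.sigma_sets_subset)
  moreover have "sets borel = sigma_sets UNIV (Collect closed :: 'a set set)"
    unfolding borel_eq_closed by (rule sets_measure_of) simp
  ultimately have sub: "sets borel \<subseteq> ?L" by simp
  have "countably_additive (sets borel) (hausdorff_outer k :: 'a set \<Rightarrow> ennreal)"
    using L sub unfolding measure_space_def countably_additive_def by blast
  then show ?thesis
    using A hausdorff_outer_empty[OF k]
    by (intro emeasure_measure_of[OF hausdorff_measure_def]) (auto simp: positive_def)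
qed


subsection \<open>Traces and the admissible class\<close>

text \<open>
  For a smooth bounded \<open>U\<close>, the trace operator is the unique continuous linear map from
  $H^1(U)$ to $L^2(\partial U)$ that restricts functions in $H^1(U) \cap C(\overline U)$, a dense
  subspace of $H^1(U)$, to the boundary. So \<open>h\<close> is the trace of \<open>v\<close> iff it is
  the limit in $L^2(\partial U)$ of the boundary values of such functions converging to \<open>v\<close>.
\<close>
definition surface_measure :: "'a::euclidean_space measure" where
  "surface_measure = hausdorff_measure (DIM('a) - 1)"

definition has_trace :: "'a::euclidean_space set \<Rightarrow> ('a \<Rightarrow> real) \<Rightarrow> ('a \<Rightarrow> real) \<Rightarrow> bool" where
  "has_trace U v h \<longleftrightarrow> v \<in> H1 U \<and>
     set_borel_measurable surface_measure (frontier U) h \<and>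
     (\<exists>w :: nat \<Rightarrow> 'a \<Rightarrow> real. (\<forall>k. w k \<in> H1 U \<and> continuous_on (closure U) (w k)) \<and>
        (\<lambda>k. H1_norm U (\<lambda>x. w k x - v x)) \<longlonglongrightarrow> 0 \<and>
        (\<lambda>k. \<integral>\<^sup>+x\<in>frontier U. ennreal ((w k x - h x)\<^sup>2) \<partial>surface_measure) \<longlonglongrightarrow> 0)"

definition admissible :: "'a::euclidean_space set \<Rightarrow> ('a \<Rightarrow> real) \<Rightarrow> ('a \<Rightarrow> real) \<Rightarrow> ('a \<Rightarrow> real) \<Rightarrow> ('a \<Rightarrow> real) set"
  where "admissible U g \<phi> \<psi> =
    {v \<in> H1 U. (AE x in lebesgue_on U. \<phi> x \<le> v x \<and> v x \<le> \<psi> x) \<and> has_trace U v g}"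

end

theory Submission
  imports Defs
begin

text \<open>
  The obstacles are Lipschitz and the boundary values are $C^{1,1}$, so barriers built from exterior
  balls give \<open>\<bar>u x - g p\<bar> \<le> C * norm (x - p)\<close> for all boundary points \<open>p\<close>. For a shift \<open>h\<close>,
  the function \<open>s x = u x - u (x + h) - L * norm h\<close> is therefore nonpositive near the boundary of
  \<open>U \<inter> (U - h)\<close> if \<open>L \<ge> 3 * C\<close>. If moreover \<open>L\<close> bounds the Lipschitz constants of both
  obstacles, then lowering \<open>u\<close> by \<open>\<tau> \<circ> s\<close> and raising it by the translate of \<open>\<tau> \<circ> s\<close> are both
  admissible, where \<open>\<tau>\<close> is increasing with \<open>0 \<le> \<tau> s \<le> max 0 s\<close>. Adding the two variational
  inequalities shows that \<open>\<tau> \<circ> s\<close> has zero gradient, so \<open>s \<le> 0\<close> and \<open>u\<close> is Lipschitz.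
\<close>

subsection \<open>Bump functions\<close>

text \<open>No regularity theory for the Laplacian is used: the variational inequality for truncated
  differences with translates replaces it, as the Dirichlet integral is translation invariant.
  Traces are the main obstacle. \<open>has_trace\<close> offers only approximation by functions
  continuous up to the boundary, with errors measured by a Hausdorff measure, whereas comparison
  with a barrier needs a truncated difference of zero trace to have a weak gradient on the whole
  space. An estimate on thin strips along the boundary provides this; it is confined to the barrier
  argument, since variations by translates can be cut off inside \<open>U\<close>. A barrier must
  dominate both the quadratic error of \<open>g\<close> along the boundary, where $C^{1,1}$ enters,
  and the lower obstacle inside, which is known to lie below \<open>g\<close> only on the boundary.
  \<open>\<tau>\<close> is of class $C^1$, unlike the positive part, so that its chain rule follows
  from mollification. Almost everywhere statements hold off null sets that depend on the boundary
  point or on the shift; countable density and mollification remove this dependence.\<close>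

definition bump_fun :: "nat \<Rightarrow> real \<Rightarrow> real" where
  "bump_fun m t = (if t > 0 then exp (- inverse t) * inverse t ^ m else 0)"

text \<open>The powers of \<open>inverse t\<close> make the family closed under differentiation up
  to linear combinations; \<open>bump_fun 0\<close> is the classical exp (-1/t). Only
  \<open>t = 0\<close> needs a limit argument.\<close>

lemma DERIV_bump_fun:
  "(bump_fun m has_real_derivative (bump_fun (m + 2) t - real m * bump_fun (m + 1) t)) (at t)"
proof -
  consider "t > 0" | "t < 0" | "t = 0" by linarith
  then show ?thesis
  proof cases
    case 1
    have "((\<lambda>t. exp (- inverse t) * inverse t ^ m) has_real_derivative
        (bump_fun (m + 2) t - real m * bump_fun (m + 1) t)) (at t)"
    proof -
      let ?x = "inverse t"
      have "((\<lambda>t. exp (- inverse t) * inverse t ^ m) has_real_derivative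
        (exp (- ?x) * (?x * ?x)) * ?x ^ m + (real m * ?x ^ (m - 1) * (- (?x * ?x))) * exp (- ?x)) (at t)"
        using 1 by (auto intro!: derivative_eq_intros)
      moreover have "real m * ?x ^ (m - 1) * (?x * ?x) = real m * ?x ^ (m + 1)"
        by (cases m) simp_all
      then have "(exp (- ?x) * (?x * ?x)) * ?x ^ m + (real m * ?x ^ (m - 1) * (- (?x * ?x))) * exp (- ?x)
          = bump_fun (m + 2) t - real m * bump_fun (m + 1) t"
        using 1 by (simp only: bump_fun_def mult_minus_right) (simp add: power2_eq_square)
      ultimately show ?thesis by simp
    qed
    then show ?thesis
    proof (rule has_field_derivative_transform_within_open[where S = "{0<..}"])
      show "exp (- inverse x) * inverse x ^ m = bump_fun m x" if "x \<in> {0<..}" for x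
        using that by (simp add: bump_fun_def)
    qed (use 1 in auto)
  next
    case 2
    have "((\<lambda>t. 0) has_real_derivative (bump_fun (m + 2) t - real m * bump_fun (m + 1) t)) (at t)"
      using 2 by (simp add: bump_fun_def)
    then show ?thesis
    proof (rule has_field_derivative_transform_within_open[where S = "{..<0}"])
      show "0 = bump_fun m x" if "x \<in> {..<0}" for x
        using that by (simp add: bump_fun_def)
    qed (use 2 in auto)
  next
    case 3
    have "((\<lambda>h. bump_fun m h / h) \<longlongrightarrow> 0) (at 0)"
    proof (rule filterlim_split_at)
      show "((\<lambda>h. bump_fun m h / h) \<longlongrightarrow> 0) (at_left 0)"
        by (rule Lim_transform_eventually[OF tendsto_const])
          (auto simp: eventually_at_filter bump_fun_def)
      \<comment> \<open>With x = 1/h the difference quotient at 0 is x^(m + 1) / exp x, and the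
        exponential wins as x grows.\<close>
      have "((\<lambda>h::real. inverse h ^ (m + 1) / exp (inverse h)) \<longlongrightarrow> 0) (at_right 0)"
        by (rule filterlim_compose[OF tendsto_power_div_exp_0 filterlim_inverse_at_top_right])
      then show "((\<lambda>h. bump_fun m h / h) \<longlongrightarrow> 0) (at_right 0)"
        by (rule Lim_transform_eventually)
          (auto simp: eventually_at_filter bump_fun_def exp_minus field_simps)
    qed
    then show ?thesis using 3 by (simp add: has_field_derivative_iff bump_fun_def)
  qed
qed

lemma GDERIV_frechet_derivative:
  assumes "GDERIV f x :> D"
  shows "f differentiable (at x)" "frechet_derivative f (at x) b = b \<bullet> D"
  using assms frechet_derivative_at[of f "\<lambda>h. h \<bullet> D" x, symmetric]
  by (auto simp: gderiv_def differentiable_def)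

lemma GDERIV_continuous: "GDERIV f x :> D \<Longrightarrow> isCont f x"
  unfolding gderiv_def by (rule has_derivative_continuous)

text \<open>Smoothness asks for iterated partial derivatives, so it suffices to exhibit a set of
  functions that is stable under directional derivatives. The induction on the order runs over all
  members of \<open>S\<close> simultaneously.\<close>

lemma smooth_coinduct:
  assumes "\<And>f. f \<in> S \<Longrightarrow> \<exists>D. (\<forall>x. GDERIV f x :> D x) \<and> (\<forall>b. (\<lambda>x. b \<bullet> D x) \<in> S)"
    and "f \<in> S"
  shows "smooth f"
proof -
  have "\<forall>f\<in>S. C_k_on k UNIV f" for k
  proof (induction k)
    case 0
    show ?case
      using assms(1) GDERIV_continuous by (fastforce simp: continuous_on_eq_continuous_at)
  next
    case (Suc k)
    show ?case
    proof
      fix f assume "f \<in> S"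
      then obtain D where D: "\<And>x. GDERIV f x :> D x" "\<And>b. (\<lambda>x. b \<bullet> D x) \<in> S"
        using assms(1) by blast
      then show "C_k_on (Suc k) UNIV f"
        using GDERIV_frechet_derivative[OF D(1)] D(2) Suc by auto
    qed
  qed
  then show ?thesis using assms(2) by (auto simp: smooth_def)
qed

text \<open>An invariant set for \<open>smooth_coinduct\<close>: differentiating the bump of
  \<open>e - x \<bullet> x\<close> produces other members of the bump family times a linear
  function, so linear functions, constants, sums and products have to be included.\<close>

inductive_set bump_algebra :: "real \<Rightarrow> ('a::euclidean_space \<Rightarrow> real) set" for e where
  base: "(\<lambda>x. bump_fun m (e - x \<bullet> x)) \<in> bump_algebra e"
| lin: "(\<lambda>x. b \<bullet> x) \<in> bump_algebra e"
| const: "(\<lambda>x. c) \<in> bump_algebra e"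
| add: "f \<in> bump_algebra e \<Longrightarrow> g \<in> bump_algebra e \<Longrightarrow> (\<lambda>x. f x + g x) \<in> bump_algebra e"
| mult: "f \<in> bump_algebra e \<Longrightarrow> g \<in> bump_algebra e \<Longrightarrow> (\<lambda>x. f x * g x) \<in> bump_algebra e"

lemma bump_algebra_smooth:
  assumes "f \<in> bump_algebra e"
  shows "smooth f"
proof (rule smooth_coinduct[OF _ assms])
  fix f :: "'a \<Rightarrow> real" assume "f \<in> bump_algebra e"
  then show "\<exists>D. (\<forall>x. GDERIV f x :> D x) \<and> (\<forall>b. (\<lambda>x. b \<bullet> D x) \<in> bump_algebra e)"
  proof induction
    case (base m)
    define D where "D = (\<lambda>x::'a. (bump_fun (m + 2) (e - x \<bullet> x)
      + (- real m) * bump_fun (m + 1) (e - x \<bullet> x)) *\<^sub>R ((-2) *\<^sub>R x))"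
    have "GDERIV (\<lambda>x. bump_fun m (e - x \<bullet> x)) x :> D x" for x
    proof -
      have "GDERIV (\<lambda>x. e - x \<bullet> x) x :> (-2) *\<^sub>R x"
        unfolding gderiv_def by (auto intro!: derivative_eq_intros simp: inner_commute)
      from GDERIV_DERIV_compose[OF this DERIV_bump_fun[of m]]
      show ?thesis by (simp add: D_def)
    qed
    moreover have "(\<lambda>x. b \<bullet> D x) \<in> bump_algebra e" for b
    proof -
      have "(\<lambda>x. (bump_fun (m + 2) (e - x \<bullet> x) + (- real m) * bump_fun (m + 1) (e - x \<bullet> x))
         * ((- 2) * (b \<bullet> x))) \<in> bump_algebra e"
        by (intro bump_algebra.intros)
      then show ?thesis by (simp only: D_def inner_scaleR_right)
    qed
    ultimately show ?case by blast
  next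
    case (lin b)
    show ?case
    proof (intro exI[of _ "\<lambda>x. b"] conjI allI)
      show "GDERIV ((\<bullet>) b) x :> b" for x
        unfolding gderiv_def by (auto intro!: derivative_eq_intros simp: inner_commute)
    qed (rule bump_algebra.const)
  next
    case (const c)
    show ?case
      by (intro exI[of _ "\<lambda>x. 0"] conjI allI GDERIV_const) (simp add: bump_algebra.const)
  next
    case (add f g)
    then obtain D E where "\<And>x. GDERIV f x :> D x" "\<And>b. (\<lambda>x. b \<bullet> D x) \<in> bump_algebra e"
        "\<And>x. GDERIV g x :> E x" "\<And>b. (\<lambda>x. b \<bullet> E x) \<in> bump_algebra e" by blast
    then show ?case
      by (intro exI[of _ "\<lambda>x. D x + E x"])
        (auto simp: inner_add_right intro: GDERIV_add bump_algebra.add)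
  next
    case (mult f g)
    then obtain D E where "\<And>x. GDERIV f x :> D x" "\<And>b. (\<lambda>x. b \<bullet> D x) \<in> bump_algebra e"
        "\<And>x. GDERIV g x :> E x" "\<And>b. (\<lambda>x. b \<bullet> E x) \<in> bump_algebra e" by blast
    with mult show ?case
      by (intro exI[of _ "\<lambda>x. f x *\<^sub>R E x + g x *\<^sub>R D x"])
        (auto simp: inner_add_right intro!: GDERIV_mult bump_algebra.add bump_algebra.mult)
  qed
qed

lemma smooth_continuous: "smooth f \<Longrightarrow> continuous_on UNIV f"
  unfolding smooth_def by (drule spec[of _ 0]) simp

lemma smooth_derivative:
  assumes "smooth f" "b \<in> Basis"
  shows "smooth (\<lambda>x. frechet_derivative f (at x) b)"
  unfolding smooth_def
proof
  fix k show "C_k_on k UNIV (\<lambda>x. frechet_derivative f (at x) b)"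
    using assms(1)[unfolded smooth_def, THEN spec, of "Suc k"] assms(2) by auto
qed

lemma smooth_differentiable: "smooth f \<Longrightarrow> f differentiable (at x)"
  unfolding smooth_def by (drule spec[of _ "Suc 0"]) simp

definition grad :: "('a::euclidean_space \<Rightarrow> real) \<Rightarrow> 'a \<Rightarrow> 'a" where
  "grad f x = (\<Sum>b\<in>Basis. frechet_derivative f (at x) b *\<^sub>R b)"

lemma GDERIV_grad:
  assumes "f differentiable (at x)"
  shows "GDERIV f x :> grad f x"
proof -
  have *: "(f has_derivative frechet_derivative f (at x)) (at x)"
    using assms by (simp add: frechet_derivative_works)
  then interpret bounded_linear "frechet_derivative f (at x)"
    by (rule has_derivative_bounded_linear)
  have "frechet_derivative f (at x) h = h \<bullet> grad f x" for h
  proof -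
    have "frechet_derivative f (at x) h = frechet_derivative f (at x) (\<Sum>b\<in>Basis. (h \<bullet> b) *\<^sub>R b)"
      by (simp add: euclidean_representation)
    also have "\<dots> = h \<bullet> grad f x"
      by (simp add: sum scaleR grad_def inner_sum_right mult.commute)
    finally show ?thesis .
  qed
  then have "frechet_derivative f (at x) = (\<lambda>h. h \<bullet> grad f x)" by blast
  with * show ?thesis unfolding gderiv_def by simp
qed

lemma smooth_GDERIV: "smooth f \<Longrightarrow> GDERIV f x :> grad f x"
  by (rule GDERIV_grad[OF smooth_differentiable])

lemma smooth_continuous_grad: "smooth f \<Longrightarrow> continuous_on UNIV (grad f)"
  unfolding grad_def
  by (intro continuous_intros smooth_continuous smooth_derivative)

text \<open>The bump of \<open>r\<^sup>2 - x \<bullet> x\<close> is positive exactly on the open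
  ball of radius \<open>r\<close>, hence has positive integral and can be normalised.\<close>

lemma smooth_bump_exists:
  assumes "0 < (r::real)"
  shows "\<exists>\<rho> :: 'a::euclidean_space \<Rightarrow> real. smooth \<rho> \<and> (\<forall>x. 0 \<le> \<rho> x) \<and>
    (\<forall>x. r \<le> norm x \<longrightarrow> \<rho> x = 0) \<and> integrable lborel \<rho> \<and> integral\<^sup>L lborel \<rho> = 1"
proof -
  define f where "f = (\<lambda>x::'a. bump_fun 0 (r\<^sup>2 - x \<bullet> x))"
  have fS: "f \<in> bump_algebra (r\<^sup>2)" unfolding f_def by (rule bump_algebra.base)
  have cont: "continuous_on UNIV f" by (intro smooth_continuous bump_algebra_smooth[OF fS])
  have nn: "0 \<le> f x" for x by (simp add: f_def bump_fun_def)
  have supp: "f x \<noteq> 0 \<longleftrightarrow> norm x < r" for x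
    using assms by (auto simp: f_def bump_fun_def dot_square_norm power2_eq_iff_nonneg
      power_less_imp_less_base intro: power_strict_mono)
  have int: "integrable lborel f"
  proof -
    have "integrable lborel (\<lambda>x. indicator (cball 0 r) x *\<^sub>R f x)"
      by (rule borel_integrable_compact) (auto intro: continuous_on_subset[OF cont])
    moreover have "indicator (cball 0 r) x *\<^sub>R f x = f x" for x
      using supp[of x] by (auto simp: indicator_def)
    ultimately show ?thesis by (simp only:)
  qed
  have pos: "0 < integral\<^sup>L lborel f"
  proof -
    have "integral\<^sup>L lborel f \<noteq> 0"
    proof
      assume "integral\<^sup>L lborel f = 0"
      then have "AE x in lborel. f x = 0"
        using integral_nonneg_eq_0_iff_AE[OF int] nn by auto
      then have "AE x in lborel. x \<notin> ball (0::'a) r" by eventually_elim (use supp in auto)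
      then have "emeasure lborel (ball (0::'a) r) = 0"
        by (subst (asm) AE_iff_measurable[of "ball 0 r"]) auto
      then show False using emeasure_ball[of r "0::'a"] assms
          content_ball_pos[of r "0::'a"] by (simp add: measure_def)
    qed
    then show ?thesis using Bochner_Integration.integral_nonneg[of lborel f] nn by (simp add: less_le)
  qed
  define c where "c = inverse (integral\<^sup>L lborel f)"
  have "(\<lambda>x. c * f x) \<in> bump_algebra (r\<^sup>2)"
    by (intro bump_algebra.intros fS)
  then have "smooth (\<lambda>x. c * f x)" by (rule bump_algebra_smooth)
  moreover have "0 < c" using pos by (simp add: c_def)
  moreover have "f x = 0" if "r \<le> norm x" for x using supp[of x] that by linarith
  moreover have "c * integral\<^sup>L lborel f = 1" using pos by (simp add: c_def)
  ultimately show ?thesis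
    using nn int by (intro exI[of _ "\<lambda>x. c * f x"]) auto
qed

subsection \<open>Compactly supported functions of class $C^1$\<close>

text \<open>Test functions are only of class $C^1$, because the proof tests with products and
  compositions involving $C^1$ functions such as \<open>ramp\<close> and the truncations in the
  chain rule. The gradient is a parameter, which keeps \<open>frechet_derivative\<close> out of all
  later integrals.\<close>

definition C1c :: "'a::euclidean_space set \<Rightarrow> ('a \<Rightarrow> real) \<Rightarrow> ('a \<Rightarrow> 'a) \<Rightarrow> bool" where
  "C1c \<Omega> \<eta> D \<longleftrightarrow> (\<forall>x. GDERIV \<eta> x :> D x) \<and> continuous_on UNIV D \<and>
     (\<exists>K. compact K \<and> K \<subseteq> \<Omega> \<and> (\<forall>x. x \<notin> K \<longrightarrow> \<eta> x = 0 \<and> D x = 0))"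

lemma GDERIV_unique: "GDERIV f x :> D \<Longrightarrow> GDERIV f x :> E \<Longrightarrow> D = E"
  by (metis GDERIV_frechet_derivative(2) vector_eq_ldot)

lemma GDERIV_transform_open:
  assumes "GDERIV f x :> D" "open S" "x \<in> S" "\<And>y. y \<in> S \<Longrightarrow> f y = g y"
  shows "GDERIV g x :> D"
  using assms has_derivative_transform_within_open unfolding gderiv_def by blast

lemma C1cI:
  assumes "\<And>x. GDERIV \<eta> x :> D x" "continuous_on UNIV D" "compact K" "K \<subseteq> \<Omega>"
    and "\<And>x. x \<notin> K \<Longrightarrow> \<eta> x = 0"
  shows "C1c \<Omega> \<eta> D"
proof -
  have "D x = 0" if "x \<notin> K" for x
  proof (rule GDERIV_unique[OF assms(1)])
    show "GDERIV \<eta> x :> 0"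
      by (rule GDERIV_transform_open[OF GDERIV_const, of "- K"])
        (use that assms(3,5) in \<open>auto simp: compact_imp_closed\<close>)
  qed
  then show ?thesis using assms unfolding C1c_def by blast
qed

lemma C1cD:
  assumes "C1c \<Omega> \<eta> D"
  shows "GDERIV \<eta> x :> D x" "continuous_on UNIV D" "continuous_on UNIV \<eta>"
    "\<exists>K. compact K \<and> K \<subseteq> \<Omega> \<and> (\<forall>x. x \<notin> K \<longrightarrow> \<eta> x = 0 \<and> D x = 0)"
  using assms GDERIV_continuous unfolding C1c_def
  by (auto simp: continuous_on_eq_continuous_at)

lemma C1c_mono: "C1c \<Omega> \<eta> D \<Longrightarrow> \<Omega> \<subseteq> \<Omega>' \<Longrightarrow> C1c \<Omega>' \<eta> D"
  unfolding C1c_def by blast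

lemma C1c_borel:
  assumes "C1c \<Omega> \<eta> D" shows "\<eta> \<in> borel_measurable borel" "D \<in> borel_measurable borel"
  using C1cD(2,3)[OF assms] by (auto intro: borel_measurable_continuous_onI)

lemma C1c_bounded:
  assumes "C1c \<Omega> \<eta> D"
  shows "\<exists>B>0. \<forall>x. \<bar>\<eta> x\<bar> \<le> B \<and> norm (D x) \<le> B"
proof -
  obtain K where K: "compact K" "\<And>x. x \<notin> K \<Longrightarrow> \<eta> x = 0 \<and> D x = 0"
    using C1cD(4)[OF assms] by blast
  have "compact (\<eta> ` K)" "compact (D ` K)"
    using K(1) C1cD(2,3)[OF assms] by (meson compact_continuous_image continuous_on_subset subset_UNIV)+
  then have "bounded (\<eta> ` K)" "bounded (D ` K)" by (auto intro: compact_imp_bounded)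
  then obtain A B where AB: "\<And>x. x \<in> K \<Longrightarrow> \<bar>\<eta> x\<bar> \<le> A" "\<And>x. x \<in> K \<Longrightarrow> norm (D x) \<le> B"
    unfolding bounded_iff by auto
  have "\<bar>\<eta> x\<bar> \<le> max 1 (max A B) \<and> norm (D x) \<le> max 1 (max A B)" for x
    using AB[of x] K(2)[of x] by (cases "x \<in> K") auto
  then show ?thesis by (intro exI[of _ "max 1 (max A B)"]) auto
qed

lemma C1c_mult:
  assumes "\<And>x. GDERIV f x :> Df x" "continuous_on UNIV Df" "C1c \<Omega> \<eta> D"
  shows "C1c \<Omega> (\<lambda>x. f x * \<eta> x) (\<lambda>x. f x *\<^sub>R D x + \<eta> x *\<^sub>R Df x)"
proof -
  have "continuous_on UNIV f"
    using assms(1) GDERIV_continuous by (auto simp: continuous_on_eq_continuous_at)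
  moreover obtain K where "compact K" "K \<subseteq> \<Omega>" "\<And>x. x \<notin> K \<Longrightarrow> \<eta> x = 0 \<and> D x = 0"
    using C1cD(4)[OF assms(3)] by blast
  ultimately show ?thesis
    using C1cD[OF assms(3)] assms(1,2)
    by (intro C1cI[of _ _ K]) (auto intro!: continuous_intros GDERIV_mult)
qed

lemma C1c_add:
  assumes "C1c \<Omega> \<eta> D" "C1c \<Omega> \<eta>' D'"
  shows "C1c \<Omega> (\<lambda>x. \<eta> x + \<eta>' x) (\<lambda>x. D x + D' x)"
proof -
  obtain K where "compact K" "K \<subseteq> \<Omega>" "\<And>x. x \<notin> K \<Longrightarrow> \<eta> x = 0"
    using C1cD(4)[OF assms(1)] by blast
  moreover obtain K' where "compact K'" "K' \<subseteq> \<Omega>" "\<And>x. x \<notin> K' \<Longrightarrow> \<eta>' x = 0"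
    using C1cD(4)[OF assms(2)] by blast
  ultimately show ?thesis
    using C1cD[OF assms(1)] C1cD[OF assms(2)]
    by (intro C1cI[of _ _ "K \<union> K'"]) (auto intro!: continuous_intros GDERIV_add)
qed

lemma C1c_scale:
  assumes "C1c \<Omega> \<eta> D"
  shows "C1c \<Omega> (\<lambda>x. c * \<eta> x) (\<lambda>x. c *\<^sub>R D x)"
  using C1c_mult[OF GDERIV_const[of c] continuous_on_const assms] by simp

lemma C1c_uniformly_continuous:
  assumes "C1c \<Omega> \<eta> D" "e > 0"
  obtains d where "d > 0" "\<And>x y. dist x y < d \<Longrightarrow> norm (D x - D y) < e"
proof -
  obtain K where K: "compact K" "\<And>x. x \<notin> K \<Longrightarrow> D x = 0"
    using C1cD(4)[OF assms(1)] by blast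
  \<comment> \<open>The compact 1-neighbourhood of the support: if one of two points closer than 1
    lies in \<open>K\<close>, both lie in \<open>L\<close>; if neither does, \<open>D\<close>
    vanishes at both.\<close>
  define L where "L = {x + y |x y. x \<in> K \<and> y \<in> cball 0 1}"
  have "compact L" unfolding L_def by (intro compact_sums K compact_cball)
  then have "uniformly_continuous_on L D"
    using C1cD(2)[OF assms(1)] compact_uniformly_continuous continuous_on_subset by blast
  then obtain d where d: "d > 0" "\<And>x y. x \<in> L \<Longrightarrow> y \<in> L \<Longrightarrow> dist y x < d \<Longrightarrow> dist (D y) (D x) < e"
    using assms(2) unfolding uniformly_continuous_on_def by blast
  have *: "norm (D x - D y) < e" if "x \<in> K" "dist x y < min d 1" for x y
  proof -
    have "x + 0 \<in> L" using that unfolding L_def by force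
    then have "x \<in> L" by simp
    moreover have "x + (y - x) \<in> L"
      using that unfolding L_def
      by (intro CollectI exI[of _ x] exI[of _ "y - x"]) (auto simp: dist_norm norm_minus_commute)
    then have "y \<in> L" by simp
    ultimately show ?thesis using d(2)[of y x] that(2) by (simp add: dist_norm)
  qed
  show ?thesis
  proof (rule that[of "min d 1"])
    show "norm (D x - D y) < e" if "dist x y < min d 1" for x y
      using *[of x y] *[of y x] that K(2)[of x] K(2)[of y] assms(2)
      by (cases "x \<in> K"; cases "y \<in> K") (auto simp: dist_commute norm_minus_commute)
  qed (use d(1) in simp)
qed

lemma C1c_uniformly_differentiable:
  assumes "C1c \<Omega> \<eta> D" "e > 0"
  obtains d where "d > 0"
    "\<And>x h. norm h < d \<Longrightarrow> \<bar>\<eta> (x + h) - \<eta> x - h \<bullet> D x\<bar> \<le> e * norm h"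
proof -
  obtain d where d: "d > 0" "\<And>x y. dist x y < d \<Longrightarrow> norm (D x - D y) < e"
    using C1c_uniformly_continuous[OF assms] by blast
  show ?thesis
  proof (rule that[OF d(1)])
    fix x h :: 'a assume h: "norm h < d"
    have "norm (\<eta> (x + h) - \<eta> x - (x + h - x) \<bullet> D x) \<le> norm (x + h - x) * e"
    proof (rule differentiable_bound_linearization[where S = "ball x d" and f' = "\<lambda>y h. h \<bullet> D y"])
      fix t :: real assume "t \<in> {0..1}"
      then have "norm (t *\<^sub>R h) \<le> norm h" by (simp add: mult_left_le_one_le)
      with h show "x + t *\<^sub>R (x + h - x) \<in> ball x d" by (simp add: dist_norm)
    next
      fix y assume y: "y \<in> ball x d"
      show "(\<eta> has_derivative (\<lambda>h. h \<bullet> D y)) (at y within ball x d)"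
        using C1cD(1)[OF assms(1), of y] has_derivative_at_withinI unfolding gderiv_def by blast
      show "onorm ((\<lambda>h. h \<bullet> D y) - (\<lambda>h. h \<bullet> D x)) \<le> e"
      proof (rule onorm_bound)
        fix z
        have "norm (((\<lambda>h. h \<bullet> D y) - (\<lambda>h. h \<bullet> D x)) z) = \<bar>z \<bullet> (D y - D x)\<bar>"
          by (simp add: inner_diff_right)
        also have "\<dots> \<le> norm z * norm (D y - D x)" by (rule Cauchy_Schwarz_ineq2)
        also have "\<dots> \<le> norm z * e"
          using d(2)[of y x] y by (intro mult_left_mono) (auto simp: dist_commute)
        finally show "norm (((\<lambda>h. h \<bullet> D y) - (\<lambda>h. h \<bullet> D x)) z) \<le> e * norm z"
          by (simp add: mult.commute)
      qed (use assms(2) in simp)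
    qed (use d(1) in simp)
    then show "\<bar>\<eta> (x + h) - \<eta> x - h \<bullet> D x\<bar> \<le> e * norm h" by (simp add: mult.commute)
  qed
qed

subsection \<open>Convolution\<close>

lemma lborel_distr_reflect: "distr lborel borel (\<lambda>y. x - y) = (lborel :: 'a::euclidean_space measure)"
  using lborel_affine[of "-1" x] by (simp add: density_1)

lemma integral_reflect:
  fixes h :: "'a::euclidean_space \<Rightarrow> 'b::euclidean_space"
  assumes "h \<in> borel_measurable borel"
  shows "(\<integral>y. h (x - y) \<partial>lborel) = integral\<^sup>L lborel h"
  by (subst lborel_distr_reflect[of x, symmetric], subst integral_distr) (use assms in auto)

lemma integral_shift:
  fixes h :: "'a::euclidean_space \<Rightarrow> 'b::euclidean_space"
  assumes "h \<in> borel_measurable borel"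
  shows "(\<integral>y. h (y + x) \<partial>lborel) = integral\<^sup>L lborel h"
  by (subst (2) lborel_distr_plus[of x, symmetric], subst integral_distr)
    (use assms in \<open>auto simp: add.commute\<close>)

lemma integrable_shift:
  fixes h :: "'a::euclidean_space \<Rightarrow> 'b::euclidean_space"
  assumes "integrable lborel h"
  shows "integrable lborel (\<lambda>y. h (y + x))"
proof -
  have "integrable (distr lborel borel ((+) x)) h"
    using assms by (simp add: lborel_distr_plus)
  then show ?thesis by (subst (asm) integrable_distr_eq) (use assms in \<open>auto simp: add.commute\<close>)
qed

lemma integrable_bounded_scaleR:
  fixes f :: "'a::euclidean_space \<Rightarrow> 'b::euclidean_space"
  assumes "integrable lborel f" "g \<in> borel_measurable borel" "\<And>x. \<bar>g x\<bar> \<le> B"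
  shows "integrable lborel (\<lambda>x. g x *\<^sub>R f x)"
proof (rule Bochner_Integration.integrable_bound)
  show "integrable lborel (\<lambda>x. B * norm (f x))" using assms(1) by simp
  show "(\<lambda>x. g x *\<^sub>R f x) \<in> borel_measurable lborel" using assms(1,2) by auto
  have "norm (g x *\<^sub>R f x) \<le> norm (B * norm (f x))" for x
    using mult_right_mono[OF order_trans[OF assms(3)[of x] abs_ge_self], of "norm (f x)"]
    by (simp add: abs_mult)
  then show "AE x in lborel. norm (g x *\<^sub>R f x) \<le> norm (B * norm (f x))" by simp
qed

lemma integrable_scaleR_bounded:
  fixes f :: "'a::euclidean_space \<Rightarrow> real" and g :: "'a \<Rightarrow> 'b::euclidean_space"
  assumes "integrable lborel f" "g \<in> borel_measurable borel" "\<And>x. norm (g x) \<le> B"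
  shows "integrable lborel (\<lambda>x. f x *\<^sub>R g x)"
proof (rule Bochner_Integration.integrable_bound)
  show "integrable lborel (\<lambda>x. B * norm (f x))" using assms(1) by simp
  show "(\<lambda>x. f x *\<^sub>R g x) \<in> borel_measurable lborel" using assms(1,2) by auto
  have "norm (f x *\<^sub>R g x) \<le> norm (B * norm (f x))" for x
  proof -
    have "norm (f x *\<^sub>R g x) = norm (g x) * \<bar>f x\<bar>" by simp
    also have "\<dots> \<le> B * \<bar>f x\<bar>" by (intro mult_right_mono assms(3)) simp
    finally show ?thesis by (simp add: abs_mult) (meson abs_ge_self abs_ge_zero mult_right_mono order_trans)
  qed
  then show "AE x in lborel. norm (f x *\<^sub>R g x) \<le> norm (B * norm (f x))" by simp
qed

definition conv :: "('a::euclidean_space \<Rightarrow> real) \<Rightarrow> ('a \<Rightarrow> 'b::euclidean_space) \<Rightarrow> 'a \<Rightarrow> 'b" where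
  "conv k f x = (\<integral>y. k (x - y) *\<^sub>R f y \<partial>lborel)"

lemma conv_commute:
  fixes f :: "'a::euclidean_space \<Rightarrow> 'b::euclidean_space"
  assumes "k \<in> borel_measurable borel" "f \<in> borel_measurable borel"
  shows "conv k f x = (\<integral>y. k y *\<^sub>R f (x - y) \<partial>lborel)"
  unfolding conv_def using assms
  by (subst integral_reflect[of "\<lambda>y. k y *\<^sub>R f (x - y)" x, symmetric]) auto

text \<open>Only the kernel is differentiated, so integrability of \<open>f\<close> suffices: the
  linearisation error of \<open>k\<close> is small uniformly in the base point and is integrated
  against \<open>f\<close>.\<close>

lemma GDERIV_conv:
  assumes k: "C1c \<Omega> k D" and f: "integrable lborel f"
  shows "GDERIV (conv k f) x :> (\<integral>y. f y *\<^sub>R D (x - y) \<partial>lborel)"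
proof -
  obtain B where B: "\<And>x. \<bar>k x\<bar> \<le> B" "\<And>x. norm (D x) \<le> B" using C1c_bounded[OF k] by blast
  note [measurable] = C1c_borel[OF k] borel_measurable_integrable[OF f, simplified]
  have i1: "integrable lborel (\<lambda>y. k (x - y) *\<^sub>R f y)" for x
    by (rule integrable_bounded_scaleR[OF f]) (use B in auto)
  have i2: "integrable lborel (\<lambda>y. f y *\<^sub>R D (x - y))" for x
    by (rule integrable_scaleR_bounded[OF f]) (use B in auto)
  define M where "M = (\<integral>y. norm (f y) \<partial>lborel)"
  have M: "0 \<le> M" by (simp add: M_def)
  let ?D = "\<integral>y. f y *\<^sub>R D (x - y) \<partial>lborel"
  have "(conv k f has_derivative (\<lambda>h. h \<bullet> ?D)) (at x)"
    unfolding has_derivative_at_alt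
  proof (intro conjI allI impI)
    show "bounded_linear (\<lambda>h. h \<bullet> ?D)" by (rule bounded_linear_inner_left)
    fix e :: real assume e: "0 < e"
    \<comment> \<open>\<open>M + 1\<close> instead of \<open>M\<close>, since the integral of
      \<open>norm (f y)\<close> may vanish.\<close>
    obtain d where d: "d > 0"
      "\<And>x h. norm h < d \<Longrightarrow> \<bar>k (x + h) - k x - h \<bullet> D x\<bar> \<le> e / (M + 1) * norm h"
      using C1c_uniformly_differentiable[OF k, of "e / (M + 1)"] e M by auto
    show "\<exists>d>0. \<forall>y. norm (y - x) < d \<longrightarrow>
        norm (conv k f y - conv k f x - (y - x) \<bullet> ?D) \<le> e * norm (y - x)"
    proof (intro exI[of _ d] conjI allI impI d(1))
      fix z assume z: "norm (z - x) < d"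
      define h where "h = z - x"
      have e': "h \<bullet> ?D = (\<integral>y. h \<bullet> (f y *\<^sub>R D (x - y)) \<partial>lborel)"
        by (rule integral_inner_right[symmetric]) (rule i2)
      have j: "integrable lborel (\<lambda>y. h \<bullet> (f y *\<^sub>R D (x - y)))"
        by (intro integrable_inner_right i2)
      have "conv k f z - conv k f x - h \<bullet> ?D
          = (\<integral>y. k (z - y) *\<^sub>R f y - k (x - y) *\<^sub>R f y - h \<bullet> (f y *\<^sub>R D (x - y)) \<partial>lborel)"
        unfolding conv_def e'
        by (simp only: Bochner_Integration.integral_diff Bochner_Integration.integrable_diff i1 j)
      also have "\<dots> = (\<integral>y. (k (x - y + h) - k (x - y) - h \<bullet> D (x - y)) *\<^sub>R f y \<partial>lborel)"
        by (intro Bochner_Integration.integral_cong) (auto simp: h_def algebra_simps)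
      also have "norm \<dots> \<le> (\<integral>y. e / (M + 1) * norm h * norm (f y) \<partial>lborel)"
      proof (rule Bochner_Integration.integral_norm_bound_integral)
        show "integrable lborel (\<lambda>y. (k (x - y + h) - k (x - y) - h \<bullet> D (x - y)) *\<^sub>R f y)"
        proof (rule integrable_bounded_scaleR[OF f])
          show "\<bar>k (x - y + h) - k (x - y) - h \<bullet> D (x - y)\<bar> \<le> e / (M + 1) * norm h" for y
            by (rule d(2)) (use z in \<open>simp add: h_def\<close>)
        qed measurable
        show "norm ((k (x - y + h) - k (x - y) - h \<bullet> D (x - y)) *\<^sub>R f y) \<le> e / (M + 1) * norm h * norm (f y)" for y
          using mult_right_mono[OF d(2)[of h "x - y"], of "norm (f y)"] z
          by (simp add: h_def abs_mult)
      qed (use f in simp)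
      also have "\<dots> = e / (M + 1) * norm h * M" by (simp add: M_def)
      also have "\<dots> = e * norm h * (M / (M + 1))" by simp
      also have "\<dots> \<le> e * norm h * 1" using e M by (intro mult_left_mono) auto
      finally show "norm (conv k f z - conv k f x - (z - x) \<bullet> ?D) \<le> e * norm (z - x)"
        by (simp add: h_def)
    qed
  qed
  then show ?thesis by (simp add: gderiv_def)
qed

lemma continuous_conv_grad:
  fixes f :: "'a::euclidean_space \<Rightarrow> real"
  assumes k: "C1c \<Omega> k D" and f: "integrable lborel f"
  shows "continuous_on UNIV (\<lambda>x. \<integral>y. f y *\<^sub>R D (x - y) \<partial>lborel)"
proof -
  obtain B where B: "\<And>x. \<bar>k x\<bar> \<le> B" "\<And>x. norm (D x) \<le> B" using C1c_bounded[OF k] by blast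
  note [measurable] = C1c_borel[OF k] borel_measurable_integrable[OF f, simplified]
  have "(\<lambda>i. \<integral>y. f y *\<^sub>R D (u i - y) \<partial>lborel) \<longlonglongrightarrow> (\<integral>y. f y *\<^sub>R D (x - y) \<partial>lborel)"
    if u: "u \<longlonglongrightarrow> x" for u x
  proof (rule integral_dominated_convergence[where w = "\<lambda>y. B * norm (f y)"])
    have "isCont D z" for z using C1cD(2)[OF k] by (simp add: continuous_on_eq_continuous_at)
    then show "AE y in lborel. (\<lambda>i. f y *\<^sub>R D (u i - y)) \<longlonglongrightarrow> f y *\<^sub>R D (x - y)"
      by (intro AE_I2 tendsto_intros isCont_tendsto_compose[where g = D] u)
    show "AE y in lborel. norm (f y *\<^sub>R D (u i - y)) \<le> B * norm (f y)" for i
      using B(2) by (auto simp: mult.commute[of B] intro!: mult_left_mono)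
  qed (use f in auto)
  then show ?thesis unfolding continuous_on_sequentially by (auto simp: o_def)
qed

lemma conv_zero:
  assumes "\<And>x. r \<le> norm x \<Longrightarrow> k x = 0" "\<And>y. y \<in> ball x r \<Longrightarrow> f y = 0"
  shows "conv k f x = 0"
proof -
  have "k (x - y) *\<^sub>R f y = 0" for y
    using assms(1)[of "x - y"] assms(2)[of y] by (cases "dist x y < r") (auto simp: dist_norm)
  then show ?thesis unfolding conv_def by (simp only: Bochner_Integration.integral_zero)
qed

lemma C1c_conv:
  fixes f :: "'a::euclidean_space \<Rightarrow> real"
  assumes k: "C1c UNIV k D" "\<And>x. r \<le> norm x \<Longrightarrow> k x = 0" and f: "integrable lborel f"
    and K: "compact K" "\<And>x. x \<notin> K \<Longrightarrow> f x = 0"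
    and \<Omega>: "\<And>x y. x \<in> K \<Longrightarrow> dist x y \<le> r \<Longrightarrow> y \<in> \<Omega>"
  shows "C1c \<Omega> (conv k f) (\<lambda>x. \<integral>y. f y *\<^sub>R D (x - y) \<partial>lborel)"
proof (rule C1cI)
  let ?K = "{x + y |x y. x \<in> K \<and> y \<in> cball 0 r}"
  show "compact ?K" by (intro compact_sums K compact_cball)
  show "?K \<subseteq> \<Omega>" using \<Omega> by (auto simp: dist_norm)
  show "conv k f x = 0" if "x \<notin> ?K" for x
  proof (rule conv_zero[OF k(2)])
    fix y assume "y \<in> ball x r"
    have "y \<notin> K"
    proof
      assume "y \<in> K"
      moreover have "x - y \<in> cball 0 r" using \<open>y \<in> ball x r\<close> by (auto simp: dist_norm norm_minus_commute)
      ultimately have "y + (x - y) \<in> ?K" by blast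
      moreover have "y + (x - y) = x" by simp
      ultimately show False using that by (simp only:)
    qed
    then show "f y = 0" by (rule K(2))
  qed
qed (use GDERIV_conv[OF k(1) f] continuous_conv_grad[OF k(1) f] in auto)

lemma smooth_compact_C1c:
  assumes "smooth k" "\<And>x. r \<le> norm x \<Longrightarrow> k x = 0"
  shows "C1c UNIV k (grad k)"
  by (rule C1cI[of _ _ "cball 0 r"])
    (use assms in \<open>auto intro: smooth_GDERIV smooth_continuous_grad\<close>)

lemma smooth_conv:
  fixes f :: "'a::euclidean_space \<Rightarrow> real"
  assumes f: "integrable lborel f" and k: "smooth k" "\<And>x. r \<le> norm x \<Longrightarrow> k x = 0"
  shows "smooth (conv k f)"
proof -
  \<comment> \<open>The kernel is generalised, since each derivative falls on it. The strict
    inequality describes an open set, on which vanishing passes to derivatives, so the radius stays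
    the same throughout the induction.\<close>
  have "\<forall>k. smooth k \<and> (\<forall>x. r < norm x \<longrightarrow> k x = 0) \<longrightarrow> C_k_on n UNIV (conv k f)" for n
  proof (induction n)
    case 0
    have "continuous_on UNIV (conv k f)" if k: "smooth k" "\<forall>x. r < norm x \<longrightarrow> k x = 0" for k
    proof -
      have "C1c UNIV k (grad k)"
        using k by (intro smooth_compact_C1c[of _ "r + 1"]) auto
      from GDERIV_continuous[OF GDERIV_conv[OF this f]] show ?thesis
        by (simp add: continuous_on_eq_continuous_at)
    qed
    then show ?case by simp
  next
    case (Suc n)
    show ?case
    proof (intro allI impI, elim conjE)
      fix k :: "'a \<Rightarrow> real" assume k: "smooth k" "\<forall>x. r < norm x \<longrightarrow> k x = 0"
      have C: "C1c UNIV k (grad k)"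
        using k by (intro smooth_compact_C1c[of _ "r + 1"]) auto
      obtain B where B: "\<And>x. norm (grad k x) \<le> B" using C1c_bounded[OF C] by blast
      note D = GDERIV_frechet_derivative[OF GDERIV_conv[OF C f]]
      note [measurable] = C1c_borel[OF C] borel_measurable_integrable[OF f, simplified]
      have i2: "integrable lborel (\<lambda>y. f y *\<^sub>R grad k (x - y))" for x
        by (rule integrable_scaleR_bounded[OF f]) (use B in auto)
      have eq: "frechet_derivative (conv k f) (at x) b = conv (\<lambda>z. frechet_derivative k (at z) b) f x"
        for x b
      proof -
        have "frechet_derivative (conv k f) (at x) b = (\<integral>y. b \<bullet> (f y *\<^sub>R grad k (x - y)) \<partial>lborel)"
          unfolding D(2) by (rule integral_inner_right[symmetric]) (rule i2)
        also have "\<dots> = conv (\<lambda>z. frechet_derivative k (at z) b) f x"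
          unfolding conv_def
          by (simp add: GDERIV_frechet_derivative(2)[OF smooth_GDERIV[OF k(1)]] mult.commute)
        finally show ?thesis .
      qed
      have z: "frechet_derivative k (at x) b = 0" if "r < norm x" for x b
      proof -
        have "GDERIV k x :> 0"
          by (rule GDERIV_transform_open[OF GDERIV_const, of "- cball 0 r"])
            (use that k(2) in auto)
        then show ?thesis by (simp add: GDERIV_frechet_derivative(2))
      qed
      show "C_k_on (Suc n) UNIV (conv k f)"
        using D(1) Suc smooth_derivative[OF k(1)] z by (simp add: eq)
    qed
  qed
  then show ?thesis using k by (auto simp: smooth_def)
qed

subsection \<open>Mollification\<close>

definition moll :: "nat \<Rightarrow> 'a::euclidean_space \<Rightarrow> real" where
  "moll k = (SOME \<rho>. smooth \<rho> \<and> (\<forall>x. 0 \<le> \<rho> x) \<and>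
    (\<forall>x. 1 / (real k + 1) \<le> norm x \<longrightarrow> \<rho> x = 0) \<and> integrable lborel \<rho> \<and> integral\<^sup>L lborel \<rho> = 1)"

lemma
  shows moll_smooth: "smooth (moll k :: 'a::euclidean_space \<Rightarrow> real)"
    and moll_nonneg: "0 \<le> moll k (x :: 'a)"
    and moll_zero: "1 / (real k + 1) \<le> norm x \<Longrightarrow> moll k (x :: 'a) = 0"
    and moll_integrable: "integrable lborel (moll k :: 'a \<Rightarrow> real)"
    and moll_integral: "integral\<^sup>L lborel (moll k :: 'a \<Rightarrow> real) = 1"
  using someI_ex[OF smooth_bump_exists[of "1 / (real k + 1)", where 'a = 'a]]
  unfolding moll_def[symmetric] by auto

lemma moll_C1c: "C1c UNIV (moll k) (grad (moll k))"
  by (rule smooth_compact_C1c[OF moll_smooth moll_zero])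

lemma moll_borel [measurable]: "moll k \<in> borel_measurable borel"
  by (rule C1c_borel(1)[OF moll_C1c])

lemma conv_moll_integrable:
  fixes f :: "'a::euclidean_space \<Rightarrow> 'b::euclidean_space"
  assumes f: "integrable lborel f"
  shows "integrable lborel (\<lambda>y. moll k (x - y) *\<^sub>R f y)"
proof -
  obtain B where "\<And>x :: 'a. \<bar>moll k x\<bar> \<le> B" using C1c_bounded[OF moll_C1c[of k]] by blast
  then show ?thesis by (intro integrable_bounded_scaleR[OF f]) auto
qed

lemma moll_integral_reflect: "(\<integral>y. moll k (x - y :: 'a::euclidean_space) \<partial>lborel) = 1"
  by (subst integral_reflect) (simp_all add: moll_integral)

lemma moll_integrable_reflect: "integrable lborel (\<lambda>y. moll k (x - y :: 'a::euclidean_space))"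
proof -
  have "integrable (distr lborel borel ((-) x)) (moll k)"
    using moll_integrable[of k] by (simp add: lborel_distr_reflect)
  then show ?thesis by (subst (asm) integrable_distr_eq) auto
qed

lemma moll_integral_shift:
  "(\<integral>x. moll k (x - y :: 'a::euclidean_space) \<partial>lborel) = 1"
  "integrable lborel (\<lambda>x. moll k (x - y :: 'a::euclidean_space))"
  using integral_shift[of "moll k" "- y"] integrable_shift[OF moll_integrable[of k], of "- y"]
  by (simp_all add: moll_integral)

lemma conv_pair_integrable:
  fixes f :: "'a::euclidean_space \<Rightarrow> 'b::euclidean_space"
  assumes f: "integrable lborel f"
  shows "integrable (lborel \<Otimes>\<^sub>M lborel) (\<lambda>(y, x). moll k (x - y) *\<^sub>R f y)"
proof -
  note [measurable] = borel_measurable_integrable[OF f, simplified]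
  show ?thesis
  proof (rule lborel_pair.Fubini_integrable)
    show "(\<lambda>(y, x). moll k (x - y) *\<^sub>R f y) \<in> borel_measurable (lborel \<Otimes>\<^sub>M lborel)"
      by measurable
    have "(\<integral>x. norm (moll k (x - y) *\<^sub>R f y) \<partial>lborel) = norm (f y)" for y
      using moll_integral_shift[of k y] by (simp add: abs_of_nonneg[OF moll_nonneg])
    then show "integrable lborel (\<lambda>y. \<integral>x. norm (case (y, x) of (y, x) \<Rightarrow> moll k (x - y) *\<^sub>R f y) \<partial>lborel)"
      using integrable_norm[OF f] by (simp only: prod.case)
    show "AE y in lborel. integrable lborel (\<lambda>x. case (y, x) of (y, x) \<Rightarrow> moll k (x - y) *\<^sub>R f y)"
      by (intro AE_I2) (simp only: prod.case integrable_scaleR_left moll_integral_shift(2))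
  qed
qed

lemma
  fixes f :: "'a::euclidean_space \<Rightarrow> 'b::euclidean_space"
  assumes f: "integrable lborel f"
  shows integrable_conv: "integrable lborel (conv (moll k) f)"
    and integral_conv: "integral\<^sup>L lborel (conv (moll k) f) = integral\<^sup>L lborel f"
    and integral_norm_conv: "(\<integral>x. norm (conv (moll k) f x) \<partial>lborel) \<le> (\<integral>x. norm (f x) \<partial>lborel)"
proof -
  note P = conv_pair_integrable[OF f, of k]
  show int: "integrable lborel (conv (moll k) f)"
    unfolding conv_def by (rule lborel_pair.integrable_snd[OF P])
  have "(\<integral>x. conv (moll k) f x \<partial>lborel) = (\<integral>y. (\<integral>x. moll k (x - y) *\<^sub>R f y \<partial>lborel) \<partial>lborel)"
    unfolding conv_def by (rule lborel_pair.Fubini_integral[OF P])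
  moreover have "(\<integral>x. moll k (x - y) *\<^sub>R f y \<partial>lborel) = f y" for y
    using moll_integral_shift[of k y] by simp
  ultimately show "integral\<^sup>L lborel (conv (moll k) f) = integral\<^sup>L lborel f"
    by (simp only:)
  note PN = conv_pair_integrable[OF integrable_norm[OF f], of k]
  have "(\<integral>x. norm (conv (moll k) f x) \<partial>lborel)
      \<le> (\<integral>x. (\<integral>y. moll k (x - y) *\<^sub>R norm (f y) \<partial>lborel) \<partial>lborel)"
  proof (rule integral_mono)
    show "integrable lborel (\<lambda>x. \<integral>y. moll k (x - y) *\<^sub>R norm (f y) \<partial>lborel)"
      by (rule lborel_pair.integrable_snd[OF PN])
    show "norm (conv (moll k) f x) \<le> (\<integral>y. moll k (x - y) *\<^sub>R norm (f y) \<partial>lborel)" for x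
      unfolding conv_def using integral_norm_bound[of lborel "\<lambda>y. moll k (x - y) *\<^sub>R f y"]
      by (simp add: abs_of_nonneg[OF moll_nonneg])
  qed (use int in simp)
  also have "\<dots> = (\<integral>y. (\<integral>x. moll k (x - y) *\<^sub>R norm (f y) \<partial>lborel) \<partial>lborel)"
    by (rule lborel_pair.Fubini_integral[OF PN])
  also have "(\<lambda>y. \<integral>x. moll k (x - y) *\<^sub>R norm (f y) \<partial>lborel) = (\<lambda>y. norm (f y))"
    by (simp add: moll_integral_shift)
  finally show "(\<integral>x. norm (conv (moll k) f x) \<partial>lborel) \<le> (\<integral>x. norm (f x) \<partial>lborel)" .
qed

lemma conv_moll_add:
  fixes f :: "'a::euclidean_space \<Rightarrow> 'b::euclidean_space"
  assumes "integrable lborel f" "integrable lborel g"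
  shows "conv (moll k) (\<lambda>x. f x + g x) x = conv (moll k) f x + conv (moll k) g x"
  using conv_moll_integrable[OF assms(1)] conv_moll_integrable[OF assms(2)]
  by (simp add: conv_def scaleR_add_right)

lemma conv_moll_diff:
  fixes f :: "'a::euclidean_space \<Rightarrow> 'b::euclidean_space"
  assumes "integrable lborel f" "integrable lborel g"
  shows "conv (moll k) (\<lambda>x. f x - g x) x = conv (moll k) f x - conv (moll k) g x"
  using conv_moll_integrable[OF assms(1)] conv_moll_integrable[OF assms(2)]
  by (simp add: conv_def scaleR_diff_right)

lemma eventually_moll_radius: "r > 0 \<Longrightarrow> \<forall>\<^sub>F k in sequentially. 1 / (real k + 1) \<le> r"
proof -
  assume "r > 0"
  have "(\<lambda>k. 1 / (real k + 1)) \<longlonglongrightarrow> 0" using LIMSEQ_inverse_real_of_nat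
    by (simp add: inverse_eq_divide add.commute)
  from order_tendstoD(2)[OF this \<open>r > 0\<close>] show ?thesis by eventually_elim simp
qed

text \<open>The mollification at \<open>x\<close> is an average of values of \<open>g\<close> in the
  ball of radius \<open>r\<close>. With \<open>e = 0\<close> it is exact where \<open>g\<close> is
  locally constant, which is how cutoffs get the value 1.\<close>

lemma conv_moll_close:
  fixes g :: "'a::euclidean_space \<Rightarrow> 'b::euclidean_space"
  assumes g: "integrable lborel g" and k: "1 / (real k + 1) \<le> r"
    and e: "\<And>y. dist x y < r \<Longrightarrow> norm (g y - g x) \<le> e"
  shows "norm (conv (moll k) g x - g x) \<le> e"
proof -
  have "conv (moll k) g x - g x = (\<integral>y. moll k (x - y) *\<^sub>R g y - moll k (x - y) *\<^sub>R g x \<partial>lborel)"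
    unfolding conv_def
    using conv_moll_integrable[OF g, of k x] moll_integrable_reflect[of k x] moll_integral_reflect[of k x]
    by (subst Bochner_Integration.integral_diff) auto
  also have "norm \<dots> \<le> (\<integral>y. moll k (x - y) * e \<partial>lborel)"
  proof (rule Bochner_Integration.integral_norm_bound_integral)
    show "integrable lborel (\<lambda>y. moll k (x - y) *\<^sub>R g y - moll k (x - y) *\<^sub>R g x)"
      using conv_moll_integrable[OF g, of k x] moll_integrable_reflect[of k x] by auto
    show "integrable lborel (\<lambda>y. moll k (x - y) * e)" using moll_integrable_reflect[of k x] by auto
    fix y
    show "norm (moll k (x - y) *\<^sub>R g y - moll k (x - y) *\<^sub>R g x) \<le> moll k (x - y) * e"
    proof (cases "dist x y < r")
      case True
      then show ?thesis using mult_left_mono[OF e[OF True] moll_nonneg[of k "x - y"]]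
        by (simp add: scaleR_diff_right[symmetric] abs_of_nonneg[OF moll_nonneg])
    next
      case False
      then show ?thesis using k by (simp add: dist_norm moll_zero)
    qed
  qed
  also have "\<dots> = e" using moll_integral_reflect[of k x] by simp
  finally show ?thesis .
qed

text \<open>Convolution with a mollifier does not increase the $L^1$ norm, so the functions for
  which mollification converges form a closed set.\<close>

lemma conv_moll_L1_closure:
  fixes f :: "'a::euclidean_space \<Rightarrow> 'b::euclidean_space"
  assumes f: "integrable lborel f"
    and g: "\<And>e. 0 < e \<Longrightarrow> \<exists>g. integrable lborel g \<and> (\<integral>x. norm (f x - g x) \<partial>lborel) < e \<and>
       (\<lambda>k. \<integral>x. norm (conv (moll k) g x - g x) \<partial>lborel) \<longlonglongrightarrow> 0"
  shows "(\<lambda>k. \<integral>x. norm (conv (moll k) f x - f x) \<partial>lborel) \<longlonglongrightarrow> 0"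
proof (rule LIMSEQ_I)
  fix r :: real assume "0 < r"
  then obtain g where g: "integrable lborel g" "(\<integral>x. norm (f x - g x) \<partial>lborel) < r / 3"
       "(\<lambda>k. \<integral>x. norm (conv (moll k) g x - g x) \<partial>lborel) \<longlonglongrightarrow> 0"
    using assms(2)[of "r / 3"] by auto
  have fg: "integrable lborel (\<lambda>x. f x - g x)" using f g by auto
  from LIMSEQ_D[OF g(3), of "r / 3"] \<open>0 < r\<close>
  obtain N where N: "\<And>k. k \<ge> N \<Longrightarrow> (\<integral>x. norm (conv (moll k) g x - g x) \<partial>lborel) < r / 3"
    by (auto simp: abs_less_iff)
  have "(\<integral>x. norm (conv (moll k) f x - f x) \<partial>lborel) < r" if "k \<ge> N" for k
  proof -
    have i: "integrable lborel (conv (moll k) (\<lambda>x. f x - g x))" "integrable lborel (conv (moll k) g)"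
      "integrable lborel (conv (moll k) f)"
      using integrable_conv[OF fg] integrable_conv[OF f] integrable_conv[OF g(1)] by auto
    have "(\<integral>x. norm (conv (moll k) f x - f x) \<partial>lborel)
      \<le> (\<integral>x. norm (conv (moll k) (\<lambda>x. f x - g x) x) + norm (conv (moll k) g x - g x) + norm (f x - g x) \<partial>lborel)"
    proof (rule integral_mono)
      fix x
      have "conv (moll k) f x - f x = conv (moll k) (\<lambda>x. f x - g x) x + (conv (moll k) g x - g x) - (f x - g x)"
        by (simp add: conv_moll_diff f g(1))
      then show "norm (conv (moll k) f x - f x)
        \<le> norm (conv (moll k) (\<lambda>x. f x - g x) x) + norm (conv (moll k) g x - g x) + norm (f x - g x)"
        using norm_triangle_ineq4[of "conv (moll k) (\<lambda>x. f x - g x) x + (conv (moll k) g x - g x)" "f x - g x"]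
          norm_triangle_ineq[of "conv (moll k) (\<lambda>x. f x - g x) x" "conv (moll k) g x - g x"] by simp
    qed (use i f g fg in auto)
    also have "\<dots> = (\<integral>x. norm (conv (moll k) (\<lambda>x. f x - g x) x) \<partial>lborel)
       + (\<integral>x. norm (conv (moll k) g x - g x) \<partial>lborel) + (\<integral>x. norm (f x - g x) \<partial>lborel)"
      using i f g fg by simp
    also have "\<dots> < r" using integral_norm_conv[OF fg, of k] N[OF that] g(2) by linarith
    finally show ?thesis .
  qed
  then show "\<exists>N. \<forall>k\<ge>N. norm ((\<integral>x. norm (conv (moll k) f x - f x) \<partial>lborel) - 0) < r"
    by (intro exI[of _ N]) (simp add: abs_of_nonneg[OF Bochner_Integration.integral_nonneg])
qed

text \<open>For open \<open>S\<close> the mollified indicator tends to 1 at every point of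
  \<open>S\<close>. Mass is preserved, so what is gained outside equals what is lost inside, and the
  $L^1$ error is twice the loss.\<close>

lemma conv_moll_L1_open:
  fixes c :: "'b::euclidean_space"
  assumes S: "open S" "emeasure lborel (S :: 'a::euclidean_space set) < \<infinity>"
  shows "(\<lambda>k. \<integral>x. norm (conv (moll k) (\<lambda>x. indicator S x *\<^sub>R c) x - indicator S x *\<^sub>R c) \<partial>lborel) \<longlonglongrightarrow> 0"
proof -
  let ?I = "indicator S :: 'a \<Rightarrow> real"
  have [measurable]: "S \<in> sets borel" using S by simp
  have I: "integrable lborel ?I" using S by (intro integrable_real_indicator) auto
  define h where "h = (\<lambda>k. conv (moll k) ?I)"
  have h: "integrable lborel (h k)" "integral\<^sup>L lborel (h k) = integral\<^sup>L lborel ?I" for k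
    using integrable_conv[OF I] integral_conv[OF I] by (auto simp: h_def)
  have h1: "0 \<le> h k x" "h k x \<le> 1" for k x
  proof -
    show "0 \<le> h k x" unfolding h_def conv_def by (rule Bochner_Integration.integral_nonneg) (simp add: moll_nonneg)
    have "h k x \<le> (\<integral>y. moll k (x - y) \<partial>lborel)" unfolding h_def conv_def
      using conv_moll_integrable[OF I, of k x] moll_integrable_reflect[of k x]
      by (intro integral_mono) (auto simp: moll_nonneg indicator_def)
    then show "h k x \<le> 1" by (simp add: moll_integral_reflect)
  qed
  have lim: "(\<lambda>k. h k x) \<longlonglongrightarrow> 1" if x: "x \<in> S" for x
  proof -
    obtain r where r: "r > 0" "ball x r \<subseteq> S" using S x openE by blast
    have "\<forall>\<^sub>F k in sequentially. h k x = 1"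
      using eventually_moll_radius[OF r(1)]
    proof eventually_elim
      case (elim k)
      have "norm (h k x - ?I x) \<le> 0" unfolding h_def
        by (rule conv_moll_close[OF I elim]) (use r(2) x in \<open>auto simp: indicator_def subset_iff\<close>)
      then show ?case using x by simp
    qed
    then show ?thesis by (rule tendsto_eventually)
  qed
  have "(\<lambda>k. \<integral>x. ?I x * (1 - h k x) \<partial>lborel) \<longlonglongrightarrow> integral\<^sup>L lborel (\<lambda>x::'a. 0)"
  proof (rule integral_dominated_convergence[where w = ?I])
    show "AE x in lborel. (\<lambda>k. ?I x * (1 - h k x)) \<longlonglongrightarrow> 0"
    proof (rule AE_I2)
      fix x show "(\<lambda>k. ?I x * (1 - h k x)) \<longlonglongrightarrow> 0"
        using tendsto_diff[OF tendsto_const[of 1] lim[of x]] by (cases "x \<in> S") auto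
    qed
    show "AE x in lborel. norm (?I x * (1 - h k x)) \<le> ?I x" for k
      using h1 by (intro AE_I2) (auto simp: indicator_def)
  qed (use I h(1) in auto)
  then have *: "(\<lambda>k. 2 * (\<integral>x. ?I x * (1 - h k x) \<partial>lborel) * norm c) \<longlonglongrightarrow> 2 * 0 * norm c"
    by (intro tendsto_intros) simp
  have "(\<integral>x. norm (conv (moll k) (\<lambda>x. indicator S x *\<^sub>R c) x - indicator S x *\<^sub>R c) \<partial>lborel)
      = 2 * (\<integral>x. ?I x * (1 - h k x) \<partial>lborel) * norm c" for k
  proof -
    have "conv (moll k) (\<lambda>x. indicator S x *\<^sub>R c) x = h k x *\<^sub>R c" for x
      unfolding h_def conv_def
      using conv_moll_integrable[OF I, of k x] by (simp add: integral_scaleR_left[symmetric] del: integral_scaleR_left)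
    \<comment> \<open>As \<open>h k\<close> takes values between 0 and 1, the absolute difference is
      the signed difference plus twice the deficit on \<open>S\<close>; the signed part integrates
      to 0.\<close>
    then have "norm (conv (moll k) (\<lambda>x. indicator S x *\<^sub>R c) x - indicator S x *\<^sub>R c)
        = ((h k x - ?I x) + 2 * (?I x * (1 - h k x))) * norm c" for x
      using h1[of k x] by (auto simp: scaleR_diff_left[symmetric] indicator_def)
    moreover have "integrable lborel (\<lambda>x. ?I x * (1 - h k x))"
      by (rule Bochner_Integration.integrable_bound[OF I]) (use h(1)[of k] h1 in \<open>auto simp: indicator_def\<close>)
    ultimately show ?thesis using h[of k] I by simp
  qed
  with * show ?thesis by simp
qed

text \<open>Indicators of Borel sets are reduced to those of open sets by outer regularity, which
  takes the place of the density of continuous functions.\<close>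

lemma conv_moll_L1:
  fixes f :: "'a::euclidean_space \<Rightarrow> 'b::euclidean_space"
  assumes "integrable lborel f"
  shows "(\<lambda>k. \<integral>x. norm (conv (moll k) f x - f x) \<partial>lborel) \<longlonglongrightarrow> 0"
  using assms
proof (induction rule: integrable_induct)
  case (base A c)
  then have A: "A \<in> sets borel" "emeasure lborel A < \<infinity>" by auto
  then have "integrable lborel (\<lambda>x. indicator A x *\<^sub>R c)" by auto
  then show ?case
  proof (rule conv_moll_L1_closure)
    fix e :: real assume e: "0 < e"
    define d where "d = e / (norm c + 1)"
    have d: "d > 0" using e by (auto simp: d_def intro!: divide_pos_pos add_nonneg_pos)
    obtain S where S: "open S" "A \<subseteq> S" "emeasure lborel (S - A) < ennreal d"
      using outer_regular_lborel[OF A(1) d] by blast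
    have [measurable]: "S \<in> sets borel" "A \<in> sets borel" using S A by auto
    have "emeasure lborel S = emeasure lborel A + emeasure lborel (S - A)"
      using S(2) by (subst plus_emeasure) (auto simp: Un_absorb1)
    also have "\<dots> < \<infinity>" using A(2) S(3) by (auto intro: less_trans)
    finally have fin: "emeasure lborel S < \<infinity>" .
    have SA: "measure lborel (S - A) < d"
      using S(3) by (simp add: measure_def enn2real_less_iff less_trans[OF _ ennreal_less_top])
    show "\<exists>g. integrable lborel g \<and> (\<integral>x. norm (indicator A x *\<^sub>R c - g x) \<partial>lborel) < e \<and>
       (\<lambda>k. \<integral>x. norm (conv (moll k) g x - g x) \<partial>lborel) \<longlonglongrightarrow> 0"
    proof (intro exI[of _ "\<lambda>x. indicator S x *\<^sub>R c"] conjI conv_moll_L1_open S(1) fin)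
      show "integrable lborel (\<lambda>x. indicator S x *\<^sub>R c)" using fin by auto
      have "norm (indicator A x *\<^sub>R c - indicator S x *\<^sub>R c) = indicator (S - A) x * norm c" for x
        using S(2) by (auto simp: indicator_def)
      then have "(\<integral>x. norm (indicator A x *\<^sub>R c - indicator S x *\<^sub>R c) \<partial>lborel) = measure lborel (S - A) * norm c"
        by simp
      also have "\<dots> \<le> d * norm c" using SA by (intro mult_right_mono) auto
      also have "\<dots> < e"
      proof -
        have "norm c / (norm c + 1) < 1" by (simp add: divide_less_eq_1 add_nonneg_pos)
        then show ?thesis using e mult_strict_left_mono[of "norm c / (norm c + 1)" 1 e]
          by (simp add: d_def)
      qed
      finally show "(\<integral>x. norm (indicator A x *\<^sub>R c - indicator S x *\<^sub>R c) \<partial>lborel) < e" .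
    qed
  qed
next
  case (add f g)
  show ?case
  proof (rule tendsto_sandwich[OF _ _ tendsto_const])
    show "(\<lambda>k. (\<integral>x. norm (conv (moll k) f x - f x) \<partial>lborel) + (\<integral>x. norm (conv (moll k) g x - g x) \<partial>lborel)) \<longlonglongrightarrow> 0"
      using tendsto_add[OF add.IH] by simp
    have i: "integrable lborel (conv (moll k) f)" "integrable lborel (conv (moll k) g)"
      "integrable lborel (conv (moll k) (\<lambda>x. f x + g x))" for k
      using integrable_conv add.hyps Bochner_Integration.integrable_add[OF add.hyps] by blast+
    have "(\<integral>x. norm (conv (moll k) (\<lambda>x. f x + g x) x - (f x + g x)) \<partial>lborel)
        \<le> (\<integral>x. norm (conv (moll k) f x - f x) + norm (conv (moll k) g x - g x) \<partial>lborel)" for k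
    proof (rule integral_mono)
      show "norm (conv (moll k) (\<lambda>x. f x + g x) x - (f x + g x))
        \<le> norm (conv (moll k) f x - f x) + norm (conv (moll k) g x - g x)" for x
        unfolding conv_moll_add[OF add.hyps] by (rule norm_diff_triangle_ineq)
    qed (use i add.hyps in auto)
    also have "(\<integral>x. norm (conv (moll k) f x - f x) + norm (conv (moll k) g x - g x) \<partial>lborel)
       = (\<integral>x. norm (conv (moll k) f x - f x) \<partial>lborel) + (\<integral>x. norm (conv (moll k) g x - g x) \<partial>lborel)" for k
      using i add.hyps by simp
    finally show "\<forall>\<^sub>F k in sequentially. (\<integral>x. norm (conv (moll k) (\<lambda>x. f x + g x) x - (f x + g x)) \<partial>lborel)
      \<le> (\<integral>x. norm (conv (moll k) f x - f x) \<partial>lborel) + (\<integral>x. norm (conv (moll k) g x - g x) \<partial>lborel)"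
      by simp
  qed simp
next
  case (lim f s)
  show ?case
  proof (rule conv_moll_L1_closure[OF lim.hyps(4)])
    fix e :: real assume e: "0 < e"
    \<comment> \<open>The approximants satisfy \<open>norm (s i x) \<le> 2 * norm (f x)\<close>,
      whence the majorant \<open>3 * norm (f x)\<close>.\<close>
    have "(\<lambda>i. \<integral>x. norm (f x - s i x) \<partial>lborel) \<longlonglongrightarrow> integral\<^sup>L lborel (\<lambda>x::'a. 0)"
    proof (rule integral_dominated_convergence[where w = "\<lambda>x. 3 * norm (f x)"])
      show "AE x in lborel. (\<lambda>i. norm (f x - s i x)) \<longlonglongrightarrow> 0"
      proof (rule AE_I2)
        fix x
        show "(\<lambda>i. norm (f x - s i x)) \<longlonglongrightarrow> 0"
          using tendsto_norm[OF tendsto_diff[OF tendsto_const[of "f x"] lim.hyps(2)[of x]]] by simp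
      qed
      show "AE x in lborel. norm (norm (f x - s i x)) \<le> 3 * norm (f x)" for i
      proof (rule AE_I2)
        fix x show "norm (norm (f x - s i x)) \<le> 3 * norm (f x)"
          using lim.hyps(3)[of x i] norm_triangle_ineq4[of "f x" "s i x"] by simp
      qed
    qed (use lim.hyps in auto)
    then have "\<forall>\<^sub>F i in sequentially. (\<integral>x. norm (f x - s i x) \<partial>lborel) < e"
      using e order_tendstoD(2) by fastforce
    then obtain i where "(\<integral>x. norm (f x - s i x) \<partial>lborel) < e"
      using eventually_happens' sequentially_bot by blast
    then show "\<exists>g. integrable lborel g \<and> (\<integral>x. norm (f x - g x) \<partial>lborel) < e \<and>
       (\<lambda>k. \<integral>x. norm (conv (moll k) g x - g x) \<partial>lborel) \<longlonglongrightarrow> 0"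
      using lim.hyps(1) lim.IH by blast
  qed
qed

text \<open>Convergence in $L^1$ gives convergence almost everywhere along a subsequence. This weak
  form of the Lebesgue differentiation theorem is all that the later arguments ask for.\<close>

lemma conv_moll_AE:
  fixes f :: "'a::euclidean_space \<Rightarrow> 'b::euclidean_space"
  assumes "integrable lborel f"
  obtains r where "strict_mono r" "AE x in lborel. (\<lambda>k. conv (moll (r k)) f x) \<longlonglongrightarrow> f x"
proof -
  obtain r where "strict_mono r" "AE x in lborel. (\<lambda>k. conv (moll (r k)) f x - f x) \<longlonglongrightarrow> 0"
    using tendsto_L1_AE_subseq[OF _ conv_moll_L1[OF assms]] integrable_conv[OF assms] assms by blast
  then show ?thesis using that by (simp add: LIM_zero_iff)
qed

lemma C1c_integrable:
  assumes "C1c \<Omega> \<eta> D"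
  shows "integrable lborel \<eta>" "integrable lborel D"
proof -
  obtain K where K: "compact K" "\<And>x. x \<notin> K \<Longrightarrow> \<eta> x = 0 \<and> D x = 0"
    using C1cD(4)[OF assms] by blast
  have "integrable lborel (\<lambda>x. indicator K x *\<^sub>R \<eta> x)"
    by (rule borel_integrable_compact[OF K(1) continuous_on_subset[OF C1cD(3)[OF assms] subset_UNIV]])
  moreover have "integrable lborel (\<lambda>x. indicator K x *\<^sub>R D x)"
    by (rule borel_integrable_compact[OF K(1) continuous_on_subset[OF C1cD(2)[OF assms] subset_UNIV]])
  moreover have "(\<lambda>x. indicator K x *\<^sub>R \<eta> x) = \<eta>" "(\<lambda>x. indicator K x *\<^sub>R D x) = D"
    using K(2) by (auto simp: fun_eq_iff indicator_def)
  ultimately show "integrable lborel \<eta>" "integrable lborel D" by simp_all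
qed

text \<open>By commutativity of convolution the derivative may fall on \<open>\<eta>\<close> instead
  of the mollifier, so the gradient is again a mollification.\<close>

lemma GDERIV_conv_moll:
  assumes "C1c \<Omega> \<eta> D"
  shows "GDERIV (conv (moll k) \<eta>) x :> conv (moll k) D x"
proof -
  note [measurable] = C1c_borel[OF assms]
  have "conv \<eta> (moll k) = conv (moll k) \<eta>"
  proof
    fix x
    have "conv \<eta> (moll k) x = (\<integral>y. \<eta> y *\<^sub>R moll k (x - y) \<partial>lborel)" by (rule conv_commute) auto
    then show "conv \<eta> (moll k) x = conv (moll k) \<eta> x" by (simp add: conv_def mult.commute)
  qed
  moreover have "conv (moll k) D x = (\<integral>y. moll k y *\<^sub>R D (x - y) \<partial>lborel)"
    by (rule conv_commute) auto
  ultimately show ?thesis using GDERIV_conv[OF assms moll_integrable[of k], of x] by simp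
qed

text \<open>Mollifying the indicator of the e/2-neighbourhood of \<open>K\<close> at a scale of at
  most e/2 leaves the value 1 on \<open>K\<close> and a support within distance \<open>e\<close> of
  \<open>K\<close>.\<close>

lemma cutoff_exists:
  assumes "compact K" "open \<Omega>" "K \<subseteq> (\<Omega> :: 'a::euclidean_space set)"
  shows "\<exists>\<theta> D. C1c \<Omega> \<theta> D \<and> (\<forall>x. 0 \<le> \<theta> x \<and> \<theta> x \<le> 1) \<and> (\<forall>x\<in>K. \<theta> x = 1 \<and> D x = 0)"
proof -
  obtain e where e: "e > 0" "(\<Union>x\<in>K. cball x e) \<subseteq> \<Omega>"
    using compact_subset_open_imp_cball_epsilon_subset[OF assms] by blast
  define L where "L = {x + y |x y. x \<in> K \<and> y \<in> cball 0 (e / 2)}"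
  have L: "compact L" unfolding L_def by (intro compact_sums assms compact_cball)
  have LI: "y \<in> L" if "x \<in> K" "dist x y \<le> e / 2" for x y
  proof -
    have "x + (y - x) \<in> L" unfolding L_def
      using that by (intro CollectI exI[of _ x] exI[of _ "y - x"]) (auto simp: dist_norm norm_minus_commute)
    then show ?thesis by simp
  qed
  obtain k where k: "1 / (real k + 1) \<le> e / 2"
    using eventually_happens'[OF sequentially_bot eventually_moll_radius[of "e / 2"]] e(1) by auto
  let ?I = "indicator L :: 'a \<Rightarrow> real"
  have [measurable]: "L \<in> sets borel" using L by (simp add: borel_compact)
  have I: "integrable lborel ?I"
    using L emeasure_compact_finite by (intro integrable_real_indicator) auto
  define \<theta> where "\<theta> = conv (moll k) ?I"
  define D where "D = (\<lambda>x. \<integral>y. ?I y *\<^sub>R grad (moll k) (x - y) \<partial>lborel)"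
  have C: "C1c \<Omega> \<theta> D" unfolding \<theta>_def D_def
  proof (rule C1c_conv[OF moll_C1c moll_zero I L])
    fix x y assume "x \<in> L" and xy: "dist x y \<le> 1 / (real k + 1)"
    then obtain z where "z \<in> K" "dist z x \<le> e / 2" by (auto simp: L_def dist_norm)
    then have "y \<in> cball z e" using xy k dist_triangle[of z y x] by simp
    with \<open>z \<in> K\<close> show "y \<in> \<Omega>" using e(2) by blast
  qed auto
  have ge0: "0 \<le> \<theta> x" for x
    unfolding \<theta>_def conv_def by (rule Bochner_Integration.integral_nonneg) (simp add: moll_nonneg)
  have le1: "\<theta> x \<le> 1" for x
  proof -
    have "\<theta> x \<le> (\<integral>y. moll k (x - y) \<partial>lborel)" unfolding \<theta>_def conv_def
      using conv_moll_integrable[OF I, of k x] moll_integrable_reflect[of k x]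
      by (intro integral_mono) (auto simp: moll_nonneg indicator_def)
    then show ?thesis by (simp add: moll_integral_reflect)
  qed
  have eq1: "\<theta> x = 1" if "x \<in> K" for x
  proof -
    have "norm (\<theta> x - ?I x) \<le> 0" unfolding \<theta>_def
      by (rule conv_moll_close[OF I k]) (use LI[OF that] e(1) in \<open>auto simp: indicator_def\<close>)
    moreover have "x \<in> L" using LI[OF that, of x] e(1) by simp
    ultimately show ?thesis by simp
  qed
  \<comment> \<open>Points of \<open>K\<close> are maxima of \<open>\<theta>\<close>, so the
    gradient vanishes there even if \<open>K\<close> has empty interior.\<close>
  have D0: "D x = 0" if "x \<in> K" for x
  proof -
    have "(\<lambda>h. h \<bullet> D x) = (\<lambda>h. 0)"
      by (rule differential_zero_maxmin[of x UNIV \<theta>])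
        (use C1cD(1)[OF C, of x] le1 eq1[OF that] in \<open>auto simp: gderiv_def\<close>)
    then show ?thesis by (metis inner_eq_zero_iff)
  qed
  show ?thesis using C ge0 le1 eq1 D0 by blast
qed

text \<open>The class \<open>C1c\<close> of test functions defines the same weak derivatives as \<open>test_function\<close>,
  because mollification of the former gives the latter.\<close>
lemma C1c_test_function:
  assumes \<Omega>: "open \<Omega>" and \<eta>: "C1c \<Omega> \<eta> D"
  shows "\<forall>\<^sub>F k in sequentially. test_function \<Omega> (conv (moll k) \<eta>)"
proof -
  obtain K where K: "compact K" "K \<subseteq> \<Omega>" "\<And>x. x \<notin> K \<Longrightarrow> \<eta> x = 0"
    using C1cD(4)[OF \<eta>] by blast
  obtain e where e: "e > 0" "(\<Union>x\<in>K. cball x e) \<subseteq> \<Omega>"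
    using compact_subset_open_imp_cball_epsilon_subset[OF K(1) \<Omega> K(2)] by blast
  note I = C1c_integrable(1)[OF \<eta>]
  show ?thesis using eventually_moll_radius[OF e(1)]
  proof eventually_elim
    case (elim k)
    have "C1c \<Omega> (conv (moll k) \<eta>) (\<lambda>x. \<integral>y. \<eta> y *\<^sub>R grad (moll k) (x - y) \<partial>lborel)"
    proof (rule C1c_conv[OF moll_C1c moll_zero I K(1) K(3)])
      fix x y assume "x \<in> K" "dist x y \<le> 1 / (real k + 1)"
      then show "y \<in> \<Omega>" using elim e(2) by fastforce
    qed auto
    from C1cD(4)[OF this] obtain L where L: "compact L" "L \<subseteq> \<Omega>" "\<And>x. x \<notin> L \<Longrightarrow> conv (moll k) \<eta> x = 0"
      by blast
    have "closure {x. conv (moll k) \<eta> x \<noteq> 0} \<subseteq> L"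
      using L by (intro closure_minimal compact_imp_closed) auto
    moreover from this have "compact (closure {x. conv (moll k) \<eta> x \<noteq> 0})"
      using L(1) by (metis closed_closure compact_Int_closed inf.absorb_iff2)
    moreover have "smooth (conv (moll k) \<eta>)"
      by (rule smooth_conv[OF I moll_smooth moll_zero])
    ultimately show ?case using L(2) by (auto simp: test_function_def)
  qed
qed

subsection \<open>Weak gradients of functions on the whole space\<close>

text \<open>Functions in \<open>H1 \<Omega>\<close> are represented by Borel functions that vanish outside \<open>\<Omega>\<close> and outside
  a bounded set, so that all integrals range over the whole space and \<open>\<Omega>\<close> only restricts the
  test functions.\<close>
definition wg :: "'a::euclidean_space set \<Rightarrow> ('a \<Rightarrow> real) \<Rightarrow> ('a \<Rightarrow> 'a) \<Rightarrow> bool" where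
  "wg \<Omega> v G \<longleftrightarrow> v \<in> borel_measurable borel \<and> G \<in> borel_measurable borel \<and>
     integrable lborel (\<lambda>x. (v x)\<^sup>2) \<and> integrable lborel (\<lambda>x. (norm (G x))\<^sup>2) \<and>
     (\<forall>x. x \<notin> \<Omega> \<longrightarrow> v x = 0 \<and> G x = 0) \<and>
     (\<exists>R. \<forall>x. x \<notin> cball 0 R \<longrightarrow> v x = 0 \<and> G x = 0) \<and>
     (\<forall>\<eta> D. C1c \<Omega> \<eta> D \<longrightarrow> (\<integral>x. v x *\<^sub>R D x + \<eta> x *\<^sub>R G x \<partial>lborel) = 0)"

lemma wgD:
  assumes "wg \<Omega> v G"
  shows "v \<in> borel_measurable borel" "G \<in> borel_measurable borel"
    "integrable lborel (\<lambda>x. (v x)\<^sup>2)" "integrable lborel (\<lambda>x. (norm (G x))\<^sup>2)"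
    "x \<notin> \<Omega> \<Longrightarrow> v x = 0" "x \<notin> \<Omega> \<Longrightarrow> G x = 0"
    "\<exists>R. \<forall>x. x \<notin> cball 0 R \<longrightarrow> v x = 0 \<and> G x = 0"
    "C1c \<Omega> \<eta> D \<Longrightarrow> (\<integral>x. v x *\<^sub>R D x + \<eta> x *\<^sub>R G x \<partial>lborel) = 0"
  using assms unfolding wg_def by blast+

section \<open>Integrability and closure properties of weak gradients\<close>

lemma integrable_of_square:
  fixes f :: "'a::euclidean_space \<Rightarrow> 'b::euclidean_space"
  assumes "f \<in> borel_measurable borel" "integrable lborel (\<lambda>x. (norm (f x))\<^sup>2)"
    and "\<And>x. x \<notin> cball 0 R \<Longrightarrow> f x = 0"
  shows "integrable lborel f"
proof (rule Bochner_Integration.integrable_bound)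
  have "integrable lborel (indicator (cball 0 R) :: 'a \<Rightarrow> real)"
    using emeasure_lborel_cball_finite[of 0 R] by (intro integrable_real_indicator) simp_all
  then show "integrable lborel (\<lambda>x. indicator (cball 0 R) x + (norm (f x))\<^sup>2 :: real)"
    using assms(2) by simp
  show "AE x in lborel. norm (f x) \<le> norm (indicator (cball 0 R) x + (norm (f x))\<^sup>2 :: real)"
  proof (rule AE_I2)
    fix x
    have "2 * norm (f x) \<le> 1 + (norm (f x))\<^sup>2"
      using zero_le_power2[of "norm (f x) - 1"] unfolding power2_diff by simp
    then have "norm (f x) \<le> 1 + (norm (f x))\<^sup>2"
      using norm_ge_zero[of "f x"] by linarith
    then show "norm (f x) \<le> norm (indicator (cball 0 R) x + (norm (f x))\<^sup>2 :: real)"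
      using assms(3)[of x] by (cases "x \<in> cball 0 R") auto
  qed
qed (use assms(1) in simp)

lemma wg_integrable:
  assumes "wg \<Omega> v G"
  shows "integrable lborel v" "integrable lborel G"
proof -
  obtain R where "\<And>x. x \<notin> cball 0 R \<Longrightarrow> v x = 0 \<and> G x = 0" using wgD(7)[OF assms] by blast
  then show "integrable lborel v" "integrable lborel G"
    using integrable_of_square[of v R] integrable_of_square[of G R] wgD(1-4)[OF assms] by auto
qed

lemma wg_test_integrable:
  assumes "wg \<Omega> v G" "C1c \<Omega>' \<eta> D"
  shows "integrable lborel (\<lambda>x. v x *\<^sub>R D x)" "integrable lborel (\<lambda>x. \<eta> x *\<^sub>R G x)"
proof -
  obtain B where "\<And>x. \<bar>\<eta> x\<bar> \<le> B" "\<And>x. norm (D x) \<le> B" using C1c_bounded[OF assms(2)] by blast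
  then show "integrable lborel (\<lambda>x. v x *\<^sub>R D x)" "integrable lborel (\<lambda>x. \<eta> x *\<^sub>R G x)"
    using wg_integrable[OF assms(1)] C1c_borel[OF assms(2)]
    by (auto intro: integrable_bounded_scaleR integrable_scaleR_bounded)
qed

lemma integrable_square_add:
  fixes f g :: "'a::euclidean_space \<Rightarrow> 'b::euclidean_space"
  assumes [measurable]: "f \<in> borel_measurable borel" "g \<in> borel_measurable borel"
    and "integrable lborel (\<lambda>x. (norm (f x))\<^sup>2)" "integrable lborel (\<lambda>x. (norm (g x))\<^sup>2)"
  shows "integrable lborel (\<lambda>x. (norm (f x + g x))\<^sup>2)"
proof (rule Bochner_Integration.integrable_bound)
  show "integrable lborel (\<lambda>x. 2 * (norm (f x))\<^sup>2 + 2 * (norm (g x))\<^sup>2)" using assms by simp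
  have "(norm (f x + g x))\<^sup>2 \<le> 2 * (norm (f x))\<^sup>2 + 2 * (norm (g x))\<^sup>2" for x
  proof -
    have "(norm (f x + g x))\<^sup>2 \<le> (norm (f x) + norm (g x))\<^sup>2"
      by (intro power_mono norm_triangle_ineq) simp
    also have "\<dots> \<le> 2 * (norm (f x))\<^sup>2 + 2 * (norm (g x))\<^sup>2"
      using sum_squares_bound[of "norm (f x)" "norm (g x)"] by (simp add: power2_sum)
    finally show ?thesis .
  qed
  then show "AE x in lborel. norm ((norm (f x + g x))\<^sup>2) \<le> norm (2 * (norm (f x))\<^sup>2 + 2 * (norm (g x))\<^sup>2)"
    by (intro AE_I2) simp
qed measurable

lemma integrable_square_bounded:
  fixes f :: "'a::euclidean_space \<Rightarrow> 'b::euclidean_space" and g :: "'a \<Rightarrow> 'c::euclidean_space"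
  assumes [measurable]: "f \<in> borel_measurable borel" "g \<in> borel_measurable borel"
    and f: "integrable lborel (\<lambda>x. (norm (f x))\<^sup>2)" and g: "\<And>x. norm (g x) \<le> B * norm (f x)"
  shows "integrable lborel (\<lambda>x. (norm (g x))\<^sup>2)"
proof (rule Bochner_Integration.integrable_bound)
  show "integrable lborel (\<lambda>x. B\<^sup>2 * (norm (f x))\<^sup>2)" using f by simp
  have "(norm (g x))\<^sup>2 \<le> B\<^sup>2 * (norm (f x))\<^sup>2" for x
    using power_mono[OF g[of x] norm_ge_zero, of 2] by (simp add: power_mult_distrib)
  then show "AE x in lborel. norm ((norm (g x))\<^sup>2) \<le> norm (B\<^sup>2 * (norm (f x))\<^sup>2)"
    by (intro AE_I2) simp
qed measurable

lemma wg_scale: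
  assumes "wg \<Omega> v G"
  shows "wg \<Omega> (\<lambda>x. c * v x) (\<lambda>x. c *\<^sub>R G x)"
proof -
  note [measurable] = wgD(1,2)[OF assms]
  have "(\<integral>x. (c * v x) *\<^sub>R D x + \<eta> x *\<^sub>R c *\<^sub>R G x \<partial>lborel) = 0" if "C1c \<Omega> \<eta> D" for \<eta> D
  proof -
    have "(\<integral>x. (c * v x) *\<^sub>R D x + \<eta> x *\<^sub>R c *\<^sub>R G x \<partial>lborel)
      = (\<integral>x. c *\<^sub>R (v x *\<^sub>R D x + \<eta> x *\<^sub>R G x) \<partial>lborel)"
      by (simp add: scaleR_add_right mult.commute)
    then show ?thesis using wgD(8)[OF assms that] by simp
  qed
  then show ?thesis
    using wgD[OF assms] unfolding wg_def by (auto simp: power_mult_distrib)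
qed

lemma wg_add:
  assumes "wg \<Omega> v G" "wg \<Omega> w H"
  shows "wg \<Omega> (\<lambda>x. v x + w x) (\<lambda>x. G x + H x)"
proof -
  note [measurable] = wgD(1,2)[OF assms(1)] wgD(1,2)[OF assms(2)]
  have "(\<integral>x. (v x + w x) *\<^sub>R D x + \<eta> x *\<^sub>R (G x + H x) \<partial>lborel) = 0" if C: "C1c \<Omega> \<eta> D" for \<eta> D
  proof -
    have "(\<integral>x. (v x + w x) *\<^sub>R D x + \<eta> x *\<^sub>R (G x + H x) \<partial>lborel)
      = (\<integral>x. (v x *\<^sub>R D x + \<eta> x *\<^sub>R G x) + (w x *\<^sub>R D x + \<eta> x *\<^sub>R H x) \<partial>lborel)"
      by (simp add: algebra_simps)
    also have "\<dots> = (\<integral>x. v x *\<^sub>R D x + \<eta> x *\<^sub>R G x \<partial>lborel) + (\<integral>x. w x *\<^sub>R D x + \<eta> x *\<^sub>R H x \<partial>lborel)"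
      by (intro Bochner_Integration.integral_add Bochner_Integration.integrable_add
          wg_test_integrable[OF assms(1) C] wg_test_integrable[OF assms(2) C])
    finally show ?thesis using wgD(8)[OF assms(1) C] wgD(8)[OF assms(2) C] by simp
  qed
  moreover obtain R S where "\<forall>x. x \<notin> cball 0 R \<longrightarrow> v x = 0 \<and> G x = 0" "\<forall>x. x \<notin> cball 0 S \<longrightarrow> w x = 0 \<and> H x = 0"
    using wgD(7)[OF assms(1)] wgD(7)[OF assms(2)] by blast
  then have "\<exists>R. \<forall>x. x \<notin> cball 0 R \<longrightarrow> v x + w x = 0 \<and> G x + H x = 0"
    by (intro exI[of _ "max R S"]) auto
  moreover have "integrable lborel (\<lambda>x. (v x + w x)\<^sup>2)" "integrable lborel (\<lambda>x. (norm (G x + H x))\<^sup>2)"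
    using integrable_square_add[of v w] integrable_square_add[of G H]
      wgD(3,4)[OF assms(1)] wgD(3,4)[OF assms(2)] by auto
  ultimately show ?thesis
    using wgD(5,6)[OF assms(1)] wgD(5,6)[OF assms(2)] unfolding wg_def by auto
qed

lemma wg_diff:
  assumes "wg \<Omega> v G" "wg \<Omega> w H"
  shows "wg \<Omega> (\<lambda>x. v x - w x) (\<lambda>x. G x - H x)"
  using wg_add[OF assms(1) wg_scale[OF assms(2), of "-1"]] by simp

lemma wg_AE_cong:
  assumes "wg \<Omega> v G" and [measurable]: "v' \<in> borel_measurable borel" "G' \<in> borel_measurable borel"
    and AE: "AE x in lborel. v x = v' x" "AE x in lborel. G x = G' x"
    and "\<And>x. x \<notin> \<Omega> \<Longrightarrow> v' x = 0 \<and> G' x = 0" "\<And>x. x \<notin> cball 0 R \<Longrightarrow> v' x = 0 \<and> G' x = 0"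
  shows "wg \<Omega> v' G'"
proof -
  note [measurable] = wgD(1,2)[OF assms(1)]
  have "integrable lborel (\<lambda>x. (v' x)\<^sup>2)"
    by (subst integrable_cong_AE[of _ _ "\<lambda>x. (v x)\<^sup>2"]) (use AE(1) wgD(3)[OF assms(1)] in auto)
  moreover have "integrable lborel (\<lambda>x. (norm (G' x))\<^sup>2)"
    by (subst integrable_cong_AE[of _ _ "\<lambda>x. (norm (G x))\<^sup>2"]) (use AE(2) wgD(4)[OF assms(1)] in auto)
  moreover have "(\<integral>x. v' x *\<^sub>R D x + \<eta> x *\<^sub>R G' x \<partial>lborel) = 0" if C: "C1c \<Omega> \<eta> D" for \<eta> D
  proof -
    note [measurable] = C1c_borel[OF C]
    have "(\<integral>x. v' x *\<^sub>R D x + \<eta> x *\<^sub>R G' x \<partial>lborel) = (\<integral>x. v x *\<^sub>R D x + \<eta> x *\<^sub>R G x \<partial>lborel)"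
      by (rule integral_cong_AE) (use AE in auto)
    then show ?thesis using wgD(8)[OF assms(1) C] by simp
  qed
  ultimately show ?thesis using assms(2,3,6,7) unfolding wg_def by blast
qed

lemma wg_subset:
  assumes "wg \<Omega>' v G" "\<Omega> \<subseteq> \<Omega>'" "\<And>x. x \<notin> \<Omega> \<Longrightarrow> v x = 0 \<and> G x = 0"
  shows "wg \<Omega> v G"
  using assms C1c_mono[OF _ assms(2)] unfolding wg_def by blast

text \<open>The sharp cutoff costs no boundary term: test functions for \<open>\<Omega>'\<close>
  vanish outside it, so the integrand is unchanged.\<close>

lemma wg_restrict:
  assumes "wg \<Omega> v G" "\<Omega>' \<subseteq> \<Omega>" "\<Omega>' \<in> sets borel"
  shows "wg \<Omega>' (\<lambda>x. indicator \<Omega>' x * v x) (\<lambda>x. indicator \<Omega>' x *\<^sub>R G x)"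
proof -
  note [measurable] = wgD(1,2)[OF assms(1)] assms(3)
  have "(\<integral>x. (indicator \<Omega>' x * v x) *\<^sub>R D x + \<eta> x *\<^sub>R indicator \<Omega>' x *\<^sub>R G x \<partial>lborel) = 0"
    if C: "C1c \<Omega>' \<eta> D" for \<eta> D
  proof -
    have "D x = 0 \<and> \<eta> x = 0" if "x \<notin> \<Omega>'" for x using C1cD(4)[OF C] that by blast
    then have "(indicator \<Omega>' x * v x) *\<^sub>R D x + \<eta> x *\<^sub>R indicator \<Omega>' x *\<^sub>R G x = v x *\<^sub>R D x + \<eta> x *\<^sub>R G x" for x
      by (cases "x \<in> \<Omega>'") auto
    then show ?thesis using wgD(8)[OF assms(1) C1c_mono[OF C assms(2)]] by simp
  qed
  moreover have "integrable lborel (\<lambda>x. (norm (indicator \<Omega>' x * v x))\<^sup>2)"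
    by (rule integrable_square_bounded[of v _ 1])
      (use wgD(3)[OF assms(1)] in \<open>auto simp: indicator_def\<close>)
  moreover have "integrable lborel (\<lambda>x. (norm (indicator \<Omega>' x *\<^sub>R G x))\<^sup>2)"
    by (rule integrable_square_bounded[of G _ 1])
      (use wgD(4)[OF assms(1)] in \<open>auto simp: indicator_def\<close>)
  moreover obtain R where "\<forall>x. x \<notin> cball 0 R \<longrightarrow> v x = 0 \<and> G x = 0" using wgD(7)[OF assms(1)] by blast
  ultimately show ?thesis unfolding wg_def by (auto simp: power2_abs)
qed

lemma wg_translate:
  assumes "wg \<Omega> v G"
  shows "wg {x. x + h \<in> \<Omega>} (\<lambda>x. v (x + h)) (\<lambda>x. G (x + h))"
proof -
  note [measurable] = wgD(1,2)[OF assms]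
  have "(\<integral>x. v (x + h) *\<^sub>R D x + \<eta> x *\<^sub>R G (x + h) \<partial>lborel) = 0"
    if C: "C1c {x. x + h \<in> \<Omega>} \<eta> D" for \<eta> D
  proof -
    note [measurable] = C1c_borel[OF C]
    obtain K where K: "compact K" "K \<subseteq> {x. x + h \<in> \<Omega>}" "\<And>x. x \<notin> K \<Longrightarrow> \<eta> x = 0"
      using C1cD(4)[OF C] by blast
    have "C1c \<Omega> (\<lambda>y. \<eta> (y - h)) (\<lambda>y. D (y - h))"
    proof (rule C1cI)
      show "GDERIV (\<lambda>y. \<eta> (y - h)) x :> D (x - h)" for x
        using C1cD(1)[OF C, of "x - h"] has_derivative_at_within
        unfolding gderiv_def by (auto intro!: derivative_eq_intros
          has_derivative_compose[of "\<lambda>y. y - h" _ x UNIV \<eta>])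
      show "continuous_on UNIV (\<lambda>y. D (y - h))"
        by (intro continuous_on_compose2[OF C1cD(2)[OF C]] continuous_intros) auto
      show "compact ((+) h ` K)" by (rule compact_translation[OF K(1)])
      show "(+) h ` K \<subseteq> \<Omega>" using K(2) by (auto simp: add.commute)
      show "\<eta> (x - h) = 0" if "x \<notin> (+) h ` K" for x
        by (rule K(3)) (use that in \<open>auto simp: image_iff algebra_simps\<close>)
    qed
    from wgD(8)[OF assms this] have "0 = (\<integral>y. v y *\<^sub>R D (y - h) + \<eta> (y - h) *\<^sub>R G y \<partial>lborel)" by simp
    also have "\<dots> = (\<integral>x. v (x + h) *\<^sub>R D x + \<eta> x *\<^sub>R G (x + h) \<partial>lborel)"
      by (subst integral_shift[of _ h, symmetric]) auto
    finally show ?thesis by simp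
  qed
  moreover obtain R where R: "\<forall>x. x \<notin> cball 0 R \<longrightarrow> v x = 0 \<and> G x = 0" using wgD(7)[OF assms] by blast
  have "v (x + h) = 0 \<and> G (x + h) = 0" if "x \<notin> cball 0 (R + norm h)" for x
    using R[rule_format, of "x + h"] that norm_triangle_ineq4[of "x + h" h] by auto
  ultimately show ?thesis
    using wgD[OF assms] integrable_shift[OF wgD(3)[OF assms], of h] integrable_shift[OF wgD(4)[OF assms], of h]
    unfolding wg_def by auto
qed

text \<open>If \<open>\<eta>\<close> is any test function on the whole space, then
  \<open>\<eta> x * \<theta> x\<close> is one on \<open>\<Omega>\<close>; the Leibniz rule moves the
  gradient of \<open>\<theta>\<close> into the new weak gradient.\<close>

lemma wg_cutoff:
  assumes "wg \<Omega> v G" "C1c \<Omega> \<theta> E"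
  shows "wg UNIV (\<lambda>x. \<theta> x * v x) (\<lambda>x. \<theta> x *\<^sub>R G x + v x *\<^sub>R E x)"
proof -
  note [measurable] = wgD(1,2)[OF assms(1)] C1c_borel[OF assms(2)]
  obtain B where B: "B > 0" "\<And>x. \<bar>\<theta> x\<bar> \<le> B" "\<And>x. norm (E x) \<le> B" using C1c_bounded[OF assms(2)] by blast
  have "(\<integral>x. (\<theta> x * v x) *\<^sub>R D x + \<eta> x *\<^sub>R (\<theta> x *\<^sub>R G x + v x *\<^sub>R E x) \<partial>lborel) = 0"
    if C: "C1c UNIV \<eta> D" for \<eta> D
  proof -
    have "C1c \<Omega> (\<lambda>x. \<eta> x * \<theta> x) (\<lambda>x. \<eta> x *\<^sub>R E x + \<theta> x *\<^sub>R D x)"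
      by (rule C1c_mult[OF C1cD(1,2)[OF C] assms(2)])
    from wgD(8)[OF assms(1) this] show ?thesis by (simp add: algebra_simps)
  qed
  moreover have "integrable lborel (\<lambda>x. (norm (\<theta> x * v x))\<^sup>2)"
    by (rule integrable_square_bounded[of v _ B])
      (use wgD(3)[OF assms(1)] B in \<open>auto simp: abs_mult intro!: mult_right_mono\<close>)
  moreover have "integrable lborel (\<lambda>x. (norm (\<theta> x *\<^sub>R G x + v x *\<^sub>R E x))\<^sup>2)"
  proof (rule integrable_square_add)
    show "integrable lborel (\<lambda>x. (norm (\<theta> x *\<^sub>R G x))\<^sup>2)"
      by (rule integrable_square_bounded[of G _ B])
        (use wgD(4)[OF assms(1)] B in \<open>auto simp: abs_mult intro!: mult_right_mono\<close>)
    show "integrable lborel (\<lambda>x. (norm (v x *\<^sub>R E x))\<^sup>2)"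
      by (rule integrable_square_bounded[of v _ B])
        (use wgD(3)[OF assms(1)] B in \<open>auto simp: mult.commute[of B] intro!: mult_left_mono\<close>)
  qed auto
  moreover obtain R where "\<forall>x. x \<notin> cball 0 R \<longrightarrow> v x = 0 \<and> G x = 0" using wgD(7)[OF assms(1)] by blast
  ultimately show ?thesis unfolding wg_def by (auto simp: power2_abs)
qed

text \<open>Convolution of \<open>\<eta>\<close> with the indicator of a large ball is constant near
  the origin, equal to the integral of \<open>\<eta>\<close>, hence has gradient 0 there; by
  differentiation under the integral sign that gradient is the integral of \<open>D\<close>.\<close>

lemma C1c_integral_grad:
  assumes "C1c \<Omega> \<eta> D"
  shows "integral\<^sup>L lborel D = 0"
proof -
  note C = C1c_mono[OF assms subset_UNIV]
  note [measurable] = C1c_borel[OF C]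
  obtain K where K: "compact K" "\<And>x. x \<notin> K \<Longrightarrow> \<eta> x = 0 \<and> D x = 0" using C1cD(4)[OF C] by blast
  obtain R where R: "\<And>x. x \<in> K \<Longrightarrow> norm x \<le> R"
    using compact_imp_bounded[OF K(1)] by (auto simp: bounded_iff)
  define f where "f = (indicator (cball 0 (R + 1)) :: 'a \<Rightarrow> real)"
  have f: "integrable lborel f" unfolding f_def
    using emeasure_lborel_cball_finite[of 0 "R + 1"] by (intro integrable_real_indicator) simp_all
  \<comment> \<open>For \<open>norm x < 1\<close> the indicator \<open>f\<close> is 1 wherever
    \<open>\<eta> (x - y)\<close> or its gradient is nonzero; this is why the radius is
    \<open>R + 1\<close>.\<close>
  have *: "\<eta> (x - y) *\<^sub>R f y = \<eta> (x - y) \<and> f y *\<^sub>R D (x - y) = D (x - y)" if "norm x < 1" for x y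
  proof (cases "x - y \<in> K")
    case True
    then have "norm y \<le> R + 1" using R[of "x - y"] that norm_triangle_ineq4[of x "x - y"] by simp
    then show ?thesis by (simp add: f_def)
  qed (use K(2) in auto)
  have "GDERIV (conv \<eta> f) 0 :> (\<integral>y. f y *\<^sub>R D (0 - y) \<partial>lborel)" by (rule GDERIV_conv[OF C f])
  moreover have "GDERIV (conv \<eta> f) 0 :> 0"
  proof (rule GDERIV_transform_open[OF GDERIV_const])
    show "integral\<^sup>L lborel \<eta> = conv \<eta> f x" if "x \<in> ball 0 1" for x
    proof -
      have "norm x < 1" using that by simp
      then show ?thesis by (simp only: conv_def conjunct1[OF *]) (simp add: integral_reflect)
    qed
  qed auto
  ultimately have "0 = (\<integral>y. f y *\<^sub>R D (0 - y) \<partial>lborel)" using GDERIV_unique by blast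
  also have "\<dots> = (\<integral>y. D (0 - y) \<partial>lborel)"
    using *[of 0] by (intro Bochner_Integration.integral_cong) auto
  also have "\<dots> = integral\<^sup>L lborel D" by (rule integral_reflect) simp
  finally show ?thesis by simp
qed

lemma C1c_moll_reflect:
  assumes "cball x (1 / (real k + 1)) \<subseteq> \<Omega>"
  shows "C1c \<Omega> (\<lambda>y. moll k (x - y)) (\<lambda>y. - grad (moll k) (x - y))"
proof (rule C1cI)
  show "GDERIV (\<lambda>y. moll k (x - y)) y :> - grad (moll k) (x - y)" for y
  proof -
    have "((\<lambda>y. x - y) has_derivative (\<lambda>h. - h)) (at y)" by (auto intro!: derivative_eq_intros)
    from has_derivative_compose[OF this C1cD(1)[OF moll_C1c[of k], of "x - y", unfolded gderiv_def]]
    show ?thesis by (simp add: gderiv_def)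
  qed
  show "continuous_on UNIV (\<lambda>y. - grad (moll k) (x - y))"
    by (intro continuous_intros continuous_on_compose2[OF C1cD(2)[OF moll_C1c[of k]]]) auto
  show "moll k (x - y) = 0" if "y \<notin> cball x (1 / (real k + 1))" for y
    by (rule moll_zero) (use that in \<open>simp add: dist_norm\<close>)
qed (use assms in auto)

text \<open>The reflected mollifier centred at \<open>x\<close> is itself a test function once its
  ball lies in \<open>\<Omega>\<close>. The left side is the classical gradient of the mollified
  \<open>v\<close>.\<close>

lemma wg_conv_grad:
  assumes "wg \<Omega> v G" "cball x (1 / (real k + 1)) \<subseteq> \<Omega>"
  shows "(\<integral>y. v y *\<^sub>R grad (moll k) (x - y) \<partial>lborel) = conv (moll k) G x"
proof -
  note C = C1c_moll_reflect[OF assms(2)]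
  have "0 = (\<integral>y. v y *\<^sub>R (- grad (moll k) (x - y)) + moll k (x - y) *\<^sub>R G y \<partial>lborel)"
    using wgD(8)[OF assms(1) C] by simp
  also have "\<dots> = (\<integral>y. v y *\<^sub>R (- grad (moll k) (x - y)) \<partial>lborel) + conv (moll k) G x"
    unfolding conv_def
    by (rule Bochner_Integration.integral_add[OF wg_test_integrable[OF assms(1) C]])
  finally show ?thesis by simp
qed

text \<open>Testing with reflected mollifiers makes \<open>conv (moll k) H\<close> vanish at each
  point of \<open>\<Omega>\<close> for large \<open>k\<close>, and these values converge to
  \<open>H\<close> almost everywhere along a subsequence.\<close>

lemma fundamental_lemma:
  fixes H :: "'a::euclidean_space \<Rightarrow> 'b::euclidean_space"
  assumes \<Omega>: "open \<Omega>" and H: "integrable lborel H" "\<And>x. x \<notin> \<Omega> \<Longrightarrow> H x = 0"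
    and test: "\<And>\<eta> D. C1c \<Omega> \<eta> D \<Longrightarrow> (\<integral>x. \<eta> x *\<^sub>R H x \<partial>lborel) = 0"
  shows "AE x in lborel. H x = 0"
proof -
  obtain r where r: "strict_mono r" "AE x in lborel. (\<lambda>k. conv (moll (r k)) H x) \<longlonglongrightarrow> H x"
    using conv_moll_AE[OF H(1)] by blast
  from r(2) show ?thesis
  proof eventually_elim
    case (elim x)
    show ?case
    proof (cases "x \<in> \<Omega>")
      case True
      then obtain e where e: "e > 0" "cball x e \<subseteq> \<Omega>" using \<Omega> open_contains_cball by blast
      have "\<forall>\<^sub>F k in sequentially. conv (moll k) H x = 0"
        using eventually_moll_radius[OF e(1)]
      proof eventually_elim
        case (elim k)
        then have "cball x (1 / (real k + 1)) \<subseteq> \<Omega>" using e(2) by (meson order_trans subset_cball)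
        from test[OF C1c_moll_reflect[OF this]] show ?case by (simp add: conv_def)
      qed
      then have "\<forall>\<^sub>F k in sequentially. conv (moll (r k)) H x = 0"
        by (rule eventually_compose_filterlim[OF _ filterlim_subseq[OF r(1)]])
      then have "(\<lambda>k. conv (moll (r k)) H x) \<longlonglongrightarrow> 0" by (rule tendsto_eventually)
      with elim show ?thesis using LIMSEQ_unique by blast
    qed (use H(2) in auto)
  qed
qed

lemma wg_unique:
  assumes \<Omega>: "open \<Omega>" and "wg \<Omega> v G" "wg \<Omega> v' G'" "AE x in lborel. v x = v' x"
  shows "AE x in lborel. G x = G' x"
proof -
  note W = wg_diff[OF assms(2,3)]
  note [measurable] = wgD(1,2)[OF W]
  have "AE x in lborel. G x - G' x = 0"
  proof (rule fundamental_lemma[OF \<Omega> wg_integrable(2)[OF W]])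
    fix \<eta> D assume C: "C1c \<Omega> \<eta> D"
    note [measurable] = C1c_borel[OF C]
    have "(\<integral>x. \<eta> x *\<^sub>R (G x - G' x) \<partial>lborel) = (\<integral>x. (v x - v' x) *\<^sub>R D x + \<eta> x *\<^sub>R (G x - G' x) \<partial>lborel)"
      by (rule integral_cong_AE) (use assms(4) in auto)
    then show "(\<integral>x. \<eta> x *\<^sub>R (G x - G' x) \<partial>lborel) = 0" using wgD(8)[OF W C] by simp
  qed (use wgD(6)[OF W] in auto)
  then show ?thesis by simp
qed

text \<open>All mollifications have gradient 0 on the whole space, so they are constant, and the
  constant is 0 because \<open>v\<close> has bounded support. This is the reason for extending
  functions to \<open>UNIV\<close> before a vanishing gradient is exploited.\<close>

lemma wg_zero_grad:
  assumes W: "wg UNIV v G" and G: "AE x in lborel. G x = 0"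
  shows "AE x in lborel. v x = 0"
proof -
  note [measurable] = wgD(1,2)[OF W]
  obtain R where R: "\<And>x. x \<notin> cball 0 R \<Longrightarrow> v x = 0" using wgD(7)[OF W] by blast
  have zero: "conv (moll k) v x = 0" for k x
  proof -
    have D: "GDERIV (conv (moll k) v) y :> 0" for y
    proof -
      have "conv (moll k) G y = (\<integral>z. 0 \<partial>(lborel :: 'a measure))" unfolding conv_def
        by (rule integral_cong_AE) (use G in auto)
      then show ?thesis
        using GDERIV_conv[OF moll_C1c[of k] wg_integrable(1)[OF W], of y] wg_conv_grad[OF W, of y k] by simp
    qed
    obtain b :: 'a where b: "b \<in> Basis" using nonempty_Basis by blast
    \<comment> \<open>Far enough away for a ball of radius at most 1 to miss
      \<open>cball 0 R\<close>; \<open>R\<close> may be negative, hence the absolute value.\<close>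
    define z where "z = (\<bar>R\<bar> + 2) *\<^sub>R b"
    have "conv (moll k) v x = conv (moll k) v z"
      using D has_derivative_zero_unique[of UNIV "conv (moll k) v" x z] unfolding gderiv_def
      by (auto simp: has_derivative_at_withinI)
    also have "\<dots> = 0"
    proof (rule conv_zero[OF moll_zero])
      fix y assume y: "y \<in> ball z (1 / (real k + 1))"
      have "1 / (real k + 1) \<le> 1" by simp
      moreover have "norm (z - y) < 1 / (real k + 1)" using y by (simp add: dist_norm)
      ultimately have "norm (z - y) < 1" by linarith
      moreover have "norm z = \<bar>R\<bar> + 2" using b by (simp add: z_def)
      ultimately have "norm y > R" using norm_triangle_sub[of z y] by linarith
      then show "v y = 0" by (intro R) simp
    qed auto
    finally show ?thesis .
  qed
  obtain r where "strict_mono r" and r: "AE x in lborel. (\<lambda>k. conv (moll (r k)) v x) \<longlonglongrightarrow> v x"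
    using conv_moll_AE[OF wg_integrable(1)[OF W]] by blast
  from r show ?thesis by eventually_elim (simp add: zero LIMSEQ_const_iff)
qed

text \<open>\<open>wg\<close> demands bounded support, so \<open>f\<close> is multiplied by a cutoff
  equal to 1 on a ball containing \<open>U\<close>; restriction to \<open>U\<close> makes the cutoff
  disappear again.\<close>

lemma wg_of_C1:
  fixes U :: "'a::euclidean_space set"
  assumes U: "open U" "bounded U" and f: "\<And>x. GDERIV f x :> D x" "continuous_on UNIV D"
  shows "wg U (\<lambda>x. indicator U x * f x) (\<lambda>x. indicator U x *\<^sub>R D x)"
proof -
  obtain R where R: "U \<subseteq> cball 0 R" using U(2) by (auto simp: bounded_iff subset_iff)
  obtain \<theta> E where \<theta>: "C1c (UNIV :: 'a set) \<theta> E" "\<forall>x. 0 \<le> \<theta> x \<and> \<theta> x \<le> 1" "\<forall>x\<in>cball 0 R. \<theta> x = 1 \<and> E x = 0"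
    using cutoff_exists[OF compact_cball open_UNIV subset_UNIV, of "0 :: 'a" R]
    by blast
  note C = C1c_mult[OF f \<theta>(1)]
  note [measurable] = C1c_borel[OF C]
  let ?f = "\<lambda>x. f x * \<theta> x" and ?D = "\<lambda>x. f x *\<^sub>R E x + \<theta> x *\<^sub>R D x"
  obtain B where B: "\<And>x. \<bar>?f x\<bar> \<le> B" "\<And>x. norm (?D x) \<le> B" using C1c_bounded[OF C] by blast
  have "wg UNIV ?f ?D"
  proof -
    have "integrable lborel (\<lambda>x. (?f x)\<^sup>2)" "integrable lborel (\<lambda>x. (norm (?D x))\<^sup>2)"
    proof -
      have "integrable lborel (\<lambda>x. ?f x *\<^sub>R ?f x)"
        by (rule integrable_bounded_scaleR[OF C1c_integrable(1)[OF C]]) (use B(1) in auto)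
      then show "integrable lborel (\<lambda>x. (?f x)\<^sup>2)" by (simp only: power2_eq_square real_scaleR_def)
      have "integrable lborel (\<lambda>x. norm (?D x) *\<^sub>R norm (?D x))"
        by (rule integrable_bounded_scaleR[OF integrable_norm[OF C1c_integrable(2)[OF C]]]) (use B(2) in auto)
      then show "integrable lborel (\<lambda>x. (norm (?D x))\<^sup>2)" by (simp only: power2_eq_square real_scaleR_def)
    qed
    moreover have "(\<integral>x. ?f x *\<^sub>R D' x + \<eta> x *\<^sub>R ?D x \<partial>lborel) = 0" if C': "C1c UNIV \<eta> D'" for \<eta> D'
      using C1c_integral_grad[OF C1c_mult[OF C1cD(1,2)[OF C] C']] by simp
    moreover have "\<exists>S. \<forall>x. x \<notin> cball 0 S \<longrightarrow> ?f x = 0 \<and> ?D x = 0"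
    proof -
      obtain K where K: "compact K" "\<And>x. x \<notin> K \<Longrightarrow> ?f x = 0 \<and> ?D x = 0" using C1cD(4)[OF C] by blast
      then obtain S where "K \<subseteq> cball 0 S" using compact_imp_bounded[OF K(1)] by (auto simp: bounded_iff subset_iff)
      then show ?thesis using K(2) by (intro exI[of _ S]) blast
    qed
    ultimately show ?thesis using C1c_borel[OF C] unfolding wg_def by blast
  qed
  from wg_restrict[OF this, of U] have "wg U (\<lambda>x. indicator U x * ?f x) (\<lambda>x. indicator U x *\<^sub>R ?D x)"
    using U(1) by simp
  moreover have "(\<lambda>x. indicator U x * ?f x) = (\<lambda>x. indicator U x * f x)"
    "(\<lambda>x. indicator U x *\<^sub>R ?D x) = (\<lambda>x. indicator U x *\<^sub>R D x)"
    using R \<theta>(3) by (auto simp: fun_eq_iff indicator_def)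
  ultimately show ?thesis by simp
qed

subsection \<open>The chain rule\<close>

lemma contraction_of_derivative:
  fixes f :: "real \<Rightarrow> real"
  assumes "\<And>t. (f has_real_derivative f' t) (at t)" "\<And>t. \<bar>f' t\<bar> \<le> 1"
  shows "\<bar>f a - f b\<bar> \<le> \<bar>a - b\<bar>"
  using field_differentiable_bound[of UNIV f f' 1 a b] assms
  by (simp add: has_field_derivative_at_within)

text \<open>The classical chain rule for the mollifications of \<open>v\<close>, followed by a
  limit. The condition \<open>f 0 = 0\<close> preserves the support, the bound 1 on
  \<open>f'\<close> preserves square integrability.\<close>

lemma wg_chain:
  assumes \<Omega>: "open \<Omega>" and W: "wg \<Omega> v G"
    and f: "\<And>t. (f has_real_derivative f' t) (at t)" "continuous_on UNIV f'" "\<And>t. \<bar>f' t\<bar> \<le> 1" "f 0 = 0"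
  shows "wg \<Omega> (\<lambda>x. f (v x)) (\<lambda>x. f' (v x) *\<^sub>R G x)"
proof -
  note [measurable] = wgD(1,2)[OF W]
  note v = wg_integrable(1)[OF W] and G = wg_integrable(2)[OF W]
  have [measurable]: "f' \<in> borel_measurable borel" using f(2) by (rule borel_measurable_continuous_onI)
  have fc: "isCont f t" for t using f(1) by (rule DERIV_isCont)
  have [measurable]: "f \<in> borel_measurable borel"
    by (rule borel_measurable_continuous_onI) (simp add: continuous_on_eq_continuous_at fc)
  note lip = contraction_of_derivative[OF f(1,3)]
  have f0: "\<bar>f a\<bar> \<le> \<bar>a\<bar>" for a using lip[of a 0] f(4) by simp
  have test: "(\<integral>x. f (v x) *\<^sub>R D x + \<eta> x *\<^sub>R (f' (v x) *\<^sub>R G x) \<partial>lborel) = 0" if C: "C1c \<Omega> \<eta> D" for \<eta> D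
  proof -
    note [measurable] = C1c_borel[OF C]
    obtain B where B: "B > 0" "\<And>x. \<bar>\<eta> x\<bar> \<le> B" "\<And>x. norm (D x) \<le> B" using C1c_bounded[OF C] by blast
    obtain K where K: "compact K" "K \<subseteq> \<Omega>" "\<And>x. x \<notin> K \<Longrightarrow> \<eta> x = 0 \<and> D x = 0" using C1cD(4)[OF C] by blast
    obtain e where e: "e > 0" "(\<Union>x\<in>K. cball x e) \<subseteq> \<Omega>"
      using compact_subset_open_imp_cball_epsilon_subset[OF K(1) \<Omega> K(2)] by blast
    define V where "V = (\<lambda>k. conv (moll k) v)"
    define H where "H = (\<lambda>k. conv (moll k) G)"
    have VI: "integrable lborel (V k)" and HI: "integrable lborel (H k)" for k
      using integrable_conv[OF v] integrable_conv[OF G] by (auto simp: V_def H_def)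
    note [measurable] = borel_measurable_integrable[OF VI, simplified] borel_measurable_integrable[OF HI, simplified]
    have zero: "\<forall>\<^sub>F k in sequentially. (\<integral>x. f (V k x) *\<^sub>R D x + \<eta> x *\<^sub>R (f' (V k x) *\<^sub>R H k x) \<partial>lborel) = 0"
      using eventually_moll_radius[OF e(1)]
    proof eventually_elim
      case (elim k)
      define DV where "DV = (\<lambda>x. \<integral>y. v y *\<^sub>R grad (moll k) (x - y) \<partial>lborel)"
      have 1: "GDERIV (V k) x :> DV x" for x
        unfolding V_def DV_def by (rule GDERIV_conv[OF moll_C1c v])
      have 2: "continuous_on UNIV DV"
        unfolding DV_def by (rule continuous_conv_grad[OF moll_C1c v])
      have 3: "continuous_on UNIV (V k)" using 1 GDERIV_continuous by (auto simp: continuous_on_eq_continuous_at)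
      have "C1c \<Omega> (\<lambda>x. f (V k x) * \<eta> x) (\<lambda>x. f (V k x) *\<^sub>R D x + \<eta> x *\<^sub>R (f' (V k x) *\<^sub>R DV x))"
      proof (rule C1c_mult[OF _ _ C])
        show "GDERIV (\<lambda>x. f (V k x)) x :> f' (V k x) *\<^sub>R DV x" for x
          by (rule GDERIV_DERIV_compose[OF 1 f(1)])
        show "continuous_on UNIV (\<lambda>x. f' (V k x) *\<^sub>R DV x)"
          by (intro continuous_intros 2 continuous_on_compose2[OF f(2) 3]) auto
      qed
      from C1c_integral_grad[OF this]
      have "(\<integral>x. f (V k x) *\<^sub>R D x + \<eta> x *\<^sub>R (f' (V k x) *\<^sub>R DV x) \<partial>lborel) = 0" .
      \<comment> \<open>The gradient of the mollification is the mollified gradient only at points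
        whose ball lies in \<open>\<Omega>\<close>; \<open>\<eta>\<close> confines the integral to
        such points.\<close>
      moreover have "\<eta> x *\<^sub>R (f' (V k x) *\<^sub>R DV x) = \<eta> x *\<^sub>R (f' (V k x) *\<^sub>R H k x)" for x
      proof (cases "x \<in> K")
        case True
        then have "cball x (1 / (real k + 1)) \<subseteq> \<Omega>" using elim e(2) by (force simp: subset_iff)
        then show ?thesis using wg_conv_grad[OF W] by (simp add: DV_def H_def)
      qed (use K(3) in auto)
      ultimately show ?case by (simp only:)
    qed
    obtain r where r: "strict_mono r" "AE x in lborel. (\<lambda>k. V (r k) x) \<longlonglongrightarrow> v x"
      unfolding V_def using conv_moll_AE[OF v] by blast
    have zero': "\<forall>\<^sub>F k in sequentially. (\<integral>x. f (V (r k) x) *\<^sub>R D x + \<eta> x *\<^sub>R (f' (V (r k) x) *\<^sub>R H (r k) x) \<partial>lborel) = 0"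
      by (rule eventually_compose_filterlim[OF zero filterlim_subseq[OF r(1)]])
    have Bf: "\<bar>\<eta> x * f' t\<bar> \<le> B" for x t
      using mult_mono[OF B(2)[of x] f(3)[of t]] B(1) by (simp add: abs_mult)
    have i1: "integrable lborel (\<lambda>x. f (V k x) *\<^sub>R D x)" for k
    proof (rule integrable_scaleR_bounded[OF _ _ B(3)])
      show "integrable lborel (\<lambda>x. f (V k x))"
        by (rule Bochner_Integration.integrable_bound[OF VI[of k]]) (use f0 in auto)
    qed auto
    have i1': "integrable lborel (\<lambda>x. f (v x) *\<^sub>R D x)"
    proof (rule integrable_scaleR_bounded[OF _ _ B(3)])
      show "integrable lborel (\<lambda>x. f (v x))"
        by (rule Bochner_Integration.integrable_bound[OF v]) (use f0 in auto)
    qed auto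
    have i2: "integrable lborel (\<lambda>x. (\<eta> x * f' (V k x)) *\<^sub>R (H k x - G x))" for k
      by (rule integrable_bounded_scaleR[OF Bochner_Integration.integrable_diff[OF HI[of k] G] _ Bf]) auto
    have i3: "integrable lborel (\<lambda>x. (\<eta> x * f' (V k x)) *\<^sub>R G x)" for k
      by (rule integrable_bounded_scaleR[OF G _ Bf]) auto
    have i3': "integrable lborel (\<lambda>x. (\<eta> x * f' (v x)) *\<^sub>R G x)"
      by (rule integrable_bounded_scaleR[OF G _ Bf]) auto
    \<comment> \<open>\<open>H k\<close> converges to \<open>G\<close> in $L^1$, but
      \<open>f' (V k x)\<close> only pointwise along a subsequence. The product is split so that one
      term needs only the boundedness of \<open>f'\<close> and the other has the fixed field
      \<open>G\<close>.\<close>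
    have split: "(\<integral>x. f (V k x) *\<^sub>R D x + \<eta> x *\<^sub>R (f' (V k x) *\<^sub>R H k x) \<partial>lborel)
      = (\<integral>x. f (V k x) *\<^sub>R D x \<partial>lborel) + (\<integral>x. (\<eta> x * f' (V k x)) *\<^sub>R (H k x - G x) \<partial>lborel)
        + (\<integral>x. (\<eta> x * f' (V k x)) *\<^sub>R G x \<partial>lborel)" for k
      by (subst Bochner_Integration.integral_add[OF i1 i2, symmetric],
          subst Bochner_Integration.integral_add[OF Bochner_Integration.integrable_add[OF i1 i2] i3, symmetric])
        (simp add: algebra_simps)
    have L1: "(\<lambda>k. \<integral>x. f (V (r k) x) *\<^sub>R D x \<partial>lborel) \<longlonglongrightarrow> (\<integral>x. f (v x) *\<^sub>R D x \<partial>lborel)"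
    proof (rule Lim_null_comparison[THEN LIM_zero_cancel])
      have "norm ((\<integral>x. f (V k x) *\<^sub>R D x \<partial>lborel) - (\<integral>x. f (v x) *\<^sub>R D x \<partial>lborel))
          \<le> B * (\<integral>x. norm (V k x - v x) \<partial>lborel)" for k
      proof -
        have "(\<integral>x. f (V k x) *\<^sub>R D x \<partial>lborel) - (\<integral>x. f (v x) *\<^sub>R D x \<partial>lborel)
           = (\<integral>x. f (V k x) *\<^sub>R D x - f (v x) *\<^sub>R D x \<partial>lborel)"
          by (rule Bochner_Integration.integral_diff[OF i1 i1', symmetric])
        also have "norm \<dots> \<le> (\<integral>x. B * norm (V k x - v x) \<partial>lborel)"
        proof (rule Bochner_Integration.integral_norm_bound_integral)
          show "norm (f (V k x) *\<^sub>R D x - f (v x) *\<^sub>R D x) \<le> B * norm (V k x - v x)" for x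
            using mult_mono[OF B(3)[of x] lip[of "V k x" "v x"]] B(1)
            by (simp add: scaleR_diff_left[symmetric] mult.commute)
        qed (use i1 i1' VI v in auto)
        finally show ?thesis by simp
      qed
      then show "\<forall>\<^sub>F k in sequentially. norm ((\<integral>x. f (V (r k) x) *\<^sub>R D x \<partial>lborel) - (\<integral>x. f (v x) *\<^sub>R D x \<partial>lborel))
          \<le> B * (\<integral>x. norm (V (r k) x - v x) \<partial>lborel)" by simp
      have "(\<lambda>k. \<integral>x. norm (V (r k) x - v x) \<partial>lborel) \<longlonglongrightarrow> 0"
        using LIMSEQ_subseq_LIMSEQ[OF conv_moll_L1[OF v] r(1)] by (simp add: o_def V_def)
      from tendsto_mult_left[OF this, of B] show "(\<lambda>k. B * (\<integral>x. norm (V (r k) x - v x) \<partial>lborel)) \<longlonglongrightarrow> 0" by simp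
    qed
    have L2: "(\<lambda>k. \<integral>x. (\<eta> x * f' (V (r k) x)) *\<^sub>R (H (r k) x - G x) \<partial>lborel) \<longlonglongrightarrow> 0"
    proof (rule Lim_null_comparison)
      have "norm (\<integral>x. (\<eta> x * f' (V k x)) *\<^sub>R (H k x - G x) \<partial>lborel) \<le> (\<integral>x. B * norm (H k x - G x) \<partial>lborel)" for k
      proof (rule Bochner_Integration.integral_norm_bound_integral)
        show "norm ((\<eta> x * f' (V k x)) *\<^sub>R (H k x - G x)) \<le> B * norm (H k x - G x)" for x
          unfolding norm_scaleR by (intro mult_right_mono Bf) simp
      qed (use i2 HI G in auto)
      then show "\<forall>\<^sub>F k in sequentially. norm (\<integral>x. (\<eta> x * f' (V (r k) x)) *\<^sub>R (H (r k) x - G x) \<partial>lborel)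
          \<le> B * (\<integral>x. norm (H (r k) x - G x) \<partial>lborel)" by simp
      have "(\<lambda>k. \<integral>x. norm (H (r k) x - G x) \<partial>lborel) \<longlonglongrightarrow> 0"
        using LIMSEQ_subseq_LIMSEQ[OF conv_moll_L1[OF G] r(1)] by (simp add: o_def H_def)
      from tendsto_mult_left[OF this, of B] show "(\<lambda>k. B * (\<integral>x. norm (H (r k) x - G x) \<partial>lborel)) \<longlonglongrightarrow> 0" by simp
    qed
    have L3: "(\<lambda>k. \<integral>x. (\<eta> x * f' (V (r k) x)) *\<^sub>R G x \<partial>lborel) \<longlonglongrightarrow> (\<integral>x. (\<eta> x * f' (v x)) *\<^sub>R G x \<partial>lborel)"
    proof (rule integral_dominated_convergence[where w = "\<lambda>x. B * norm (G x)"])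
      have c: "isCont f' t" for t using f(2) by (simp add: continuous_on_eq_continuous_at)
      show "AE x in lborel. (\<lambda>k. (\<eta> x * f' (V (r k) x)) *\<^sub>R G x) \<longlonglongrightarrow> (\<eta> x * f' (v x)) *\<^sub>R G x"
        using r(2) by eventually_elim (intro tendsto_intros isCont_tendsto_compose[OF c])
      show "AE x in lborel. norm ((\<eta> x * f' (V (r k) x)) *\<^sub>R G x) \<le> B * norm (G x)" for k
        unfolding norm_scaleR by (intro AE_I2 mult_right_mono Bf) simp
    qed (use G in auto)
    have "(\<lambda>k. \<integral>x. f (V (r k) x) *\<^sub>R D x + \<eta> x *\<^sub>R (f' (V (r k) x) *\<^sub>R H (r k) x) \<partial>lborel)
        \<longlonglongrightarrow> (\<integral>x. f (v x) *\<^sub>R D x \<partial>lborel) + 0 + (\<integral>x. (\<eta> x * f' (v x)) *\<^sub>R G x \<partial>lborel)"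
      unfolding split by (intro tendsto_add L1 L2 L3)
    moreover have "(\<lambda>k. \<integral>x. f (V (r k) x) *\<^sub>R D x + \<eta> x *\<^sub>R (f' (V (r k) x) *\<^sub>R H (r k) x) \<partial>lborel) \<longlonglongrightarrow> 0"
      using zero' by (rule tendsto_eventually)
    ultimately have "(\<integral>x. f (v x) *\<^sub>R D x \<partial>lborel) + (\<integral>x. (\<eta> x * f' (v x)) *\<^sub>R G x \<partial>lborel) = 0"
      using LIMSEQ_unique by fastforce
    then show ?thesis using i1' i3' by (simp add: Bochner_Integration.integral_add)
  qed
  have "integrable lborel (\<lambda>x. (norm (f (v x)))\<^sup>2)"
    by (rule integrable_square_bounded[of v _ 1]) (use wgD(3)[OF W] f0 in auto)
  moreover have "integrable lborel (\<lambda>x. (norm (f' (v x) *\<^sub>R G x))\<^sup>2)"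
    by (rule integrable_square_bounded[of G _ 1]) (use wgD(4)[OF W] f(3) in \<open>auto intro: mult_left_le_one_le\<close>)
  moreover have "\<exists>R. \<forall>x. x \<notin> cball 0 R \<longrightarrow> f (v x) = 0 \<and> f' (v x) *\<^sub>R G x = 0"
    using wgD(7)[OF W] f(4) by (metis scaleR_zero_right)
  ultimately show ?thesis using test wgD(5,6)[OF W] f(4) unfolding wg_def by auto
qed

text \<open>The convergence is only claimed along a subsequence, as it is obtained from pointwise
  convergence almost everywhere.\<close>
lemma chain_continuous:
  fixes v :: "'a::euclidean_space \<Rightarrow> real" and G :: "'a \<Rightarrow> 'a"
  assumes W: "wg \<Omega> v G" "\<And>k::nat. wg \<Omega> (V k) (H k)"
    and lim: "(\<lambda>k. \<integral>x. (V k x - v x)\<^sup>2 \<partial>lborel) \<longlonglongrightarrow> 0" "(\<lambda>k. \<integral>x. (norm (H k x - G x))\<^sup>2 \<partial>lborel) \<longlonglongrightarrow> 0"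
    and f: "\<And>t. (f has_real_derivative f' t) (at t)" "continuous_on UNIV f'" "\<And>t. \<bar>f' t\<bar> \<le> 1" "f 0 = 0"
  shows "\<exists>r. strict_mono r \<and> (\<lambda>k. \<integral>x. (f (V (r k) x) - f (v x))\<^sup>2 \<partial>lborel) \<longlonglongrightarrow> 0 \<and>
    (\<lambda>k. \<integral>x. (norm (f' (V (r k) x) *\<^sub>R H (r k) x - f' (v x) *\<^sub>R G x))\<^sup>2 \<partial>lborel) \<longlonglongrightarrow> 0"
proof -
  note [measurable] = wgD(1,2)[OF W(1)] wgD(1,2)[OF W(2)]
  have [measurable]: "f' \<in> borel_measurable borel" using f(2) by (rule borel_measurable_continuous_onI)
  have fc: "isCont f t" for t using f(1) by (rule DERIV_isCont)
  have [measurable]: "f \<in> borel_measurable borel"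
    by (rule borel_measurable_continuous_onI) (simp add: continuous_on_eq_continuous_at fc)
  note lip = contraction_of_derivative[OF f(1,3)]
  note Wd = wg_diff[OF W(2,1)]
  have sq4: "(f' s - f' t)\<^sup>2 \<le> 4" for s t
  proof -
    have "\<bar>f' s - f' t\<bar> \<le> \<bar>2\<bar>" using f(3)[of s] f(3)[of t] by linarith
    then show ?thesis unfolding abs_le_square_iff by simp
  qed
  obtain r where r: "strict_mono r" "AE x in lborel. (\<lambda>k. (V (r k) x - v x)\<^sup>2) \<longlonglongrightarrow> 0"
    using tendsto_L1_AE_subseq[of lborel "\<lambda>k x. (V k x - v x)\<^sup>2"] lim(1) wgD(3)[OF Wd] by auto
  have AE: "AE x in lborel. (\<lambda>k. V (r k) x) \<longlonglongrightarrow> v x"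
    using r(2)
  proof eventually_elim
    case (elim x)
    from tendsto_real_sqrt[OF this] show ?case by (simp add: tendsto_rabs_zero_iff LIM_zero_iff)
  qed
  have 1: "(\<lambda>k. \<integral>x. (f (V k x) - f (v x))\<^sup>2 \<partial>lborel) \<longlonglongrightarrow> 0"
  proof (rule tendsto_sandwich[OF _ _ tendsto_const lim(1)])
    show "\<forall>\<^sub>F k in sequentially. 0 \<le> (\<integral>x. (f (V k x) - f (v x))\<^sup>2 \<partial>lborel)" by simp
    have "(f (V k x) - f (v x))\<^sup>2 \<le> (V k x - v x)\<^sup>2" for k x
      using lip[of "V k x" "v x"] by (simp add: abs_le_square_iff)
    then show "\<forall>\<^sub>F k in sequentially. (\<integral>x. (f (V k x) - f (v x))\<^sup>2 \<partial>lborel) \<le> (\<integral>x. (V k x - v x)\<^sup>2 \<partial>lborel)"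
      using wgD(3)[OF Wd] by (intro always_eventually allI integral_mono')
        (auto simp: zero_le_power2)
  qed
  have 2: "(\<lambda>k. \<integral>x. 2 * (norm (H (r k) x - G x))\<^sup>2 + 2 * ((f' (V (r k) x) - f' (v x))\<^sup>2 * (norm (G x))\<^sup>2) \<partial>lborel) \<longlonglongrightarrow> 0"
  proof -
    have i: "integrable lborel (\<lambda>x. (f' (V k x) - f' (v x))\<^sup>2 * (norm (G x))\<^sup>2)" for k
    proof (rule Bochner_Integration.integrable_bound)
      show "integrable lborel (\<lambda>x. 4 * (norm (G x))\<^sup>2)" using wgD(4)[OF W(1)] by simp
      from sq4 show "AE x in lborel. norm ((f' (V k x) - f' (v x))\<^sup>2 * (norm (G x))\<^sup>2) \<le> norm (4 * (norm (G x))\<^sup>2)"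
        by (intro AE_I2) (auto simp: abs_mult intro!: mult_right_mono)
    qed auto
    have "(\<lambda>k. \<integral>x. (f' (V (r k) x) - f' (v x))\<^sup>2 * (norm (G x))\<^sup>2 \<partial>lborel) \<longlonglongrightarrow> integral\<^sup>L lborel (\<lambda>x::'a. 0)"
    proof (rule integral_dominated_convergence[where w = "\<lambda>x. 4 * (norm (G x))\<^sup>2"])
      have c: "isCont f' t" for t using f(2) by (simp add: continuous_on_eq_continuous_at)
      show "AE x in lborel. (\<lambda>k. (f' (V (r k) x) - f' (v x))\<^sup>2 * (norm (G x))\<^sup>2) \<longlonglongrightarrow> 0"
        using AE
      proof eventually_elim
        case (elim x)
        have "(\<lambda>k. (f' (V (r k) x) - f' (v x))\<^sup>2 * (norm (G x))\<^sup>2) \<longlonglongrightarrow> (f' (v x) - f' (v x))\<^sup>2 * (norm (G x))\<^sup>2"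
          by (intro tendsto_intros isCont_tendsto_compose[OF c] elim)
        then show ?case by simp
      qed
      from sq4 show "AE x in lborel. norm ((f' (V (r k) x) - f' (v x))\<^sup>2 * (norm (G x))\<^sup>2) \<le> 4 * (norm (G x))\<^sup>2" for k
        by (intro AE_I2) (auto simp: abs_mult intro!: mult_right_mono)
    qed (use wgD(4)[OF W(1)] in auto)
    moreover have "(\<lambda>k. \<integral>x. (norm (H (r k) x - G x))\<^sup>2 \<partial>lborel) \<longlonglongrightarrow> 0"
      using LIMSEQ_subseq_LIMSEQ[OF lim(2) r(1)] by (simp add: o_def)
    ultimately have "(\<lambda>k. 2 * (\<integral>x. (norm (H (r k) x - G x))\<^sup>2 \<partial>lborel)
       + 2 * (\<integral>x. (f' (V (r k) x) - f' (v x))\<^sup>2 * (norm (G x))\<^sup>2 \<partial>lborel)) \<longlonglongrightarrow> 2 * 0 + 2 * 0"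
      by (intro tendsto_intros) simp_all
    then show ?thesis using i wgD(4)[OF Wd] by (simp add: Bochner_Integration.integral_add)
  qed
  have "(\<lambda>k. \<integral>x. (norm (f' (V (r k) x) *\<^sub>R H (r k) x - f' (v x) *\<^sub>R G x))\<^sup>2 \<partial>lborel) \<longlonglongrightarrow> 0"
  proof (rule tendsto_sandwich[OF _ _ tendsto_const 2])
    show "\<forall>\<^sub>F k in sequentially. 0 \<le> (\<integral>x. (norm (f' (V (r k) x) *\<^sub>R H (r k) x - f' (v x) *\<^sub>R G x))\<^sup>2 \<partial>lborel)" by simp
    \<comment> \<open>One term is controlled by the convergence of the gradients; the other contains
      a fixed gradient and tends to 0 by dominated convergence.\<close>
    have *: "(norm (f' s *\<^sub>R a - f' t *\<^sub>R b))\<^sup>2 \<le> 2 * (norm (a - b))\<^sup>2 + 2 * ((f' s - f' t)\<^sup>2 * (norm b)\<^sup>2)"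
      for s t and a b :: 'a
    proof -
      have "norm (f' s *\<^sub>R a - f' t *\<^sub>R b) = norm (f' s *\<^sub>R (a - b) + (f' s - f' t) *\<^sub>R b)"
        by (simp add: algebra_simps)
      also have "\<dots> \<le> norm (f' s *\<^sub>R (a - b)) + norm ((f' s - f' t) *\<^sub>R b)" by (rule norm_triangle_ineq)
      also have "\<dots> \<le> norm (a - b) + \<bar>f' s - f' t\<bar> * norm b"
        using mult_right_mono[OF f(3)[of s], of "norm (a - b)"] by simp
      finally have "(norm (f' s *\<^sub>R a - f' t *\<^sub>R b))\<^sup>2 \<le> (norm (a - b) + \<bar>f' s - f' t\<bar> * norm b)\<^sup>2"
        by (rule power_mono) simp
      also have "\<dots> \<le> 2 * (norm (a - b))\<^sup>2 + 2 * (\<bar>f' s - f' t\<bar> * norm b)\<^sup>2"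
        using sum_squares_bound[of "norm (a - b)" "\<bar>f' s - f' t\<bar> * norm b"] by (simp add: power2_sum)
      finally show ?thesis by (simp add: power_mult_distrib)
    qed
    have i: "integrable lborel (\<lambda>x. 2 * (norm (H k x - G x))\<^sup>2 + 2 * ((f' (V k x) - f' (v x))\<^sup>2 * (norm (G x))\<^sup>2))" for k
    proof (rule Bochner_Integration.integrable_bound)
      show "integrable lborel (\<lambda>x. 2 * (norm (H k x - G x))\<^sup>2 + 8 * (norm (G x))\<^sup>2)"
        using wgD(4)[OF W(1)] wgD(4)[OF Wd] by simp
      show "AE x in lborel. norm (2 * (norm (H k x - G x))\<^sup>2 + 2 * ((f' (V k x) - f' (v x))\<^sup>2 * (norm (G x))\<^sup>2))
         \<le> norm (2 * (norm (H k x - G x))\<^sup>2 + 8 * (norm (G x))\<^sup>2)"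
      proof (rule AE_I2)
        fix x
        have "(f' (V k x) - f' (v x))\<^sup>2 * (norm (G x))\<^sup>2 \<le> 4 * (norm (G x))\<^sup>2"
          by (intro mult_right_mono sq4) simp
        then show "norm (2 * (norm (H k x - G x))\<^sup>2 + 2 * ((f' (V k x) - f' (v x))\<^sup>2 * (norm (G x))\<^sup>2))
         \<le> norm (2 * (norm (H k x - G x))\<^sup>2 + 8 * (norm (G x))\<^sup>2)" by (simp add: mult.commute)
      qed
    qed auto
    then show "\<forall>\<^sub>F k in sequentially. (\<integral>x. (norm (f' (V (r k) x) *\<^sub>R H (r k) x - f' (v x) *\<^sub>R G x))\<^sup>2 \<partial>lborel)
       \<le> (\<integral>x. 2 * (norm (H (r k) x - G x))\<^sup>2 + 2 * ((f' (V (r k) x) - f' (v x))\<^sup>2 * (norm (G x))\<^sup>2) \<partial>lborel)"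
      using * by (intro always_eventually allI integral_mono') auto
  qed
  moreover have "(\<lambda>k. \<integral>x. (f (V (r k) x) - f (v x))\<^sup>2 \<partial>lborel) \<longlonglongrightarrow> 0"
    using LIMSEQ_subseq_LIMSEQ[OF 1 r(1)] by (simp add: o_def)
  ultimately show ?thesis using r(1) by blast
qed

subsection \<open>Sobolev functions and their Borel representatives\<close>

lemma AE_lebesgue_on:
  "S \<in> sets borel \<Longrightarrow> (AE x in lebesgue_on S. P x) \<longleftrightarrow> (AE x in lborel. x \<in> S \<longrightarrow> P x)"
  by (simp add: AE_restrict_space_iff AE_completion_iff)

lemma borel_lebesgue_on:
  fixes f :: "'a::euclidean_space \<Rightarrow> 'b::euclidean_space"
  shows "f \<in> borel_measurable borel \<Longrightarrow> f \<in> borel_measurable (lebesgue_on S)"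
  by (rule measurable_restrict_space1) (simp add: measurable_completion)

lemma integral_lebesgue_on_borel:
  fixes f :: "'a::euclidean_space \<Rightarrow> 'b::euclidean_space"
  assumes "f \<in> borel_measurable borel" "S \<in> sets borel" "\<And>x. x \<notin> S \<Longrightarrow> f x = 0"
  shows "integral\<^sup>L (lebesgue_on S) f = integral\<^sup>L lborel f"
    and "integrable (lebesgue_on S) f \<longleftrightarrow> integrable lborel f"
proof -
  have *: "(\<lambda>x. indicator S x *\<^sub>R f x) = f" using assms(3) by (auto simp: fun_eq_iff indicator_def)
  show "integral\<^sup>L (lebesgue_on S) f = integral\<^sup>L lborel f"
    using assms by (simp add: integral_restrict_space * integral_completion)
  show "integrable (lebesgue_on S) f \<longleftrightarrow> integrable lborel f"
    using assms by (simp add: integrable_restrict_space * integrable_completion)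
qed

lemma borel_representative_real:
  fixes f :: "'a::euclidean_space \<Rightarrow> real"
  assumes f: "f \<in> borel_measurable (lebesgue_on S)" and S: "S \<in> sets borel"
  shows "\<exists>g. g \<in> borel_measurable borel \<and> (\<forall>x. x \<notin> S \<longrightarrow> g x = 0) \<and> (AE x in lborel. x \<in> S \<longrightarrow> f x = g x)"
proof -
  have "(\<lambda>x. if x \<in> S then f x else 0) \<in> borel_measurable lebesgue"
    by (rule borel_measurable_if_I[OF f]) (use S in auto)
  then obtain g where g: "g \<in> borel_measurable lborel" "AE x in lborel. (if x \<in> S then f x else 0) = g x"
    using completion_ex_borel_measurable_real by blast
  have "(\<lambda>x. indicator S x * g x) \<in> borel_measurable borel" using g(1) S by simp
  moreover have "AE x in lborel. x \<in> S \<longrightarrow> f x = indicator S x * g x"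
    using g(2) by eventually_elim auto
  ultimately show ?thesis by (intro exI[of _ "\<lambda>x. indicator S x * g x"]) auto
qed

lemma borel_representative:
  fixes f :: "'a::euclidean_space \<Rightarrow> 'b::euclidean_space"
  assumes f: "f \<in> borel_measurable (lebesgue_on S)" and S: "S \<in> sets borel"
  shows "\<exists>g. g \<in> borel_measurable borel \<and> (\<forall>x. x \<notin> S \<longrightarrow> g x = 0) \<and> (AE x in lborel. x \<in> S \<longrightarrow> f x = g x)"
proof -
  have "\<exists>g. g \<in> borel_measurable borel \<and> (\<forall>x. x \<notin> S \<longrightarrow> g x = 0) \<and> (AE x in lborel. x \<in> S \<longrightarrow> f x \<bullet> b = g x)" for b
    by (rule borel_representative_real[OF _ S]) (use f in simp)
  then obtain g where g: "\<And>b. g b \<in> borel_measurable borel" "\<And>b x. x \<notin> S \<Longrightarrow> g b x = 0"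
    "\<And>b. AE x in lborel. x \<in> S \<longrightarrow> f x \<bullet> b = g b x" by metis
  have "AE x in lborel. \<forall>b\<in>Basis. x \<in> S \<longrightarrow> f x \<bullet> b = g b x"
    using g(3) by (intro AE_finite_allI finite_Basis)
  then have "AE x in lborel. x \<in> S \<longrightarrow> f x = (\<Sum>b\<in>Basis. g b x *\<^sub>R b)"
  proof eventually_elim
    case (elim x)
    show ?case
    proof
      assume "x \<in> S"
      then have "(\<Sum>b\<in>Basis. g b x *\<^sub>R b) = (\<Sum>b\<in>Basis. (f x \<bullet> b) *\<^sub>R b)"
        using elim by (intro sum.cong) auto
      then show "f x = (\<Sum>b\<in>Basis. g b x *\<^sub>R b)" by (simp add: euclidean_representation)
    qed
  qed
  then show ?thesis using g(1,2) by (intro exI[of _ "\<lambda>x. \<Sum>b\<in>Basis. g b x *\<^sub>R b"]) auto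
qed

lemma measurable_of_AE_eq:
  fixes f :: "'a::euclidean_space \<Rightarrow> 'b::euclidean_space"
  assumes g: "g \<in> borel_measurable borel" and S: "S \<in> sets borel" and AE: "AE x in lborel. x \<in> S \<longrightarrow> f x = g x"
  shows "f \<in> borel_measurable (lebesgue_on S)"
proof -
  have "(\<lambda>x. if x \<in> S then f x else 0) \<in> borel_measurable lebesgue"
  proof (rule borel_measurable_AE)
    have "(\<lambda>x. indicator S x *\<^sub>R g x) \<in> borel_measurable lborel" using g S by simp
    then show "(\<lambda>x. indicator S x *\<^sub>R g x) \<in> borel_measurable lebesgue" by (rule measurable_completion)
    show "AE x in lebesgue. indicator S x *\<^sub>R g x = (if x \<in> S then f x else 0)"
      unfolding AE_completion_iff using AE by eventually_elim auto
  qed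
  then show ?thesis by (rule borel_measurable_if_D)
qed

lemma conv_moll_tendsto:
  fixes g :: "'a::euclidean_space \<Rightarrow> 'b::euclidean_space"
  assumes g: "integrable lborel g" "isCont g x"
  shows "(\<lambda>k. conv (moll k) g x) \<longlonglongrightarrow> g x"
proof (rule tendstoI)
  fix e :: real assume "0 < e"
  then obtain d where d: "d > 0" "\<And>y. dist y x < d \<Longrightarrow> dist (g y) (g x) < e / 2"
    using g(2) unfolding continuous_at by (metis half_gt_zero isCont_def g(2) continuous_at_eps_delta)
  show "\<forall>\<^sub>F k in sequentially. dist (conv (moll k) g x) (g x) < e"
    using eventually_moll_radius[OF d(1)]
  proof eventually_elim
    case (elim k)
    have "norm (conv (moll k) g x - g x) \<le> e / 2"
      by (rule conv_moll_close[OF g(1) elim]) (use d(2) in \<open>auto simp: dist_norm norm_minus_commute less_imp_le\<close>)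
    then show ?case using \<open>0 < e\<close> by (simp add: dist_norm)
  qed
qed

text \<open>The factor 3 is not sharp: it is the price for deducing the bound from the oscillation
  estimate \<open>conv_moll_close\<close>.\<close>

lemma conv_moll_bounded:
  fixes g :: "'a::euclidean_space \<Rightarrow> 'b::euclidean_space"
  assumes "integrable lborel g" "\<And>x. norm (g x) \<le> B"
  shows "norm (conv (moll k) g x) \<le> 3 * B"
proof -
  have "norm (conv (moll k) g x - g x) \<le> 2 * B"
  proof (rule conv_moll_close[OF assms(1) order_refl])
    show "norm (g y - g x) \<le> 2 * B" for y
      using norm_triangle_ineq4[of "g y" "g x"] assms(2)[of x] assms(2)[of y] by linarith
  qed
  then show ?thesis using norm_triangle_sub[of "conv (moll k) g x" "g x"] assms(2)[of x] by linarith
qed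

text \<open>\<open>is_weak_gradient\<close> speaks only of smooth test functions. A function of
  class \<open>C1c\<close> is replaced by its mollifications, which are test functions from some
  index on and converge boundedly together with their gradients.\<close>

lemma wg_of_weak_gradient:
  assumes U: "open U" "bounded U" and v: "v \<in> L2 U" and G: "G \<in> L2 U" and W: "is_weak_gradient U v G"
  shows "\<exists>v0 G0. wg U v0 G0 \<and> (AE x in lborel. x \<in> U \<longrightarrow> v x = v0 x) \<and> (AE x in lborel. x \<in> U \<longrightarrow> G x = G0 x)"
proof -
  have Ub [measurable]: "U \<in> sets borel" using U by simp
  obtain v0 where v0 [measurable]: "v0 \<in> borel_measurable borel" and v0z: "\<And>x. x \<notin> U \<Longrightarrow> v0 x = 0"
    and vAE: "AE x in lborel. x \<in> U \<longrightarrow> v x = v0 x"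
    using borel_representative[OF _ Ub, of v] v by (auto simp: L2_def)
  obtain G0 where G0 [measurable]: "G0 \<in> borel_measurable borel" and G0z: "\<And>x. x \<notin> U \<Longrightarrow> G0 x = 0"
    and GAE: "AE x in lborel. x \<in> U \<longrightarrow> G x = G0 x"
    using borel_representative[OF _ Ub, of G] G by (auto simp: L2_def)
  have vm [measurable]: "v \<in> borel_measurable (lebesgue_on U)" and Gm [measurable]: "G \<in> borel_measurable (lebesgue_on U)"
    using v G by (auto simp: L2_def)
  have v0m [measurable]: "v0 \<in> borel_measurable (lebesgue_on U)" and G0m [measurable]: "G0 \<in> borel_measurable (lebesgue_on U)"
    using v0 G0 by (auto intro: borel_lebesgue_on)
  have vL: "integrable lborel (\<lambda>x. (v0 x)\<^sup>2)"
  proof -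
    have "integrable (lebesgue_on U) (\<lambda>x. (norm (v x))\<^sup>2)" using v by (simp add: L2_def)
    then have "integrable (lebesgue_on U) (\<lambda>x. (v0 x)\<^sup>2)"
      by (subst (asm) integrable_cong_AE[where g = "\<lambda>x. (v0 x)\<^sup>2"])
        (use vAE in \<open>auto simp: AE_lebesgue_on\<close>)
    then show ?thesis by (subst (asm) integral_lebesgue_on_borel(2)) (auto simp: v0z)
  qed
  have GL: "integrable lborel (\<lambda>x. (norm (G0 x))\<^sup>2)"
  proof -
    have "integrable (lebesgue_on U) (\<lambda>x. (norm (G x))\<^sup>2)" using G by (simp add: L2_def)
    then have "integrable (lebesgue_on U) (\<lambda>x. (norm (G0 x))\<^sup>2)"
      by (subst (asm) integrable_cong_AE[where g = "\<lambda>x. (norm (G0 x))\<^sup>2"])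
        (use GAE in \<open>auto simp: AE_lebesgue_on\<close>)
    then show ?thesis by (subst (asm) integral_lebesgue_on_borel(2)) (auto simp: G0z)
  qed
  obtain R where R: "U \<subseteq> cball 0 R" using U(2) by (auto simp: bounded_iff subset_iff)
  have vI: "integrable lborel v0"
    by (rule integrable_of_square[of _ R]) (use vL R v0z in \<open>auto simp: subset_iff\<close>)
  have GI: "integrable lborel G0"
    by (rule integrable_of_square[of _ R]) (use GL R G0z in \<open>auto simp: subset_iff\<close>)
  have test: "(\<integral>x. v0 x *\<^sub>R D x + \<eta> x *\<^sub>R G0 x \<partial>lborel) = 0" if C: "C1c U \<eta> D" for \<eta> D
  proof -
    note [measurable] = C1c_borel[OF C]
    obtain B where B: "B > 0" "\<And>x. \<bar>\<eta> x\<bar> \<le> B" "\<And>x. norm (D x) \<le> B" using C1c_bounded[OF C] by blast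
    have \<eta>I: "integrable lborel \<eta>" and DI: "integrable lborel D" using C1c_integrable[OF C] by auto
    define E where "E = (\<lambda>k. conv (moll k) \<eta>)"
    define DE where "DE = (\<lambda>k. conv (moll k) D)"
    have [measurable]: "E k \<in> borel_measurable borel" "DE k \<in> borel_measurable borel" for k
      using borel_measurable_integrable[OF integrable_conv[OF \<eta>I]] borel_measurable_integrable[OF integrable_conv[OF DI]]
      by (auto simp: E_def DE_def)
    then have [measurable]: "E k \<in> borel_measurable (lebesgue_on U)" "DE k \<in> borel_measurable (lebesgue_on U)" for k
      by (auto intro: borel_lebesgue_on)
    have Eb: "\<bar>E k x\<bar> \<le> 3 * B" and DEb: "norm (DE k x) \<le> 3 * B" for k x
      using conv_moll_bounded[OF \<eta>I, of B] conv_moll_bounded[OF DI, of B] B by (auto simp: E_def DE_def)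
    have Et: "(\<lambda>k. E k x) \<longlonglongrightarrow> \<eta> x" and DEt: "(\<lambda>k. DE k x) \<longlonglongrightarrow> D x" for x
      unfolding E_def DE_def using C1cD(2,3)[OF C]
      by (auto intro!: conv_moll_tendsto \<eta>I DI simp: continuous_on_eq_continuous_at)
    have vDb: "integrable lborel (\<lambda>x. v0 x *\<^sub>R D' x)" if "D' \<in> borel_measurable borel" "\<And>x. norm (D' x) \<le> 3 * B"
      for D' :: "'a \<Rightarrow> 'a" by (rule integrable_scaleR_bounded[OF vI that])
    have \<eta>Gb: "integrable lborel (\<lambda>x. \<eta>' x *\<^sub>R G0 x)" if "\<eta>' \<in> borel_measurable borel" "\<And>x. \<bar>\<eta>' x\<bar> \<le> 3 * B"
      for \<eta>' by (rule integrable_bounded_scaleR[OF GI that])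
    have step: "(\<integral>x. v0 x *\<^sub>R DE k x + E k x *\<^sub>R G0 x \<partial>lborel) = 0" if T: "test_function U (E k)" for k
    proof (rule euclidean_eqI)
      fix b :: 'a assume b: "b \<in> Basis"
      have fr: "frechet_derivative (E k) (at x) b = b \<bullet> DE k x" for x
        unfolding E_def DE_def by (rule GDERIV_frechet_derivative(2)[OF GDERIV_conv_moll[OF C]])
      have "(\<integral>x. v x * (b \<bullet> DE k x) \<partial>lebesgue_on U) = - (\<integral>x. (G x \<bullet> b) * E k x \<partial>lebesgue_on U)"
        using W T b unfolding is_weak_gradient_def fr[symmetric] by blast
      moreover have "(\<integral>x. v x * (b \<bullet> DE k x) \<partial>lebesgue_on U) = (\<integral>x. v0 x * (b \<bullet> DE k x) \<partial>lborel)"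
      proof -
        have "(\<integral>x. v x * (b \<bullet> DE k x) \<partial>lebesgue_on U) = (\<integral>x. v0 x * (b \<bullet> DE k x) \<partial>lebesgue_on U)"
          by (rule integral_cong_AE) (use vAE in \<open>auto simp: AE_lebesgue_on intro: borel_lebesgue_on\<close>)
        then show ?thesis by (subst (asm) (2) integral_lebesgue_on_borel(1)) (auto simp: v0z)
      qed
      moreover have "(\<integral>x. (G x \<bullet> b) * E k x \<partial>lebesgue_on U) = (\<integral>x. (G0 x \<bullet> b) * E k x \<partial>lborel)"
      proof -
        have "(\<integral>x. (G x \<bullet> b) * E k x \<partial>lebesgue_on U) = (\<integral>x. (G0 x \<bullet> b) * E k x \<partial>lebesgue_on U)"
          by (rule integral_cong_AE) (use GAE in \<open>auto simp: AE_lebesgue_on intro: borel_lebesgue_on\<close>)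
        then show ?thesis by (subst (asm) (2) integral_lebesgue_on_borel(1)) (auto simp: G0z)
      qed
      ultimately have eq: "(\<integral>x. v0 x * (b \<bullet> DE k x) \<partial>lborel) + (\<integral>x. (G0 x \<bullet> b) * E k x \<partial>lborel) = 0" by simp
      have i1: "integrable lborel (\<lambda>x. v0 x *\<^sub>R DE k x)" and i2: "integrable lborel (\<lambda>x. E k x *\<^sub>R G0 x)"
        by (rule vDb \<eta>Gb; use Eb DEb in auto)+
      have "(\<integral>x. v0 x *\<^sub>R DE k x + E k x *\<^sub>R G0 x \<partial>lborel) \<bullet> b
        = (\<integral>x. v0 x *\<^sub>R DE k x \<partial>lborel) \<bullet> b + (\<integral>x. E k x *\<^sub>R G0 x \<partial>lborel) \<bullet> b"
        using i1 i2 by (simp add: inner_add_left)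
      also have "\<dots> = (\<integral>x. (v0 x *\<^sub>R DE k x) \<bullet> b \<partial>lborel) + (\<integral>x. (E k x *\<^sub>R G0 x) \<bullet> b \<partial>lborel)"
        using integral_inner_left[of b lborel, OF i1] integral_inner_left[of b lborel, OF i2] by (simp only:)
      also have "\<dots> = 0" using eq by (simp add: inner_commute mult.commute)
      finally show "(\<integral>x. v0 x *\<^sub>R DE k x + E k x *\<^sub>R G0 x \<partial>lborel) \<bullet> b = 0 \<bullet> b" by simp
    qed
    have "\<forall>\<^sub>F k in sequentially. (\<integral>x. v0 x *\<^sub>R DE k x + E k x *\<^sub>R G0 x \<partial>lborel) = 0"
      using C1c_test_function[OF U(1) C] by eventually_elim (rule step, simp add: E_def)
    then have "(\<lambda>k. \<integral>x. v0 x *\<^sub>R DE k x + E k x *\<^sub>R G0 x \<partial>lborel) \<longlonglongrightarrow> 0" by (rule tendsto_eventually)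
    moreover have "(\<lambda>k. \<integral>x. v0 x *\<^sub>R DE k x + E k x *\<^sub>R G0 x \<partial>lborel) \<longlonglongrightarrow> (\<integral>x. v0 x *\<^sub>R D x + \<eta> x *\<^sub>R G0 x \<partial>lborel)"
    proof (rule integral_dominated_convergence[where w = "\<lambda>x. norm (v0 x) * (3 * B) + 3 * B * norm (G0 x)"])
      show "AE x in lborel. (\<lambda>k. v0 x *\<^sub>R DE k x + E k x *\<^sub>R G0 x) \<longlonglongrightarrow> v0 x *\<^sub>R D x + \<eta> x *\<^sub>R G0 x"
        by (intro AE_I2 tendsto_intros Et DEt)
      show "AE x in lborel. norm (v0 x *\<^sub>R DE k x + E k x *\<^sub>R G0 x) \<le> norm (v0 x) * (3 * B) + 3 * B * norm (G0 x)" for k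
      proof (rule AE_I2)
        fix x
        have "norm (v0 x *\<^sub>R DE k x + E k x *\<^sub>R G0 x) \<le> norm (v0 x) * norm (DE k x) + \<bar>E k x\<bar> * norm (G0 x)"
          using norm_triangle_ineq[of "v0 x *\<^sub>R DE k x" "E k x *\<^sub>R G0 x"] by simp
        also have "\<dots> \<le> norm (v0 x) * (3 * B) + 3 * B * norm (G0 x)"
          using Eb DEb B(1) by (intro add_mono mult_mono) auto
        finally show "norm (v0 x *\<^sub>R DE k x + E k x *\<^sub>R G0 x) \<le> norm (v0 x) * (3 * B) + 3 * B * norm (G0 x)" .
      qed
    qed (use vI GI in auto)
    ultimately show ?thesis using LIMSEQ_unique by blast
  qed
  have "\<forall>x. x \<notin> cball 0 R \<longrightarrow> v0 x = 0 \<and> G0 x = 0" using R v0z G0z by blast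
  then have "wg U v0 G0" unfolding wg_def using test vL GL v0z G0z v0 G0 by blast
  then show ?thesis using vAE GAE by blast
qed

lemma test_function_C1c:
  assumes "test_function U \<phi>"
  shows "C1c U \<phi> (grad \<phi>)"
  by (rule C1cI[of _ _ "closure {x. \<phi> x \<noteq> 0}"])
    (use assms closure_subset[of "{x. \<phi> x \<noteq> 0}"] in
      \<open>auto simp: test_function_def intro: smooth_GDERIV smooth_continuous_grad\<close>)

lemma weak_gradient_of_wg:
  assumes U: "open U" and W: "wg U v0 G0" and vAE: "AE x in lborel. x \<in> U \<longrightarrow> v x = v0 x"
  shows "v \<in> L2 U" "G0 \<in> L2 U" "is_weak_gradient U v G0"
proof -
  have Ub [measurable]: "U \<in> sets borel" using U by simp
  note [measurable] = wgD(1,2)[OF W]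
  have vm [measurable]: "v \<in> borel_measurable (lebesgue_on U)"
    by (rule measurable_of_AE_eq[OF wgD(1)[OF W] Ub vAE])
  have v0m [measurable]: "v0 \<in> borel_measurable (lebesgue_on U)" and G0m [measurable]: "G0 \<in> borel_measurable (lebesgue_on U)"
    using wgD(1,2)[OF W] by (auto intro: borel_lebesgue_on)
  have "integrable (lebesgue_on U) (\<lambda>x. (v0 x)\<^sup>2)"
    using wgD(3)[OF W] by (subst integral_lebesgue_on_borel(2)) (auto simp: wgD(5)[OF W])
  then have "integrable (lebesgue_on U) (\<lambda>x. (v x)\<^sup>2)"
    by (subst integrable_cong_AE[where g = "\<lambda>x. (v0 x)\<^sup>2"]) (use vAE in \<open>auto simp: AE_lebesgue_on\<close>)
  then show "v \<in> L2 U" by (simp add: L2_def)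
  have "integrable (lebesgue_on U) (\<lambda>x. (norm (G0 x))\<^sup>2)"
    using wgD(4)[OF W] by (subst integral_lebesgue_on_borel(2)) (auto simp: wgD(6)[OF W])
  then show "G0 \<in> L2 U" by (simp add: L2_def)
  show "is_weak_gradient U v G0"
    unfolding is_weak_gradient_def
  proof (intro allI impI ballI)
    fix \<phi> and b :: 'a assume T: "test_function U \<phi>" and b: "b \<in> Basis"
    note C = test_function_C1c[OF T]
    note [measurable] = C1c_borel[OF C]
    have [measurable]: "\<phi> \<in> borel_measurable (lebesgue_on U)" "grad \<phi> \<in> borel_measurable (lebesgue_on U)"
      using C1c_borel[OF C] by (auto intro: borel_lebesgue_on)
    have fr: "frechet_derivative \<phi> (at x) b = b \<bullet> grad \<phi> x" for x
      by (rule GDERIV_frechet_derivative(2)[OF C1cD(1)[OF C]])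
    have "(\<integral>x. v x * (b \<bullet> grad \<phi> x) \<partial>lebesgue_on U) = (\<integral>x. v0 x * (b \<bullet> grad \<phi> x) \<partial>lebesgue_on U)"
      by (rule integral_cong_AE) (use vAE in \<open>auto simp: AE_lebesgue_on intro: borel_lebesgue_on\<close>)
    also have "\<dots> = (\<integral>x. v0 x * (b \<bullet> grad \<phi> x) \<partial>lborel)"
      by (subst integral_lebesgue_on_borel(1)) (auto simp: wgD(5)[OF W])
    finally have 1: "(\<integral>x. v x * frechet_derivative \<phi> (at x) b \<partial>lebesgue_on U)
      = (\<integral>x. (v0 x *\<^sub>R grad \<phi> x) \<bullet> b \<partial>lborel)" by (simp add: fr inner_commute)
    have 2: "(\<integral>x. (G0 x \<bullet> b) * \<phi> x \<partial>lebesgue_on U) = (\<integral>x. (\<phi> x *\<^sub>R G0 x) \<bullet> b \<partial>lborel)"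
      by (subst integral_lebesgue_on_borel(1)) (auto simp: wgD(6)[OF W] mult.commute)
    note i = wg_test_integrable[OF W C]
    have "(\<integral>x. (v0 x *\<^sub>R grad \<phi> x) \<bullet> b \<partial>lborel) + (\<integral>x. (\<phi> x *\<^sub>R G0 x) \<bullet> b \<partial>lborel)
        = (\<integral>x. v0 x *\<^sub>R grad \<phi> x + \<phi> x *\<^sub>R G0 x \<partial>lborel) \<bullet> b"
      unfolding integral_inner_left[of b lborel, OF i(1)] integral_inner_left[of b lborel, OF i(2)]
      using i by (simp add: inner_add_left)
    also have "\<dots> = 0" using wgD(8)[OF W C] by simp
    finally show "(\<integral>x. v x * frechet_derivative \<phi> (at x) b \<partial>lebesgue_on U) = - (\<integral>x. (G0 x \<bullet> b) * \<phi> x \<partial>lebesgue_on U)"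
      unfolding 1 2 by simp
  qed
qed

section \<open>Membership, energy, norm and trace in terms of representatives\<close>

lemma H1_wg:
  assumes "open U" "bounded U" "v \<in> H1 U"
  shows "\<exists>v0 G0. wg U v0 G0 \<and> (AE x in lborel. x \<in> U \<longrightarrow> v x = v0 x)"
proof -
  obtain G where "v \<in> L2 U" "G \<in> L2 U" "is_weak_gradient U v G" using assms(3) unfolding H1_def by blast
  from wg_of_weak_gradient[OF assms(1,2) this] show ?thesis
    by (elim exE conjE, intro exI conjI)
qed

lemma wg_H1:
  assumes "open U" "wg U v0 G0" "AE x in lborel. x \<in> U \<longrightarrow> v x = v0 x"
  shows "v \<in> H1 U"
  unfolding H1_def using weak_gradient_of_wg[OF assms]
  by (intro CollectI conjI bexI[of _ G0])

text \<open>\<open>weak_gradient\<close> picks an unspecified weak gradient, so uniqueness up to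
  null sets is what identifies its energy with that of \<open>G0\<close>.\<close>

lemma energy_wg:
  assumes U: "open U" "bounded U" and W: "wg U v0 G0" and vAE: "AE x in lborel. x \<in> U \<longrightarrow> v x = v0 x"
  shows "energy U v = (\<integral>x. (norm (G0 x))\<^sup>2 \<partial>lborel)"
proof -
  have Ub [measurable]: "U \<in> sets borel" using U by simp
  define G where "G = weak_gradient U v"
  have "G \<in> L2 U \<and> is_weak_gradient U v G"
    unfolding G_def weak_gradient_def
    by (rule someI[of _ G0]) (intro conjI weak_gradient_of_wg[OF U(1) W vAE])
  then have G: "G \<in> L2 U" "is_weak_gradient U v G" by simp_all
  obtain v1 where "\<exists>G1. wg U v1 G1 \<and> (AE x in lborel. x \<in> U \<longrightarrow> v x = v1 x) \<and> (AE x in lborel. x \<in> U \<longrightarrow> G x = G1 x)"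
    using wg_of_weak_gradient[OF U weak_gradient_of_wg(1)[OF U(1) W vAE] G] ..
  then obtain G1 where "wg U v1 G1 \<and> (AE x in lborel. x \<in> U \<longrightarrow> v x = v1 x) \<and> (AE x in lborel. x \<in> U \<longrightarrow> G x = G1 x)" ..
  then have W1: "wg U v1 G1" and AE1: "AE x in lborel. x \<in> U \<longrightarrow> v x = v1 x" "AE x in lborel. x \<in> U \<longrightarrow> G x = G1 x"
    by simp_all
  have "AE x in lborel. v1 x = v0 x"
    using vAE AE1(1) by eventually_elim (metis wgD(5)[OF W] wgD(5)[OF W1])
  from wg_unique[OF U(1) W1 W this] have GAE: "AE x in lborel. x \<in> U \<longrightarrow> G x = G0 x"
    using AE1(2) by eventually_elim auto
  note [measurable] = wgD(1,2)[OF W]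
  have [measurable]: "G \<in> borel_measurable (lebesgue_on U)" "G0 \<in> borel_measurable (lebesgue_on U)"
    using G(1) wgD(2)[OF W] by (auto simp: L2_def intro: borel_lebesgue_on)
  have "energy U v = (\<integral>x. (norm (G0 x))\<^sup>2 \<partial>lebesgue_on U)"
    unfolding energy_def G_def[symmetric]
    by (rule integral_cong_AE) (use GAE in \<open>auto simp: AE_lebesgue_on\<close>)
  also have "\<dots> = (\<integral>x. (norm (G0 x))\<^sup>2 \<partial>lborel)"
    by (subst integral_lebesgue_on_borel(1)) (auto simp: wgD(6)[OF W])
  finally show ?thesis .
qed

lemma H1_norm_wg:
  assumes U: "open U" "bounded U" and W: "wg U v0 G0" and vAE: "AE x in lborel. x \<in> U \<longrightarrow> v x = v0 x"
  shows "H1_norm U v = sqrt ((\<integral>x. (v0 x)\<^sup>2 \<partial>lborel) + (\<integral>x. (norm (G0 x))\<^sup>2 \<partial>lborel))"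
proof -
  have Ub [measurable]: "U \<in> sets borel" using U by simp
  note [measurable] = wgD(1,2)[OF W]
  have [measurable]: "v \<in> borel_measurable (lebesgue_on U)"
    by (rule measurable_of_AE_eq[OF wgD(1)[OF W] Ub vAE])
  have [measurable]: "v0 \<in> borel_measurable (lebesgue_on U)"
    by (rule measurable_restrict_space1) (simp add: measurable_completion)
  have "(\<integral>x. (v x)\<^sup>2 \<partial>lebesgue_on U) = (\<integral>x. (v0 x)\<^sup>2 \<partial>lebesgue_on U)"
    by (rule integral_cong_AE) (use vAE in \<open>auto simp: AE_lebesgue_on\<close>)
  also have "\<dots> = (\<integral>x. (v0 x)\<^sup>2 \<partial>lborel)"
    by (subst integral_lebesgue_on_borel(1)) (auto simp: wgD(5)[OF W])
  finally show ?thesis using energy_wg[OF U W vAE] by (simp add: H1_norm_def)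
qed

text \<open>The witnesses of \<open>has_trace\<close>, with convergence in $H^1$ split into
  functions and gradients. The weak gradients \<open>H k\<close> are named because later
  constructions build new approximants from old ones together with their gradients.\<close>

definition trace_approx ::
    "'a::euclidean_space set \<Rightarrow> ('a \<Rightarrow> real) \<Rightarrow> ('a \<Rightarrow> 'a) \<Rightarrow> ('a \<Rightarrow> real) \<Rightarrow> (nat \<Rightarrow> 'a \<Rightarrow> real) \<Rightarrow> (nat \<Rightarrow> 'a \<Rightarrow> 'a) \<Rightarrow> bool" where
  "trace_approx U v0 G0 h w H \<longleftrightarrow>
     (\<forall>k. continuous_on (closure U) (w k) \<and> wg U (\<lambda>x. indicator U x * w k x) (H k)) \<and>
     (\<lambda>k. \<integral>x. (indicator U x * w k x - v0 x)\<^sup>2 \<partial>lborel) \<longlonglongrightarrow> 0 \<and>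
     (\<lambda>k. \<integral>x. (norm (H k x - G0 x))\<^sup>2 \<partial>lborel) \<longlonglongrightarrow> 0 \<and>
     (\<lambda>k. \<integral>\<^sup>+x\<in>frontier U. ennreal ((w k x - h x)\<^sup>2) \<partial>surface_measure) \<longlonglongrightarrow> 0"

lemma has_trace_wg:
  assumes U: "open U" "bounded U" and W: "wg U v0 G0" and vAE: "AE x in lborel. x \<in> U \<longrightarrow> v x = v0 x"
  shows "has_trace U v h \<longleftrightarrow>
    set_borel_measurable surface_measure (frontier U) h \<and> (\<exists>w H. trace_approx U v0 G0 h w H)"
proof -
  have Ub [measurable]: "U \<in> sets borel" using U by simp
  have norm: "H1_norm U (\<lambda>x. w x - v x)
     = sqrt ((\<integral>x. (indicator U x * w x - v0 x)\<^sup>2 \<partial>lborel) + (\<integral>x. (norm (H x - G0 x))\<^sup>2 \<partial>lborel))"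
    if "wg U (\<lambda>x. indicator U x * w x) H" for w H
    by (rule H1_norm_wg[OF U wg_diff[OF that W]]) (use vAE in \<open>auto elim: eventually_mono\<close>)
  show ?thesis
  proof
    assume tr: "has_trace U v h"
    then obtain w where w: "\<And>k. w k \<in> H1 U" "\<And>k. continuous_on (closure U) (w k)"
      "(\<lambda>k. H1_norm U (\<lambda>x. w k x - v x)) \<longlonglongrightarrow> 0"
      "(\<lambda>k. \<integral>\<^sup>+x\<in>frontier U. ennreal ((w k x - h x)\<^sup>2) \<partial>surface_measure) \<longlonglongrightarrow> 0"
      unfolding has_trace_def by blast
    have "\<exists>H. wg U (\<lambda>x. indicator U x * w k x) H" for k
    proof -
      obtain w0 H where wH: "wg U w0 H" "AE x in lborel. x \<in> U \<longrightarrow> w k x = w0 x" using H1_wg[OF U w(1)[of k]] by blast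
      obtain R where R: "U \<subseteq> cball 0 R" using U(2) by (auto simp: bounded_iff subset_iff)
      have "wg U (\<lambda>x. indicator U x * w k x) H"
      proof (rule wg_AE_cong[OF wH(1)])
        \<comment> \<open>Being continuous, \<open>w k\<close> is its own Borel representative after
          cutting off at \<open>U\<close>. The function must not be exchanged for another one, since
          its boundary values enter the trace.\<close>
        have "continuous_on U (w k)" by (rule continuous_on_subset[OF w(2) closure_subset])
        from borel_measurable_continuous_on_indicator[OF Ub this]
        show "(\<lambda>x. indicator U x * w k x) \<in> borel_measurable borel" by simp
        show "AE x in lborel. w0 x = indicator U x * w k x"
          using wH(2) by eventually_elim (use wgD(5)[OF wH(1)] in \<open>auto simp: indicator_def\<close>)
        show "indicator U x * w k x = 0 \<and> H x = 0" if "x \<notin> cball 0 R" for x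
          using that R wgD(6)[OF wH(1)] by (auto simp: indicator_def subset_iff)
      qed (use wgD(2,6)[OF wH(1)] in auto)
      then show ?thesis by blast
    qed
    then obtain H where H: "\<And>k. wg U (\<lambda>x. indicator U x * w k x) (H k)" by metis
    have L: "(\<lambda>k. (\<integral>x. (indicator U x * w k x - v0 x)\<^sup>2 \<partial>lborel) + (\<integral>x. (norm (H k x - G0 x))\<^sup>2 \<partial>lborel)) \<longlonglongrightarrow> 0"
      using tendsto_power[OF w(3)[unfolded norm[OF H]], of 2] by simp
    have "(\<lambda>k. \<integral>x. (indicator U x * w k x - v0 x)\<^sup>2 \<partial>lborel) \<longlonglongrightarrow> 0"
      by (rule tendsto_sandwich[OF _ _ tendsto_const L]) simp_all
    moreover have "(\<lambda>k. \<integral>x. (norm (H k x - G0 x))\<^sup>2 \<partial>lborel) \<longlonglongrightarrow> 0"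
      by (rule tendsto_sandwich[OF _ _ tendsto_const L]) simp_all
    ultimately show "set_borel_measurable surface_measure (frontier U) h \<and> (\<exists>w H. trace_approx U v0 G0 h w H)"
      using tr w H unfolding has_trace_def trace_approx_def by blast
  next
    assume "set_borel_measurable surface_measure (frontier U) h \<and> (\<exists>w H. trace_approx U v0 G0 h w H)"
    then obtain w H where m: "set_borel_measurable surface_measure (frontier U) h"
      and w: "\<And>k. continuous_on (closure U) (w k)" "\<And>k. wg U (\<lambda>x. indicator U x * w k x) (H k)"
        "(\<lambda>k. \<integral>x. (indicator U x * w k x - v0 x)\<^sup>2 \<partial>lborel) \<longlonglongrightarrow> 0"
        "(\<lambda>k. \<integral>x. (norm (H k x - G0 x))\<^sup>2 \<partial>lborel) \<longlonglongrightarrow> 0"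
        "(\<lambda>k. \<integral>\<^sup>+x\<in>frontier U. ennreal ((w k x - h x)\<^sup>2) \<partial>surface_measure) \<longlonglongrightarrow> 0"
      unfolding trace_approx_def by blast
    have "(\<lambda>k. H1_norm U (\<lambda>x. w k x - v x)) \<longlonglongrightarrow> sqrt (0 + 0)"
      unfolding norm[OF w(2)] by (intro tendsto_intros w(3,4))
    moreover have "w k \<in> H1 U" for k
      by (rule wg_H1[OF U(1) w(2)[of k]]) simp
    ultimately show "has_trace U v h"
      using m w(1,5) wg_H1[OF U(1) W vAE] unfolding has_trace_def by auto
  qed
qed

subsection \<open>Volume of thin strips and Hausdorff measure\<close>

definition proj_perp :: "'a::euclidean_space \<Rightarrow> 'a \<Rightarrow> 'a" where
  "proj_perp e x = x - (x \<bullet> e) *\<^sub>R e"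

lemma proj_perp_diff: "proj_perp e (x - y) = proj_perp e x - proj_perp e y"
  by (simp add: proj_perp_def algebra_simps)

lemma proj_perp_add_axis: "norm e = 1 \<Longrightarrow> proj_perp e (x + s *\<^sub>R e) = proj_perp e x"
  by (simp add: proj_perp_def algebra_simps dot_square_norm)

lemma norm_proj_perp_le: "norm e = 1 \<Longrightarrow> norm (proj_perp e x) \<le> norm x"
proof -
  assume e: "norm e = 1"
  have ee: "e \<bullet> e = 1" using e by (simp add: dot_square_norm)
  have "(norm (proj_perp e x))\<^sup>2 = (norm x)\<^sup>2 - (x \<bullet> e)\<^sup>2"
    unfolding proj_perp_def power2_norm_eq_inner
    by (simp add: inner_diff_left inner_diff_right inner_commute ee power2_eq_square del: norm_eq_1)
  then have "(norm (proj_perp e x))\<^sup>2 \<le> (norm x)\<^sup>2" by simp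
  then show ?thesis by (rule power2_le_imp_le) simp
qed

lemma proj_perp_adjoint: "proj_perp e x \<bullet> y = x \<bullet> proj_perp e y"
  by (simp add: proj_perp_def algebra_simps inner_commute)

lemma continuous_on_proj_perp [continuous_intros]:
  "continuous_on S f \<Longrightarrow> continuous_on S (\<lambda>x. proj_perp e (f x))"
  unfolding proj_perp_def by (intro continuous_intros)

definition cylinder :: "'a::euclidean_space \<Rightarrow> 'a \<Rightarrow> real \<Rightarrow> real \<Rightarrow> real \<Rightarrow> 'a set" where
  "cylinder e p c d s = {x. norm (proj_perp e (x - p)) \<le> d \<and> \<bar>(x - p) \<bullet> e - c\<bar> \<le> s}"

lemma closed_cylinder: "closed (cylinder e p c d s)"
  unfolding cylinder_def by (intro closed_Collect_conj closed_Collect_le continuous_intros)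

text \<open>Balls of radius \<open>2 * d\<close> centred on the axis at spacing \<open>d\<close>
  cover the cylinder; about \<open>2 * s / d\<close> of them suffice, and \<open>d \<le> s\<close>
  bounds \<open>N + 1\<close> by \<open>3 * s / d\<close>. Covering avoids a change to coordinates
  adapted to \<open>e\<close>.\<close>

lemma emeasure_cylinder_le:
  fixes e p :: "'a::euclidean_space"
  assumes e: "norm e = 1" and d: "0 < d" "d \<le> s"
  shows "emeasure lborel (cylinder e p c d s)
    \<le> ennreal (3 * 2 ^ DIM('a) * unit_ball_vol (DIM('a)) * d ^ (DIM('a) - 1) * s)"
proof -
  define N where "N = nat \<lfloor>2 * s / d\<rfloor>"
  define z where "z = (\<lambda>j::nat. p + (c - s + real j * d) *\<^sub>R e)"
  have sub: "cylinder e p c d s \<subseteq> (\<Union>j\<in>{..N}. cball (z j) (2 * d))"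
  proof
    fix x assume x: "x \<in> cylinder e p c d s"
    define a where "a = (x - p) \<bullet> e - (c - s)"
    have a: "0 \<le> a" "a \<le> 2 * s" using x by (auto simp: cylinder_def a_def abs_le_iff)
    define j where "j = nat \<lfloor>a / d\<rfloor>"
    have fl: "real j \<le> a / d" "a / d < real j + 1"
      using a d by (auto simp: j_def)
    have j: "j \<le> N" unfolding j_def N_def using a d by (intro nat_mono floor_mono divide_right_mono) auto
    have jd: "real j * d \<le> a" "a < (real j + 1) * d" using fl d by (auto simp: field_simps)
    have "x - z j = proj_perp e (x - p) + (a - real j * d) *\<^sub>R e"
      unfolding z_def a_def proj_perp_def by (simp add: algebra_simps)
    then have "norm (x - z j) \<le> norm (proj_perp e (x - p)) + \<bar>a - real j * d\<bar>"
      using norm_triangle_ineq[of "proj_perp e (x - p)" "(a - real j * d) *\<^sub>R e"] e by simp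
    also have "\<dots> \<le> d + d" using x jd by (intro add_mono) (auto simp: cylinder_def algebra_simps)
    finally have "x \<in> cball (z j) (2 * d)" by (simp add: dist_norm norm_minus_commute)
    then show "x \<in> (\<Union>j\<in>{..N}. cball (z j) (2 * d))" using j by blast
  qed
  have "emeasure lborel (cylinder e p c d s) \<le> emeasure lborel (\<Union>j\<in>{..N}. cball (z j) (2 * d))"
    using sub by (intro emeasure_mono) auto
  also have "\<dots> \<le> (\<Sum>j\<in>{..N}. emeasure lborel (cball (z j) (2 * d)))"
    by (intro emeasure_subadditive_finite) auto
  also have "\<dots> = (\<Sum>j\<in>{..N}. ennreal (unit_ball_vol (DIM('a)) * (2 * d) ^ DIM('a)))"
    using d by (intro sum.cong) (auto simp: emeasure_cball)
  also have "\<dots> = ennreal ((real N + 1) * (unit_ball_vol (DIM('a)) * (2 * d) ^ DIM('a)))"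
    using d by (simp add: ennreal_of_nat_eq_real_of_nat ennreal_mult'[symmetric] algebra_simps flip: ennreal_plus)
  also have "\<dots> \<le> ennreal (3 * s / d * (unit_ball_vol (DIM('a)) * (2 * d) ^ DIM('a)))"
  proof (intro ennreal_leI mult_right_mono)
    have "real N \<le> 2 * s / d" using d by (simp add: N_def)
    then have "real N \<le> 2 * (s / d)" by simp
    moreover have "1 \<le> s / d" using d by simp
    ultimately have "real N + 1 \<le> 3 * (s / d)" by linarith
    then show "real N + 1 \<le> 3 * s / d" by simp
  qed (use d in auto)
  also have "3 * s / d * (unit_ball_vol (DIM('a)) * (2 * d) ^ DIM('a))
    = 3 * 2 ^ DIM('a) * unit_ball_vol (DIM('a)) * d ^ (DIM('a) - 1) * s"
  proof -
    have "d ^ DIM('a) = d * d ^ (DIM('a) - 1)" using DIM_positive[where 'a = 'a]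
      by (metis Suc_diff_1 power_Suc)
    then show ?thesis using d by (simp add: power_mult_distrib)
  qed
  finally show ?thesis .
qed

text \<open>The bound of \<open>emeasure_cylinder_le\<close> for half height
  \<open>2 * \<delta>\<close>, divided by \<delta> and by the weight of a covering set in
  \<open>hausdorff_pre\<close>: 6 is 3 times 2, and the second power of 2 undoes the halving of the
  diameter.\<close>

definition strip_const :: "'a::euclidean_space itself \<Rightarrow> real" where
  "strip_const _ = 6 * 2 ^ DIM('a) * unit_ball_vol (DIM('a)) * 2 ^ (DIM('a) - 1) / unit_ball_vol (real (DIM('a) - 1))"

lemma strip_const_pos: "0 < strip_const TYPE('a::euclidean_space)"
  unfolding strip_const_def by simp

text \<open>The part of the strip \<open>{\<delta> < t < 2\<delta>}\<close> above a piece of the graph of diameter at most \<open>\<delta>\<close>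
  lies in a cylinder of comparable height.\<close>
lemma strip_piece:
  fixes e :: "'a::euclidean_space"
  assumes e: "norm e = 1" and dim: "2 \<le> DIM('a)" and \<delta>: "0 < \<delta>"
    and C: "bounded C" "diameter C \<le> \<delta>"
  shows "\<exists>B\<in>sets borel. {x. \<delta> < t x \<and> t x < 2 * \<delta> \<and> x - t x *\<^sub>R e \<in> C} \<subseteq> B \<and>
    emeasure lborel B \<le> ennreal (strip_const TYPE('a) * \<delta>)
      * ennreal (unit_ball_vol (real (DIM('a) - 1)) * (diameter C / 2) ^ (DIM('a) - 1))"
proof (cases "C = {}")
  case True
  then show ?thesis by (intro bexI[of _ "{}"]) auto
next
  case False
  then obtain p where p: "p \<in> C" by blast
  \<comment> \<open>Heights over \<open>p\<close> range between 0 and 3\<delta>: the strip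
    contributes \<delta> to 2\<delta>, and the piece \<open>C\<close> at most \<delta> in either
    direction. Half height \<open>2 * \<delta>\<close> leaves room.\<close>
  define B where "B = cylinder e p (3 * \<delta> / 2) (diameter C) (2 * \<delta>)"
  have d0: "0 \<le> diameter C" using C(1) by (rule diameter_ge_0)
  have sub: "{x. \<delta> < t x \<and> t x < 2 * \<delta> \<and> x - t x *\<^sub>R e \<in> C} \<subseteq> B"
  proof
    fix x assume x: "x \<in> {x. \<delta> < t x \<and> t x < 2 * \<delta> \<and> x - t x *\<^sub>R e \<in> C}"
    define y where "y = x - t x *\<^sub>R e - p"
    have y: "norm y \<le> diameter C"
      using diameter_bounded_bound[OF C(1), of "x - t x *\<^sub>R e" p] x p by (simp add: y_def dist_norm)
    have xp: "x - p = y + t x *\<^sub>R e" by (simp add: y_def)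
    have "norm (proj_perp e (x - p)) \<le> diameter C"
      unfolding xp proj_perp_add_axis[OF e] using norm_proj_perp_le[OF e, of y] y by linarith
    moreover have "(x - p) \<bullet> e = y \<bullet> e + t x" unfolding xp using e by (simp add: algebra_simps dot_square_norm)
    moreover have "\<bar>y \<bullet> e\<bar> \<le> \<delta>" using Cauchy_Schwarz_ineq2[of y e] e y C(2) by simp
    ultimately show "x \<in> B" using x by (auto simp: B_def cylinder_def abs_le_iff)
  qed
  have le: "emeasure lborel B \<le> ennreal (3 * 2 ^ DIM('a) * unit_ball_vol (DIM('a)) * d ^ (DIM('a) - 1) * (2 * \<delta>))"
    if "diameter C \<le> d" "0 < d" "d \<le> \<delta>" for d
  proof -
    have "B \<subseteq> cylinder e p (3 * \<delta> / 2) d (2 * \<delta>)" using that by (auto simp: B_def cylinder_def)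
    then have "emeasure lborel B \<le> emeasure lborel (cylinder e p (3 * \<delta> / 2) d (2 * \<delta>))"
      by (intro emeasure_mono) (auto simp: closed_cylinder borel_closed)
    also have "\<dots> \<le> ennreal (3 * 2 ^ DIM('a) * unit_ball_vol (DIM('a)) * d ^ (DIM('a) - 1) * (2 * \<delta>))"
      using that \<delta> by (intro emeasure_cylinder_le[OF e]) auto
    finally show ?thesis .
  qed
  let ?c = "3 * 2 ^ DIM('a) * unit_ball_vol (DIM('a)) * (2 * \<delta>)"
  have c: "0 < ?c" using \<delta> by simp
  have "emeasure lborel B \<le> ennreal (?c * diameter C ^ (DIM('a) - 1))"
  proof (cases "diameter C = 0")
    case False
    then show ?thesis using le[of "diameter C"] C(2) d0 by (simp add: mult_ac)
  next
    case True
    \<comment> \<open>A piece of diameter 0 has weight 0, so its cylinder must be null: it lies in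
      cylinders of small positive radius \<open>d\<close>, where
      \<open>d ^ (DIM('a) - 1) \<le> d\<close> by \<open>dim\<close>.\<close>
    have "emeasure lborel B \<le> 0 + ennreal \<epsilon>" if \<epsilon>: "0 < \<epsilon>" for \<epsilon>
    proof -
      define d where "d = min (min 1 \<delta>) (\<epsilon> / ?c)"
      have d: "0 < d" "d \<le> \<delta>" "d \<le> 1" "d \<le> \<epsilon> / ?c" using \<delta> \<epsilon> c by (auto simp: d_def)
      have "d ^ (DIM('a) - 1) \<le> d ^ 1" using d dim by (intro power_decreasing) auto
      then have "?c * d ^ (DIM('a) - 1) \<le> ?c * (\<epsilon> / ?c)" using c d by (intro mult_left_mono) auto
      also have "\<dots> = \<epsilon>" using c by (metis less_irrefl nonzero_mult_div_cancel_left times_divide_eq_right)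
      finally show ?thesis using le[of d] True d by (auto simp: mult_ac intro: order_trans ennreal_leI)
    qed
    then have "emeasure lborel B \<le> 0" using ennreal_le_epsilon[of 0 "emeasure lborel B"] by simp
    then show ?thesis by simp
  qed
  also have "?c * diameter C ^ (DIM('a) - 1)
    = strip_const TYPE('a) * \<delta> * (unit_ball_vol (real (DIM('a) - 1)) * (diameter C / 2) ^ (DIM('a) - 1))"
  proof -
    have "unit_ball_vol (real (DIM('a) - 1)) \<noteq> 0"
      by (metis of_nat_0_le_iff less_irrefl unit_ball_vol_pos)
    then show ?thesis by (simp add: strip_const_def power_divide del: of_nat_diff)
  qed
  also have "ennreal \<dots> = ennreal (strip_const TYPE('a) * \<delta>)
      * ennreal (unit_ball_vol (real (DIM('a) - 1)) * (diameter C / 2) ^ (DIM('a) - 1))"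
    using strip_const_pos[where 'a = 'a] \<delta> d0 by (intro ennreal_mult) auto
  finally show ?thesis using sub by (intro bexI[of _ B]) (auto simp: B_def closed_cylinder borel_closed)
qed

text \<open>A cover of \<open>A\<close> by sets of diameter at most \<open>\<delta>\<close> lifts to
  a cover of the strip over \<open>A\<close> by cylinders. The single scale \<open>\<delta>\<close>
  is enough, because \<open>hausdorff_pre\<close> at any scale is below
  \<open>hausdorff_outer\<close>.\<close>

lemma strip_hausdorff:
  fixes e :: "'a::euclidean_space"
  assumes e: "norm e = 1" and dim: "2 \<le> DIM('a)" and \<delta>: "0 < \<delta>"
    and S: "S \<subseteq> {x. \<delta> < t x \<and> t x < 2 * \<delta> \<and> x - t x *\<^sub>R e \<in> A}"
  shows "emeasure lborel S \<le> ennreal (strip_const TYPE('a) * \<delta>) * hausdorff_outer (DIM('a) - 1) A"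
proof -
  define K where "K = strip_const TYPE('a) * \<delta>"
  have K: "0 < K" using strip_const_pos[where 'a = 'a] \<delta> by (simp add: K_def)
  have K1: "ennreal (1 / K) * ennreal K = 1" using K by (subst ennreal_mult[symmetric]) auto
  let ?w = "\<lambda>C :: 'a set. ennreal (unit_ball_vol (real (DIM('a) - 1)) * (diameter C / 2) ^ (DIM('a) - 1))"
  have "ennreal (1 / K) * emeasure lborel S \<le> hausdorff_pre (DIM('a) - 1) \<delta> A"
    unfolding hausdorff_pre_def
  proof (rule INF_greatest)
    fix C :: "nat \<Rightarrow> 'a set"
    assume "C \<in> {C. A \<subseteq> (\<Union>j. C j) \<and> (\<forall>j. bounded (C j) \<and> diameter (C j) \<le> \<delta>)}"
    then have C: "A \<subseteq> (\<Union>j. C j)" "\<And>j. bounded (C j)" "\<And>j. diameter (C j) \<le> \<delta>" by auto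
    have ex: "\<forall>j. \<exists>B. B \<in> sets borel \<and> {x. \<delta> < t x \<and> t x < 2 * \<delta> \<and> x - t x *\<^sub>R e \<in> C j} \<subseteq> B \<and>
      emeasure lborel B \<le> ennreal K * ?w (C j)"
    proof
      fix j
      show "\<exists>B. B \<in> sets borel \<and> {x. \<delta> < t x \<and> t x < 2 * \<delta> \<and> x - t x *\<^sub>R e \<in> C j} \<subseteq> B \<and>
        emeasure lborel B \<le> ennreal K * ?w (C j)"
        using strip_piece[OF e dim \<delta> C(2)[of j] C(3)[of j], of t] unfolding K_def Bex_def .
    qed
    from choice[OF ex] obtain B where BB: "\<forall>j. B j \<in> sets borel \<and>
      {x. \<delta> < t x \<and> t x < 2 * \<delta> \<and> x - t x *\<^sub>R e \<in> C j} \<subseteq> B j \<and>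
      emeasure lborel (B j) \<le> ennreal K * ?w (C j)" ..
    then have B: "B j \<in> sets borel"
      "{x. \<delta> < t x \<and> t x < 2 * \<delta> \<and> x - t x *\<^sub>R e \<in> C j} \<subseteq> B j"
      "emeasure lborel (B j) \<le> ennreal K * ?w (C j)" for j by simp_all
    have "S \<subseteq> (\<Union>j. B j)" using S C(1) B(2) by blast
    then have "emeasure lborel S \<le> emeasure lborel (\<Union>j. B j)" using B(1) by (intro emeasure_mono) auto
    also have "\<dots> \<le> (\<Sum>j. emeasure lborel (B j))" using B(1) by (intro emeasure_subadditive_countably) auto
    also have "\<dots> \<le> (\<Sum>j. ennreal K * ?w (C j))" by (intro suminf_le B(3)) auto
    also have "\<dots> = ennreal K * (\<Sum>j. ?w (C j))" by (rule ennreal_suminf_cmult)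
    finally have "ennreal (1 / K) * emeasure lborel S \<le> ennreal (1 / K) * (ennreal K * (\<Sum>j. ?w (C j)))"
      by (rule mult_left_mono) simp
    also have "\<dots> = (\<Sum>j. ?w (C j))" by (simp add: mult.assoc[symmetric] K1)
    finally show "ennreal (1 / K) * emeasure lborel S \<le> (\<Sum>j. ?w (C j))" .
  qed
  also have "\<dots> \<le> hausdorff_outer (DIM('a) - 1) A"
    unfolding hausdorff_outer_def using \<delta> by (intro SUP_upper) auto
  finally have "ennreal K * (ennreal (1 / K) * emeasure lborel S) \<le> ennreal K * hausdorff_outer (DIM('a) - 1) A"
    by (rule mult_left_mono) simp
  moreover have "ennreal K * ennreal (1 / K) = 1" using K1 by (simp only: mult.commute)
  ultimately have "emeasure lborel S \<le> ennreal K * hausdorff_outer (DIM('a) - 1) A"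
    by (simp only: mult.assoc[symmetric] mult_1_left)
  then show ?thesis by (simp only: K_def)
qed

text \<open>By the set estimate, the image of Lebesgue measure on the strip under vertical
  projection to the graph is at most a constant times \<delta> times surface measure; integrals are
  compared by monotonicity in the measure.\<close>

lemma strip_nn_integral:
  fixes e :: "'a::euclidean_space"
  assumes e: "norm e = 1" and dim: "2 \<le> DIM('a)" and \<delta>: "0 < \<delta>"
    and t [measurable]: "t \<in> borel_measurable borel" and Sm [measurable]: "S \<in> sets borel"
    and S: "\<And>x. x \<in> S \<Longrightarrow> \<delta> < t x \<and> t x < 2 * \<delta>" and g [measurable]: "g \<in> borel_measurable borel"
  shows "(\<integral>\<^sup>+x\<in>S. g (x - t x *\<^sub>R e) \<partial>lborel)
    \<le> ennreal (strip_const TYPE('a) * \<delta>) * integral\<^sup>N surface_measure g"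
proof -
  let ?P = "\<lambda>x. x - t x *\<^sub>R e"
  let ?N = "distr (restrict_space lborel S) borel ?P"
  let ?M = "scale_measure (ennreal (strip_const TYPE('a) * \<delta>)) (surface_measure :: 'a measure)"
  have Pm [measurable]: "?P \<in> borel_measurable (restrict_space lborel S)"
    by (rule measurable_restrict_space1) measurable
  have sets: "sets (surface_measure :: 'a measure) = sets borel" by (simp add: surface_measure_def)
  have "emeasure ?N A \<le> emeasure ?M A" for A
  proof (cases "A \<in> sets borel")
    case A [measurable]: True
    have "emeasure ?N A = emeasure lborel (?P -` A \<inter> S)"
      by (simp add: emeasure_distr emeasure_restrict_space space_restrict_space)
    also have "\<dots> \<le> ennreal (strip_const TYPE('a) * \<delta>) * hausdorff_outer (DIM('a) - 1) A"
      by (rule strip_hausdorff[OF e dim \<delta>, of _ t]) (use S in auto)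
    also have "\<dots> = emeasure ?M A"
      using dim A by (simp add: surface_measure_def emeasure_hausdorff_measure)
    finally show ?thesis .
  qed (simp add: emeasure_notin_sets)
  then have "?N \<le> ?M" using sets by (subst le_measure_iff) (auto simp: le_fun_def space_scale_measure sets_eq_imp_space_eq[OF sets])
  then have "integral\<^sup>N ?N g \<le> integral\<^sup>N ?M g"
    by (intro nn_integral_mono_measure) (auto simp: sets)
  also have "\<dots> = ennreal (strip_const TYPE('a) * \<delta>) * integral\<^sup>N surface_measure g"
  proof (rule nn_integral_scale_measure)
    show "g \<in> borel_measurable surface_measure" using g by (simp cong: measurable_cong_sets add: measurable_cong_sets[OF sets refl])
  qed
  also have "integral\<^sup>N ?N g = (\<integral>\<^sup>+x\<in>S. g (?P x) \<partial>lborel)"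
    by (subst nn_integral_distr) (auto simp: nn_integral_restrict_space)
  finally show ?thesis .
qed

text \<open>Translates of \<open>S\<close> by multiples of \<open>\<delta>\<close> along the axis
  are disjoint, since \<open>t\<close> is shifted by the same amount and lies strictly between
  \<delta> and 2\<delta> on \<open>S\<close>. About 1/\<delta> of them fit into a ball of radius
  \<open>R + 1\<close>.\<close>

lemma strip_volume:
  fixes e :: "'a::euclidean_space"
  assumes e: "norm e = 1" and t: "\<And>x s. t (x + s *\<^sub>R e) = t x + s" and \<delta>: "0 < \<delta>" "\<delta> \<le> 1 / 2"
    and Sm: "S \<in> sets borel" and S: "\<And>x. x \<in> S \<Longrightarrow> \<delta> < t x \<and> t x < 2 * \<delta>" "S \<subseteq> cball 0 R"
  shows "measure lborel S \<le> 2 * measure lborel (cball (0::'a) (R + 1)) * \<delta>"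
proof -
  define N where "N = nat \<lfloor>1 / \<delta>\<rfloor>"
  have N: "real N * \<delta> \<le> 1" "1 / (2 * \<delta>) \<le> real N"
  proof -
    have "real N \<le> 1 / \<delta>" using \<delta> by (simp add: N_def)
    then show "real N * \<delta> \<le> 1" using \<delta> by (simp add: field_simps)
    have "1 / \<delta> - 1 \<le> real N" unfolding N_def by linarith
    moreover have "1 / (2 * \<delta>) \<le> 1 / \<delta> - 1" using \<delta> by (simp add: field_simps)
    ultimately show "1 / (2 * \<delta>) \<le> real N" by linarith
  qed
  define T where "T = (\<lambda>j::nat. (+) ((real j * \<delta>) *\<^sub>R e) ` S)"
  have T: "T j \<in> sets borel" for j
  proof -
    have eq: "T j = (\<lambda>x. x - (real j * \<delta>) *\<^sub>R e) -` S \<inter> space borel"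
      by (force simp: T_def image_iff algebra_simps)
    show ?thesis unfolding eq by (rule measurable_sets[OF _ Sm]) simp
  qed
  have Tt: "(real j + 1) * \<delta> < t x \<and> t x < (real j + 2) * \<delta>" if "x \<in> T j" for x j
  proof -
    obtain y where y: "y \<in> S" "x = y + (real j * \<delta>) *\<^sub>R e" using \<open>x \<in> T j\<close> by (auto simp: T_def add.commute)
    then show ?thesis using t[of y "real j * \<delta>"] S(1)[OF y(1)] by (simp add: algebra_simps)
  qed
  have disj: "disjoint_family_on T {..<N}"
  proof (unfold disjoint_family_on_def, intro ballI impI)
    fix i j :: nat assume "i \<noteq> j"
    then have *: "real i + 1 \<le> real j \<or> real j + 1 \<le> real i" by linarith
    have False if "x \<in> T i" "x \<in> T j" for x
    proof -
      have "(real i + 1) * \<delta> < (real j + 2) * \<delta>" "(real j + 1) * \<delta> < (real i + 2) * \<delta>"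
        using Tt[OF that(1)] Tt[OF that(2)] by linarith+
      then have "real i < real j + 1" "real j < real i + 1" using \<delta> by (auto simp: mult_less_cancel_right_pos)
      with * show False by linarith
    qed
    then show "T i \<inter> T j = {}" by blast
  qed
  have sub: "(\<Union>j<N. T j) \<subseteq> cball 0 (R + 1)"
  proof
    fix x assume "x \<in> (\<Union>j<N. T j)"
    then obtain j y where j: "j < N" and y: "y \<in> S" "x = (real j * \<delta>) *\<^sub>R e + y" by (auto simp: T_def)
    have "real j * \<delta> \<le> real N * \<delta>" using j \<delta> by (intro mult_right_mono) auto
    then have "\<bar>real j * \<delta>\<bar> \<le> 1" using N(1) \<delta> by (simp only: abs_le_iff) (smt (verit) mult_nonneg_nonneg of_nat_0_le_iff)
    then have "norm ((real j * \<delta>) *\<^sub>R e) \<le> 1" unfolding norm_scaleR e by simp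
    moreover have "norm y \<le> R" using S(2) y(1) by auto
    ultimately show "x \<in> cball 0 (R + 1)" using norm_triangle_ineq[of "(real j * \<delta>) *\<^sub>R e" y] y(2) by simp
  qed
  have meas: "measure lborel (T j) = measure lborel S" for j
  proof -
    have "emeasure lborel (T j) = emeasure (distr lborel borel ((+) ((real j * \<delta>) *\<^sub>R e))) (T j)"
      by (simp add: lborel_distr_plus)
    also have "\<dots> = emeasure lborel S"
      using T by (subst emeasure_distr) (auto simp: T_def inj_vimage_image_eq)
    finally show ?thesis by (simp add: measure_def)
  qed
  have fin: "emeasure lborel (T j) \<noteq> \<infinity>" if "j < N" for j
  proof -
    have "emeasure lborel (T j) \<le> emeasure lborel (cball (0::'a) (R + 1))"
      using sub that by (intro emeasure_mono) auto
    then show ?thesis using emeasure_lborel_cball_finite[of "0::'a" "R + 1"] by (auto simp: top_unique)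
  qed
  have "real N * measure lborel S = (\<Sum>j<N. measure lborel (T j))" by (simp add: meas)
  also have "\<dots> = measure lborel (\<Union>j<N. T j)"
    by (rule measure_finite_Union[symmetric]) (use T disj fin in auto)
  also have "\<dots> \<le> measure lborel (cball (0::'a) (R + 1))"
    using sub T emeasure_lborel_cball_finite[of "0::'a" "R + 1"]
    by (intro measure_mono_fmeasurable) (auto simp: fmeasurable_def)
  finally have "real N * measure lborel S \<le> measure lborel (cball (0::'a) (R + 1))" .
  moreover have "1 / (2 * \<delta>) * measure lborel S \<le> real N * measure lborel S"
    by (intro mult_right_mono N) simp
  ultimately have "1 / (2 * \<delta>) * measure lborel S \<le> measure lborel (cball (0::'a) (R + 1))" by linarith
  then show ?thesis using \<delta> by (simp add: field_simps)
qed

subsection \<open>The height function of a boundary chart\<close>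

text \<open>Height above the graph along the axis: in a chart, \<open>U\<close> is where it is
  positive. For a unit vector \<open>e\<close> its gradient has component 1 along \<open>e\<close>,
  so it is a nondegenerate defining function of the boundary.\<close>

definition height :: "('a::euclidean_space \<Rightarrow> real) \<Rightarrow> 'a \<Rightarrow> 'a \<Rightarrow> real" where
  "height \<gamma> e x = x \<bullet> e - \<gamma> (proj_perp e x)"

definition height_grad :: "('a::euclidean_space \<Rightarrow> real) \<Rightarrow> 'a \<Rightarrow> 'a \<Rightarrow> 'a" where
  "height_grad \<gamma> e x = e - proj_perp e (grad \<gamma> (proj_perp e x))"

lemma GDERIV_height:
  assumes "smooth \<gamma>"
  shows "GDERIV (height \<gamma> e) x :> height_grad \<gamma> e x"
proof -
  have "(\<gamma> has_derivative (\<lambda>h. h \<bullet> grad \<gamma> (proj_perp e x))) (at (proj_perp e x))"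
    using smooth_GDERIV[OF assms] by (simp add: gderiv_def)
  moreover have "(proj_perp e has_derivative proj_perp e) (at x)"
    unfolding proj_perp_def[abs_def] by (auto intro!: derivative_eq_intros)
  ultimately have "((\<lambda>x. \<gamma> (proj_perp e x)) has_derivative (\<lambda>h. proj_perp e h \<bullet> grad \<gamma> (proj_perp e x))) (at x)"
    using has_derivative_compose by fastforce
  then show ?thesis unfolding gderiv_def height_def[abs_def] height_grad_def
    by (auto intro!: derivative_eq_intros simp: proj_perp_adjoint inner_diff_right)
qed

lemma continuous_height_grad: "smooth \<gamma> \<Longrightarrow> continuous_on UNIV (height_grad \<gamma> e)"
  unfolding height_grad_def[abs_def]
  by (intro continuous_intros continuous_on_compose2[OF smooth_continuous_grad]) auto

lemma continuous_height: "smooth \<gamma> \<Longrightarrow> continuous_on UNIV (height \<gamma> e)"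
  using GDERIV_continuous[OF GDERIV_height] by (auto simp: continuous_on_eq_continuous_at)

lemma height_add_axis: "norm e = 1 \<Longrightarrow> height \<gamma> e (x + s *\<^sub>R e) = height \<gamma> e x + s"
  by (simp add: height_def proj_perp_add_axis inner_add_left dot_square_norm)

lemma chart_height:
  assumes "U \<inter> ball x0 r = {x \<in> ball x0 r. \<gamma> (x - (x \<bullet> e) *\<^sub>R e) < x \<bullet> e}" "x \<in> ball x0 r"
  shows "x \<in> U \<longleftrightarrow> 0 < height \<gamma> e x"
proof -
  have "x \<in> U \<inter> ball x0 r \<longleftrightarrow> x \<in> ball x0 r \<and> 0 < height \<gamma> e x"
    unfolding assms(1) by (simp add: height_def proj_perp_def)
  then show ?thesis using assms(2) by blast
qed

subsection \<open>Zero trace and extension by zero\<close>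

lemma DERIV_max_square: "((\<lambda>x. (max 0 x)\<^sup>2) has_real_derivative 2 * max 0 x) (at x)"
proof -
  consider "x > 0" | "x < 0" | "x = 0" by linarith
  then show ?thesis
  proof cases
    case 1
    have "((\<lambda>x. x\<^sup>2) has_real_derivative 2 * max 0 x) (at x)"
      using 1 by (auto intro!: derivative_eq_intros)
    then show ?thesis
      by (rule has_field_derivative_transform_within_open[where S = "{0<..}"]) (use 1 in auto)
  next
    case 2
    have "((\<lambda>x. 0) has_real_derivative 2 * max 0 x) (at x)" using 2 by simp
    then show ?thesis
      by (rule has_field_derivative_transform_within_open[where S = "{..<0}"]) (use 2 in auto)
  next
    case 3
    have "((\<lambda>h::real. (max 0 h)\<^sup>2 / h) \<longlongrightarrow> 0) (at 0)"
    proof (rule Lim_null_comparison)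
      show "\<forall>\<^sub>F h::real in at 0. norm ((max 0 h)\<^sup>2 / h) \<le> \<bar>h\<bar>"
        by (intro always_eventually allI) (auto simp: max_def power2_eq_square)
      show "((\<lambda>h::real. \<bar>h\<bar>) \<longlongrightarrow> 0) (at 0)" by (intro tendsto_rabs_zero tendsto_ident_at)
    qed
    then show ?thesis using 3 by (simp add: has_field_derivative_iff)
  qed
qed

text \<open>A quadratic spline: a transition of class $C^1$ from 0 on \<open>s \<le> 1\<close> to 1 on \<open>s \<ge> 2\<close>.\<close>
definition ramp :: "real \<Rightarrow> real" where
  "ramp s = 2 * (max 0 (s - 1))\<^sup>2 - 4 * (max 0 (s - 3 / 2))\<^sup>2 + 2 * (max 0 (s - 2))\<^sup>2"

definition ramp' :: "real \<Rightarrow> real" where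
  "ramp' s = 4 * max 0 (s - 1) - 8 * max 0 (s - 3 / 2) + 4 * max 0 (s - 2)"

lemma DERIV_ramp: "(ramp has_real_derivative ramp' s) (at s)"
proof -
  have "((\<lambda>s. (max 0 (s - a))\<^sup>2) has_real_derivative 2 * max 0 (s - a)) (at s)" for a :: real
  proof -
    have "((\<lambda>s. s - a) has_real_derivative 1) (at s)" by (auto intro!: derivative_eq_intros)
    from DERIV_chain2[OF DERIV_max_square this] show ?thesis by simp
  qed
  from DERIV_add[OF DERIV_diff[OF DERIV_cmult[OF this, of 2] DERIV_cmult[OF this, of 4]] DERIV_cmult[OF this, of 2]]
  have "((\<lambda>s. 2 * (max 0 (s - 1))\<^sup>2 - 4 * (max 0 (s - 3 / 2))\<^sup>2 + 2 * (max 0 (s - 2))\<^sup>2) has_real_derivative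
    2 * (2 * max 0 (s - 1)) - 4 * (2 * max 0 (s - 3 / 2)) + 2 * (2 * max 0 (s - 2))) (at s)" by blast
  then show ?thesis by (simp add: ramp_def[abs_def] ramp'_def)
qed

lemma continuous_on_ramp': "continuous_on UNIV ramp'"
  unfolding ramp'_def[abs_def] by (intro continuous_intros)

lemma ramp'_bound: "\<bar>ramp' s\<bar> \<le> 2"
  by (auto simp: ramp'_def max_def)

lemma ramp'_zero: "s \<le> 1 \<or> 2 \<le> s \<Longrightarrow> ramp' s = 0"
  by (auto simp: ramp'_def max_def)

lemma ramp_zero: "s \<le> 1 \<Longrightarrow> ramp s = 0"
  by (auto simp: ramp_def max_def)

lemma ramp_one: "2 \<le> s \<Longrightarrow> ramp s = 1"
  by (auto simp: ramp_def max_def power2_eq_square field_simps)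

lemma ramp_bound: "\<bar>ramp s\<bar> \<le> 1"
proof -
  consider "s \<le> 1" | "1 \<le> s" "s \<le> 3 / 2" | "3 / 2 \<le> s" "s \<le> 2" | "2 \<le> s" by linarith
  then show ?thesis
  proof cases
    case 2
    then have "ramp s = 2 * (s - 1)\<^sup>2" by (simp add: ramp_def)
    moreover have "(s - 1)\<^sup>2 \<le> (1 / 2)\<^sup>2" using 2 by (intro power_mono) auto
    ultimately show ?thesis by (simp add: power2_eq_square)
  next
    case 3
    then have "ramp s = 1 - 2 * (2 - s)\<^sup>2" by (simp add: ramp_def power2_eq_square field_simps)
    moreover have "(2 - s)\<^sup>2 \<le> (1 / 2)\<^sup>2" using 3 by (intro power_mono) auto
    ultimately show ?thesis using zero_le_power2[of "2 - s"] by (simp add: power2_eq_square abs_le_iff)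
  qed (auto simp: ramp_zero ramp_one)
qed

text \<open>Testing with \<open>ramp (t x / \<delta>) * \<eta> x\<close>, which vanishes near the
  boundary, leaves an error of order \<bar>f\<bar>/\<delta> on the strip \<delta> < t < 2\<delta>.
  There \<open>f\<close> is close to its value at the foot point on the boundary, the strip has
  volume of order \<delta>, and strip integrals of boundary values are at most of order \<delta>
  times surface integrals. So the error stays below \<open>c * \<epsilon>\<close> as \<delta> tends
  to 0, with \<open>c\<close> depending only on the chart and the test function.\<close>

lemma zero_trace_local:
  fixes U :: "'a::euclidean_space set"
  assumes dim: "2 \<le> DIM('a)" and U: "open U" "bounded U" and e: "norm e = 1" and \<gamma>: "smooth \<gamma>"
    and chart: "U \<inter> ball x0 r = {x \<in> ball x0 r. \<gamma> (x - (x \<bullet> e) *\<^sub>R e) < x \<bullet> e}"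
    and C: "C1c (ball x0 r) \<eta> D"
  shows "\<exists>c\<ge>0. \<forall>f H \<epsilon>. 0 < \<epsilon> \<and> continuous_on (closure U) f \<and> wg U (\<lambda>x. indicator U x * f x) H \<and>
      (\<integral>\<^sup>+x\<in>frontier U. ennreal ((f x)\<^sup>2) \<partial>surface_measure) \<le> ennreal (\<epsilon>\<^sup>2) \<longrightarrow>
    norm (\<integral>x. (indicator U x * f x) *\<^sub>R D x + \<eta> x *\<^sub>R H x \<partial>lborel) \<le> c * \<epsilon>"
proof -
  define t where "t = height \<gamma> e"
  define Dt where "Dt = height_grad \<gamma> e"
  have tD: "GDERIV t x :> Dt x" for x unfolding t_def Dt_def by (rule GDERIV_height[OF \<gamma>])
  have cDt: "continuous_on UNIV Dt" unfolding Dt_def by (rule continuous_height_grad[OF \<gamma>])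
  have ct: "continuous_on UNIV t" unfolding t_def by (rule continuous_height[OF \<gamma>])
  have [measurable]: "t \<in> borel_measurable borel" "Dt \<in> borel_measurable borel"
    using ct cDt by (auto intro: borel_measurable_continuous_onI)
  have ts: "t (x + s *\<^sub>R e) = t x + s" for x s unfolding t_def by (rule height_add_axis[OF e])
  have tU: "x \<in> U \<longleftrightarrow> 0 < t x" if "x \<in> ball x0 r" for x
    unfolding t_def by (rule chart_height[OF chart that])
  obtain K where K: "compact K" "K \<subseteq> ball x0 r" "\<And>x. x \<notin> K \<Longrightarrow> \<eta> x = 0 \<and> D x = 0"
    using C1cD(4)[OF C] by blast
  obtain e1 where e1: "e1 > 0" "(\<Union>x\<in>K. cball x e1) \<subseteq> ball x0 r"
    using compact_subset_open_imp_cball_epsilon_subset[OF K(1) open_ball K(2)] by blast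
  obtain R where R: "K \<subseteq> cball 0 R" using compact_imp_bounded[OF K(1)] by (auto simp: bounded_iff subset_iff)
  obtain B where B: "B > 0" "\<And>x. \<bar>\<eta> x\<bar> \<le> B" "\<And>x. norm (D x) \<le> B" using C1c_bounded[OF C] by blast
  have "compact (Dt ` K)" using K(1) cDt continuous_on_subset compact_continuous_image by blast
  then obtain M where M: "\<And>x. x \<in> K \<Longrightarrow> norm (Dt x) \<le> M"
    using compact_imp_bounded by (fastforce simp: bounded_iff)
  define M' where "M' = max 0 M"
  have M': "0 \<le> M'" "\<And>x. x \<in> K \<Longrightarrow> norm (Dt x) \<le> M'" using M by (auto simp: M'_def intro: max.coboundedI2)
  note [measurable] = C1c_borel[OF C]
  have [measurable]: "K \<in> sets borel" using K(1) by (simp add: borel_compact)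
  define V where "V = measure lborel (cball (0::'a) (R + 1))"
  define sc where "sc = strip_const TYPE('a)"
  have sc: "0 < sc" by (simp add: sc_def strip_const_pos)
  have V: "0 \<le> V" by (simp add: V_def)
  \<comment> \<open>From \<open>2 * B * M' / \<delta> * (2 * \<epsilon> * (2 * V * \<delta>) + sc *
    \<delta> * \<epsilon>)\<close>: the bound for \<eta> times the gradient of the ramp, multiplied
    by the volume part plus the surface part. The width \<delta> cancels.\<close>
  define c where "c = 2 * B * M' * (4 * V + sc)"
  show ?thesis
  proof (intro exI[of _ c] conjI allI impI)
    show "0 \<le> c" using B M' V sc by (simp add: c_def)
    fix f H \<epsilon>
    assume "0 < \<epsilon> \<and> continuous_on (closure U) f \<and> wg U (\<lambda>x. indicator U x * f x) H \<and>
      (\<integral>\<^sup>+x\<in>frontier U. ennreal ((f x)\<^sup>2) \<partial>surface_measure) \<le> ennreal (\<epsilon>\<^sup>2)"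
    then have \<epsilon>: "0 < \<epsilon>" and f: "continuous_on (closure U) f" and W: "wg U (\<lambda>x. indicator U x * f x) H"
      and tr: "(\<integral>\<^sup>+x\<in>frontier U. ennreal ((f x)\<^sup>2) \<partial>surface_measure) \<le> ennreal (\<epsilon>\<^sup>2)" by auto
    define v where "v = (\<lambda>x. indicator U x * f x)"
    have Wv: "wg U v H" using W by (simp add: v_def)
    note [measurable] = wgD(1,2)[OF Wv]
    have "compact (closure U)" using U(2) by (simp add: compact_closure)
    then have "uniformly_continuous_on (closure U) f" using f compact_uniformly_continuous by blast
    then obtain d where d: "d > 0" "\<And>x y. x \<in> closure U \<Longrightarrow> y \<in> closure U \<Longrightarrow> dist x y < d \<Longrightarrow> dist (f x) (f y) < \<epsilon>"
      using \<epsilon> unfolding uniformly_continuous_on_def by (metis dist_commute)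
    \<comment> \<open>The three bounds serve \<open>strip_volume\<close>, the vertical segment down
      to the foot point, which must stay in the chart, and the uniform continuity of
      \<open>f\<close>.\<close>
    define \<delta>0 where "\<delta>0 = min (1 / 2) (min (e1 / 2) (d / 2))"
    have \<delta>0: "0 < \<delta>0" using e1 d by (simp add: \<delta>0_def)
    \<comment> \<open>The surface density in \<bar>f\<bar> \<le> \<epsilon> + f^2/\<epsilon>; the
      factor 1/\<epsilon> makes its integral at most \<epsilon>.\<close>
    define g where "g = (\<lambda>y. ennreal (1 / \<epsilon>) * (ennreal ((f y)\<^sup>2) * indicator (frontier U) y))"
    have fI: "(\<lambda>x. indicator (frontier U) x *\<^sub>R f x) \<in> borel_measurable borel"
      by (rule borel_measurable_continuous_on_indicator)
        (use f in \<open>auto simp: frontier_def intro: continuous_on_subset\<close>)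
    have gm [measurable]: "g \<in> borel_measurable borel"
    proof -
      have "g = (\<lambda>y. ennreal (1 / \<epsilon>) * ennreal ((indicator (frontier U) y *\<^sub>R f y)\<^sup>2))"
        by (auto simp: g_def fun_eq_iff indicator_def)
      then show ?thesis using fI by simp
    qed
    have gint: "integral\<^sup>N surface_measure g \<le> ennreal \<epsilon>"
    proof -
      have "integral\<^sup>N surface_measure g = ennreal (1 / \<epsilon>) * (\<integral>\<^sup>+x\<in>frontier U. ennreal ((f x)\<^sup>2) \<partial>surface_measure)"
        unfolding g_def
      proof (rule nn_integral_cmult)
        have "(\<lambda>y. ennreal ((f y)\<^sup>2) * indicator (frontier U) y) = (\<lambda>y. ennreal ((indicator (frontier U) y *\<^sub>R f y)\<^sup>2))"
          by (auto simp: fun_eq_iff indicator_def)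
        moreover have "(\<lambda>y. ennreal ((indicator (frontier U) y *\<^sub>R f y)\<^sup>2)) \<in> borel_measurable borel" using fI by simp
        ultimately show "(\<lambda>y. ennreal ((f y)\<^sup>2) * indicator (frontier U) y) \<in> borel_measurable surface_measure"
          by (simp add: surface_measure_def measurable_cong_sets[OF sets_hausdorff_measure refl])
      qed
      also have "\<dots> \<le> ennreal (1 / \<epsilon>) * ennreal (\<epsilon>\<^sup>2)" using tr by (rule mult_left_mono) simp
      also have "\<dots> = ennreal \<epsilon>" using \<epsilon> by (simp add: ennreal_mult[symmetric] power2_eq_square)
      finally show ?thesis .
    qed
    have est: "norm (\<integral>x. ramp (t x / \<delta>) *\<^sub>R (v x *\<^sub>R D x + \<eta> x *\<^sub>R H x) \<partial>lborel) \<le> c * \<epsilon>"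
      if \<delta>: "0 < \<delta>" "\<delta> < \<delta>0" for \<delta>
    proof -
      have \<delta>': "\<delta> \<le> 1 / 2" "2 * \<delta> < e1" "2 * \<delta> < d" using \<delta>(2) by (auto simp: \<delta>0_def)
      define \<tau> where "\<tau> = (\<lambda>x. ramp (t x / \<delta>))"
      define D\<tau> where "D\<tau> = (\<lambda>x. (ramp' (t x / \<delta>) / \<delta>) *\<^sub>R Dt x)"
      have \<tau>D: "GDERIV \<tau> x :> D\<tau> x" for x
      proof -
        have "((\<lambda>s. ramp (s / \<delta>)) has_real_derivative ramp' (t x / \<delta>) / \<delta>) (at (t x))"
        proof -
          have "((\<lambda>s. s / \<delta>) has_real_derivative 1 / \<delta>) (at (t x))"
            using \<delta>(1) by (auto intro!: derivative_eq_intros)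
          from DERIV_chain2[OF DERIV_ramp this] show ?thesis by simp
        qed
        from GDERIV_DERIV_compose[OF tD this] show ?thesis by (simp add: \<tau>_def D\<tau>_def)
      qed
      have c\<tau>D: "continuous_on UNIV D\<tau>" unfolding D\<tau>_def
        by (intro continuous_intros cDt continuous_on_compose2[OF continuous_on_ramp'] ct) (use \<delta>(1) in auto)
      have [measurable]: "\<tau> \<in> borel_measurable borel" "D\<tau> \<in> borel_measurable borel"
        using c\<tau>D GDERIV_continuous[OF \<tau>D]
        by (auto intro!: borel_measurable_continuous_onI simp: continuous_on_eq_continuous_at)
      have C0: "C1c UNIV (\<lambda>x. \<tau> x * \<eta> x) (\<lambda>x. \<tau> x *\<^sub>R D x + \<eta> x *\<^sub>R D\<tau> x)"
        by (rule C1c_mult[OF \<tau>D c\<tau>D C1c_mono[OF C subset_UNIV]])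
      have C1: "C1c U (\<lambda>x. \<tau> x * \<eta> x) (\<lambda>x. \<tau> x *\<^sub>R D x + \<eta> x *\<^sub>R D\<tau> x)"
      proof (rule C1cI[OF C1cD(1,2)[OF C0]])
        have "closed {x. \<delta> \<le> t x}" by (intro closed_Collect_le continuous_intros ct)
        then show "compact (K \<inter> {x. \<delta> \<le> t x})" by (rule compact_Int_closed[OF K(1)])
        show "K \<inter> {x. \<delta> \<le> t x} \<subseteq> U"
        proof
          fix x assume "x \<in> K \<inter> {x. \<delta> \<le> t x}"
          then show "x \<in> U" using K(2) tU[of x] \<delta>(1) by auto
        qed
        show "\<tau> x * \<eta> x = 0" if "x \<notin> K \<inter> {x. \<delta> \<le> t x}" for x
        proof (cases "x \<in> K")
          case True
          then have "t x / \<delta> \<le> 1" using that \<delta>(1) by simp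
          then show ?thesis by (simp add: \<tau>_def ramp_zero)
        qed (use K(3) in simp)
      qed
      \<comment> \<open>The tested identity splits into \<open>a\<close>, the desired integrand
        damped by the ramp, and \<open>b\<close>, which carries the gradient of the ramp.\<close>
      define a where "a = (\<lambda>x. \<tau> x *\<^sub>R (v x *\<^sub>R D x + \<eta> x *\<^sub>R H x))"
      define b where "b = (\<lambda>x. (v x * \<eta> x) *\<^sub>R D\<tau> x)"
      have ia: "integrable lborel a" unfolding a_def
      proof (rule integrable_bounded_scaleR[OF Bochner_Integration.integrable_add[OF wg_test_integrable[OF Wv C]]])
        show "\<bar>\<tau> x\<bar> \<le> 1" for x by (simp add: \<tau>_def ramp_bound)
      qed measurable
      have "integrable lborel (\<lambda>x. v x *\<^sub>R (\<tau> x *\<^sub>R D x + \<eta> x *\<^sub>R D\<tau> x) + (\<tau> x * \<eta> x) *\<^sub>R H x)"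
        by (intro Bochner_Integration.integrable_add wg_test_integrable[OF Wv C1])
      moreover have sum: "(\<lambda>x. v x *\<^sub>R (\<tau> x *\<^sub>R D x + \<eta> x *\<^sub>R D\<tau> x) + (\<tau> x * \<eta> x) *\<^sub>R H x) = (\<lambda>x. a x + b x)"
        by (simp add: a_def b_def algebra_simps)
      ultimately have iab: "integrable lborel (\<lambda>x. a x + b x)" by simp
      have ib: "integrable lborel b"
        using Bochner_Integration.integrable_diff[OF iab ia] by simp
      have "integral\<^sup>L lborel (\<lambda>x. a x + b x) = 0" using wgD(8)[OF Wv C1] sum by simp
      then have ab: "integral\<^sup>L lborel a = - integral\<^sup>L lborel b"
        using Bochner_Integration.integral_add[OF ia ib] by (simp add: eq_neg_iff_add_eq_0)
      define S where "S = {x \<in> K. \<delta> < t x \<and> t x < 2 * \<delta>}"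
      have [measurable]: "S \<in> sets borel" unfolding S_def by measurable
      have fS: "ennreal (norm (v x)) \<le> ennreal (2 * \<epsilon>) + g (x - t x *\<^sub>R e)" if x: "x \<in> S" for x
      proof -
        \<comment> \<open>The foot point of \<open>x\<close> on the graph. It is not in
          \<open>U\<close> because its height is 0, but it is a limit of points of \<open>U\<close>
          on the vertical segment up to \<open>x\<close>.\<close>
        define y where "y = x - t x *\<^sub>R e"
        have tx: "\<delta> < t x" "t x < 2 * \<delta>" "x \<in> K" using x by (auto simp: S_def)
        have xU: "x \<in> U" using tU[of x] tx \<delta>(1) K(2) by auto
        have xy: "dist x y = t x" using e tx \<delta>(1) by (simp add: y_def dist_norm)
        have near: "y + s *\<^sub>R e \<in> ball x0 r" if "0 \<le> s" "s < t x" for s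
        proof -
          have "dist x (y + s *\<^sub>R e) = norm ((t x - s) *\<^sub>R e)" by (simp add: y_def dist_norm algebra_simps)
          also have "\<dots> \<le> t x" using e that by simp
          finally have "y + s *\<^sub>R e \<in> cball x e1" using tx \<delta>' by simp
          then show ?thesis using e1(2) tx(3) by blast
        qed
        have ty: "t (y + s *\<^sub>R e) = s" for s
          using ts[of x "s - t x"] by (simp add: y_def algebra_simps)
        have yn: "y \<notin> U" using tU[of y] near[of 0] ty[of 0] tx \<delta>(1) by auto
        have yc: "y \<in> closure U"
          unfolding closure_approachable
        proof (intro allI impI)
          fix \<rho> :: real assume \<rho>: "0 < \<rho>"
          define s where "s = min (\<rho> / 2) (t x / 2)"
          have s: "0 < s" "s < t x" "s < \<rho>" using \<rho> tx \<delta>(1) by (auto simp: s_def)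
          then have "y + s *\<^sub>R e \<in> U" using tU[OF near[of s]] ty[of s] by auto
          moreover have "dist (y + s *\<^sub>R e) y < \<rho>" using s e by (simp add: dist_norm)
          ultimately show "\<exists>z\<in>U. dist z y < \<rho>" by blast
        qed
        have yf: "y \<in> frontier U" using yn yc U(1) by (simp add: frontier_def interior_open)
        have "dist (f x) (f y) < \<epsilon>"
          using d(2)[of x y] xU yc closure_subset[of U] xy tx \<delta>' by auto
        moreover have "\<bar>f y\<bar> \<le> \<epsilon> + 1 / \<epsilon> * (f y)\<^sup>2"
        proof -
          have "2 * \<bar>f y\<bar> * \<epsilon> \<le> \<epsilon>\<^sup>2 + (f y)\<^sup>2"
            using zero_le_power2[of "\<epsilon> - \<bar>f y\<bar>"] by (simp add: power2_diff algebra_simps)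
          moreover have "0 \<le> \<bar>f y\<bar> * \<epsilon>" using \<epsilon> by simp
          ultimately have "\<bar>f y\<bar> * \<epsilon> \<le> \<epsilon>\<^sup>2 + (f y)\<^sup>2" by linarith
          then show ?thesis using \<epsilon> by (simp add: field_simps power2_eq_square)
        qed
        ultimately have "\<bar>f x\<bar> \<le> 2 * \<epsilon> + 1 / \<epsilon> * (f y)\<^sup>2" by (simp add: dist_real_def abs_le_iff abs_less_iff)
        then have "ennreal (norm (v x)) \<le> ennreal (2 * \<epsilon> + 1 / \<epsilon> * (f y)\<^sup>2)"
          using xU by (intro ennreal_leI) (simp add: v_def)
        also have "\<dots> = ennreal (2 * \<epsilon>) + ennreal (1 / \<epsilon> * (f y)\<^sup>2)"
          using \<epsilon> by (intro ennreal_plus) auto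
        also have "ennreal (1 / \<epsilon> * (f y)\<^sup>2) = ennreal (1 / \<epsilon>) * ennreal ((f y)\<^sup>2)"
          using \<epsilon> by (intro ennreal_mult) auto
        also have "\<dots> = g y" using yf by (simp add: g_def)
        finally show ?thesis by (simp add: y_def)
      qed
      have bS: "ennreal (norm (b x)) \<le> ennreal (2 * B * M' / \<delta>) * ((ennreal (2 * \<epsilon>) + g (x - t x *\<^sub>R e)) * indicator S x)" for x
      proof (cases "x \<in> S")
        case True
        then have "x \<in> K" by (simp add: S_def)
        have "norm (b x) = norm (v x) * (\<bar>\<eta> x\<bar> * ((\<bar>ramp' (t x / \<delta>)\<bar> / \<delta>) * norm (Dt x)))"
          using \<delta>(1) by (simp add: b_def D\<tau>_def abs_mult)
        also have "\<dots> \<le> norm (v x) * (B * ((2 / \<delta>) * M'))"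
          using B \<delta>(1) M'(1) M'(2)[OF \<open>x \<in> K\<close>] ramp'_bound[of "t x / \<delta>"]
          by (intro mult_left_mono mult_mono divide_right_mono) auto
        also have "\<dots> = (2 * B * M' / \<delta>) * norm (v x)" by simp
        finally have "ennreal (norm (b x)) \<le> ennreal ((2 * B * M' / \<delta>) * norm (v x))" by (rule ennreal_leI)
        also have "\<dots> = ennreal (2 * B * M' / \<delta>) * ennreal (norm (v x))"
          using B M'(1) \<delta>(1) by (intro ennreal_mult) auto
        also have "\<dots> \<le> ennreal (2 * B * M' / \<delta>) * (ennreal (2 * \<epsilon>) + g (x - t x *\<^sub>R e))"
          using fS[OF True] by (rule mult_left_mono) simp
        finally show ?thesis using True by simp
      next
        case False
        have "b x = 0"
        proof (cases "x \<in> K")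
          case True
          then have "t x / \<delta> \<le> 1 \<or> 2 \<le> t x / \<delta>" using False \<delta>(1) by (auto simp: S_def field_simps)
          then show ?thesis by (simp add: b_def D\<tau>_def ramp'_zero)
        qed (use K(3) in \<open>simp add: b_def\<close>)
        then show ?thesis by simp
      qed
      have mS: "emeasure lborel S \<le> ennreal (2 * V * \<delta>)"
      proof -
        have "emeasure lborel S \<noteq> \<infinity>"
        proof -
          have "emeasure lborel S \<le> emeasure lborel (cball (0::'a) R)"
            using R by (intro emeasure_mono) (auto simp: S_def)
          then show ?thesis using emeasure_lborel_cball_finite[of "0::'a" R] by (auto simp: top_unique)
        qed
        moreover have "measure lborel S \<le> 2 * V * \<delta>" unfolding V_def
          by (rule strip_volume[where t = t, OF e ts \<delta>(1) \<delta>'(1)]) (use R in \<open>auto simp: S_def\<close>)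
        ultimately show ?thesis by (simp add: emeasure_eq_ennreal_measure ennreal_leI)
      qed
      have "ennreal (norm (integral\<^sup>L lborel b)) \<le> (\<integral>\<^sup>+x. norm (b x) \<partial>lborel)"
        by (rule integral_norm_bound_ennreal[OF ib])
      also have "\<dots> \<le> (\<integral>\<^sup>+x. ennreal (2 * B * M' / \<delta>) * ((ennreal (2 * \<epsilon>) + g (x - t x *\<^sub>R e)) * indicator S x) \<partial>lborel)"
        by (intro nn_integral_mono bS)
      also have "\<dots> = ennreal (2 * B * M' / \<delta>) * (\<integral>\<^sup>+x. (ennreal (2 * \<epsilon>) + g (x - t x *\<^sub>R e)) * indicator S x \<partial>lborel)"
        by (rule nn_integral_cmult) measurable
      also have "(\<integral>\<^sup>+x. (ennreal (2 * \<epsilon>) + g (x - t x *\<^sub>R e)) * indicator S x \<partial>lborel)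
        = ennreal (2 * \<epsilon>) * emeasure lborel S + (\<integral>\<^sup>+x\<in>S. g (x - t x *\<^sub>R e) \<partial>lborel)"
        by (simp add: distrib_right nn_integral_add nn_integral_cmult_indicator)
      also have "ennreal (2 * B * M' / \<delta>) * \<dots> \<le> ennreal (2 * B * M' / \<delta>) * (ennreal (2 * \<epsilon>) * ennreal (2 * V * \<delta>) + ennreal (sc * \<delta>) * ennreal \<epsilon>)"
      proof (intro mult_left_mono add_mono mS)
        have "(\<integral>\<^sup>+x\<in>S. g (x - t x *\<^sub>R e) \<partial>lborel) \<le> ennreal (sc * \<delta>) * integral\<^sup>N surface_measure g"
          unfolding sc_def by (rule strip_nn_integral[OF e dim \<delta>(1)]) (auto simp: S_def)
        also have "\<dots> \<le> ennreal (sc * \<delta>) * ennreal \<epsilon>" using gint by (rule mult_left_mono) simp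
        finally show "(\<integral>\<^sup>+x\<in>S. g (x - t x *\<^sub>R e) \<partial>lborel) \<le> ennreal (sc * \<delta>) * ennreal \<epsilon>" .
      qed auto
      also have "\<dots> = ennreal (2 * B * M' / \<delta> * (2 * \<epsilon> * (2 * V * \<delta>) + sc * \<delta> * \<epsilon>))"
      proof -
        have "ennreal (2 * \<epsilon>) * ennreal (2 * V * \<delta>) = ennreal (2 * \<epsilon> * (2 * V * \<delta>))"
          "ennreal (sc * \<delta>) * ennreal \<epsilon> = ennreal (sc * \<delta> * \<epsilon>)"
          using \<epsilon> \<delta>(1) V sc by (simp_all only: ennreal_mult mult_nonneg_nonneg less_imp_le zero_le_numeral)
        moreover have "ennreal (2 * \<epsilon> * (2 * V * \<delta>)) + ennreal (sc * \<delta> * \<epsilon>)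
            = ennreal (2 * \<epsilon> * (2 * V * \<delta>) + sc * \<delta> * \<epsilon>)"
          using \<epsilon> \<delta>(1) V sc by (intro ennreal_plus[symmetric] mult_nonneg_nonneg) auto
        moreover have "ennreal (2 * B * M' / \<delta>) * ennreal (2 * \<epsilon> * (2 * V * \<delta>) + sc * \<delta> * \<epsilon>)
            = ennreal (2 * B * M' / \<delta> * (2 * \<epsilon> * (2 * V * \<delta>) + sc * \<delta> * \<epsilon>))"
          using \<epsilon> \<delta>(1) V sc B(1) M'(1)
          by (intro ennreal_mult[symmetric] add_nonneg_nonneg mult_nonneg_nonneg divide_nonneg_nonneg) auto
        ultimately show ?thesis by (simp only:)
      qed
      also have "2 * B * M' / \<delta> * (2 * \<epsilon> * (2 * V * \<delta>) + sc * \<delta> * \<epsilon>) = c * \<epsilon>"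
        using \<delta>(1) by (simp add: c_def field_simps)
      finally have "norm (integral\<^sup>L lborel b) \<le> c * \<epsilon>"
        using \<epsilon> \<open>0 \<le> c\<close> by (subst (asm) ennreal_le_iff) auto
      then show ?thesis using ab by (simp add: a_def \<tau>_def)
    qed
    \<comment> \<open>As \<delta> = 1/(j + 1) shrinks, the ramp becomes 1 at every point of
      \<open>U\<close> in the support; outside \<open>U\<close> both \<open>v\<close> and
      \<open>H\<close> vanish.\<close>
    have "(\<lambda>j. \<integral>x. ramp (t x / (1 / (real j + 1))) *\<^sub>R (v x *\<^sub>R D x + \<eta> x *\<^sub>R H x) \<partial>lborel)
       \<longlonglongrightarrow> (\<integral>x. v x *\<^sub>R D x + \<eta> x *\<^sub>R H x \<partial>lborel)"
    proof (rule integral_dominated_convergence[where w = "\<lambda>x. norm (v x *\<^sub>R D x + \<eta> x *\<^sub>R H x)"])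
      have rm [measurable]: "ramp \<in> borel_measurable borel"
        by (rule borel_measurable_continuous_onI)
          (use DERIV_isCont[OF DERIV_ramp] in \<open>auto simp: continuous_on_eq_continuous_at\<close>)
      show "(\<lambda>x. ramp (t x / (1 / (real j + 1))) *\<^sub>R (v x *\<^sub>R D x + \<eta> x *\<^sub>R H x)) \<in> borel_measurable lborel" for j
        by measurable
      show "integrable lborel (\<lambda>x. norm (v x *\<^sub>R D x + \<eta> x *\<^sub>R H x))"
        by (intro integrable_norm Bochner_Integration.integrable_add wg_test_integrable[OF Wv C])
      show "AE x in lborel. norm (ramp (t x / (1 / (real j + 1))) *\<^sub>R (v x *\<^sub>R D x + \<eta> x *\<^sub>R H x))
          \<le> norm (v x *\<^sub>R D x + \<eta> x *\<^sub>R H x)" for j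
        unfolding norm_scaleR using ramp_bound by (intro AE_I2 mult_left_le_one_le) auto
      show "AE x in lborel. (\<lambda>j. ramp (t x / (1 / (real j + 1))) *\<^sub>R (v x *\<^sub>R D x + \<eta> x *\<^sub>R H x))
          \<longlonglongrightarrow> v x *\<^sub>R D x + \<eta> x *\<^sub>R H x"
      proof (rule AE_I2)
        fix x
        show "(\<lambda>j. ramp (t x / (1 / (real j + 1))) *\<^sub>R (v x *\<^sub>R D x + \<eta> x *\<^sub>R H x))
          \<longlonglongrightarrow> v x *\<^sub>R D x + \<eta> x *\<^sub>R H x"
        proof (cases "x \<in> U \<and> x \<in> K")
          case True
          then have tx: "0 < t x" using tU[of x] K(2) by auto
          have "\<forall>\<^sub>F j in sequentially. 1 / (real j + 1) \<le> t x / 2"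
            using tx by (intro eventually_moll_radius) simp
          then have "\<forall>\<^sub>F j in sequentially. ramp (t x / (1 / (real j + 1))) *\<^sub>R (v x *\<^sub>R D x + \<eta> x *\<^sub>R H x)
              = v x *\<^sub>R D x + \<eta> x *\<^sub>R H x"
          proof eventually_elim
            case (elim j)
            then have "2 \<le> t x / (1 / (real j + 1))" by (simp add: field_simps)
            then show ?case by (simp only: ramp_one scaleR_one)
          qed
          then show ?thesis by (rule tendsto_eventually)
        next
          case False
          then have "v x *\<^sub>R D x + \<eta> x *\<^sub>R H x = 0"
            using K(3)[of x] wgD(5,6)[OF Wv, of x] by auto
          then show ?thesis by simp
        qed
      qed
    qed measurable
    moreover have "\<forall>\<^sub>F j in sequentially. norm (\<integral>x. ramp (t x / (1 / (real j + 1))) *\<^sub>R (v x *\<^sub>R D x + \<eta> x *\<^sub>R H x) \<partial>lborel) \<le> c * \<epsilon>"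
    proof -
      have "\<forall>\<^sub>F j in sequentially. 1 / (real j + 1) \<le> \<delta>0 / 2"
        using \<delta>0 by (intro eventually_moll_radius) simp
      then show ?thesis
      proof eventually_elim
        case (elim j)
        show ?case
        proof (rule est)
          show "1 / (real j + 1) < \<delta>0" using elim \<delta>0 by linarith
        qed simp
      qed
    qed
    ultimately show "norm (\<integral>x. (indicator U x * f x) *\<^sub>R D x + \<eta> x *\<^sub>R H x \<partial>lborel) \<le> c * \<epsilon>"
      unfolding v_def by (rule Lim_norm_ubound[OF sequentially_bot])
  qed
qed

text \<open>For every positive \<open>a\<close> one has \<bar>f\<bar> \<le> a + \<bar>f\<bar>^2/a on
  the ball; \<open>a\<close> is adjusted to the volume so that the first term integrates to less
  than \<epsilon>/2.\<close>

lemma L1_of_L2: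
  fixes f :: "nat \<Rightarrow> 'a::euclidean_space \<Rightarrow> 'b::euclidean_space"
  assumes m [measurable]: "\<And>k. f k \<in> borel_measurable borel"
    and i: "\<And>k. integrable lborel (\<lambda>x. (norm (f k x))\<^sup>2)"
    and z: "\<And>k x. x \<notin> cball 0 R \<Longrightarrow> f k x = 0"
    and lim: "(\<lambda>k. \<integral>x. (norm (f k x))\<^sup>2 \<partial>lborel) \<longlonglongrightarrow> 0"
  shows "(\<lambda>k. \<integral>x. norm (f k x) \<partial>lborel) \<longlonglongrightarrow> 0"
proof (rule LIMSEQ_I)
  fix \<epsilon> :: real assume \<epsilon>: "0 < \<epsilon>"
  let ?I = "indicator (cball 0 R) :: 'a \<Rightarrow> real"
  have I: "integrable lborel ?I"
    using emeasure_lborel_cball_finite[of "0::'a" R] by (intro integrable_real_indicator) simp_all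
  define V where "V = measure lborel (cball (0::'a) R)"
  have V: "0 \<le> V" by (simp add: V_def)
  define a where "a = \<epsilon> / (2 * (V + 1))"
  have a: "0 < a" "a * V < \<epsilon> / 2"
  proof -
    show "0 < a" using \<epsilon> V by (simp add: a_def)
    have "a * V < a * (V + 1)" using \<open>0 < a\<close> by simp
    also have "\<dots> = \<epsilon> / 2"
    proof -
      have "V + 1 \<noteq> 0" using V by linarith
      then show ?thesis unfolding a_def by (metis nonzero_mult_divide_mult_cancel_right times_divide_eq_left)
    qed
    finally show "a * V < \<epsilon> / 2" .
  qed
  have le: "(\<integral>x. norm (f k x) \<partial>lborel) \<le> a * V + 1 / a * (\<integral>x. (norm (f k x))\<^sup>2 \<partial>lborel)" for k
  proof -
    have "(\<integral>x. norm (f k x) \<partial>lborel) \<le> (\<integral>x. a * ?I x + 1 / a * (norm (f k x))\<^sup>2 \<partial>lborel)"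
    proof (rule integral_mono)
      show "integrable lborel (\<lambda>x. norm (f k x))"
        by (rule integrable_norm[OF integrable_of_square[OF m i z]])
      show "integrable lborel (\<lambda>x. a * ?I x + 1 / a * (norm (f k x))\<^sup>2)" using I i[of k] by simp
      show "norm (f k x) \<le> a * ?I x + 1 / a * (norm (f k x))\<^sup>2" for x
      proof (cases "x \<in> cball 0 R")
        case True
        have "2 * norm (f k x) * a \<le> a\<^sup>2 + (norm (f k x))\<^sup>2"
          using zero_le_power2[of "a - norm (f k x)"] by (simp add: power2_diff algebra_simps)
        moreover have "0 \<le> norm (f k x) * a" using a by simp
        ultimately have "norm (f k x) * a \<le> a\<^sup>2 + (norm (f k x))\<^sup>2" by linarith
        then show ?thesis using True a by (simp add: field_simps power2_eq_square)
      qed (use z a in simp)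
    qed
    also have "\<dots> = a * V + 1 / a * (\<integral>x. (norm (f k x))\<^sup>2 \<partial>lborel)" using I i[of k] by (simp add: V_def)
    finally show ?thesis .
  qed
  have "(\<lambda>k. 1 / a * (\<integral>x. (norm (f k x))\<^sup>2 \<partial>lborel)) \<longlonglongrightarrow> 1 / a * 0" by (intro tendsto_intros lim)
  from order_tendstoD(2)[OF this, of "\<epsilon> / 2"] \<epsilon> have "\<forall>\<^sub>F k in sequentially. 1 / a * (\<integral>x. (norm (f k x))\<^sup>2 \<partial>lborel) < \<epsilon> / 2" by simp
  then obtain N where N: "\<And>k. k \<ge> N \<Longrightarrow> 1 / a * (\<integral>x. (norm (f k x))\<^sup>2 \<partial>lborel) < \<epsilon> / 2"
    unfolding eventually_sequentially by blast
  show "\<exists>N. \<forall>k\<ge>N. norm ((\<integral>x. norm (f k x) \<partial>lborel) - 0) < \<epsilon>"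
  proof (intro exI[of _ N] allI impI)
    fix k assume "N \<le> k"
    have "(\<integral>x. norm (f k x) \<partial>lborel) < \<epsilon>" using le[of k] N[OF \<open>N \<le> k\<close>] a by linarith
    then show "norm ((\<integral>x. norm (f k x) \<partial>lborel) - 0) < \<epsilon>"
      by (simp add: abs_of_nonneg[OF Bochner_Integration.integral_nonneg])
  qed
qed

lemma zero_test_local_to_global:
  fixes v :: "'a::euclidean_space \<Rightarrow> real"
  assumes v: "integrable lborel v" and G: "integrable lborel G"
    and loc: "\<And>x0. \<exists>r>0. \<forall>\<eta> D. C1c (ball x0 r) \<eta> D \<longrightarrow> (\<integral>x. v x *\<^sub>R D x + \<eta> x *\<^sub>R G x \<partial>lborel) = 0"
    and C: "C1c UNIV \<eta> D"
  shows "(\<integral>x. v x *\<^sub>R D x + \<eta> x *\<^sub>R G x \<partial>lborel) = 0"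
proof -
  have "\<forall>x0. \<exists>r>0. \<forall>\<eta> D. C1c (ball x0 r) \<eta> D \<longrightarrow> (\<integral>x. v x *\<^sub>R D x + \<eta> x *\<^sub>R G x \<partial>lborel) = 0"
    using loc by blast
  from choice[OF this] obtain r where "\<forall>x0. 0 < r x0 \<and> (\<forall>\<eta> D. C1c (ball x0 (r x0)) \<eta> D \<longrightarrow>
      (\<integral>x. v x *\<^sub>R D x + \<eta> x *\<^sub>R G x \<partial>lborel) = 0)" ..
  then have r: "\<And>x0. 0 < r x0" "\<And>x0 \<eta> D. C1c (ball x0 (r x0)) \<eta> D \<Longrightarrow> (\<integral>x. v x *\<^sub>R D x + \<eta> x *\<^sub>R G x \<partial>lborel) = 0"
    by simp_all
  have i: "integrable lborel (\<lambda>x. v x *\<^sub>R D x)" "integrable lborel (\<lambda>x. \<eta> x *\<^sub>R G x)" if C: "C1c UNIV \<eta> D" for \<eta> D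
  proof -
    obtain B where "\<And>x. \<bar>\<eta> x\<bar> \<le> B" "\<And>x. norm (D x) \<le> B" using C1c_bounded[OF C] by blast
    then show "integrable lborel (\<lambda>x. v x *\<^sub>R D x)" "integrable lborel (\<lambda>x. \<eta> x *\<^sub>R G x)"
      using v G C1c_borel[OF C] by (auto intro: integrable_bounded_scaleR integrable_scaleR_bounded)
  qed
  have peel: "\<forall>\<eta> D. C1c UNIV \<eta> D \<and> (\<forall>x. \<eta> x \<noteq> 0 \<longrightarrow> x \<in> (\<Union>z\<in>I. cball z (r z / 2))) \<longrightarrow>
      (\<integral>x. v x *\<^sub>R D x + \<eta> x *\<^sub>R G x \<partial>lborel) = 0" if "finite I" for I
    using that
  proof (induction I rule: finite_induct)
    case empty
    show ?case
    proof (intro allI impI, elim conjE)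
      fix \<eta> :: "'a \<Rightarrow> real" and D assume C: "C1c UNIV \<eta> D" and "\<forall>x. \<eta> x \<noteq> 0 \<longrightarrow> x \<in> (\<Union>z\<in>{}. cball z (r z / 2))"
      then have \<eta>: "\<eta> = (\<lambda>x. 0)" by auto
      have "D x = 0" for x using C1cD(1)[OF C, of x] GDERIV_const GDERIV_unique unfolding \<eta> by blast
      then show "(\<integral>x. v x *\<^sub>R D x + \<eta> x *\<^sub>R G x \<partial>lborel) = 0" by (simp add: \<eta>)
    qed
  next
    case (insert z I)
    show ?case
    proof (intro allI impI, elim conjE)
      fix \<eta> :: "'a \<Rightarrow> real" and D
      assume C: "C1c UNIV \<eta> D" and sup: "\<forall>x. \<eta> x \<noteq> 0 \<longrightarrow> x \<in> (\<Union>z\<in>insert z I. cball z (r z / 2))"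
      have "cball z (r z / 2) \<subseteq> ball z (r z)" using r(1)[of z] by auto
      then obtain \<theta> E where \<theta>: "C1c (ball z (r z)) \<theta> E" "\<forall>x. 0 \<le> \<theta> x \<and> \<theta> x \<le> 1"
        "\<forall>x\<in>cball z (r z / 2). \<theta> x = 1 \<and> E x = 0"
        using cutoff_exists[OF compact_cball open_ball, of z "r z / 2" z "r z"] by blast
      let ?D1 = "\<lambda>x. \<eta> x *\<^sub>R E x + \<theta> x *\<^sub>R D x"
      have C1: "C1c (ball z (r z)) (\<lambda>x. \<eta> x * \<theta> x) ?D1" by (rule C1c_mult[OF C1cD(1,2)[OF C] \<theta>(1)])
      have C2: "C1c UNIV (\<lambda>x. \<eta> x + - 1 * (\<eta> x * \<theta> x)) (\<lambda>x. D x + - 1 *\<^sub>R ?D1 x)"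
        by (rule C1c_add[OF C C1c_scale[OF C1c_mono[OF C1 subset_UNIV]]])
      have "\<forall>x. \<eta> x + - 1 * (\<eta> x * \<theta> x) \<noteq> 0 \<longrightarrow> x \<in> (\<Union>z\<in>I. cball z (r z / 2))"
      proof (intro allI impI)
        fix x assume x: "\<eta> x + - 1 * (\<eta> x * \<theta> x) \<noteq> 0"
        then have "\<eta> x \<noteq> 0" "\<theta> x \<noteq> 1" by auto
        then have "x \<notin> cball z (r z / 2)" using \<theta>(3) by blast
        with sup \<open>\<eta> x \<noteq> 0\<close> show "x \<in> (\<Union>z\<in>I. cball z (r z / 2))" by blast
      qed
      with insert.IH C2 have 2: "(\<integral>x. v x *\<^sub>R (D x + - 1 *\<^sub>R ?D1 x) + (\<eta> x + - 1 * (\<eta> x * \<theta> x)) *\<^sub>R G x \<partial>lborel) = 0"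
        by blast
      have 1: "(\<integral>x. v x *\<^sub>R ?D1 x + (\<eta> x * \<theta> x) *\<^sub>R G x \<partial>lborel) = 0" by (rule r(2)[OF C1])
      have "(\<integral>x. v x *\<^sub>R D x + \<eta> x *\<^sub>R G x \<partial>lborel)
        = (\<integral>x. (v x *\<^sub>R (D x + - 1 *\<^sub>R ?D1 x) + (\<eta> x + - 1 * (\<eta> x * \<theta> x)) *\<^sub>R G x)
            + (v x *\<^sub>R ?D1 x + (\<eta> x * \<theta> x) *\<^sub>R G x) \<partial>lborel)"
        by (intro Bochner_Integration.integral_cong refl) (simp add: algebra_simps)
      also have "\<dots> = 0"
        unfolding Bochner_Integration.integral_add[OF Bochner_Integration.integrable_add[OF i[OF C2]]
          Bochner_Integration.integrable_add[OF i[OF C1c_mono[OF C1 subset_UNIV]]]] 1 2 by simp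
      finally show "(\<integral>x. v x *\<^sub>R D x + \<eta> x *\<^sub>R G x \<partial>lborel) = 0" .
    qed
  qed
  obtain K where K: "compact K" "\<And>x. x \<notin> K \<Longrightarrow> \<eta> x = 0" using C1cD(4)[OF C] by blast
  have "K \<subseteq> (\<Union>z\<in>K. ball z (r z / 2))" using r(1) by force
  then obtain I where I: "I \<subseteq> K" "finite I" "K \<subseteq> (\<Union>z\<in>I. ball z (r z / 2))"
    using compactE_image[OF K(1), of K "\<lambda>z. ball z (r z / 2)"] by auto
  have "\<forall>x. \<eta> x \<noteq> 0 \<longrightarrow> x \<in> (\<Union>z\<in>I. cball z (r z / 2))"
  proof (intro allI impI)
    fix x assume "\<eta> x \<noteq> 0"
    then have "x \<in> (\<Union>z\<in>I. ball z (r z / 2))" using K(2) I(3) by blast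
    then show "x \<in> (\<Union>z\<in>I. cball z (r z / 2))" using ball_subset_cball by blast
  qed
  with peel[OF I(2)] C show ?thesis by blast
qed

text \<open>Near interior and exterior points the identity is immediate. Near the boundary
  \<open>zero_trace_local\<close> is applied to the approximants \<open>w k\<close>, whose boundary
  values tend to 0 in $L^2$.\<close>

theorem zero_trace_extension:
  fixes U :: "'a::euclidean_space set"
  assumes dim: "2 \<le> DIM('a)" and U: "open U" "bounded U" "smooth_boundary U"
    and W: "wg U v G" and tr: "trace_approx U v G (\<lambda>x. 0) w H"
  shows "wg UNIV v G"
proof -
  note w = tr[unfolded trace_approx_def]
  have w1: "continuous_on (closure U) (w k)" and w2: "wg U (\<lambda>x. indicator U x * w k x) (H k)" for k
    using w by blast+
  have w3: "(\<lambda>k. \<integral>x. (norm (indicator U x * w k x - v x))\<^sup>2 \<partial>lborel) \<longlonglongrightarrow> 0"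
    and w4: "(\<lambda>k. \<integral>x. (norm (H k x - G x))\<^sup>2 \<partial>lborel) \<longlonglongrightarrow> 0"
    and w5: "(\<lambda>k. \<integral>\<^sup>+x\<in>frontier U. ennreal ((w k x)\<^sup>2) \<partial>surface_measure) \<longlonglongrightarrow> 0"
    using w by simp_all
  note Wd = wg_diff[OF w2 W]
  note [measurable] = wgD(1,2)[OF W] wgD(1,2)[OF w2]
  obtain R where R: "U \<subseteq> cball 0 R" using U(2) by (auto simp: bounded_iff subset_iff)
  have L1: "(\<lambda>k. \<integral>x. norm (indicator U x * w k x - v x) \<partial>lborel) \<longlonglongrightarrow> 0"
    by (rule L1_of_L2[OF _ _ _ w3, of R])
      (use wgD(1,3)[OF Wd] wgD(5)[OF W] R in \<open>auto simp: indicator_def subset_iff\<close>)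
  have L2: "(\<lambda>k. \<integral>x. norm (H k x - G x) \<partial>lborel) \<longlonglongrightarrow> 0"
  proof (rule L1_of_L2[OF _ _ _ w4, of R])
    show "H k x - G x = 0" if "x \<notin> cball 0 R" for k x
      using wgD(6)[OF Wd, of x k] R that by blast
  qed (use wgD(2,4)[OF Wd] in auto)
  have "\<exists>r>0. \<forall>\<eta> D. C1c (ball x0 r) \<eta> D \<longrightarrow> (\<integral>x. v x *\<^sub>R D x + \<eta> x *\<^sub>R G x \<partial>lborel) = 0" for x0
  proof -
    consider "x0 \<in> U" | "x0 \<notin> closure U" | "x0 \<in> frontier U"
      using U(1) by (auto simp: frontier_def interior_open)
    then show ?thesis
    proof cases
      case 1
      then obtain r where "r > 0" "ball x0 r \<subseteq> U" using U(1) openE by blast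
      then show ?thesis using wgD(8)[OF W C1c_mono] by blast
    next
      case 2
      then obtain r where r: "r > 0" "ball x0 r \<subseteq> - closure U" using openE[of "- closure U" x0] by auto
      show ?thesis
      proof (intro exI[of _ r] conjI allI impI r(1))
        fix \<eta> :: "'a \<Rightarrow> real" and D assume C: "C1c (ball x0 r) \<eta> D"
        have "v x *\<^sub>R D x + \<eta> x *\<^sub>R G x = 0" for x
        proof (cases "x \<in> U")
          case True
          then have "x \<notin> ball x0 r" using r(2) closure_subset by blast
          then have "\<eta> x = 0 \<and> D x = 0" using C1cD(4)[OF C] by blast
          then show ?thesis by simp
        qed (use wgD(5,6)[OF W] in simp)
        then show "(\<integral>x. v x *\<^sub>R D x + \<eta> x *\<^sub>R G x \<partial>lborel) = 0" by simp
      qed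
    next
      case 3
      then obtain r e \<gamma> where r: "r > 0" and e: "norm e = 1" and \<gamma>: "smooth \<gamma>"
        and chart: "U \<inter> ball x0 r = {x \<in> ball x0 r. \<gamma> (x - (x \<bullet> e) *\<^sub>R e) < x \<bullet> e}"
        using U(3) unfolding smooth_boundary_def by blast
      show ?thesis
      proof (intro exI[of _ r] conjI allI impI r)
        fix \<eta> :: "'a \<Rightarrow> real" and D assume C: "C1c (ball x0 r) \<eta> D"
        note [measurable] = C1c_borel[OF C]
        obtain B where B: "B > 0" "\<And>x. \<bar>\<eta> x\<bar> \<le> B" "\<And>x. norm (D x) \<le> B" using C1c_bounded[OF C] by blast
        let ?\<Lambda> = "\<integral>x. v x *\<^sub>R D x + \<eta> x *\<^sub>R G x \<partial>lborel"
        let ?\<Lambda>k = "\<lambda>k. \<integral>x. (indicator U x * w k x) *\<^sub>R D x + \<eta> x *\<^sub>R H k x \<partial>lborel"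
        \<comment> \<open>\<open>c\<close> is the same for all approximants and all
          \<open>\<epsilon>\<close>, so the limit in \<open>k\<close> preserves the estimate and
          \<open>\<epsilon>\<close> can then go to 0.\<close>
        obtain c where c: "c \<ge> 0" "\<And>f H \<epsilon>. 0 < \<epsilon> \<Longrightarrow> continuous_on (closure U) f \<Longrightarrow> wg U (\<lambda>x. indicator U x * f x) H \<Longrightarrow>
            (\<integral>\<^sup>+x\<in>frontier U. ennreal ((f x)\<^sup>2) \<partial>surface_measure) \<le> ennreal (\<epsilon>\<^sup>2) \<Longrightarrow>
            norm (\<integral>x. (indicator U x * f x) *\<^sub>R D x + \<eta> x *\<^sub>R H x \<partial>lborel) \<le> c * \<epsilon>"
          using zero_trace_local[OF dim U(1,2) e \<gamma> chart C] by meson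
        have lim: "?\<Lambda>k \<longlonglongrightarrow> ?\<Lambda>"
        proof (rule Lim_null_comparison[THEN LIM_zero_cancel])
          have "norm (?\<Lambda>k k - ?\<Lambda>) \<le> B * (\<integral>x. norm (indicator U x * w k x - v x) \<partial>lborel) + B * (\<integral>x. norm (H k x - G x) \<partial>lborel)" for k
          proof -
            have iw: "integrable lborel (\<lambda>x. indicator U x * w k x - v x)" "integrable lborel (\<lambda>x. H k x - G x)"
              using wg_integrable[OF Wd[of k]] by auto
            have "?\<Lambda>k k - ?\<Lambda> = (\<integral>x. ((indicator U x * w k x) *\<^sub>R D x + \<eta> x *\<^sub>R H k x) - (v x *\<^sub>R D x + \<eta> x *\<^sub>R G x) \<partial>lborel)"
              by (rule Bochner_Integration.integral_diff[symmetric])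
                (intro Bochner_Integration.integrable_add wg_test_integrable[OF w2 C] wg_test_integrable[OF W C])+
            also have "\<dots> = (\<integral>x. (indicator U x * w k x - v x) *\<^sub>R D x + \<eta> x *\<^sub>R (H k x - G x) \<partial>lborel)"
              by (simp add: algebra_simps)
            also have "norm \<dots> \<le> (\<integral>x. B * norm (indicator U x * w k x - v x) + B * norm (H k x - G x) \<partial>lborel)"
            proof (rule Bochner_Integration.integral_norm_bound_integral)
              show "integrable lborel (\<lambda>x. (indicator U x * w k x - v x) *\<^sub>R D x + \<eta> x *\<^sub>R (H k x - G x))"
                by (intro Bochner_Integration.integrable_add wg_test_integrable[OF Wd C])
              show "integrable lborel (\<lambda>x. B * norm (indicator U x * w k x - v x) + B * norm (H k x - G x))"
                using iw by (intro Bochner_Integration.integrable_add integrable_mult_right integrable_norm)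
              fix x
              have "norm ((indicator U x * w k x - v x) *\<^sub>R D x + \<eta> x *\<^sub>R (H k x - G x))
                \<le> norm (indicator U x * w k x - v x) * norm (D x) + \<bar>\<eta> x\<bar> * norm (H k x - G x)"
                using norm_triangle_ineq[of "(indicator U x * w k x - v x) *\<^sub>R D x" "\<eta> x *\<^sub>R (H k x - G x)"] by simp
              also have "\<dots> \<le> norm (indicator U x * w k x - v x) * B + B * norm (H k x - G x)"
                using B by (intro add_mono mult_left_mono mult_right_mono) auto
              finally show "norm ((indicator U x * w k x - v x) *\<^sub>R D x + \<eta> x *\<^sub>R (H k x - G x))
                \<le> B * norm (indicator U x * w k x - v x) + B * norm (H k x - G x)" by (simp add: mult.commute)
            qed
            also have "\<dots> = B * (\<integral>x. norm (indicator U x * w k x - v x) \<partial>lborel) + B * (\<integral>x. norm (H k x - G x) \<partial>lborel)"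
              using iw by (subst Bochner_Integration.integral_add) auto
            finally show ?thesis .
          qed
          then show "\<forall>\<^sub>F k in sequentially. norm (?\<Lambda>k k - ?\<Lambda>)
            \<le> B * (\<integral>x. norm (indicator U x * w k x - v x) \<partial>lborel) + B * (\<integral>x. norm (H k x - G x) \<partial>lborel)" by simp
          have "(\<lambda>k. B * (\<integral>x. norm (indicator U x * w k x - v x) \<partial>lborel) + B * (\<integral>x. norm (H k x - G x) \<partial>lborel)) \<longlonglongrightarrow> B * 0 + B * 0"
            by (intro tendsto_intros L1 L2)
          then show "(\<lambda>k. B * (\<integral>x. norm (indicator U x * w k x - v x) \<partial>lborel) + B * (\<integral>x. norm (H k x - G x) \<partial>lborel)) \<longlonglongrightarrow> 0"
            by simp
        qed
        have b0: "norm ?\<Lambda> \<le> c * \<epsilon>" if \<epsilon>: "0 < \<epsilon>" for \<epsilon>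
        proof (rule Lim_norm_ubound[OF sequentially_bot lim])
          have "\<forall>\<^sub>F k in sequentially. (\<integral>\<^sup>+x\<in>frontier U. ennreal ((w k x)\<^sup>2) \<partial>surface_measure) < ennreal (\<epsilon>\<^sup>2)"
            using \<epsilon> by (intro order_tendstoD(2)[OF w5]) simp
          then show "\<forall>\<^sub>F k in sequentially. norm (?\<Lambda>k k) \<le> c * \<epsilon>"
            by eventually_elim (rule c(2)[OF \<epsilon> w1 w2 less_imp_le])
        qed
        have bound: "norm ?\<Lambda> \<le> c * (\<epsilon> / (c + 1))" if "0 < \<epsilon>" for \<epsilon>
          by (rule b0) (use that c(1) in simp)
        have "norm ?\<Lambda> \<le> 0"
        proof (rule field_le_epsilon)
          fix \<epsilon> :: real assume \<epsilon>: "0 < \<epsilon>"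
          have "c * (\<epsilon> / (c + 1)) \<le> \<epsilon>" using c(1) \<epsilon> by (simp add: field_simps)
          with bound[OF \<epsilon>] show "norm ?\<Lambda> \<le> 0 + \<epsilon>" by linarith
        qed
        then show "?\<Lambda> = 0" by simp
      qed
    qed
  qed
  then have "(\<integral>x. v x *\<^sub>R D x + \<eta> x *\<^sub>R G x \<partial>lborel) = 0" if "C1c UNIV \<eta> D" for \<eta> D
    using zero_test_local_to_global[OF wg_integrable[OF W] _ that] by blast
  then show ?thesis using W unfolding wg_def by blast
qed

subsection \<open>Geometry of the boundary\<close>

text \<open>\<open>Q\<close> is monotone in the constant, so the maximum over a finite subcover
  serves everywhere. It makes constants obtained in single charts uniform along the
  boundary.\<close>

lemma uniform_on_compact:
  fixes S :: "'a::metric_space set" and Q :: "real \<Rightarrow> 'a \<Rightarrow> bool"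
  assumes S: "compact S" and mono: "\<And>C C' p. Q C p \<Longrightarrow> C \<le> C' \<Longrightarrow> Q C' p"
    and loc: "\<And>x0. x0 \<in> S \<Longrightarrow> \<exists>\<rho>>0. \<exists>C. \<forall>p\<in>S \<inter> ball x0 \<rho>. Q C p"
  shows "\<exists>C>0. \<forall>p\<in>S. Q C p"
proof -
  obtain \<rho> where \<rho>: "\<And>x0. x0 \<in> S \<Longrightarrow> 0 < \<rho> x0" "\<And>x0. x0 \<in> S \<Longrightarrow> \<exists>C. \<forall>p\<in>S \<inter> ball x0 (\<rho> x0). Q C p"
    using loc by metis
  then obtain C where C: "\<And>x0 p. x0 \<in> S \<Longrightarrow> p \<in> S \<inter> ball x0 (\<rho> x0) \<Longrightarrow> Q (C x0) p" by metis
  have "S \<subseteq> (\<Union>x\<in>S. ball x (\<rho> x))" using \<rho>(1) by force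
  then obtain I where I: "I \<subseteq> S" "finite I" "S \<subseteq> (\<Union>x\<in>I. ball x (\<rho> x))"
    using compactE_image[OF S, of S "\<lambda>x. ball x (\<rho> x)"] by auto
  define M where "M = Max (insert 1 (C ` I))"
  have M: "1 \<le> M" "\<And>x. x \<in> I \<Longrightarrow> C x \<le> M" using I(2) by (auto simp: M_def)
  have "Q M p" if p: "p \<in> S" for p
  proof -
    obtain x where x: "x \<in> I" "p \<in> ball x (\<rho> x)" using I(3) p by blast
    then show ?thesis using C[of x p] p I(1) mono[OF _ M(2)[OF x(1)]] by blast
  qed
  then show ?thesis using M(1) by (intro exI[of _ M]) auto
qed

lemma smooth_lipschitz:
  fixes f :: "'a::euclidean_space \<Rightarrow> real"
  assumes f: "smooth f"
  shows "\<exists>L\<ge>0. \<forall>x\<in>cball 0 R. \<forall>y\<in>cball 0 R. \<bar>f x - f y\<bar> \<le> L * norm (x - y)"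
proof -
  have "compact (grad f ` cball 0 R)"
    using smooth_continuous_grad[OF f] by (intro compact_continuous_image) (auto intro: continuous_on_subset)
  then obtain L where L: "\<And>x. x \<in> cball 0 R \<Longrightarrow> norm (grad f x) \<le> L"
    using compact_imp_bounded by (fastforce simp: bounded_iff)
  define L' where "L' = max 0 L"
  have "\<bar>f x - f y\<bar> \<le> L' * norm (x - y)" if "x \<in> cball 0 R" "y \<in> cball 0 R" for x y
  proof -
    have "norm (f x - f y) \<le> L' * norm (x - y)"
    proof (rule differentiable_bound[OF convex_cball _ _ that])
      fix z :: 'a assume z: "z \<in> cball 0 R"
      show "(f has_derivative (\<lambda>h. h \<bullet> grad f z)) (at z within cball 0 R)"
        using smooth_GDERIV[OF f, of z] unfolding gderiv_def by (rule has_derivative_at_withinI)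
      show "onorm (\<lambda>h. h \<bullet> grad f z) \<le> L'"
      proof (rule onorm_bound)
        fix h :: 'a
        have "\<bar>h \<bullet> grad f z\<bar> \<le> norm h * norm (grad f z)" by (rule Cauchy_Schwarz_ineq2)
        also have "\<dots> \<le> norm h * L'" using L[OF z] by (intro mult_left_mono) (auto simp: L'_def)
        finally show "norm (h \<bullet> grad f z) \<le> L' * norm h" by (simp add: mult.commute)
      qed (simp add: L'_def)
    qed
    then show ?thesis by simp
  qed
  then show ?thesis by (intro exI[of _ L']) (auto simp: L'_def)
qed

lemma smooth_grad_lipschitz:
  fixes f :: "'a::euclidean_space \<Rightarrow> real"
  assumes f: "smooth f"
  shows "\<exists>L\<ge>0. \<forall>x\<in>cball 0 R. \<forall>y\<in>cball 0 R. norm (grad f x - grad f y) \<le> L * norm (x - y)"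
proof -
  have "\<forall>b\<in>Basis. \<exists>L\<ge>0. \<forall>x\<in>cball 0 R. \<forall>y\<in>cball 0 R.
      \<bar>frechet_derivative f (at x) b - frechet_derivative f (at y) b\<bar> \<le> L * norm (x - y)"
    using smooth_lipschitz[OF smooth_derivative[OF f]] by blast
  then obtain L where L: "\<And>b. b \<in> Basis \<Longrightarrow> 0 \<le> L b" "\<And>b x y. b \<in> Basis \<Longrightarrow> x \<in> cball 0 R \<Longrightarrow> y \<in> cball 0 R \<Longrightarrow>
      \<bar>frechet_derivative f (at x) b - frechet_derivative f (at y) b\<bar> \<le> L b * norm (x - y)" by metis
  have "norm (grad f x - grad f y) \<le> (\<Sum>b\<in>Basis. L b) * norm (x - y)"
    if "x \<in> cball 0 R" "y \<in> cball 0 R" for x y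
  proof -
    have "grad f x - grad f y = (\<Sum>b\<in>Basis. (frechet_derivative f (at x) b - frechet_derivative f (at y) b) *\<^sub>R b)"
      by (simp add: grad_def sum_subtractf algebra_simps)
    also have "norm \<dots> \<le> (\<Sum>b\<in>Basis. L b * norm (x - y))"
      by (rule sum_norm_le) (use L(2) that in auto)
    finally show ?thesis by (simp add: sum_distrib_right)
  qed
  then show ?thesis using L(1) by (intro exI[of _ "\<Sum>b\<in>Basis. L b"]) (auto intro: sum_nonneg)
qed

lemma height_grad_lipschitz:
  fixes e :: "'a::euclidean_space"
  assumes e: "norm e = 1" and \<gamma>: "smooth \<gamma>"
  shows "\<exists>L\<ge>0. \<forall>x\<in>cball 0 R. \<forall>y\<in>cball 0 R. norm (height_grad \<gamma> e x - height_grad \<gamma> e y) \<le> L * norm (x - y)"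
proof -
  obtain L where L: "L \<ge> 0" "\<And>x y. x \<in> cball 0 R \<Longrightarrow> y \<in> cball 0 R \<Longrightarrow> norm (grad \<gamma> x - grad \<gamma> y) \<le> L * norm (x - y)"
    using smooth_grad_lipschitz[OF \<gamma>, of R] by blast
  have "norm (height_grad \<gamma> e x - height_grad \<gamma> e y) \<le> L * norm (x - y)" if "x \<in> cball 0 R" "y \<in> cball 0 R" for x y
  proof -
    have "proj_perp e x \<in> cball 0 R" "proj_perp e y \<in> cball 0 R"
      using that norm_proj_perp_le[OF e] by (auto intro: order_trans)
    note Lxy = L(2)[OF this]
    have "height_grad \<gamma> e x - height_grad \<gamma> e y = proj_perp e (grad \<gamma> (proj_perp e y) - grad \<gamma> (proj_perp e x))"
      by (simp add: height_grad_def proj_perp_diff)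
    also have "norm \<dots> \<le> norm (grad \<gamma> (proj_perp e y) - grad \<gamma> (proj_perp e x))" by (rule norm_proj_perp_le[OF e])
    also have "\<dots> \<le> L * norm (proj_perp e (x - y))" using Lxy by (simp add: norm_minus_commute proj_perp_diff)
    also have "\<dots> \<le> L * norm (x - y)" by (intro mult_left_mono norm_proj_perp_le[OF e] L(1))
    finally show ?thesis .
  qed
  then show ?thesis using L(1) by blast
qed

text \<open>Differentiability is asked for only in the open segment, so that an endpoint may lie on
  the boundary of \<open>U\<close>, where \<open>C11\<close> provides continuity but no
  \<open>GDERIV\<close>.\<close>

lemma linearization_bound:
  fixes f :: "'a::euclidean_space \<Rightarrow> real"
  assumes cont: "continuous_on (closed_segment a b) f"
    and D: "\<And>z. z \<in> open_segment a b \<Longrightarrow> GDERIV f z :> D z"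
    and M: "\<And>z. z \<in> open_segment a b \<Longrightarrow> norm (D z - d) \<le> M"
  shows "\<bar>f b - f a - d \<bullet> (b - a)\<bar> \<le> M * norm (b - a)"
proof (cases "a = b")
  case False
  define \<phi> where "\<phi> = (\<lambda>s::real. f (a + s *\<^sub>R (b - a)) - d \<bullet> (a + s *\<^sub>R (b - a)))"
  have seg: "a + s *\<^sub>R (b - a) \<in> closed_segment a b" if "s \<in> {0..1}" for s
    using that by (auto simp: in_segment algebra_simps)
  have oseg: "a + s *\<^sub>R (b - a) \<in> open_segment a b" if "0 < s" "s < 1" for s
    using that False by (auto simp: in_segment algebra_simps intro!: exI[of _ s])
  have "\<exists>s\<in>{0<..<1}. norm (\<phi> 1 - \<phi> 0) \<le> norm ((1 - 0) *\<^sub>R ((b - a) \<bullet> (D (a + s *\<^sub>R (b - a)) - d)))"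
  proof (rule mvt_general[where f' = "\<lambda>s h. h *\<^sub>R ((b - a) \<bullet> (D (a + s *\<^sub>R (b - a)) - d))"])
    show "continuous_on {0..1} \<phi>" unfolding \<phi>_def
      by (intro continuous_intros continuous_on_compose2[OF cont]) (use seg in auto)
    fix s :: real assume s: "0 < s" "s < 1"
    have 1: "((\<lambda>s. a + s *\<^sub>R (b - a)) has_derivative (\<lambda>h. h *\<^sub>R (b - a))) (at s)"
      by (auto intro!: derivative_eq_intros)
    have "((\<lambda>s. f (a + s *\<^sub>R (b - a))) has_derivative (\<lambda>h. (h *\<^sub>R (b - a)) \<bullet> D (a + s *\<^sub>R (b - a)))) (at s)"
      by (rule has_derivative_compose[OF 1 D[OF oseg[OF s], unfolded gderiv_def]])
    then show "(\<phi> has_derivative (\<lambda>h. h *\<^sub>R ((b - a) \<bullet> (D (a + s *\<^sub>R (b - a)) - d)))) (at s)"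
      unfolding \<phi>_def using 1
      by (auto intro!: derivative_eq_intros simp: algebra_simps inner_commute)
  qed simp
  then obtain s where s: "0 < s" "s < 1" "norm (\<phi> 1 - \<phi> 0) \<le> \<bar>(b - a) \<bullet> (D (a + s *\<^sub>R (b - a)) - d)\<bar>" by auto
  have "\<bar>f b - f a - d \<bullet> (b - a)\<bar> = norm (\<phi> 1 - \<phi> 0)" by (simp add: \<phi>_def inner_diff_right)
  also have "\<dots> \<le> norm (b - a) * norm (D (a + s *\<^sub>R (b - a)) - d)"
    using s(3) Cauchy_Schwarz_ineq2 order_trans by blast
  also have "\<dots> \<le> norm (b - a) * M" using M[OF oseg[OF s(1,2)]] by (intro mult_left_mono) auto
  finally show ?thesis by (simp add: mult.commute)
qed simp

text \<open>The sign of the height decides membership in \<open>U\<close>: openness of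
  \<open>U\<close> excludes a positive value at \<open>p\<close>, and closedness of the set of
  nonnegative heights excludes a negative one.\<close>

lemma frontier_chart_height:
  assumes U: "open U" and \<gamma>: "smooth \<gamma>"
    and chart: "U \<inter> ball x0 r = {x \<in> ball x0 r. \<gamma> (x - (x \<bullet> e) *\<^sub>R e) < x \<bullet> e}"
    and p: "p \<in> frontier U" "p \<in> ball x0 r"
  shows "height \<gamma> e p = 0"
proof (rule antisym)
  have "p \<notin> U" using p(1) U by (simp add: frontier_def interior_open)
  then show "height \<gamma> e p \<le> 0" using chart_height[OF chart p(2)] by simp
  have "p \<in> closure (U \<inter> ball x0 r)"
    using p open_Int_closure_subset[OF open_ball, of x0 r U] by (auto simp: frontier_def Int_commute)
  moreover have "closed {x. 0 \<le> height \<gamma> e x}"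
    by (intro closed_Collect_le continuous_intros continuous_height[OF \<gamma>])
  moreover have "U \<inter> ball x0 r \<subseteq> {x. 0 \<le> height \<gamma> e x}" using chart_height[OF chart] by auto
  ultimately show "0 \<le> height \<gamma> e p" using closure_minimal by blast
qed

text \<open>The inequality says that the open ball of radius 1/(2 K) touching at \<open>p\<close>
  from the side of -\<nu> misses \<open>closure U\<close>. It is the second order Taylor bound for
  the height, which is 0 at \<open>p\<close>, positive in \<open>U\<close> near \<open>p\<close> and
  has a Lipschitz gradient; \<nu> is its normalised gradient.\<close>

lemma exterior_ball:
  fixes U :: "'a::euclidean_space set"
  assumes U: "open U" "bounded U" "smooth_boundary U"
  shows "\<exists>K>0. \<forall>p\<in>frontier U. \<exists>\<nu>. norm \<nu> = 1 \<and> (\<forall>x\<in>closure U. - K * (norm (x - p))\<^sup>2 \<le> (x - p) \<bullet> \<nu>)"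
proof (rule uniform_on_compact)
  show "compact (frontier U)" using U(2) by (rule compact_frontier_bounded)
  show "\<exists>\<nu>. norm \<nu> = 1 \<and> (\<forall>x\<in>closure U. - C' * (norm (x - p))\<^sup>2 \<le> (x - p) \<bullet> \<nu>)"
    if "\<exists>\<nu>. norm \<nu> = 1 \<and> (\<forall>x\<in>closure U. - C * (norm (x - p))\<^sup>2 \<le> (x - p) \<bullet> \<nu>)" "C \<le> C'" for C C' p
  proof -
    have "- C' * (norm (x - p))\<^sup>2 \<le> - C * (norm (x - p))\<^sup>2" for x
      using that(2) by (intro mult_right_mono) auto
    then show ?thesis using that(1) order_trans by blast
  qed
  fix x0 assume "x0 \<in> frontier U"
  then obtain r e \<gamma> where r: "r > 0" and e: "norm e = 1" and \<gamma>: "smooth \<gamma>"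
    and chart: "U \<inter> ball x0 r = {x \<in> ball x0 r. \<gamma> (x - (x \<bullet> e) *\<^sub>R e) < x \<bullet> e}"
    using U(3) unfolding smooth_boundary_def by blast
  let ?t = "height \<gamma> e" and ?Dt = "height_grad \<gamma> e"
  obtain L where L: "L \<ge> 0" "\<And>x y. x \<in> cball 0 (norm x0 + r) \<Longrightarrow> y \<in> cball 0 (norm x0 + r) \<Longrightarrow> norm (?Dt x - ?Dt y) \<le> L * norm (x - y)"
    using height_grad_lipschitz[OF e \<gamma>, of "norm x0 + r"] by blast
  have inball: "x \<in> cball 0 (norm x0 + r)" if "x \<in> ball x0 r" for x
    using that norm_triangle_sub[of x x0] by (simp add: dist_norm norm_minus_commute)
  \<comment> \<open>\<open>2 / r\<close> handles points outside the chart ball: their distance from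
    \<open>p\<close> is at least r/2, so the quadratic term is at least \<bar>x - p\<bar>.\<close>
  define C where "C = max L (2 / r)"
  show "\<exists>\<rho>>0. \<exists>C. \<forall>p\<in>frontier U \<inter> ball x0 \<rho>. \<exists>\<nu>. norm \<nu> = 1 \<and> (\<forall>x\<in>closure U. - C * (norm (x - p))\<^sup>2 \<le> (x - p) \<bullet> \<nu>)"
  proof (rule exI[of _ "r / 2"], intro exI[of _ C] conjI ballI)
    fix p assume "p \<in> frontier U \<inter> ball x0 (r / 2)"
    then have p: "p \<in> frontier U" "p \<in> ball x0 r" "dist x0 p < r / 2" using r by auto
    have tp: "?t p = 0" by (rule frontier_chart_height[OF U(1) \<gamma> chart p(1,2)])
    have ee: "e \<bullet> e = 1" using e by (simp add: dot_square_norm)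
    have "?Dt p \<bullet> e = 1"
      by (simp add: height_grad_def proj_perp_def inner_diff_left ee)
    then have nD: "1 \<le> norm (?Dt p)" using Cauchy_Schwarz_ineq2[of "?Dt p" e] e by simp
    define \<nu> where "\<nu> = (1 / norm (?Dt p)) *\<^sub>R ?Dt p"
    have "closed {x. - C * (norm (x - p))\<^sup>2 \<le> (x - p) \<bullet> \<nu>}"
      by (intro closed_Collect_le continuous_intros)
    moreover have "U \<subseteq> {x. - C * (norm (x - p))\<^sup>2 \<le> (x - p) \<bullet> \<nu>}"
    proof
      fix x assume x: "x \<in> U"
      have "- C * (norm (x - p))\<^sup>2 \<le> (x - p) \<bullet> \<nu>"
      proof (cases "x \<in> ball x0 r")
        case True
        have tx: "0 < ?t x" using chart_height[OF chart True] x by simp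
        have seg: "z \<in> ball x0 r" "norm (z - p) \<le> norm (x - p)" if "z \<in> open_segment p x" for z
        proof -
          have zc: "z \<in> closed_segment p x" using that by (simp add: open_segment_def)
          then show "z \<in> ball x0 r"
            using closed_segment_subset[OF p(2) True convex_ball] by blast
          show "norm (z - p) \<le> norm (x - p)" using segment_bound(1)[OF zc] by simp
        qed
        have "\<bar>?t x - ?t p - ?Dt p \<bullet> (x - p)\<bar> \<le> (L * norm (x - p)) * norm (x - p)"
        proof (rule linearization_bound[OF _ GDERIV_height[OF \<gamma>]])
          show "continuous_on (closed_segment p x) ?t" using continuous_height[OF \<gamma>] continuous_on_subset by blast
          fix z assume z: "z \<in> open_segment p x"
          have "norm (?Dt z - ?Dt p) \<le> L * norm (z - p)" by (rule L(2)[OF inball[OF seg(1)[OF z]] inball[OF p(2)]])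
          also have "\<dots> \<le> L * norm (x - p)" by (intro mult_left_mono seg(2)[OF z] L(1))
          finally show "norm (?Dt z - ?Dt p) \<le> L * norm (x - p)" .
        qed
        then have "- L * (norm (x - p))\<^sup>2 \<le> ?Dt p \<bullet> (x - p)" using tx tp by (simp add: power2_eq_square abs_le_iff)
        then have "(- L * (norm (x - p))\<^sup>2) / norm (?Dt p) \<le> (?Dt p \<bullet> (x - p)) / norm (?Dt p)"
          by (rule divide_right_mono) simp
        also have "\<dots> = (x - p) \<bullet> \<nu>" by (simp add: \<nu>_def inner_commute)
        finally have 1: "- (L * (norm (x - p))\<^sup>2 / norm (?Dt p)) \<le> (x - p) \<bullet> \<nu>" by simp
        have "L * (norm (x - p))\<^sup>2 / norm (?Dt p) \<le> L * (norm (x - p))\<^sup>2 / 1"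
          using nD L(1) by (intro divide_left_mono) auto
        also have "\<dots> \<le> C * (norm (x - p))\<^sup>2" by (simp add: C_def mult_right_mono)
        finally show ?thesis using 1 by simp
      next
        case False
        then have "r / 2 \<le> norm (x - p)"
          using p(3) dist_triangle[of x0 x p] by (simp add: dist_norm norm_minus_commute)
        then have "1 \<le> 2 / r * norm (x - p)" using r by (simp add: field_simps)
        also have "\<dots> \<le> C * norm (x - p)" by (intro mult_right_mono) (auto simp: C_def)
        finally have "norm (x - p) * 1 \<le> norm (x - p) * (C * norm (x - p))" by (rule mult_left_mono) simp
        moreover have "norm \<nu> = 1" using nD by (auto simp: \<nu>_def)
        then have "- norm (x - p) \<le> (x - p) \<bullet> \<nu>" using Cauchy_Schwarz_ineq2[of "x - p" \<nu>] by simp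
        ultimately show ?thesis by (simp add: power2_eq_square mult_ac)
      qed
      then show "x \<in> {x. - C * (norm (x - p))\<^sup>2 \<le> (x - p) \<bullet> \<nu>}" by simp
    qed
    ultimately have "closure U \<subseteq> {x. - C * (norm (x - p))\<^sup>2 \<le> (x - p) \<bullet> \<nu>}" by (rule closure_minimal[rotated])
    moreover have "norm \<nu> = 1" using nD by (auto simp: \<nu>_def)
    ultimately show "\<exists>\<nu>. norm \<nu> = 1 \<and> (\<forall>x\<in>closure U. - C * (norm (x - p))\<^sup>2 \<le> (x - p) \<bullet> \<nu>)" by blast
  qed (use r in simp)
qed

text \<open>As \<open>U\<close> need not be convex, \<open>g\<close> is compared along a path that leaves the boundary in the
  direction of the chart axis, runs parallel to the chord, and returns.\<close>
lemma C11_boundary_taylor: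
  fixes U :: "'a::euclidean_space set"
  assumes U: "open U" "bounded U" "smooth_boundary U"
    and g: "continuous_on (closure U) g" and G: "\<And>x. x \<in> U \<Longrightarrow> GDERIV g x :> G x" and L: "L-lipschitz_on (closure U) G"
  shows "\<exists>C>0. \<forall>p\<in>frontier U. \<forall>x\<in>frontier U. \<bar>g x - g p - G p \<bullet> (x - p)\<bar> \<le> C * (norm (x - p))\<^sup>2"
proof (rule uniform_on_compact)
  show "compact (frontier U)" using U(2) by (rule compact_frontier_bounded)
  show "\<forall>x\<in>frontier U. \<bar>g x - g p - G p \<bullet> (x - p)\<bar> \<le> C' * (norm (x - p))\<^sup>2"
    if "\<forall>x\<in>frontier U. \<bar>g x - g p - G p \<bullet> (x - p)\<bar> \<le> C * (norm (x - p))\<^sup>2" "C \<le> C'" for C C' p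
  proof -
    have "C * (norm (x - p))\<^sup>2 \<le> C' * (norm (x - p))\<^sup>2" for x using that(2) by (intro mult_right_mono) auto
    then show ?thesis using that(1) order_trans by blast
  qed
  have fc: "frontier U \<subseteq> closure U" by (simp add: frontier_def)
  have L0: "0 \<le> L" using L by (rule lipschitz_on_nonneg)
  have LG: "norm (G x - G y) \<le> L * norm (x - y)" if "x \<in> closure U" "y \<in> closure U" for x y
    using lipschitz_onD[OF L that] by (simp add: dist_norm)
  have cc: "compact (closure U)" using U(2) by (simp add: compact_closure)
  obtain Mg where Mg: "\<And>x. x \<in> closure U \<Longrightarrow> \<bar>g x\<bar> \<le> Mg"
    using compact_imp_bounded[OF compact_continuous_image[OF g cc]] by (fastforce simp: bounded_iff)
  obtain MG where MG: "\<And>x. x \<in> closure U \<Longrightarrow> norm (G x) \<le> MG"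
    using compact_imp_bounded[OF compact_continuous_image[OF lipschitz_on_continuous_on[OF L] cc]]
    by (fastforce simp: bounded_iff)
  fix x0 assume "x0 \<in> frontier U"
  then obtain r e \<gamma> where r: "r > 0" and e: "norm e = 1" and \<gamma>: "smooth \<gamma>"
    and chart: "U \<inter> ball x0 r = {x \<in> ball x0 r. \<gamma> (x - (x \<bullet> e) *\<^sub>R e) < x \<bullet> e}"
    using U(3) unfolding smooth_boundary_def by blast
  let ?t = "height \<gamma> e"
  obtain \<Lambda> where \<Lambda>: "\<Lambda> \<ge> 0" "\<And>x y. x \<in> cball 0 (norm x0 + r) \<Longrightarrow> y \<in> cball 0 (norm x0 + r) \<Longrightarrow> \<bar>\<gamma> x - \<gamma> y\<bar> \<le> \<Lambda> * norm (x - y)"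
    using smooth_lipschitz[OF \<gamma>, of "norm x0 + r"] by blast
  have tlip: "\<bar>?t x - ?t y\<bar> \<le> (\<Lambda> + 1) * norm (x - y)" if "x \<in> ball x0 r" "y \<in> ball x0 r" for x y
  proof -
    have in': "proj_perp e x \<in> cball 0 (norm x0 + r)" if "x \<in> ball x0 r" for x
      using that norm_triangle_sub[of x x0] norm_proj_perp_le[OF e, of x] by (simp add: dist_norm norm_minus_commute)
    have "\<bar>?t x - ?t y\<bar> \<le> \<bar>(x - y) \<bullet> e\<bar> + \<bar>\<gamma> (proj_perp e x) - \<gamma> (proj_perp e y)\<bar>"
      by (simp add: height_def inner_diff_left)
    also have "\<dots> \<le> norm (x - y) + \<Lambda> * norm (x - y)"
    proof (intro add_mono)
      show "\<bar>(x - y) \<bullet> e\<bar> \<le> norm (x - y)" using Cauchy_Schwarz_ineq2[of "x - y" e] e by simp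
      have "\<bar>\<gamma> (proj_perp e x) - \<gamma> (proj_perp e y)\<bar> \<le> \<Lambda> * norm (proj_perp e (x - y))"
        using \<Lambda>(2)[OF in'[OF that(1)] in'[OF that(2)]] by (simp add: proj_perp_diff)
      also have "\<dots> \<le> \<Lambda> * norm (x - y)" by (intro mult_left_mono norm_proj_perp_le[OF e] \<Lambda>(1))
      finally show "\<bar>\<gamma> (proj_perp e x) - \<gamma> (proj_perp e y)\<bar> \<le> \<Lambda> * norm (x - y)" .
    qed
    finally show ?thesis by (simp add: algebra_simps)
  qed
  \<comment> \<open>Along the chord the height drops by at most (\<Lambda> + 1) times its length, so
    lifting by \<Lambda> + 2 times that length keeps the path in \<open>U\<close>.\<close>
  define \<kappa> where "\<kappa> = \<Lambda> + 2"
  have \<kappa>: "2 \<le> \<kappa>" using \<Lambda>(1) by (simp add: \<kappa>_def)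
  \<comment> \<open>The path stays within (\<kappa> + 1) d of \<open>p\<close>, where d < 2\<rho>,
    and \<open>p\<close> is within \<rho> of \<open>x0\<close>; altogether \<rho> (3 + 2\<kappa>) =
    r.\<close>
  define \<rho> where "\<rho> = r / (3 + 2 * \<kappa>)"
  have \<rho>: "0 < \<rho>" "\<rho> * (3 + 2 * \<kappa>) = r" using r \<kappa> by (auto simp: \<rho>_def)
  \<comment> \<open>First entry, for nearby points: the Lipschitz constant of \<open>G\<close> times
    the distance of the path from \<open>p\<close> times its length. Second entry: crude bounds on
    \<open>g\<close> and \<open>G\<close> for points at distance at least \<rho>/2.\<close>
  define C where "C = max ((2 * \<kappa> + 1) * (L * (\<kappa> + 1))) (8 * max 0 Mg / \<rho>\<^sup>2 + 2 * max 0 MG / \<rho>)"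
  have near: "\<bar>g x - g p - G p \<bullet> (x - p)\<bar> \<le> (2 * \<kappa> + 1) * (L * (\<kappa> + 1)) * (norm (x - p))\<^sup>2"
    if p: "p \<in> frontier U" "p \<in> ball x0 \<rho>" and x: "x \<in> frontier U" "x \<in> ball x0 \<rho>" for p x
  proof (cases "x = p")
    case False
    define d where "d = norm (x - p)"
    have d: "0 < d" "d < 2 * \<rho>"
    proof -
      show "0 < d" using False by (simp add: d_def)
      have "dist x p < \<rho> + \<rho>" using p(2) x(2) dist_triangle2[of x p x0] by (simp add: dist_commute)
      then show "d < 2 * \<rho>" by (simp add: d_def dist_norm)
    qed
    define \<tau> where "\<tau> = \<kappa> * d"
    have \<tau>: "0 < \<tau>" using \<kappa> d by (simp add: \<tau>_def)
    have inb: "z \<in> ball x0 r" if "norm (z - p) \<le> \<tau> + d" for z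
    proof -
      have "dist x0 z \<le> dist x0 p + dist p z" by (rule dist_triangle)
      also have "\<dots> < \<rho> + (\<tau> + d)" using p(2) that by (simp add: dist_norm norm_minus_commute)
      also have "\<tau> + d = (\<kappa> + 1) * d" by (simp add: \<tau>_def algebra_simps)
      also have "\<rho> + (\<kappa> + 1) * d \<le> \<rho> + (\<kappa> + 1) * (2 * \<rho>)" using d \<kappa> by (intro add_left_mono mult_left_mono) auto
      also have "\<dots> = r" using \<rho>(2) by (simp add: algebra_simps)
      finally show ?thesis by simp
    qed
    have pr: "p \<in> ball x0 r" using inb[of p] \<tau> d by simp
    have xr: "x \<in> ball x0 r" using inb[of x] \<tau> by (simp add: d_def)
    have tp: "?t p = 0" by (rule frontier_chart_height[OF U(1) \<gamma> chart p(1) pr])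
    have tx: "?t x = 0" by (rule frontier_chart_height[OF U(1) \<gamma> chart x(1) xr])
    have up: "y + s *\<^sub>R e \<in> U" "norm (y + s *\<^sub>R e - p) \<le> \<tau> + d"
      if y: "y = p \<or> y = x" and s: "0 < s" "s \<le> \<tau>" for y s
    proof -
      have "norm (y + s *\<^sub>R e - p) \<le> norm (y - p) + norm (s *\<^sub>R e)"
        using norm_triangle_ineq[of "y - p" "s *\<^sub>R e"] by (simp add: algebra_simps)
      also have "\<dots> \<le> d + \<tau>"
      proof (rule add_mono)
        show "norm (y - p) \<le> d" using y by (auto simp: d_def)
        show "norm (s *\<^sub>R e) \<le> \<tau>" using s e by simp
      qed
      also have "d + \<tau> = \<tau> + d" by simp
      finally show n: "norm (y + s *\<^sub>R e - p) \<le> \<tau> + d" .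
      have "?t (y + s *\<^sub>R e) = s" using y tp tx height_add_axis[OF e, of \<gamma>] by auto
      then show "y + s *\<^sub>R e \<in> U" using chart_height[OF chart inb[OF n]] s by simp
    qed
    have mid: "z \<in> U \<and> norm (z - p) \<le> \<tau> + d" if z: "z \<in> closed_segment (p + \<tau> *\<^sub>R e) (x + \<tau> *\<^sub>R e)" for z
    proof -
      obtain s where s: "0 \<le> s" "s \<le> 1" "z = (1 - s) *\<^sub>R (p + \<tau> *\<^sub>R e) + s *\<^sub>R (x + \<tau> *\<^sub>R e)"
        using z by (auto simp: in_segment)
      define y where "y = p + s *\<^sub>R (x - p)"
      have zy: "z = y + \<tau> *\<^sub>R e" by (simp add: s(3) y_def algebra_simps)
      have yp: "norm (y - p) \<le> d" using s by (simp add: y_def d_def mult_left_le_one_le)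
      have "norm (z - p) \<le> norm (y - p) + norm (\<tau> *\<^sub>R e)"
        unfolding zy using norm_triangle_ineq[of "y - p" "\<tau> *\<^sub>R e"] by (simp add: algebra_simps)
      then have n: "norm (z - p) \<le> \<tau> + d" using yp e \<tau> by simp
      have "\<bar>?t y - ?t p\<bar> \<le> (\<Lambda> + 1) * norm (y - p)"
        by (rule tlip[OF inb pr]) (use yp \<tau> in simp)
      also have "\<dots> \<le> (\<Lambda> + 1) * d" using yp \<Lambda>(1) by (intro mult_left_mono) auto
      finally have "- ((\<Lambda> + 1) * d) \<le> ?t y" using tp by simp
      moreover have "?t z = ?t y + \<tau>" unfolding zy by (rule height_add_axis[OF e])
      ultimately have "0 < ?t z" using d(1) by (simp add: \<tau>_def \<kappa>_def algebra_simps)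
      then show ?thesis using chart_height[OF chart inb[OF n]] n by simp
    qed
    have vert: "z \<in> U \<and> norm (z - p) \<le> \<tau> + d" if y: "y = p \<or> y = x" and z: "z \<in> open_segment y (y + \<tau> *\<^sub>R e)" for y z
    proof -
      obtain s where s: "0 < s" "s < 1" "z = (1 - s) *\<^sub>R y + s *\<^sub>R (y + \<tau> *\<^sub>R e)"
        using z by (auto simp: in_segment)
      have "z = y + (s * \<tau>) *\<^sub>R e" by (simp add: s(3) algebra_simps)
      then show ?thesis using up[OF y, of "s * \<tau>"] s \<tau> by (simp add: mult_left_le_one_le)
    qed
    have MGz: "norm (G z - G p) \<le> L * (\<tau> + d)" if "z \<in> U \<and> norm (z - p) \<le> \<tau> + d" for z
    proof -
      have "norm (G z - G p) \<le> L * norm (z - p)" using that p(1) fc closure_subset by (intro LG) auto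
      also have "\<dots> \<le> L * (\<tau> + d)" using that by (intro mult_left_mono L0) auto
      finally show ?thesis .
    qed
    have s1: "\<bar>g (y + \<tau> *\<^sub>R e) - g y - G p \<bullet> (y + \<tau> *\<^sub>R e - y)\<bar> \<le> L * (\<tau> + d) * norm (y + \<tau> *\<^sub>R e - y)"
      if y: "y = p \<or> y = x" for y
    proof (rule linearization_bound)
      have "closed_segment y (y + \<tau> *\<^sub>R e) \<subseteq> closure U"
      proof
        fix z assume "z \<in> closed_segment y (y + \<tau> *\<^sub>R e)"
        then have "z \<in> open_segment y (y + \<tau> *\<^sub>R e) \<or> z = y \<or> z = y + \<tau> *\<^sub>R e"
          by (auto simp: open_segment_def)
        moreover have "y \<in> closure U" using y p(1) x(1) fc by auto
        moreover have "y + \<tau> *\<^sub>R e \<in> U" using up(1)[OF y \<tau>] by simp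
        ultimately show "z \<in> closure U" using vert[OF y] closure_subset by blast
      qed
      then show "continuous_on (closed_segment y (y + \<tau> *\<^sub>R e)) g" by (rule continuous_on_subset[OF g])
    qed (use vert[OF y] G MGz in auto)
    have s2: "\<bar>g (x + \<tau> *\<^sub>R e) - g (p + \<tau> *\<^sub>R e) - G p \<bullet> (x + \<tau> *\<^sub>R e - (p + \<tau> *\<^sub>R e))\<bar>
        \<le> L * (\<tau> + d) * norm (x + \<tau> *\<^sub>R e - (p + \<tau> *\<^sub>R e))"
    proof (rule linearization_bound)
      show "continuous_on (closed_segment (p + \<tau> *\<^sub>R e) (x + \<tau> *\<^sub>R e)) g"
        by (rule continuous_on_subset[OF g]) (use mid closure_subset in blast)
    qed (use mid G MGz in \<open>auto simp: open_segment_def\<close>)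
    \<comment> \<open>The linear contributions of the two vertical pieces cancel, as one is
      traversed upwards and the other downwards; the error is summed over the total length 2\<tau> +
      d.\<close>
    have "\<bar>g x - g p - G p \<bullet> (x - p)\<bar> \<le> L * (\<tau> + d) * (\<tau> + d + \<tau>)"
    proof -
      have n: "norm (\<tau> *\<^sub>R e) = \<tau>" using e \<tau> by simp
      have 1: "\<bar>g (p + \<tau> *\<^sub>R e) - g p - G p \<bullet> (\<tau> *\<^sub>R e)\<bar> \<le> L * (\<tau> + d) * \<tau>" using s1[of p] n by simp
      have 2: "\<bar>g (x + \<tau> *\<^sub>R e) - g x - G p \<bullet> (\<tau> *\<^sub>R e)\<bar> \<le> L * (\<tau> + d) * \<tau>" using s1[of x] n by simp
      have 3: "\<bar>g (x + \<tau> *\<^sub>R e) - g (p + \<tau> *\<^sub>R e) - G p \<bullet> (x - p)\<bar> \<le> L * (\<tau> + d) * d" using s2 by (simp add: d_def)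
      have "L * (\<tau> + d) * (\<tau> + d + \<tau>) = L * (\<tau> + d) * \<tau> + L * (\<tau> + d) * d + L * (\<tau> + d) * \<tau>" by (simp only: distrib_left)
      with 1 2 3 show ?thesis by linarith
    qed
    also have "\<dots> = (2 * \<kappa> + 1) * (L * (\<kappa> + 1)) * (norm (x - p))\<^sup>2"
      unfolding \<tau>_def d_def[symmetric] by (simp add: power2_eq_square algebra_simps)
    finally show ?thesis .
  qed simp
  show "\<exists>\<rho>>0. \<exists>C. \<forall>p\<in>frontier U \<inter> ball x0 \<rho>. \<forall>x\<in>frontier U. \<bar>g x - g p - G p \<bullet> (x - p)\<bar> \<le> C * (norm (x - p))\<^sup>2"
  proof (rule exI[of _ "\<rho> / 2"], intro exI[of _ C] conjI ballI)
    fix p x assume "p \<in> frontier U \<inter> ball x0 (\<rho> / 2)" and x: "x \<in> frontier U"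
    then have p: "p \<in> frontier U" "dist x0 p < \<rho> / 2" "p \<in> ball x0 \<rho>" using \<rho>(1) by auto
    show "\<bar>g x - g p - G p \<bullet> (x - p)\<bar> \<le> C * (norm (x - p))\<^sup>2"
    proof (cases "x \<in> ball x0 \<rho>")
      case True
      have "(2 * \<kappa> + 1) * (L * (\<kappa> + 1)) * (norm (x - p))\<^sup>2 \<le> C * (norm (x - p))\<^sup>2"
        by (intro mult_right_mono) (auto simp: C_def)
      with near[OF p(1,3) x True] show ?thesis by linarith
    next
      case False
      define d where "d = norm (x - p)"
      have d: "\<rho> / 2 \<le> d" using False p(2) dist_triangle[of x0 x p] by (simp add: d_def dist_norm norm_minus_commute)
      have d1: "1 \<le> 2 * d / \<rho>" using d \<rho>(1) by (simp add: field_simps)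
      have d2: "1 \<le> 4 * d\<^sup>2 / \<rho>\<^sup>2"
        using power_mono[OF d1, of 2] by (simp add: power_divide power_mult_distrib)
      have "\<bar>g x - g p - G p \<bullet> (x - p)\<bar> \<le> \<bar>g x\<bar> + \<bar>g p\<bar> + \<bar>G p \<bullet> (x - p)\<bar>" by linarith
      also have "\<dots> \<le> max 0 Mg + max 0 Mg + max 0 MG * d"
      proof (intro add_mono)
        show "\<bar>g x\<bar> \<le> max 0 Mg" using Mg[of x] x fc by (auto intro: max.coboundedI2)
        show "\<bar>g p\<bar> \<le> max 0 Mg" using Mg[of p] p(1) fc by (auto intro: max.coboundedI2)
        have "\<bar>G p \<bullet> (x - p)\<bar> \<le> norm (G p) * d" unfolding d_def by (rule Cauchy_Schwarz_ineq2)
        also have "\<dots> \<le> max 0 MG * d"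
          using MG[of p] p(1) fc by (intro mult_right_mono) (auto simp: d_def intro: max.coboundedI2)
        finally show "\<bar>G p \<bullet> (x - p)\<bar> \<le> max 0 MG * d" .
      qed
      also have "\<dots> \<le> 2 * max 0 Mg * (4 * d\<^sup>2 / \<rho>\<^sup>2) + max 0 MG * d * (2 * d / \<rho>)"
      proof -
        have "2 * max 0 Mg * 1 \<le> 2 * max 0 Mg * (4 * d\<^sup>2 / \<rho>\<^sup>2)" by (intro mult_left_mono d2) simp
        moreover have "max 0 MG * d * 1 \<le> max 0 MG * d * (2 * d / \<rho>)" by (intro mult_left_mono d1) (simp add: d_def)
        ultimately show ?thesis by linarith
      qed
      also have "\<dots> = (8 * max 0 Mg / \<rho>\<^sup>2 + 2 * max 0 MG / \<rho>) * d\<^sup>2"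
        by (simp add: power2_eq_square algebra_simps)
      also have "\<dots> \<le> C * d\<^sup>2" by (intro mult_right_mono) (auto simp: C_def)
      finally show ?thesis by (simp add: d_def)
    qed
  qed (use \<rho>(1) in simp)
qed

subsection \<open>Barriers\<close>

text \<open>Second derivatives are encoded by the gradients \<open>E b\<close> of the components of
  \<open>D\<close>, so that the sum over the basis is the Laplacian. Regularity on the whole space
  lets the components of \<open>D\<close> serve directly in \<open>wg_test_field\<close>.\<close>

definition superharmonic_on :: "'a::euclidean_space set \<Rightarrow> ('a \<Rightarrow> real) \<Rightarrow> ('a \<Rightarrow> 'a) \<Rightarrow> bool" where
  "superharmonic_on U w D \<longleftrightarrow> (\<forall>x. GDERIV w x :> D x) \<and> continuous_on UNIV D \<and>
     (\<exists>E. (\<forall>b x. GDERIV (\<lambda>x. D x \<bullet> b) x :> E b x) \<and> (\<forall>b. continuous_on UNIV (E b)) \<and>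
       (\<forall>x\<in>U. (\<Sum>b\<in>Basis. E b x \<bullet> b) \<le> 0))"

text \<open>The affine part is harmonic, and the Laplacian of the rest is 2 M \<alpha> times the
  exponential times n - 2 \<alpha> \<bar>x - z\<bar>^2, with n the dimension.\<close>

lemma hopf_superharmonic:
  fixes z c :: "'a::euclidean_space"
  assumes M: "0 \<le> M" and \<alpha>: "0 < \<alpha>" and U: "\<And>x. x \<in> U \<Longrightarrow> real DIM('a) \<le> 2 * \<alpha> * ((x - z) \<bullet> (x - z))"
  shows "superharmonic_on U (\<lambda>x. a + c \<bullet> (x - p) + M * (1 - exp (- \<alpha> * ((x - z) \<bullet> (x - z) - s))))
    (\<lambda>x. c + (2 * M * \<alpha> * exp (- \<alpha> * ((x - z) \<bullet> (x - z) - s))) *\<^sub>R (x - z))"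
proof -
  let ?e = "\<lambda>x. exp (- \<alpha> * ((x - z) \<bullet> (x - z) - s))"
  have e: "(?e has_derivative (\<lambda>h. ?e x * (- \<alpha> * (2 * (h \<bullet> (x - z)))))) (at x)" for x
    by (auto intro!: derivative_eq_intros simp: inner_commute)
  define E where "E = (\<lambda>b x. (2 * M * \<alpha> * ?e x) *\<^sub>R (b - (2 * \<alpha> * ((x - z) \<bullet> b)) *\<^sub>R (x - z)))"
  have 1: "GDERIV (\<lambda>x. a + c \<bullet> (x - p) + M * (1 - ?e x)) x :> c + (2 * M * \<alpha> * ?e x) *\<^sub>R (x - z)" for x
    unfolding gderiv_def
    by (rule derivative_eq_intros e refl | simp)+ (simp add: fun_eq_iff inner_add_right inner_commute algebra_simps)
  have 2: "GDERIV (\<lambda>x. (c + (2 * M * \<alpha> * ?e x) *\<^sub>R (x - z)) \<bullet> b) x :> E b x" for b x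
    unfolding gderiv_def inner_add_left inner_scaleR_left
    by (rule derivative_eq_intros e refl | simp)+
      (simp add: fun_eq_iff E_def inner_diff_right inner_commute algebra_simps)
  have 3: "(\<Sum>b\<in>Basis. E b x \<bullet> b) \<le> 0" if "x \<in> U" for x
  proof -
    have "(\<Sum>b\<in>Basis. E b x \<bullet> b) = (2 * M * \<alpha> * ?e x) * (\<Sum>b\<in>Basis. (b - (2 * \<alpha> * ((x - z) \<bullet> b)) *\<^sub>R (x - z)) \<bullet> b)"
      by (simp add: E_def sum_distrib_left)
    also have "(\<Sum>b\<in>Basis. (b - (2 * \<alpha> * ((x - z) \<bullet> b)) *\<^sub>R (x - z)) \<bullet> b)
        = (\<Sum>b\<in>Basis. 1 - 2 * \<alpha> * (((x - z) \<bullet> b) * ((x - z) \<bullet> b)))"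
      by (intro sum.cong refl) (simp add: inner_diff_left inner_same_Basis)
    also have "\<dots> = real DIM('a) - 2 * \<alpha> * ((x - z) \<bullet> (x - z))"
      unfolding euclidean_inner[of "x - z" "x - z"] by (simp add: sum_subtractf sum_distrib_left)
    finally show ?thesis using U[OF that] M \<alpha> by (simp add: mult_nonneg_nonpos)
  qed
  have 4: "continuous_on UNIV (E b)" for b unfolding E_def by (intro continuous_intros)
  have 5: "continuous_on UNIV (\<lambda>x. c + (2 * M * \<alpha> * ?e x) *\<^sub>R (x - z))" by (intro continuous_intros)
  show ?thesis unfolding superharmonic_on_def using 1 2 3 4 5 by blast
qed

text \<open>The barrier is the affine part of \<open>g\<close> at \<open>p\<close> plus a Hopf function of the exterior ball; the latter
  dominates both $|x - p|^2$ and the distance to the boundary.\<close>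
lemma barrier_exists:
  fixes U :: "'a::euclidean_space set"
  assumes U: "open U" "bounded U" "smooth_boundary U" and \<phi>: "\<phi> \<in> C01 U" and g: "g \<in> C11 U"
    and \<phi>g: "\<And>x. x \<in> frontier U \<Longrightarrow> \<phi> x \<le> g x"
  shows "\<exists>C\<ge>0. \<forall>p\<in>frontier U. \<exists>w D. superharmonic_on U w D \<and> (\<forall>x\<in>U. \<phi> x \<le> w x) \<and>
    (\<forall>x\<in>frontier U. g x \<le> w x) \<and> (\<forall>x\<in>U. w x \<le> g p + C * norm (x - p))"
proof -
  obtain G LG where gc: "continuous_on (closure U) g" and G: "\<And>x. x \<in> U \<Longrightarrow> GDERIV g x :> G x"
    and LG: "LG-lipschitz_on (closure U) G" using g unfolding C11_def by blast
  obtain L\<phi> where L\<phi>: "L\<phi>-lipschitz_on (closure U) \<phi>" using \<phi> unfolding C01_def by blast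
  have L0: "0 \<le> L\<phi>" using L\<phi> by (rule lipschitz_on_nonneg)
  obtain Cg where Cg: "Cg > 0" "\<And>p x. p \<in> frontier U \<Longrightarrow> x \<in> frontier U \<Longrightarrow> \<bar>g x - g p - G p \<bullet> (x - p)\<bar> \<le> Cg * (norm (x - p))\<^sup>2"
    using C11_boundary_taylor[OF U gc G LG] by blast
  obtain K where K: "K > 0" "\<And>p. p \<in> frontier U \<Longrightarrow> \<exists>\<nu>. norm \<nu> = 1 \<and> (\<forall>x\<in>closure U. - K * (norm (x - p))\<^sup>2 \<le> (x - p) \<bullet> \<nu>)"
    using exterior_ball[OF U] by blast
  have fc: "frontier U \<subseteq> closure U" by (simp add: frontier_def)
  have cc: "compact (closure U)" using U(2) by (simp add: compact_closure)
  obtain MG0 where "\<And>x. x \<in> closure U \<Longrightarrow> norm (G x) \<le> MG0"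
    using compact_imp_bounded[OF compact_continuous_image[OF lipschitz_on_continuous_on[OF LG] cc]]
    by (fastforce simp: bounded_iff)
  then obtain MG where MG: "0 \<le> MG" "\<And>x. x \<in> closure U \<Longrightarrow> norm (G x) \<le> MG"
    by (intro that[of "max 0 MG0"]) (auto intro: max.coboundedI2)
  obtain R0 where R0: "\<And>x. x \<in> closure U \<Longrightarrow> norm x \<le> R0"
    using compact_imp_bounded[OF cc] by (auto simp: bounded_iff)
  define Dm where "Dm = max 1 (2 * R0)"
  have Dm: "1 \<le> Dm" "\<And>x y. x \<in> closure U \<Longrightarrow> y \<in> closure U \<Longrightarrow> norm (x - y) \<le> Dm"
  proof -
    show "1 \<le> Dm" by (simp add: Dm_def)
    show "norm (x - y) \<le> Dm" if "x \<in> closure U" "y \<in> closure U" for x y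
      using norm_triangle_ineq4[of x y] R0[OF that(1)] R0[OF that(2)] by (simp add: Dm_def)
  qed
  \<comment> \<open>Half the radius of the exterior ball: the smaller ball touches only at
    \<open>p\<close>, and \<open>q\<close> below is at least \<bar>x - p\<bar>^2 / 2 on
    \<open>closure U\<close>.\<close>
  define R where "R = 1 / (4 * K)"
  have R: "0 < R" "2 * R * K = 1 / 2" using K(1) by (auto simp: R_def)
  \<comment> \<open>The smallest \<alpha> with which \<open>hopf_superharmonic\<close> covers the
    whole exterior of the ball of radius \<open>R\<close>.\<close>
  define \<alpha> where "\<alpha> = real DIM('a) / (2 * R\<^sup>2)"
  have \<alpha>: "0 < \<alpha>" "2 * \<alpha> * R\<^sup>2 = real DIM('a)" using R(1) by (auto simp: \<alpha>_def)
  \<comment> \<open>\<open>Q\<close> bounds \<open>q\<close> on \<open>closure U\<close>, so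
    \<open>c1\<close> is a lower bound there for the slope of 1 - exp (-\<alpha> q) as a function of
    q.\<close>
  define Q where "Q = Dm\<^sup>2 + 2 * R * Dm"
  define c1 where "c1 = \<alpha> * exp (- \<alpha> * Q)"
  have c1: "0 < c1" using \<alpha>(1) by (simp add: c1_def)
  \<comment> \<open>The multiple of \<open>q\<close> that the barrier has to provide:
    \<open>2 * Cg\<close> suffices against the Taylor error on the boundary, while the full sum is
    what the obstacle estimate below requires. Division by \<open>c1\<close> turns it into
    \<open>M\<close>.\<close>
  define A where "A = (MG + L\<phi> + 2 * Cg * Dm) / R + 4 * Cg"
  have A: "0 \<le> A" "2 * Cg \<le> A" using MG(1) L0 Cg(1) Dm(1) R(1) by (auto simp: A_def)
  define M where "M = A / c1"
  have M: "0 \<le> M" "M * c1 = A" using A(1) c1 by (auto simp: M_def)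
  define C where "C = MG + M * \<alpha> * (Dm + 2 * R)"
  have C: "0 \<le> C" using MG(1) M(1) \<alpha>(1) Dm(1) R(1) by (simp add: C_def)
  show ?thesis
  proof (intro exI[of _ C] conjI C ballI)
    fix p assume p: "p \<in> frontier U"
    have pc: "p \<in> closure U" and pU: "p \<notin> U" using p U(1) by (auto simp: frontier_def interior_open)
    obtain \<nu> where \<nu>: "norm \<nu> = 1" "\<And>x. x \<in> closure U \<Longrightarrow> - K * (norm (x - p))\<^sup>2 \<le> (x - p) \<bullet> \<nu>"
      using K(2)[OF p] by blast
    define z where "z = p - R *\<^sub>R \<nu>"
    \<comment> \<open>The power of \<open>x\<close> with respect to the exterior sphere: nonnegative
      on \<open>closure U\<close> and zero at \<open>p\<close>.\<close>
    define q where "q = (\<lambda>x. (x - z) \<bullet> (x - z) - R\<^sup>2)"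
    have \<nu>\<nu>: "\<nu> \<bullet> \<nu> = 1" using \<nu>(1) by (simp add: dot_square_norm)
    have q: "q x = (norm (x - p))\<^sup>2 + 2 * R * ((x - p) \<bullet> \<nu>)" for x
    proof -
      have "x - z = (x - p) + R *\<^sub>R \<nu>" by (simp add: z_def)
      then have "(x - z) \<bullet> (x - z) = (x - p) \<bullet> (x - p) + 2 * R * ((x - p) \<bullet> \<nu>) + R * R * (\<nu> \<bullet> \<nu>)"
        by (simp only: inner_add_left inner_add_right inner_scaleR_left inner_scaleR_right)
          (simp add: inner_commute algebra_simps)
      then show ?thesis by (simp add: q_def \<nu>(1) power2_eq_square dot_square_norm)
    qed
    have qge: "(norm (x - p))\<^sup>2 \<le> 2 * q x" if "x \<in> closure U" for x
    proof -
      define X where "X = 2 * R * ((x - p) \<bullet> \<nu>)"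
      have "- (2 * R * K) * (norm (x - p))\<^sup>2 = 2 * R * (- K * (norm (x - p))\<^sup>2)" by simp
      also have "\<dots> \<le> X" unfolding X_def using \<nu>(2)[OF that] R(1) by (intro mult_left_mono) auto
      finally have "- (1 / 2) * (norm (x - p))\<^sup>2 \<le> X" by (simp only: R(2))
      moreover have "- (1 / 2) * N \<le> X \<Longrightarrow> N \<le> 2 * (N + X)" for N :: real by (simp add: field_simps)
      ultimately show ?thesis unfolding q X_def[symmetric] by blast
    qed
    have q0: "0 \<le> q x" if "x \<in> closure U" for x
      using qge[OF that] zero_le_power2[of "norm (x - p)"] by linarith
    have qle: "q x \<le> (Dm + 2 * R) * norm (x - p)" if "x \<in> closure U" for x
    proof -
      have "norm (x - p) * norm (x - p) \<le> Dm * norm (x - p)"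
        using Dm(2)[OF that pc] by (intro mult_right_mono) auto
      moreover have "2 * R * ((x - p) \<bullet> \<nu>) \<le> 2 * R * norm (x - p)"
        using Cauchy_Schwarz_ineq2[of "x - p" \<nu>] \<nu>(1) R(1) by (intro mult_left_mono) auto
      ultimately show ?thesis unfolding q by (simp add: power2_eq_square algebra_simps)
    qed
    have qQ: "q x \<le> Q" if "x \<in> closure U" for x
    proof -
      have "q x \<le> (Dm + 2 * R) * norm (x - p)" by (rule qle[OF that])
      also have "\<dots> \<le> (Dm + 2 * R) * Dm" using Dm(2)[OF that pc] Dm(1) R(1) by (intro mult_left_mono) auto
      finally show ?thesis by (simp add: Q_def power2_eq_square algebra_simps)
    qed
    have lower: "A * q x \<le> M * (1 - exp (- \<alpha> * q x))" if "x \<in> closure U" for x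
    proof -
      have s: "0 \<le> \<alpha> * q x" using \<alpha>(1) q0[OF that] by simp
      have "c1 * q x \<le> exp (- \<alpha> * q x) * (\<alpha> * q x)"
      proof -
        have "exp (- \<alpha> * Q) \<le> exp (- \<alpha> * q x)" using qQ[OF that] \<alpha>(1) by simp
        from mult_right_mono[OF this s] show ?thesis by (simp add: c1_def mult_ac)
      qed
      also have "\<dots> \<le> exp (- \<alpha> * q x) * (exp (\<alpha> * q x) - 1)"
      proof (rule mult_left_mono)
        show "\<alpha> * q x \<le> exp (\<alpha> * q x) - 1" using exp_ge_add_one_self[of "\<alpha> * q x"] by linarith
      qed simp
      also have "\<dots> = 1 - exp (- \<alpha> * q x)" by (simp add: right_diff_distrib exp_minus)
      finally have "M * (c1 * q x) \<le> M * (1 - exp (- \<alpha> * q x))" using M(1) by (rule mult_left_mono)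
      then show ?thesis using M(2) by (simp add: mult.assoc[symmetric])
    qed
    have upper: "M * (1 - exp (- \<alpha> * q x)) \<le> M * (\<alpha> * q x)" for x
    proof (rule mult_left_mono[OF _ M(1)])
      show "1 - exp (- \<alpha> * q x) \<le> \<alpha> * q x" using exp_ge_add_one_self[of "- \<alpha> * q x"] by simp
    qed
    define w where "w = (\<lambda>x. g p + G p \<bullet> (x - p) + M * (1 - exp (- \<alpha> * ((x - z) \<bullet> (x - z) - R\<^sup>2))))"
    have w: "w x = g p + G p \<bullet> (x - p) + M * (1 - exp (- \<alpha> * q x))" for x by (simp add: w_def q_def)
    have "superharmonic_on U w (\<lambda>x. G p + (2 * M * \<alpha> * exp (- \<alpha> * ((x - z) \<bullet> (x - z) - R\<^sup>2))) *\<^sub>R (x - z))"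
      unfolding w_def
    proof (rule hopf_superharmonic[OF M(1) \<alpha>(1)])
      fix x assume "x \<in> U"
      then have "R\<^sup>2 \<le> (x - z) \<bullet> (x - z)" using q0[of x] closure_subset[of U] by (auto simp: q_def)
      then have "2 * \<alpha> * R\<^sup>2 \<le> 2 * \<alpha> * ((x - z) \<bullet> (x - z))" using \<alpha>(1) by (intro mult_left_mono) auto
      then show "real DIM('a) \<le> 2 * \<alpha> * ((x - z) \<bullet> (x - z))" using \<alpha>(2) by simp
    qed
    moreover have "g x \<le> w x" if x: "x \<in> frontier U" for x
    proof -
      have xc: "x \<in> closure U" using x fc by blast
      have "Cg * (norm (x - p))\<^sup>2 \<le> Cg * (2 * q x)" using qge[OF xc] Cg(1) by (intro mult_left_mono) auto
      also have "\<dots> = 2 * Cg * q x" by simp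
      also have "\<dots> \<le> A * q x" using A(2) q0[OF xc] by (rule mult_right_mono)
      finally show ?thesis using lower[OF xc] Cg(2)[OF p x] unfolding w by linarith
    qed
    moreover have "\<phi> x \<le> w x" if x: "x \<in> U" for x
    proof -
      have xc: "x \<in> closure U" using x closure_subset by blast
      define \<rho> where "\<rho> = norm (x - z)"
      have \<rho>2: "\<rho>\<^sup>2 = R\<^sup>2 + q x" by (simp add: \<rho>_def q_def power2_norm_eq_inner)
      have "R\<^sup>2 \<le> \<rho>\<^sup>2" using \<rho>2 q0[OF xc] by simp
      then have \<rho>: "R \<le> \<rho>" by (rule power2_le_imp_le) (simp add: \<rho>_def)
      \<comment> \<open>The radial projection of \<open>x\<close> to the exterior sphere. It is not
        in \<open>U\<close>, so the segment from \<open>x\<close> meets the boundary at some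
        \<open>y\<close> with \<bar>x - y\<bar> \<le> \<rho> - R \<le> q x / R. There the obstacle
        lies below \<open>g\<close>, and Lipschitz bounds carry this back to
        \<open>x\<close>.\<close>
      define y0 where "y0 = z + (R / \<rho>) *\<^sub>R (x - z)"
      have "y0 - z = (R / \<rho>) *\<^sub>R (x - z)" by (simp add: y0_def)
      then have "norm (y0 - z) = \<bar>R / \<rho>\<bar> * \<rho>" by (simp only: norm_scaleR \<rho>_def)
      also have "\<dots> = R" using R(1) \<rho> by simp
      finally have "norm (y0 - z) = R" .
      then have qy0: "q y0 = 0" by (simp add: q_def dot_square_norm)
      have y0U: "y0 \<notin> U"
      proof
        assume "y0 \<in> U"
        then have "(norm (y0 - p))\<^sup>2 \<le> 0" using qge[of y0] qy0 closure_subset by fastforce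
        then have "y0 = p" by simp
        with pU \<open>y0 \<in> U\<close> show False by simp
      qed
      have "x - y0 = (1 - R / \<rho>) *\<^sub>R (x - z)" by (simp add: y0_def algebra_simps)
      then have "norm (x - y0) = \<bar>1 - R / \<rho>\<bar> * \<rho>" by (simp only: norm_scaleR \<rho>_def)
      also have "\<dots> = (1 - R / \<rho>) * \<rho>" using \<rho> R(1) by simp
      also have "\<dots> = \<rho> - R" using \<rho> R(1) by (simp add: left_diff_distrib)
      finally have xy0: "norm (x - y0) = \<rho> - R" .
      have "closed_segment x y0 \<inter> frontier U \<noteq> {}"
      proof (rule connected_Int_frontier)
        show "closed_segment x y0 \<inter> U \<noteq> {}" using x by auto
        show "closed_segment x y0 - U \<noteq> {}" using y0U by auto
      qed simp
      then obtain y where y: "y \<in> closed_segment x y0" "y \<in> frontier U" by blast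
      have yc: "y \<in> closure U" using y(2) fc by blast
      define d where "d = norm (x - y)"
      have d0: "0 \<le> d" by (simp add: d_def)
      have "d \<le> \<rho> - R" using segment_bound(1)[OF y(1)] xy0 by (simp add: d_def norm_minus_commute)
      then have "d * R \<le> (\<rho> - R) * R" using R(1) by (intro mult_right_mono) auto
      also have "\<dots> \<le> (\<rho> - R) * (\<rho> + R)" using \<rho> R(1) by (intro mult_left_mono) auto
      also have "\<dots> = q x" using \<rho>2 by (simp add: power2_eq_square algebra_simps)
      finally have dq: "d \<le> q x / R" using R(1) by (simp add: field_simps)
      have "\<phi> x \<le> \<phi> y + L\<phi> * d"
        using lipschitz_onD[OF L\<phi> xc yc] by (simp add: dist_norm d_def dist_real_def abs_le_iff)
      also have "\<phi> y \<le> g y" by (rule \<phi>g[OF y(2)])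
      also have "g y \<le> g p + G p \<bullet> (y - p) + Cg * (norm (y - p))\<^sup>2" using Cg(2)[OF p y(2)] by (simp add: abs_le_iff)
      also have "G p \<bullet> (y - p) \<le> G p \<bullet> (x - p) + MG * d"
      proof -
        have "G p \<bullet> (y - p) = G p \<bullet> (x - p) + G p \<bullet> (y - x)" by (simp add: inner_diff_right)
        moreover have "G p \<bullet> (y - x) \<le> norm (G p) * d"
          using Cauchy_Schwarz_ineq2[of "G p" "y - x"] by (simp add: d_def norm_minus_commute)
        moreover have "norm (G p) * d \<le> MG * d" using MG(2)[OF pc] d0 by (rule mult_right_mono)
        ultimately show ?thesis by linarith
      qed
      also have "(norm (y - p))\<^sup>2 \<le> 2 * Dm * d + 4 * q x"
      proof -
        have "norm (y - p) \<le> d + norm (x - p)"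
          using norm_triangle_ineq[of "y - x" "x - p"] by (simp add: d_def norm_minus_commute)
        then have "(norm (y - p))\<^sup>2 \<le> (d + norm (x - p))\<^sup>2" by (rule power_mono) simp
        also have "\<dots> \<le> 2 * d\<^sup>2 + 2 * (norm (x - p))\<^sup>2"
          using sum_squares_bound[of d "norm (x - p)"] by (simp add: power2_sum)
        also have "d\<^sup>2 \<le> Dm * d" using Dm(2)[OF xc yc] d0 by (simp add: d_def power2_eq_square mult_right_mono)
        finally show ?thesis using qge[OF xc] by simp
      qed
      finally have "\<phi> x \<le> g p + (G p \<bullet> (x - p) + MG * d) + Cg * (2 * Dm * d + 4 * q x) + L\<phi> * d"
        using Cg(1) by simp
      also have "\<dots> = g p + G p \<bullet> (x - p) + ((MG + L\<phi> + 2 * Cg * Dm) * d + 4 * Cg * q x)"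
        by (simp add: algebra_simps)
      also have "(MG + L\<phi> + 2 * Cg * Dm) * d \<le> (MG + L\<phi> + 2 * Cg * Dm) * (q x / R)"
        using MG(1) L0 Cg(1) Dm(1) by (intro mult_left_mono dq) simp
      also have "(MG + L\<phi> + 2 * Cg * Dm) * (q x / R) + 4 * Cg * q x = A * q x"
        by (simp add: A_def add_divide_distrib algebra_simps)
      finally show ?thesis using lower[OF xc] unfolding w by linarith
    qed
    moreover have "w x \<le> g p + C * norm (x - p)" if x: "x \<in> U" for x
    proof -
      have xc: "x \<in> closure U" using x closure_subset by blast
      have "G p \<bullet> (x - p) \<le> norm (G p) * norm (x - p)" using Cauchy_Schwarz_ineq2[of "G p" "x - p"] by simp
      also have "\<dots> \<le> MG * norm (x - p)" using MG(2)[OF pc] by (rule mult_right_mono) simp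
      finally have 1: "G p \<bullet> (x - p) \<le> MG * norm (x - p)" .
      have "M * (\<alpha> * q x) \<le> M * (\<alpha> * ((Dm + 2 * R) * norm (x - p)))"
        using qle[OF xc] M(1) \<alpha>(1) by (intro mult_left_mono) auto
      then show ?thesis using 1 upper[of x] unfolding w C_def by (simp add: algebra_simps)
    qed
    ultimately show "\<exists>w D. superharmonic_on U w D \<and> (\<forall>x\<in>U. \<phi> x \<le> w x) \<and>
      (\<forall>x\<in>frontier U. g x \<le> w x) \<and> (\<forall>x\<in>U. w x \<le> g p + C * norm (x - p))" by blast
  qed
qed

subsection \<open>Variations of the minimizer\<close>

text \<open>A $C^1$ substitute for the positive part: it vanishes exactly for s \<le> 0, is at most
  max 0 s, and its derivative stays between 0 and 1, as \<open>wg_chain\<close> requires.\<close>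

definition trunc :: "real \<Rightarrow> real" where
  "trunc s = sqrt (1 + (max 0 s)\<^sup>2) - 1"

definition trunc' :: "real \<Rightarrow> real" where
  "trunc' s = max 0 s / sqrt (1 + (max 0 s)\<^sup>2)"

lemma one_plus_square_pos: "0 < 1 + (x::real)\<^sup>2"
  using zero_le_power2[of x] by linarith

lemma DERIV_trunc: "(trunc has_real_derivative trunc' s) (at s)"
proof -
  have "((\<lambda>s. 1 + (max 0 s)\<^sup>2) has_real_derivative 2 * max 0 s) (at s)"
    using DERIV_add[OF DERIV_const[of 1] DERIV_max_square] by simp
  from DERIV_diff[OF DERIV_chain2[OF DERIV_real_sqrt[OF one_plus_square_pos] this] DERIV_const[of 1]]
  show ?thesis by (simp add: trunc_def[abs_def] trunc'_def field_simps)
qed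

lemma continuous_trunc': "continuous_on UNIV trunc'"
  unfolding trunc'_def[abs_def]
  by (intro continuous_intros) (metis less_irrefl one_plus_square_pos real_sqrt_gt_zero)

lemma continuous_trunc: "continuous_on UNIV trunc"
  unfolding trunc_def[abs_def] by (intro continuous_intros)

lemma trunc'_nonneg: "0 \<le> trunc' s"
  by (simp add: trunc'_def)

lemma trunc'_le_1: "trunc' s \<le> 1"
proof -
  have "max 0 s \<le> sqrt (1 + (max 0 s)\<^sup>2)" by (rule real_le_rsqrt) simp
  moreover have "0 < sqrt (1 + (max 0 s)\<^sup>2)" using one_plus_square_pos by simp
  ultimately show ?thesis unfolding trunc'_def by (simp add: divide_le_eq_1)
qed

lemma trunc'_abs_le: "\<bar>trunc' s\<bar> \<le> 1"
  using trunc'_nonneg trunc'_le_1 by (simp add: abs_of_nonneg)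

lemma trunc_0 [simp]: "trunc 0 = 0"
  by (simp add: trunc_def)

lemma trunc_nonpos: "s \<le> 0 \<Longrightarrow> trunc s = 0"
  by (simp add: trunc_def max_def)

lemma trunc'_nonpos: "s \<le> 0 \<Longrightarrow> trunc' s = 0"
  by (simp add: trunc'_def max_def)

lemma trunc_nonneg: "0 \<le> trunc s"
  by (simp add: trunc_def)

lemma trunc_le: "trunc s \<le> max 0 s"
proof -
  have "sqrt (1 + (max 0 s)\<^sup>2) \<le> 1 + max 0 s"
    by (rule real_le_lsqrt) (auto simp: power2_sum)
  then show ?thesis by (simp add: trunc_def)
qed

lemma trunc_eq_0: "trunc s = 0 \<Longrightarrow> s \<le> 0"
  by (auto simp: trunc_def max_def split: if_splits)

lemmas trunc_chain = DERIV_trunc continuous_trunc' trunc'_abs_le trunc_0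

lemma integrable_inner_squares:
  fixes f g :: "'a::euclidean_space \<Rightarrow> 'b::euclidean_space"
  assumes [measurable]: "f \<in> borel_measurable borel" "g \<in> borel_measurable borel"
    and "integrable lborel (\<lambda>x. (norm (f x))\<^sup>2)" "integrable lborel (\<lambda>x. (norm (g x))\<^sup>2)"
  shows "integrable lborel (\<lambda>x. f x \<bullet> g x)"
proof (rule Bochner_Integration.integrable_bound)
  show "integrable lborel (\<lambda>x. (norm (f x))\<^sup>2 + (norm (g x))\<^sup>2)" using assms by simp
  have "\<bar>f x \<bullet> g x\<bar> \<le> (norm (f x))\<^sup>2 + (norm (g x))\<^sup>2" for x
  proof -
    have "2 * (norm (f x) * norm (g x)) \<le> (norm (f x))\<^sup>2 + (norm (g x))\<^sup>2"
      using sum_squares_bound[of "norm (f x)" "norm (g x)"] by simp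
    moreover have "0 \<le> norm (f x) * norm (g x)" by simp
    ultimately show ?thesis using Cauchy_Schwarz_ineq2[of "f x" "g x"] by linarith
  qed
  then show "AE x in lborel. norm (f x \<bullet> g x) \<le> norm ((norm (f x))\<^sup>2 + (norm (g x))\<^sup>2)"
    by (intro AE_I2) simp
qed measurable

text \<open>Since \<open>trunc'\<close> lies between 0 and 1, the energy of the truncation is at
  most the given integral, hence 0; having zero gradient on the whole space, the truncation
  vanishes.\<close>

lemma trunc_grad_zero:
  fixes S :: "'a::euclidean_space \<Rightarrow> 'a"
  assumes W: "wg UNIV (\<lambda>x. trunc (s x)) (\<lambda>x. trunc' (s x) *\<^sub>R S x)"
    and i: "integrable lborel (\<lambda>x. S x \<bullet> (trunc' (s x) *\<^sub>R S x))"
    and le: "(\<integral>x. S x \<bullet> (trunc' (s x) *\<^sub>R S x) \<partial>lborel) \<le> 0"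
  shows "AE x in lborel. s x \<le> 0"
proof -
  have *: "(norm (trunc' (s x) *\<^sub>R S x))\<^sup>2 \<le> S x \<bullet> (trunc' (s x) *\<^sub>R S x)" for x
  proof -
    have "trunc' (s x) * trunc' (s x) \<le> trunc' (s x) * 1"
      by (intro mult_left_mono trunc'_le_1 trunc'_nonneg)
    from mult_right_mono[OF this, of "(norm (S x))\<^sup>2"] show ?thesis
      by (simp add: power_mult_distrib power2_eq_square[of "trunc' (s x)"] power2_norm_eq_inner)
  qed
  have "(\<integral>x. (norm (trunc' (s x) *\<^sub>R S x))\<^sup>2 \<partial>lborel) \<le> 0"
    using integral_mono[OF wgD(4)[OF W] i *] le by linarith
  then have "(\<integral>x. (norm (trunc' (s x) *\<^sub>R S x))\<^sup>2 \<partial>lborel) = 0"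
    by (rule antisym) (rule Bochner_Integration.integral_nonneg, simp)
  then have "AE x in lborel. (norm (trunc' (s x) *\<^sub>R S x))\<^sup>2 = 0"
    using integral_nonneg_eq_0_iff_AE[OF wgD(4)[OF W]] by simp
  then have "AE x in lborel. trunc' (s x) *\<^sub>R S x = 0" by eventually_elim simp
  from wg_zero_grad[OF W this] show ?thesis by eventually_elim (rule trunc_eq_0)
qed

text \<open>A test function without compact support is allowed, because \<open>v\<close> has bounded
  support and a cutoff equal to 1 there changes nothing.\<close>

lemma wg_test_field:
  fixes v :: "'a::euclidean_space \<Rightarrow> real"
  assumes W: "wg UNIV v G" and f: "\<And>x. GDERIV f x :> D x" "continuous_on UNIV D"
  shows "(\<integral>x. v x *\<^sub>R D x + f x *\<^sub>R G x \<partial>lborel) = 0"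
    "integrable lborel (\<lambda>x. v x *\<^sub>R D x)" "integrable lborel (\<lambda>x. f x *\<^sub>R G x)"
proof -
  obtain R where R: "\<And>x. x \<notin> cball 0 R \<Longrightarrow> v x = 0 \<and> G x = 0" using wgD(7)[OF W] by blast
  obtain \<theta> E where \<theta>: "C1c (UNIV :: 'a set) \<theta> E" "\<forall>x. 0 \<le> \<theta> x \<and> \<theta> x \<le> 1" "\<forall>x\<in>cball 0 R. \<theta> x = 1 \<and> E x = 0"
    using cutoff_exists[OF compact_cball open_UNIV subset_UNIV, of 0 R] by blast
  note C = C1c_mult[OF f \<theta>(1)]
  have eq: "v x *\<^sub>R (f x *\<^sub>R E x + \<theta> x *\<^sub>R D x) = v x *\<^sub>R D x" "(f x * \<theta> x) *\<^sub>R G x = f x *\<^sub>R G x" for x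
    using R[of x] \<theta>(3) by (cases "x \<in> cball 0 R"; simp)+
  show "integrable lborel (\<lambda>x. v x *\<^sub>R D x)" "integrable lborel (\<lambda>x. f x *\<^sub>R G x)"
    using wg_test_integrable[OF W C] by (simp_all only: eq)
  show "(\<integral>x. v x *\<^sub>R D x + f x *\<^sub>R G x \<partial>lborel) = 0" using wgD(8)[OF W C] by (simp only: eq)
qed

text \<open>Integration by parts for each component of \<open>D\<close> turns the integral into
  minus that of \<zeta> times the Laplacian of \<open>w\<close>, where \<zeta> is nonnegative and
  the Laplacian nonpositive on \<open>U\<close>.\<close>

lemma superharmonic_test:
  assumes W: "wg UNIV \<zeta> Z" and w: "superharmonic_on U w D"
    and \<zeta>: "\<And>x. 0 \<le> \<zeta> x" "\<And>x. x \<notin> U \<Longrightarrow> \<zeta> x = 0"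
  shows "0 \<le> (\<integral>x. D x \<bullet> Z x \<partial>lborel)" "integrable lborel (\<lambda>x. D x \<bullet> Z x)"
proof -
  obtain E where E: "\<And>b x. GDERIV (\<lambda>x. D x \<bullet> b) x :> E b x" "\<And>b. continuous_on UNIV (E b)"
    "\<And>x. x \<in> U \<Longrightarrow> (\<Sum>b\<in>Basis. E b x \<bullet> b) \<le> 0" using w unfolding superharmonic_on_def by blast
  note T = wg_test_field[OF W E(1,2)]
  have i1: "integrable lborel (\<lambda>x. (\<zeta> x *\<^sub>R E b x) \<bullet> b)" and i2: "integrable lborel (\<lambda>x. ((D x \<bullet> b) *\<^sub>R Z x) \<bullet> b)" for b
    using T(2,3) by (intro integrable_inner_left; blast)+
  have DZ: "D x \<bullet> Z x = (\<Sum>b\<in>Basis. ((D x \<bullet> b) *\<^sub>R Z x) \<bullet> b)" for x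
    by (subst euclidean_inner) simp
  show "integrable lborel (\<lambda>x. D x \<bullet> Z x)" unfolding DZ by (intro Bochner_Integration.integrable_sum i2)
  have "(\<integral>x. ((D x \<bullet> b) *\<^sub>R Z x) \<bullet> b \<partial>lborel) = - (\<integral>x. (\<zeta> x *\<^sub>R E b x) \<bullet> b \<partial>lborel)" for b
  proof -
    have "(\<integral>x. (\<zeta> x *\<^sub>R E b x) \<bullet> b \<partial>lborel) + (\<integral>x. ((D x \<bullet> b) *\<^sub>R Z x) \<bullet> b \<partial>lborel)
      = (\<integral>x. \<zeta> x *\<^sub>R E b x \<partial>lborel) \<bullet> b + (\<integral>x. (D x \<bullet> b) *\<^sub>R Z x \<partial>lborel) \<bullet> b"
      using integral_inner_left[of b lborel, OF T(2)] integral_inner_left[of b lborel, OF T(3)] by simp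
    also have "\<dots> = (\<integral>x. \<zeta> x *\<^sub>R E b x + (D x \<bullet> b) *\<^sub>R Z x \<partial>lborel) \<bullet> b"
      using T(2,3)[of b] by (simp add: inner_add_left)
    finally show ?thesis using T(1)[of b] by simp
  qed
  then have "(\<Sum>b\<in>Basis. (\<integral>x. ((D x \<bullet> b) *\<^sub>R Z x) \<bullet> b \<partial>lborel)) = - (\<Sum>b\<in>Basis. (\<integral>x. (\<zeta> x *\<^sub>R E b x) \<bullet> b \<partial>lborel))"
    by (simp only: sum_negf)
  also have "(\<Sum>b\<in>Basis. (\<integral>x. (\<zeta> x *\<^sub>R E b x) \<bullet> b \<partial>lborel)) = (\<integral>x. (\<Sum>b\<in>Basis. (\<zeta> x *\<^sub>R E b x) \<bullet> b) \<partial>lborel)"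
    by (rule Bochner_Integration.integral_sum[symmetric]) (rule i1)
  also have "(\<Sum>b\<in>Basis. (\<integral>x. ((D x \<bullet> b) *\<^sub>R Z x) \<bullet> b \<partial>lborel)) = (\<integral>x. D x \<bullet> Z x \<partial>lborel)"
    unfolding DZ by (rule Bochner_Integration.integral_sum[symmetric]) (rule i2)
  finally have eq: "(\<integral>x. D x \<bullet> Z x \<partial>lborel) = - (\<integral>x. (\<Sum>b\<in>Basis. (\<zeta> x *\<^sub>R E b x) \<bullet> b) \<partial>lborel)" .
  have "(\<integral>x. (\<Sum>b\<in>Basis. (\<zeta> x *\<^sub>R E b x) \<bullet> b) \<partial>lborel) \<le> (\<integral>x. 0 \<partial>(lborel :: 'a measure))"
  proof (rule integral_mono)
    show "integrable lborel (\<lambda>x. \<Sum>b\<in>Basis. (\<zeta> x *\<^sub>R E b x) \<bullet> b)" by (intro Bochner_Integration.integrable_sum i1)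
    show "(\<Sum>b\<in>Basis. (\<zeta> x *\<^sub>R E b x) \<bullet> b) \<le> 0" for x
    proof (cases "x \<in> U")
      case True
      have "(\<Sum>b\<in>Basis. (\<zeta> x *\<^sub>R E b x) \<bullet> b) = \<zeta> x * (\<Sum>b\<in>Basis. E b x \<bullet> b)" by (simp add: sum_distrib_left)
      then show ?thesis using E(3)[OF True] \<zeta>(1)[of x] by (simp add: mult_nonneg_nonpos)
    qed (use \<zeta>(2) in simp)
  qed simp
  then show "0 \<le> (\<integral>x. D x \<bullet> Z x \<partial>lborel)" using eq by simp
qed

lemma L2_combination_tendsto:
  fixes a :: "nat \<Rightarrow> 'a::euclidean_space \<Rightarrow> 'b::euclidean_space"
    and b :: "nat \<Rightarrow> 'a \<Rightarrow> 'c::euclidean_space" and c :: "nat \<Rightarrow> 'a \<Rightarrow> 'd::euclidean_space"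
  assumes [measurable]: "\<And>k. a k \<in> borel_measurable borel" "\<And>k. b k \<in> borel_measurable borel" "\<And>k. c k \<in> borel_measurable borel"
    and i: "\<And>k. integrable lborel (\<lambda>x. (norm (a k x))\<^sup>2)" "\<And>k. integrable lborel (\<lambda>x. (norm (b k x))\<^sup>2)"
    and le: "\<And>k x. norm (c k x) \<le> B * (norm (a k x) + norm (b k x))"
    and lim: "(\<lambda>k. \<integral>x. (norm (a k x))\<^sup>2 \<partial>lborel) \<longlonglongrightarrow> 0" "(\<lambda>k. \<integral>x. (norm (b k x))\<^sup>2 \<partial>lborel) \<longlonglongrightarrow> 0"
  shows "(\<lambda>k. \<integral>x. (norm (c k x))\<^sup>2 \<partial>lborel) \<longlonglongrightarrow> 0"
proof (rule tendsto_sandwich[OF _ _ tendsto_const])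
  have "(norm (c k x))\<^sup>2 \<le> 2 * B\<^sup>2 * (norm (a k x))\<^sup>2 + 2 * B\<^sup>2 * (norm (b k x))\<^sup>2" for k x
  proof -
    have "(norm (c k x))\<^sup>2 \<le> (B * (norm (a k x) + norm (b k x)))\<^sup>2" by (rule power_mono[OF le]) simp
    also have "\<dots> = B\<^sup>2 * (norm (a k x) + norm (b k x))\<^sup>2" by (simp add: power_mult_distrib)
    also have "\<dots> \<le> B\<^sup>2 * (2 * (norm (a k x))\<^sup>2 + 2 * (norm (b k x))\<^sup>2)"
      using sum_squares_bound[of "norm (a k x)" "norm (b k x)"] by (intro mult_left_mono) (simp_all add: power2_sum)
    finally show ?thesis by (simp add: algebra_simps)
  qed
  then have "(\<integral>x. (norm (c k x))\<^sup>2 \<partial>lborel) \<le> (\<integral>x. 2 * B\<^sup>2 * (norm (a k x))\<^sup>2 + 2 * B\<^sup>2 * (norm (b k x))\<^sup>2 \<partial>lborel)" for k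
    using i by (intro integral_mono') auto
  also have "(\<integral>x. 2 * B\<^sup>2 * (norm (a k x))\<^sup>2 + 2 * B\<^sup>2 * (norm (b k x))\<^sup>2 \<partial>lborel)
    = 2 * B\<^sup>2 * (\<integral>x. (norm (a k x))\<^sup>2 \<partial>lborel) + 2 * B\<^sup>2 * (\<integral>x. (norm (b k x))\<^sup>2 \<partial>lborel)" for k
    using i by simp
  finally show "\<forall>\<^sub>F k in sequentially. (\<integral>x. (norm (c k x))\<^sup>2 \<partial>lborel)
    \<le> 2 * B\<^sup>2 * (\<integral>x. (norm (a k x))\<^sup>2 \<partial>lborel) + 2 * B\<^sup>2 * (\<integral>x. (norm (b k x))\<^sup>2 \<partial>lborel)" by simp
  have "(\<lambda>k. 2 * B\<^sup>2 * (\<integral>x. (norm (a k x))\<^sup>2 \<partial>lborel) + 2 * B\<^sup>2 * (\<integral>x. (norm (b k x))\<^sup>2 \<partial>lborel)) \<longlonglongrightarrow> 2 * B\<^sup>2 * 0 + 2 * B\<^sup>2 * 0"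
    by (intro tendsto_intros lim)
  then show "(\<lambda>k. 2 * B\<^sup>2 * (\<integral>x. (norm (a k x))\<^sup>2 \<partial>lborel) + 2 * B\<^sup>2 * (\<integral>x. (norm (b k x))\<^sup>2 \<partial>lborel)) \<longlonglongrightarrow> 0" by simp
qed simp

definition minimizer ::
    "'a::euclidean_space set \<Rightarrow> ('a \<Rightarrow> real) \<Rightarrow> ('a \<Rightarrow> real) \<Rightarrow> ('a \<Rightarrow> real) \<Rightarrow> ('a \<Rightarrow> real) \<Rightarrow> bool" where
  "minimizer U g \<phi> \<psi> u \<longleftrightarrow> is_arg_min (energy U) (\<lambda>v. v \<in> admissible U g \<phi> \<psi>) u"

text \<open>The first variation in the direction \<open>- \<zeta>\<close>. The functions \<open>c k\<close>, which vanish on the boundary at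
  least as fast as \<open>w (r k) - g\<close>, show that subtracting multiples of \<open>\<zeta>\<close> does not change the trace.\<close>
lemma first_variation:
  fixes U :: "'a::euclidean_space set"
  assumes U: "open U" "bounded U" and min: "minimizer U g \<phi> \<psi> u"
    and W: "wg U u0 G0" and uAE: "AE x in lborel. x \<in> U \<longrightarrow> u x = u0 x"
    and tr: "trace_approx U u0 G0 g w H" and r: "strict_mono r"
    and Z: "wg U \<zeta> Z"
    and c: "\<And>k. continuous_on (closure U) (c k)" "\<And>k. wg U (\<lambda>x. indicator U x * c k x) (Zk k)"
      "(\<lambda>k. \<integral>x. (indicator U x * c k x - \<zeta> x)\<^sup>2 \<partial>lborel) \<longlonglongrightarrow> 0"
      "(\<lambda>k. \<integral>x. (norm (Zk k x - Z x))\<^sup>2 \<partial>lborel) \<longlonglongrightarrow> 0"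
    and bd: "\<And>k x. x \<in> frontier U \<Longrightarrow> \<bar>c k x\<bar> \<le> \<bar>w (r k) x - g x\<bar>"
    and adm: "\<And>t. 0 \<le> t \<Longrightarrow> t \<le> 1 \<Longrightarrow> AE x in lborel. x \<in> U \<longrightarrow> \<phi> x \<le> u0 x - t * \<zeta> x \<and> u0 x - t * \<zeta> x \<le> \<psi> x"
  shows "(\<integral>x. G0 x \<bullet> Z x \<partial>lborel) \<le> 0"
proof -
  have Ub [measurable]: "U \<in> sets borel" using U by simp
  have uadm: "u \<in> admissible U g \<phi> \<psi>" and le: "\<And>v. v \<in> admissible U g \<phi> \<psi> \<Longrightarrow> energy U u \<le> energy U v"
    using min unfolding minimizer_def is_arg_min_def by (auto simp: not_less)
  have gm: "set_borel_measurable surface_measure (frontier U) g"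
    using uadm unfolding admissible_def has_trace_def by blast
  have T: "\<And>k. continuous_on (closure U) (w k)" "\<And>k. wg U (\<lambda>x. indicator U x * w k x) (H k)"
    "(\<lambda>k. \<integral>x. (norm (indicator U x * w k x - u0 x))\<^sup>2 \<partial>lborel) \<longlonglongrightarrow> 0"
    "(\<lambda>k. \<integral>x. (norm (H k x - G0 x))\<^sup>2 \<partial>lborel) \<longlonglongrightarrow> 0"
    "(\<lambda>k. \<integral>\<^sup>+x\<in>frontier U. ennreal ((w k x - g x)\<^sup>2) \<partial>surface_measure) \<longlonglongrightarrow> 0"
    using tr unfolding trace_approx_def by simp_all
  note sub = LIMSEQ_subseq_LIMSEQ[OF T(3) r] LIMSEQ_subseq_LIMSEQ[OF T(4) r] LIMSEQ_subseq_LIMSEQ[OF T(5) r]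
  have Wt: "wg U (\<lambda>x. u0 x - t * \<zeta> x) (\<lambda>x. G0 x - t *\<^sub>R Z x)" for t
    by (rule wg_diff[OF W wg_scale[OF Z]])
  have energy_le: "(\<integral>x. (norm (G0 x))\<^sup>2 \<partial>lborel) \<le> (\<integral>x. (norm (G0 x - t *\<^sub>R Z x))\<^sup>2 \<partial>lborel)"
    if t: "0 \<le> t" "t \<le> 1" for t
  proof -
    define w' where "w' = (\<lambda>k x. w (r k) x - t * c k x)"
    define H' where "H' = (\<lambda>k x. H (r k) x - t *\<^sub>R Zk k x)"
    have Wk: "wg U (\<lambda>x. indicator U x * w' k x) (H' k)" for k
      using wg_diff[OF T(2)[of "r k"] wg_scale[OF c(2)[of k], of t]]
      by (simp add: w'_def H'_def algebra_simps)
    have "trace_approx U (\<lambda>x. u0 x - t * \<zeta> x) (\<lambda>x. G0 x - t *\<^sub>R Z x) g w' H'"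
      unfolding trace_approx_def
    proof (intro conjI allI Wk)
      show "continuous_on (closure U) (w' k)" for k unfolding w'_def by (intro continuous_intros T(1) c(1))
      note D1 = wg_diff[OF T(2) W] and D2 = wg_diff[OF c(2) Z]
      have "(\<lambda>k. \<integral>x. (norm (indicator U x * w' k x - (u0 x - t * \<zeta> x)))\<^sup>2 \<partial>lborel) \<longlonglongrightarrow> 0"
      proof (rule L2_combination_tendsto[where B = 1])
        show "norm (indicator U x * w' k x - (u0 x - t * \<zeta> x))
          \<le> 1 * (norm (indicator U x * w (r k) x - u0 x) + norm (indicator U x * c k x - \<zeta> x))" for k x
        proof -
          have "indicator U x * w' k x - (u0 x - t * \<zeta> x)
            = (indicator U x * w (r k) x - u0 x) - t * (indicator U x * c k x - \<zeta> x)"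
            by (simp add: w'_def algebra_simps)
          also have "norm \<dots> \<le> norm (indicator U x * w (r k) x - u0 x) + norm (t * (indicator U x * c k x - \<zeta> x))"
            by (rule norm_triangle_ineq4)
          also have "norm (t * (indicator U x * c k x - \<zeta> x)) \<le> norm (indicator U x * c k x - \<zeta> x)"
            using t by (simp add: abs_mult mult_left_le_one_le)
          finally show ?thesis by simp
        qed
      qed (use wgD(1,3)[OF D1] wgD(1,3)[OF D2] wgD(1)[OF wg_diff[OF Wk Wt]] sub(1) c(3) in \<open>simp_all add: o_def\<close>)
      then show "(\<lambda>k. \<integral>x. (indicator U x * w' k x - (u0 x - t * \<zeta> x))\<^sup>2 \<partial>lborel) \<longlonglongrightarrow> 0" by simp
      show "(\<lambda>k. \<integral>x. (norm (H' k x - (G0 x - t *\<^sub>R Z x)))\<^sup>2 \<partial>lborel) \<longlonglongrightarrow> 0"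
      proof (rule L2_combination_tendsto[where B = 1])
        show "norm (H' k x - (G0 x - t *\<^sub>R Z x)) \<le> 1 * (norm (H (r k) x - G0 x) + norm (Zk k x - Z x))" for k x
        proof -
          have "H' k x - (G0 x - t *\<^sub>R Z x) = (H (r k) x - G0 x) - t *\<^sub>R (Zk k x - Z x)"
            by (simp add: H'_def algebra_simps)
          also have "norm \<dots> \<le> norm (H (r k) x - G0 x) + norm (t *\<^sub>R (Zk k x - Z x))"
            by (rule norm_triangle_ineq4)
          also have "norm (t *\<^sub>R (Zk k x - Z x)) \<le> norm (Zk k x - Z x)"
            using t by (simp add: mult_left_le_one_le)
          finally show ?thesis by simp
        qed
      qed (use wgD(2,4)[OF D1] wgD(2,4)[OF D2] wgD(2)[OF wg_diff[OF Wk Wt]] sub(2) c(4) in \<open>simp_all add: o_def\<close>)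
      show "(\<lambda>k. \<integral>\<^sup>+x\<in>frontier U. ennreal ((w' k x - g x)\<^sup>2) \<partial>surface_measure) \<longlonglongrightarrow> 0"
      proof (rule tendsto_sandwich[OF _ _ tendsto_const])
        have wm: "(\<lambda>x. ennreal ((w j x - g x)\<^sup>2) * indicator (frontier U) x) \<in> borel_measurable surface_measure" for j
        proof -
          have sets: "sets (surface_measure :: 'a measure) = sets borel" by (simp add: surface_measure_def)
          have "(\<lambda>x. indicator (frontier U) x *\<^sub>R w j x) \<in> borel_measurable borel"
            by (rule borel_measurable_continuous_on_indicator)
              (use T(1) in \<open>auto simp: frontier_def intro: continuous_on_subset\<close>)
          then have "(\<lambda>x. indicator (frontier U) x *\<^sub>R w j x) \<in> borel_measurable surface_measure"
            by (simp add: measurable_cong_sets[OF sets refl])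
          then have "(\<lambda>x. ennreal ((indicator (frontier U) x *\<^sub>R w j x - indicator (frontier U) x *\<^sub>R g x)\<^sup>2)) \<in> borel_measurable surface_measure"
            using gm unfolding set_borel_measurable_def by measurable
          moreover have "(\<lambda>x. ennreal ((indicator (frontier U) x *\<^sub>R w j x - indicator (frontier U) x *\<^sub>R g x)\<^sup>2))
            = (\<lambda>x. ennreal ((w j x - g x)\<^sup>2) * indicator (frontier U) x)" by (auto simp: fun_eq_iff indicator_def)
          ultimately show ?thesis by (simp only:)
        qed
        \<comment> \<open>On the boundary the perturbation is at most the error already present, so
          the distance to \<open>g\<close> at most doubles and its square grows by a factor of at
          most 4.\<close>
        have "ennreal ((w' k x - g x)\<^sup>2) * indicator (frontier U) x
          \<le> 4 * (ennreal ((w (r k) x - g x)\<^sup>2) * indicator (frontier U) x)" for k x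
        proof (cases "x \<in> frontier U")
          case True
          have "w' k x - g x = (w (r k) x - g x) - t * c k x" by (simp add: w'_def)
          also have "\<bar>\<dots>\<bar> \<le> \<bar>w (r k) x - g x\<bar> + \<bar>t * c k x\<bar>" by (rule abs_triangle_ineq4)
          also have "\<bar>t * c k x\<bar> \<le> \<bar>c k x\<bar>" using t by (simp add: abs_mult mult_left_le_one_le)
          also have "\<bar>c k x\<bar> \<le> \<bar>w (r k) x - g x\<bar>" by (rule bd[OF True])
          finally have "\<bar>w' k x - g x\<bar> \<le> 2 * \<bar>w (r k) x - g x\<bar>" by simp
          then have "\<bar>w' k x - g x\<bar> \<le> \<bar>2 * (w (r k) x - g x)\<bar>" by (simp only: abs_mult abs_numeral)
          then have "(w' k x - g x)\<^sup>2 \<le> (2 * (w (r k) x - g x))\<^sup>2" by (simp only: abs_le_square_iff)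
          also have "\<dots> = 4 * (w (r k) x - g x)\<^sup>2" unfolding power_mult_distrib by simp
          finally have "ennreal ((w' k x - g x)\<^sup>2) \<le> ennreal (4 * (w (r k) x - g x)\<^sup>2)"
            by (rule ennreal_leI)
          also have "\<dots> = 4 * ennreal ((w (r k) x - g x)\<^sup>2)" by (simp add: ennreal_mult')
          finally show ?thesis using True by simp
        qed simp
        then have "(\<integral>\<^sup>+x\<in>frontier U. ennreal ((w' k x - g x)\<^sup>2) \<partial>surface_measure)
          \<le> (\<integral>\<^sup>+x. 4 * (ennreal ((w (r k) x - g x)\<^sup>2) * indicator (frontier U) x) \<partial>surface_measure)" for k
          by (intro nn_integral_mono) auto
        also have "(\<integral>\<^sup>+x. 4 * (ennreal ((w (r k) x - g x)\<^sup>2) * indicator (frontier U) x) \<partial>surface_measure)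
          = 4 * (\<integral>\<^sup>+x\<in>frontier U. ennreal ((w (r k) x - g x)\<^sup>2) \<partial>surface_measure)" for k
          by (rule nn_integral_cmult[OF wm])
        finally show "\<forall>\<^sub>F k in sequentially. (\<integral>\<^sup>+x\<in>frontier U. ennreal ((w' k x - g x)\<^sup>2) \<partial>surface_measure)
          \<le> 4 * (\<integral>\<^sup>+x\<in>frontier U. ennreal ((w (r k) x - g x)\<^sup>2) \<partial>surface_measure)" by simp
        show "(\<lambda>k. 4 * (\<integral>\<^sup>+x\<in>frontier U. ennreal ((w (r k) x - g x)\<^sup>2) \<partial>surface_measure)) \<longlonglongrightarrow> 0"
          using ennreal_tendsto_cmult[OF _ sub(3), of 4] by (simp add: o_def)
      qed simp
    qed
    then have "has_trace U (\<lambda>x. u0 x - t * \<zeta> x) g"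
      using has_trace_wg[OF U Wt[of t], of "\<lambda>x. u0 x - t * \<zeta> x" g] gm by auto
    moreover have "(\<lambda>x. u0 x - t * \<zeta> x) \<in> H1 U" by (rule wg_H1[OF U(1) Wt[of t]]) simp
    moreover have "AE x in lebesgue_on U. \<phi> x \<le> u0 x - t * \<zeta> x \<and> u0 x - t * \<zeta> x \<le> \<psi> x"
      using adm[OF t] by (simp only: AE_lebesgue_on[OF Ub])
    ultimately have "(\<lambda>x. u0 x - t * \<zeta> x) \<in> admissible U g \<phi> \<psi>"
      unfolding admissible_def by blast
    from le[OF this] show ?thesis
      using energy_wg[OF U W uAE] energy_wg[OF U Wt[of t], of "\<lambda>x. u0 x - t * \<zeta> x"] by simp
  qed
  note [measurable] = wgD(1,2)[OF W] wgD(1,2)[OF Z]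
  define a where "a = (\<integral>x. G0 x \<bullet> Z x \<partial>lborel)"
  define b where "b = (\<integral>x. (norm (Z x))\<^sup>2 \<partial>lborel)"
  have iGZ: "integrable lborel (\<lambda>x. G0 x \<bullet> Z x)"
    by (rule integrable_inner_squares) (use wgD(4)[OF W] wgD(4)[OF Z] in auto)
  have expand: "(\<integral>x. (norm (G0 x - t *\<^sub>R Z x))\<^sup>2 \<partial>lborel) = (\<integral>x. (norm (G0 x))\<^sup>2 \<partial>lborel) - 2 * t * a + t\<^sup>2 * b" for t
  proof -
    have "(norm (G0 x - t *\<^sub>R Z x))\<^sup>2 = (norm (G0 x))\<^sup>2 - 2 * t * (G0 x \<bullet> Z x) + t\<^sup>2 * (norm (Z x))\<^sup>2" for x
      unfolding power2_norm_eq_inner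
      by (simp add: inner_diff_left inner_diff_right inner_commute power2_eq_square algebra_simps)
    then show ?thesis using iGZ wgD(4)[OF W] wgD(4)[OF Z] by (simp add: a_def b_def)
  qed
  \<comment> \<open>The energy along the segment is a quadratic polynomial in t that is minimal at t
    = 0 among 0 \<le> t \<le> 1; dividing by t and letting t tend to 0 gives the sign of its linear
    coefficient.\<close>
  have tb: "2 * a \<le> t * b" if "0 < t" "t \<le> 1" for t
  proof -
    have "0 \<le> t * (t * b - 2 * a)" using energy_le[of t] that unfolding expand by (simp add: power2_eq_square algebra_simps)
    then show ?thesis using that by (simp add: zero_le_mult_iff)
  qed
  have "2 * a \<le> (1 / (real k + 1)) * b" for k by (rule tb) auto
  moreover have "(\<lambda>k. (1 / (real k + 1)) * b) \<longlonglongrightarrow> 0 * b"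
  proof (intro tendsto_intros)
    show "(\<lambda>k. 1 / (real k + 1)) \<longlonglongrightarrow> 0" using LIMSEQ_inverse_real_of_nat by (simp add: inverse_eq_divide add.commute)
  qed
  ultimately have "2 * a \<le> 0 * b" by (intro LIMSEQ_le_const) auto
  then show ?thesis by (simp add: a_def)
qed

text \<open>Subtracting the truncated excess of \<open>u0\<close> over \<open>w0\<close> leaves a
  function above min u0 w0, hence above the lower obstacle, and keeps the trace, since g \<le> w0 on
  the boundary. The first variation is nonpositive, the pairing with the superharmonic
  \<open>w0\<close> nonnegative, and their difference is the integral in
  \<open>trunc_grad_zero\<close>.\<close>

lemma comparison:
  fixes U :: "'a::euclidean_space set"
  assumes dim: "2 \<le> DIM('a)" and U: "open U" "bounded U" "smooth_boundary U" and min: "minimizer U g \<phi> \<psi> u"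
    and W: "wg U u0 G0" and uAE: "AE x in lborel. x \<in> U \<longrightarrow> u x = u0 x"
    and sh: "superharmonic_on U w0 D" and w0\<phi>: "\<And>x. x \<in> U \<Longrightarrow> \<phi> x \<le> w0 x"
    and w0g: "\<And>x. x \<in> frontier U \<Longrightarrow> g x \<le> w0 x"
  shows "AE x in lborel. x \<in> U \<longrightarrow> u0 x \<le> w0 x"
proof -
  have Ub [measurable]: "U \<in> sets borel" using U by simp
  have uadm: "u \<in> admissible U g \<phi> \<psi>" using min unfolding minimizer_def is_arg_min_def by simp
  then obtain w H where tr: "trace_approx U u0 G0 g w H"
    using has_trace_wg[OF U(1,2) W uAE] unfolding admissible_def by blast
  have obs: "AE x in lborel. x \<in> U \<longrightarrow> \<phi> x \<le> u0 x \<and> u0 x \<le> \<psi> x"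
  proof -
    have "AE x in lebesgue_on U. \<phi> x \<le> u x \<and> u x \<le> \<psi> x" using uadm unfolding admissible_def by blast
    then have "AE x in lborel. x \<in> U \<longrightarrow> \<phi> x \<le> u x \<and> u x \<le> \<psi> x" by (simp only: AE_lebesgue_on[OF Ub])
    with uAE show ?thesis by eventually_elim auto
  qed
  have T: "\<And>k. continuous_on (closure U) (w k)" "\<And>k. wg U (\<lambda>x. indicator U x * w k x) (H k)"
    "(\<lambda>k. \<integral>x. (indicator U x * w k x - u0 x)\<^sup>2 \<partial>lborel) \<longlonglongrightarrow> 0"
    "(\<lambda>k. \<integral>x. (norm (H k x - G0 x))\<^sup>2 \<partial>lborel) \<longlonglongrightarrow> 0"
    "(\<lambda>k. \<integral>\<^sup>+x\<in>frontier U. ennreal ((w k x - g x)\<^sup>2) \<partial>surface_measure) \<longlonglongrightarrow> 0"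
    using tr unfolding trace_approx_def by simp_all
  have D: "\<And>x. GDERIV w0 x :> D x" "continuous_on UNIV D" using sh unfolding superharmonic_on_def by blast+
  have cw0: "continuous_on UNIV w0" using GDERIV_continuous[OF D(1)] by (simp add: continuous_on_eq_continuous_at)
  note W0 = wg_of_C1[OF U(1,2) D]
  define s where "s = (\<lambda>x. u0 x - indicator U x * w0 x)"
  define S where "S = (\<lambda>x. G0 x - indicator U x *\<^sub>R D x)"
  define sk where "sk = (\<lambda>k x. indicator U x * w k x - indicator U x * w0 x)"
  define Sk where "Sk = (\<lambda>k x. H k x - indicator U x *\<^sub>R D x)"
  have WS: "wg U s S" unfolding s_def S_def by (rule wg_diff[OF W W0])
  have WSk: "wg U (sk k) (Sk k)" for k unfolding sk_def Sk_def by (rule wg_diff[OF T(2) W0])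
  have "\<exists>r. strict_mono r \<and> (\<lambda>k. \<integral>x. (trunc (sk (r k) x) - trunc (s x))\<^sup>2 \<partial>lborel) \<longlonglongrightarrow> 0 \<and>
    (\<lambda>k. \<integral>x. (norm (trunc' (sk (r k) x) *\<^sub>R Sk (r k) x - trunc' (s x) *\<^sub>R S x))\<^sup>2 \<partial>lborel) \<longlonglongrightarrow> 0"
    by (rule chain_continuous[OF WS WSk _ _ trunc_chain])
      (use T(3,4) in \<open>simp_all add: sk_def s_def Sk_def S_def\<close>)
  then obtain r where r: "strict_mono r" "(\<lambda>k. \<integral>x. (trunc (sk (r k) x) - trunc (s x))\<^sup>2 \<partial>lborel) \<longlonglongrightarrow> 0"
    "(\<lambda>k. \<integral>x. (norm (trunc' (sk (r k) x) *\<^sub>R Sk (r k) x - trunc' (s x) *\<^sub>R S x))\<^sup>2 \<partial>lborel) \<longlonglongrightarrow> 0" by blast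
  define \<zeta> where "\<zeta> = (\<lambda>x. trunc (s x))"
  define Z where "Z = (\<lambda>x. trunc' (s x) *\<^sub>R S x)"
  \<comment> \<open>On the boundary g \<le> w0, so \<open>c k\<close> is at most the excess of
    \<open>w (r k)\<close> over \<open>g\<close>. This one bound serves both the trace of the
    competitors and the zero trace of \<zeta>.\<close>
  define c where "c = (\<lambda>k x. trunc (w (r k) x - w0 x))"
  define Zk where "Zk = (\<lambda>k x. trunc' (sk (r k) x) *\<^sub>R Sk (r k) x)"
  have WZ: "wg U \<zeta> Z" unfolding \<zeta>_def Z_def by (rule wg_chain[OF U(1) WS trunc_chain])
  have ceq: "indicator U x * c k x = trunc (sk (r k) x)" for k x
    by (simp add: c_def sk_def indicator_def)
  have Wc: "wg U (\<lambda>x. indicator U x * c k x) (Zk k)" for k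
    unfolding ceq Zk_def by (rule wg_chain[OF U(1) WSk trunc_chain])
  have cc: "continuous_on (closure U) (c k)" for k unfolding c_def
    by (intro continuous_on_compose2[OF continuous_trunc] continuous_intros T(1) continuous_on_subset[OF cw0]) auto
  have cb: "\<bar>c k x\<bar> \<le> \<bar>w (r k) x - g x\<bar>" if "x \<in> frontier U" for k x
    using trunc_le[of "w (r k) x - w0 x"] trunc_nonneg[of "w (r k) x - w0 x"] w0g[OF that]
    unfolding c_def by (auto simp: max_def abs_if split: if_splits)
  have L1: "(\<lambda>k. \<integral>x. (indicator U x * c k x - \<zeta> x)\<^sup>2 \<partial>lborel) \<longlonglongrightarrow> 0" using r(2) by (simp add: ceq \<zeta>_def)
  have L2: "(\<lambda>k. \<integral>x. (norm (Zk k x - Z x))\<^sup>2 \<partial>lborel) \<longlonglongrightarrow> 0" using r(3) by (simp add: Zk_def Z_def)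
  have "(\<integral>x. G0 x \<bullet> Z x \<partial>lborel) \<le> 0"
  proof (rule first_variation[OF U(1,2) min W uAE tr r(1) WZ cc Wc L1 L2 cb])
    fix t :: real assume t: "0 \<le> t" "t \<le> 1"
    show "AE x in lborel. x \<in> U \<longrightarrow> \<phi> x \<le> u0 x - t * \<zeta> x \<and> u0 x - t * \<zeta> x \<le> \<psi> x"
      using obs
    proof eventually_elim
      case (elim x)
      show ?case
      proof
        assume x: "x \<in> U"
        have s: "s x = u0 x - w0 x" using x by (simp add: s_def)
        have z: "0 \<le> t * \<zeta> x" "t * \<zeta> x \<le> \<zeta> x" using t trunc_nonneg[of "s x"] by (auto simp: \<zeta>_def mult_left_le_one_le)
        have "\<zeta> x \<le> max 0 (u0 x - w0 x)" using trunc_le[of "s x"] s by (simp add: \<zeta>_def)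
        then show "\<phi> x \<le> u0 x - t * \<zeta> x \<and> u0 x - t * \<zeta> x \<le> \<psi> x"
          using z elim x w0\<phi>[OF x] by (auto simp: max_def split: if_splits)
      qed
    qed
  qed
  moreover have WZ': "wg UNIV \<zeta> Z"
  proof (rule zero_trace_extension[OF dim U WZ])
    show "trace_approx U \<zeta> Z (\<lambda>x. 0) c Zk"
      unfolding trace_approx_def
    proof (intro conjI allI cc Wc L1 L2)
      show "(\<lambda>k. \<integral>\<^sup>+x\<in>frontier U. ennreal ((c k x - 0)\<^sup>2) \<partial>surface_measure) \<longlonglongrightarrow> 0"
      proof (rule tendsto_sandwich[OF _ _ tendsto_const])
        show "(\<lambda>k. \<integral>\<^sup>+x\<in>frontier U. ennreal ((w (r k) x - g x)\<^sup>2) \<partial>surface_measure) \<longlonglongrightarrow> 0"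
          using LIMSEQ_subseq_LIMSEQ[OF T(5) r(1)] by (simp add: o_def)
        have "ennreal ((c k x - 0)\<^sup>2) * indicator (frontier U) x \<le> ennreal ((w (r k) x - g x)\<^sup>2) * indicator (frontier U) x" for k x
          using cb[of x k] by (auto simp: indicator_def abs_le_square_iff intro!: ennreal_leI)
        then show "\<forall>\<^sub>F k in sequentially. (\<integral>\<^sup>+x\<in>frontier U. ennreal ((c k x - 0)\<^sup>2) \<partial>surface_measure)
          \<le> (\<integral>\<^sup>+x\<in>frontier U. ennreal ((w (r k) x - g x)\<^sup>2) \<partial>surface_measure)"
          by (intro always_eventually allI nn_integral_mono) auto
      qed simp
    qed
  qed
  have \<zeta>0: "0 \<le> \<zeta> x" for x by (simp add: \<zeta>_def trunc_nonneg)
  note ST = superharmonic_test[OF WZ' sh \<zeta>0 wgD(5)[OF WZ]]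
  have iG: "integrable lborel (\<lambda>x. G0 x \<bullet> Z x)"
    by (rule integrable_inner_squares) (use wgD(2,4)[OF W] wgD(2,4)[OF WZ] in auto)
  have SZ: "S x \<bullet> Z x = G0 x \<bullet> Z x - D x \<bullet> Z x" for x
    using wgD(6)[OF WZ, of x] by (cases "x \<in> U") (auto simp: S_def inner_diff_left)
  have iS: "integrable lborel (\<lambda>x. S x \<bullet> Z x)" unfolding SZ using iG ST(2) by simp
  have "(\<integral>x. S x \<bullet> Z x \<partial>lborel) = (\<integral>x. G0 x \<bullet> Z x \<partial>lborel) - (\<integral>x. D x \<bullet> Z x \<partial>lborel)"
    unfolding SZ using iG ST(2) by simp
  ultimately have "(\<integral>x. S x \<bullet> Z x \<partial>lborel) \<le> 0" using ST(1) by simp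
  then have "AE x in lborel. s x \<le> 0"
    using trunc_grad_zero[of s S] WZ' iS unfolding \<zeta>_def Z_def by blast
  then show ?thesis by eventually_elim (auto simp: s_def)
qed

section \<open>Symmetry under a change of sign\<close>

lemma trace_approx_minus:
  assumes "trace_approx U v G g w H"
  shows "trace_approx U (\<lambda>x. - v x) (\<lambda>x. - G x) (\<lambda>x. - g x) (\<lambda>k x. - w k x) (\<lambda>k x. - H k x)"
proof -
  have W: "wg U (\<lambda>x. indicator U x * - w k x) (\<lambda>x. - H k x)" for k
    using wg_scale[of U "\<lambda>x. indicator U x * w k x" "H k" "-1"] assms unfolding trace_approx_def by simp
  have 1: "(indicator U x * - w k x - - v x)\<^sup>2 = (indicator U x * w k x - v x)\<^sup>2" for k x
    by (simp add: power2_eq_square algebra_simps)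
  have 2: "norm (- H k x - - G x) = norm (H k x - G x)" for k x
    by (simp add: norm_minus_commute)
  have 3: "(- w k x - - g x)\<^sup>2 = (w k x - g x)\<^sup>2" for k x by (simp add: power2_eq_square algebra_simps)
  show ?thesis using assms W unfolding trace_approx_def 1 2 3 by (auto intro: continuous_on_minus)
qed

lemma admissible_minus:
  assumes U: "open U" "bounded U" and v: "v \<in> admissible U g \<phi> \<psi>"
  shows "(\<lambda>x. - v x) \<in> admissible U (\<lambda>x. - g x) (\<lambda>x. - \<psi> x) (\<lambda>x. - \<phi> x)"
    and "energy U (\<lambda>x. - v x) = energy U v"
proof -
  obtain v0 G0 where W: "wg U v0 G0" and AE: "AE x in lborel. x \<in> U \<longrightarrow> v x = v0 x"
    using H1_wg[OF U, of v] v unfolding admissible_def by blast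
  have Wm: "wg U (\<lambda>x. - v0 x) (\<lambda>x. - G0 x)" using wg_scale[OF W, of "-1"] by simp
  have AEm: "AE x in lborel. x \<in> U \<longrightarrow> - v x = - v0 x" using AE by eventually_elim simp
  show "energy U (\<lambda>x. - v x) = energy U v"
    using energy_wg[OF U W AE] energy_wg[OF U Wm AEm] by simp
  have gm: "set_borel_measurable surface_measure (frontier U) g" and "\<exists>w H. trace_approx U v0 G0 g w H"
    using v has_trace_wg[OF U W AE] unfolding admissible_def by blast+
  then obtain w H where "trace_approx U v0 G0 g w H" by blast
  from trace_approx_minus[OF this]
  have "\<exists>w H. trace_approx U (\<lambda>x. - v0 x) (\<lambda>x. - G0 x) (\<lambda>x. - g x) w H" by blast
  moreover have "set_borel_measurable surface_measure (frontier U) (\<lambda>x. - g x)"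
    using gm borel_measurable_uminus[of "\<lambda>x. indicator (frontier U) x *\<^sub>R g x" surface_measure]
    by (simp add: set_borel_measurable_def)
  ultimately have "has_trace U (\<lambda>x. - v x) (\<lambda>x. - g x)" using has_trace_wg[OF U Wm AEm] by blast
  moreover have "(\<lambda>x. - v x) \<in> H1 U" by (rule wg_H1[OF U(1) Wm AEm])
  moreover have "AE x in lebesgue_on U. - \<psi> x \<le> - v x \<and> - v x \<le> - \<phi> x"
  proof -
    have "AE x in lebesgue_on U. \<phi> x \<le> v x \<and> v x \<le> \<psi> x" using v unfolding admissible_def by blast
    then show ?thesis by eventually_elim simp
  qed
  ultimately show "(\<lambda>x. - v x) \<in> admissible U (\<lambda>x. - g x) (\<lambda>x. - \<psi> x) (\<lambda>x. - \<phi> x)"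
    unfolding admissible_def by blast
qed

text \<open>The change of sign swaps the obstacles, so every one-sided statement about minimizers
  yields its mirror image: bounds from below at the boundary, and raising instead of lowering
  \<open>u\<close>.\<close>

lemma minimizer_minus:
  assumes U: "open U" "bounded U" and min: "minimizer U g \<phi> \<psi> u"
  shows "minimizer U (\<lambda>x. - g x) (\<lambda>x. - \<psi> x) (\<lambda>x. - \<phi> x) (\<lambda>x. - u x)"
  unfolding minimizer_def is_arg_min_def
proof (intro conjI notI)
  have u: "u \<in> admissible U g \<phi> \<psi>" and le: "\<And>v. v \<in> admissible U g \<phi> \<psi> \<Longrightarrow> energy U u \<le> energy U v"
    using min unfolding minimizer_def is_arg_min_def by (auto simp: not_less)
  show "(\<lambda>x. - u x) \<in> admissible U (\<lambda>x. - g x) (\<lambda>x. - \<psi> x) (\<lambda>x. - \<phi> x)" by (rule admissible_minus(1)[OF U u])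
  assume "\<exists>y. y \<in> admissible U (\<lambda>x. - g x) (\<lambda>x. - \<psi> x) (\<lambda>x. - \<phi> x) \<and> energy U y < energy U (\<lambda>x. - u x)"
  then obtain y where y: "y \<in> admissible U (\<lambda>x. - g x) (\<lambda>x. - \<psi> x) (\<lambda>x. - \<phi> x)" "energy U y < energy U (\<lambda>x. - u x)" by blast
  have "energy U u \<le> energy U (\<lambda>x. - y x)" using admissible_minus(1)[OF U y(1)] by (intro le) simp
  then show False using y(2) admissible_minus(2)[OF U y(1)] admissible_minus(2)[OF U u] by simp
qed

subsection \<open>Comparison with translates\<close>

lemma AE_shift:
  fixes h :: "'a::euclidean_space"
  assumes "AE x in lborel. P x"
  shows "AE x in lborel. P (x + h)"
proof -
  have "AE x in distr lborel borel ((+) h). P x" by (subst lborel_distr_plus) (rule assms)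
  from AE_distrD[OF _ this] show ?thesis by (simp add: add.commute)
qed

lemma open_translate_inter:
  fixes U :: "'a::real_normed_vector set"
  assumes "open U"
  shows "open {x \<in> U. x + h \<in> U}"
proof -
  have "{x \<in> U. x + h \<in> U} = U \<inter> (\<lambda>x. x + h) -` U" by auto
  then show ?thesis using assms by (auto intro!: open_Int open_vimage continuous_intros)
qed

lemma wg_translate_diff:
  fixes U :: "'a::euclidean_space set"
  assumes U: "open U" "bounded U" and W: "wg U v G" and D: "D = {x \<in> U. x + h \<in> U}"
  shows "wg D (\<lambda>x. indicator D x * (v x - v (x + h) - c)) (\<lambda>x. indicator D x *\<^sub>R (G x - G (x + h)))"
proof -
  have oD: "open D" unfolding D by (rule open_translate_inter[OF U(1)])
  have bD: "bounded D" using U(2) by (rule bounded_subset) (auto simp: D)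
  have Db: "D \<in> sets borel" using oD by simp
  have sub: "D \<subseteq> U" "D \<subseteq> {x. x + h \<in> U}" by (auto simp: D)
  note W1 = wg_restrict[OF W sub(1) Db]
  note W2 = wg_restrict[OF wg_translate[OF W, of h] sub(2) Db]
  note W3 = wg_of_C1[OF oD bD GDERIV_const[of c] continuous_on_const]
  from wg_diff[OF wg_diff[OF W1 W2] W3] show ?thesis by (simp add: algebra_simps)
qed

text \<open>Only lowering is treated, which puts the lower obstacle at risk; raising is the same
  statement for \<open>- u\<close> and \<open>- h\<close>. Up to null sets the positive part of
  \<open>s\<close> lives on a compact subset \<open>K\<close> of \<open>D\<close>, so a cutoff makes
  the variation compactly supported: the trace is untouched, and the weak gradient extends to the
  whole space without any appeal to zero traces.\<close>

lemma translation_variation: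
  fixes U :: "'a::euclidean_space set" and h :: 'a and u0 s :: "'a \<Rightarrow> real" and G0 S :: "'a \<Rightarrow> 'a"
  assumes U: "open U" "bounded U" "U \<noteq> {}" and min: "minimizer U g \<phi> \<psi> u"
    and W: "wg U u0 G0" and uAE: "AE x in lborel. x \<in> U \<longrightarrow> u x = u0 x"
    and bdry: "AE x in lborel. x \<in> U \<longrightarrow> (\<forall>p\<in>frontier U. \<bar>u0 x - g p\<bar> \<le> C * norm (x - p))"
    and C: "0 \<le> C" and L: "3 * C \<le> L" and \<phi>: "\<And>x y. x \<in> U \<Longrightarrow> y \<in> U \<Longrightarrow> \<bar>\<phi> x - \<phi> y\<bar> \<le> L * norm (x - y)"
    and h: "h \<noteq> 0" and D: "D = {x \<in> U. x + h \<in> U}"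
    and s: "s = (\<lambda>x. indicator D x * (u0 x - u0 (x + h) - L * norm h))"
    and S: "S = (\<lambda>x. indicator D x *\<^sub>R (G0 x - G0 (x + h)))"
  shows "wg UNIV (\<lambda>x. trunc (s x)) (\<lambda>x. trunc' (s x) *\<^sub>R S x)"
    and "(\<integral>x. G0 x \<bullet> (trunc' (s x) *\<^sub>R S x) \<partial>lborel) \<le> 0"
proof -
  have Ub [measurable]: "U \<in> sets borel" using U by simp
  have uadm: "u \<in> admissible U g \<phi> \<psi>" using min unfolding minimizer_def is_arg_min_def by simp
  then obtain w H where tr: "trace_approx U u0 G0 g w H"
    using has_trace_wg[OF U(1,2) W uAE] unfolding admissible_def by blast
  have obs: "AE x in lborel. x \<in> U \<longrightarrow> \<phi> x \<le> u0 x \<and> u0 x \<le> \<psi> x"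
  proof -
    have "AE x in lebesgue_on U. \<phi> x \<le> u x \<and> u x \<le> \<psi> x" using uadm unfolding admissible_def by blast
    then have "AE x in lborel. x \<in> U \<longrightarrow> \<phi> x \<le> u x \<and> u x \<le> \<psi> x" by (simp only: AE_lebesgue_on[OF Ub])
    with uAE show ?thesis by eventually_elim auto
  qed
  have T: "\<And>k. continuous_on (closure U) (w k)" "\<And>k. wg U (\<lambda>x. indicator U x * w k x) (H k)"
    "(\<lambda>k. \<integral>x. (norm (indicator U x * w k x - u0 x))\<^sup>2 \<partial>lborel) \<longlonglongrightarrow> 0"
    "(\<lambda>k. \<integral>x. (norm (H k x - G0 x))\<^sup>2 \<partial>lborel) \<longlonglongrightarrow> 0"
    using tr unfolding trace_approx_def by simp_all
  have oD: "open D" unfolding D by (rule open_translate_inter[OF U(1)])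
  have DU: "D \<subseteq> U" by (auto simp: D)
  have WS: "wg D s S" unfolding s S by (rule wg_translate_diff[OF U(1,2) W D])
  define sk where "sk = (\<lambda>k x. indicator D x * (indicator U x * w k x - indicator U (x + h) * w k (x + h) - L * norm h))"
  define Sk where "Sk = (\<lambda>k x. indicator D x *\<^sub>R (H k x - H k (x + h)))"
  have WSk: "wg D (sk k) (Sk k)" for k unfolding sk_def Sk_def by (rule wg_translate_diff[OF U(1,2) T(2) D])
  note Wa = wg_diff[OF T(2) W]
  have shift: "(\<lambda>k. \<integral>x. (norm (indicator U (x + h) * w k (x + h) - u0 (x + h)))\<^sup>2 \<partial>lborel) \<longlonglongrightarrow> 0"
    "(\<lambda>k. \<integral>x. (norm (H k (x + h) - G0 (x + h)))\<^sup>2 \<partial>lborel) \<longlonglongrightarrow> 0"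
    "integrable lborel (\<lambda>x. (norm (indicator U (x + h) * w k (x + h) - u0 (x + h)))\<^sup>2)"
    "integrable lborel (\<lambda>x. (norm (H k (x + h) - G0 (x + h)))\<^sup>2)" for k
  proof -
    have m: "(\<lambda>x. (norm (indicator U x * w k x - u0 x))\<^sup>2) \<in> borel_measurable borel"
      "(\<lambda>x. (norm (H k x - G0 x))\<^sup>2) \<in> borel_measurable borel" for k
      using wgD(1,2)[OF Wa[of k]] by measurable
    show "(\<lambda>k. \<integral>x. (norm (indicator U (x + h) * w k (x + h) - u0 (x + h)))\<^sup>2 \<partial>lborel) \<longlonglongrightarrow> 0"
      using T(3) integral_shift[OF m(1), where x = h] by simp
    show "(\<lambda>k. \<integral>x. (norm (H k (x + h) - G0 (x + h)))\<^sup>2 \<partial>lborel) \<longlonglongrightarrow> 0"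
      using T(4) integral_shift[OF m(2), where x = h] by simp
    show "integrable lborel (\<lambda>x. (norm (indicator U (x + h) * w k (x + h) - u0 (x + h)))\<^sup>2)"
      using integrable_shift[of "\<lambda>x. (norm (indicator U x * w k x - u0 x))\<^sup>2" h] wgD(3)[OF Wa[of k]] by simp
    show "integrable lborel (\<lambda>x. (norm (H k (x + h) - G0 (x + h)))\<^sup>2)"
      using integrable_shift[of "\<lambda>x. (norm (H k x - G0 x))\<^sup>2" h] wgD(4)[OF Wa[of k]] by simp
  qed
  have mU [measurable]: "(\<lambda>x. indicator U x * w k x) \<in> borel_measurable borel" "H k \<in> borel_measurable borel" for k
    using wgD(1,2)[OF T(2)] by auto
  note [measurable] = wgD(1,2)[OF W] wgD(1,2)[OF WS] wgD(1,2)[OF WSk]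
  have mUh [measurable]: "(\<lambda>x. indicator U (x + h) * w k (x + h) - u0 (x + h)) \<in> borel_measurable borel"
    "(\<lambda>x. indicator U x * w k x - u0 x) \<in> borel_measurable borel" for k
    using wgD(1)[OF wg_translate[OF Wa[of k], of h]] wgD(1)[OF Wa[of k]] by auto
  have lim1: "(\<lambda>k. \<integral>x. (norm (sk k x - s x))\<^sup>2 \<partial>lborel) \<longlonglongrightarrow> 0"
  proof (rule L2_combination_tendsto[OF mUh(2) mUh(1) _ _ shift(3) _ T(3) shift(1), of _ 1])
    show "norm (sk k x - s x) \<le> 1 * (norm (indicator U x * w k x - u0 x) + norm (indicator U (x + h) * w k (x + h) - u0 (x + h)))" for k x
    proof (cases "x \<in> D")
      case True
      then have "sk k x - s x = (indicator U x * w k x - u0 x) - (indicator U (x + h) * w k (x + h) - u0 (x + h))"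
        by (simp add: sk_def s)
      then show ?thesis using norm_triangle_ineq4 by simp
    qed (simp add: sk_def s)
  qed (use wgD(3)[OF Wa] in auto)
  have lim2: "(\<lambda>k. \<integral>x. (norm (Sk k x - S x))\<^sup>2 \<partial>lborel) \<longlonglongrightarrow> 0"
  proof (rule L2_combination_tendsto[OF _ _ _ _ shift(4) _ T(4) shift(2), of _ 1])
    show "norm (Sk k x - S x) \<le> 1 * (norm (H k x - G0 x) + norm (H k (x + h) - G0 (x + h)))" for k x
    proof (cases "x \<in> D")
      case True
      then have "Sk k x - S x = (H k x - G0 x) - (H k (x + h) - G0 (x + h))" by (simp add: Sk_def S)
      then show ?thesis using norm_triangle_ineq4 by simp
    qed (simp add: Sk_def S)
  qed (use wgD(4)[OF Wa] in auto)
  have "\<exists>r. strict_mono r \<and> (\<lambda>k. \<integral>x. (trunc (sk (r k) x) - trunc (s x))\<^sup>2 \<partial>lborel) \<longlonglongrightarrow> 0 \<and>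
    (\<lambda>k. \<integral>x. (norm (trunc' (sk (r k) x) *\<^sub>R Sk (r k) x - trunc' (s x) *\<^sub>R S x))\<^sup>2 \<partial>lborel) \<longlonglongrightarrow> 0"
    by (rule chain_continuous[OF WS WSk _ lim2 trunc_chain]) (use lim1 in simp)
  then obtain r where r: "strict_mono r" "(\<lambda>k. \<integral>x. (norm (trunc (sk (r k) x) - trunc (s x)))\<^sup>2 \<partial>lborel) \<longlonglongrightarrow> 0"
    "(\<lambda>k. \<integral>x. (norm (trunc' (sk (r k) x) *\<^sub>R Sk (r k) x - trunc' (s x) *\<^sub>R S x))\<^sup>2 \<partial>lborel) \<longlonglongrightarrow> 0" by auto
  define \<zeta> where "\<zeta> = (\<lambda>x. trunc (s x))"
  define A where "A = (\<lambda>x. trunc' (s x) *\<^sub>R S x)"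
  define Ak where "Ak = (\<lambda>k x. trunc' (sk (r k) x) *\<^sub>R Sk (r k) x)"
  have WA: "wg D \<zeta> A" unfolding \<zeta>_def A_def by (rule wg_chain[OF oD WS trunc_chain])
  have WAk: "wg D (\<lambda>x. trunc (sk (r k) x)) (Ak k)" for k unfolding Ak_def by (rule wg_chain[OF oD WSk trunc_chain])
  have fne: "frontier U \<noteq> {}" using U by (auto simp: frontier_eq_empty)
  have fcl: "closed (frontier U)" by simp
  \<comment> \<open>Both \<open>x\<close> and its translate keep distance at least \<bar>h\<bar>
    from the boundary. For points of \<open>D\<close> off this set, some boundary point has
    distances to the two points that add up to at most 3\<bar>h\<bar>; this is the origin of 3 C
    \<le> L.\<close>
  define K where "K = {x \<in> closure U. x + h \<in> closure U \<and> norm h \<le> infdist x (frontier U) \<and> norm h \<le> infdist (x + h) (frontier U)}"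
  have K: "compact K"
  proof -
    have "{x. x + h \<in> closure U} = (\<lambda>x. x + h) -` closure U" by auto
    then have "closed {x. x + h \<in> closure U}"
      using continuous_closed_vimage[OF closed_closure[of U], of "\<lambda>x. x + h"] by (auto intro: continuous_intros)
    then have "closed K" unfolding K_def
      by (intro closed_Collect_conj closed_Collect_le continuous_intros continuous_on_infdist) (auto simp: Collect_mem_eq)
    moreover have "bounded K" using bounded_closure[OF U(2)] by (rule bounded_subset) (auto simp: K_def)
    ultimately show ?thesis by (simp add: compact_eq_bounded_closed)
  qed
  have inU: "x \<in> U" if "x \<in> closure U" "norm h \<le> infdist x (frontier U)" for x
  proof (rule ccontr)
    assume "x \<notin> U"
    then have "x \<in> frontier U" using that(1) U(1) by (simp add: frontier_def interior_open)
    then show False using that(2) h by (simp add: infdist_zero)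
  qed
  have KD: "K \<subseteq> D" unfolding K_def D using inU by blast
  have off: "AE x in lborel. x \<notin> K \<longrightarrow> s x \<le> 0"
    using bdry AE_shift[OF bdry, of h]
  proof eventually_elim
    case (elim x)
    show ?case
    proof
      assume xK: "x \<notin> K"
      show "s x \<le> 0"
      proof (cases "x \<in> D")
        case True
        then have xU: "x \<in> U" "x + h \<in> U" by (auto simp: D)
        have Lh: "3 * C * norm h \<le> L * norm h" using L by (rule mult_right_mono) simp
        have "\<exists>p\<in>frontier U. norm (x - p) + norm (x + h - p) \<le> 3 * norm h"
        proof -
          have "infdist x (frontier U) < norm h \<or> infdist (x + h) (frontier U) < norm h"
            using xK xU closure_subset[of U] by (auto simp: K_def not_le)
          then show ?thesis
          proof
            assume *: "infdist x (frontier U) < norm h"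
            obtain p where p: "p \<in> frontier U" "infdist x (frontier U) = dist x p"
              using infdist_attains_inf[OF fcl fne] by blast
            have "norm (x + h - p) \<le> norm (x - p) + norm h" using norm_triangle_ineq[of "x - p" h] by (simp add: algebra_simps)
            then show ?thesis using p * by (intro bexI[of _ p]) (auto simp: dist_norm)
          next
            assume *: "infdist (x + h) (frontier U) < norm h"
            obtain p where p: "p \<in> frontier U" "infdist (x + h) (frontier U) = dist (x + h) p"
              using infdist_attains_inf[OF fcl fne] by blast
            have "norm (x - p) \<le> norm (x + h - p) + norm h" using norm_triangle_ineq4[of "x + h - p" h] by (simp add: algebra_simps)
            then show ?thesis using p * by (intro bexI[of _ p]) (auto simp: dist_norm)
          qed
        qed
        then obtain p where p: "p \<in> frontier U" "norm (x - p) + norm (x + h - p) \<le> 3 * norm h" by blast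
        have "\<bar>u0 x - g p\<bar> \<le> C * norm (x - p)" "\<bar>u0 (x + h) - g p\<bar> \<le> C * norm (x + h - p)"
          using elim xU p(1) by auto
        then have "u0 x - u0 (x + h) \<le> C * (norm (x - p) + norm (x + h - p))" by (simp add: algebra_simps abs_le_iff)
        also have "\<dots> \<le> C * (3 * norm h)" using p(2) C by (rule mult_left_mono)
        finally show ?thesis using True Lh by (simp add: s)
      qed (simp add: s)
    qed
  qed
  \<comment> \<open>The cutoff changes \<open>trunc (s x)\<close> only on a null set, but the
    truncated approximants may be nonzero off \<open>K\<close>. It makes them vanish outside a
    compact subset of \<open>D\<close>, in particular on the boundary of \<open>U\<close>.\<close>
  obtain \<theta> E where \<theta>: "C1c D \<theta> E" "\<forall>x. 0 \<le> \<theta> x \<and> \<theta> x \<le> 1" "\<forall>x\<in>K. \<theta> x = 1 \<and> E x = 0"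
    using cutoff_exists[OF K oD KD] by blast
  obtain B where B: "B > 0" "\<And>x. \<bar>\<theta> x\<bar> \<le> B" "\<And>x. norm (E x) \<le> B" using C1c_bounded[OF \<theta>(1)] by blast
  obtain K1 where K1: "compact K1" "K1 \<subseteq> D" "\<And>x. x \<notin> K1 \<Longrightarrow> \<theta> x = 0 \<and> E x = 0" using C1cD(4)[OF \<theta>(1)] by blast
  have \<theta>U: "\<theta> x = 0 \<and> E x = 0" if "x \<notin> U" for x using K1 DU that by blast
  define \<zeta>' where "\<zeta>' = (\<lambda>x. \<theta> x * \<zeta> x)"
  define Z' where "Z' = (\<lambda>x. \<theta> x *\<^sub>R A x + \<zeta> x *\<^sub>R E x)"
  define c where "c = (\<lambda>k x. \<theta> x * trunc (sk (r k) x))"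
  define Zk where "Zk = (\<lambda>k x. \<theta> x *\<^sub>R Ak k x + trunc (sk (r k) x) *\<^sub>R E x)"
  have WZu: "wg UNIV \<zeta>' Z'" unfolding \<zeta>'_def Z'_def by (rule wg_cutoff[OF WA \<theta>(1)])
  have WZ: "wg U \<zeta>' Z'" by (rule wg_subset[OF WZu]) (auto simp: \<zeta>'_def Z'_def \<theta>U)
  have cU: "indicator U x * c k x = c k x" for k x using \<theta>U[of x] by (auto simp: c_def indicator_def)
  have Wc: "wg U (\<lambda>x. indicator U x * c k x) (Zk k)" for k
  proof -
    have "wg UNIV (c k) (Zk k)" unfolding c_def Zk_def by (rule wg_cutoff[OF WAk \<theta>(1)])
    then have "wg U (c k) (Zk k)" by (rule wg_subset) (auto simp: c_def Zk_def \<theta>U)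
    then show ?thesis by (simp add: cU)
  qed
  have cc: "continuous_on (closure U) (c k)" for k
  proof -
    \<comment> \<open>\<open>sk\<close> contains indicators and may jump. The product with \<theta>
      is continuous on \<open>D\<close> and 0 on the complement of \<open>K1\<close>, two open sets
      that cover the space.\<close>
    have "continuous_on (D \<union> - K1) (c k)"
    proof (rule continuous_on_open_Un[OF oD])
      show "open (- K1)" using K1(1) by (simp add: compact_imp_closed open_Compl)
      have "continuous_on D (\<lambda>x. \<theta> x * trunc (w (r k) x - w (r k) (x + h) - L * norm h))"
      proof (intro continuous_intros continuous_on_compose2[OF continuous_trunc])
        show "continuous_on D \<theta>" using C1cD(3)[OF \<theta>(1)] continuous_on_subset by blast
        have 1: "continuous_on U (w (r k))" by (rule continuous_on_subset[OF T(1) closure_subset])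
        then show "continuous_on D (w (r k))" using DU continuous_on_subset by blast
        show "continuous_on D (\<lambda>x. w (r k) (x + h))"
          by (rule continuous_on_compose2[OF 1]) (auto intro!: continuous_intros simp: D)
      qed auto
      then show "continuous_on D (c k)"
        by (rule continuous_on_eq) (auto simp: c_def sk_def D)
      have "continuous_on (- K1) (\<lambda>x. 0::real)" by simp
      then show "continuous_on (- K1) (c k)" by (rule continuous_on_eq) (use K1(3) in \<open>auto simp: c_def\<close>)
    qed
    moreover have "D \<union> - K1 = UNIV" using K1(2) by blast
    ultimately show ?thesis using continuous_on_subset by (metis subset_UNIV)
  qed
  note Wd = wg_diff[OF WAk WA]
  have LB: "norm (indicator U x * c k x - \<zeta>' x) \<le> B * (norm (trunc (sk (r k) x) - \<zeta> x) + norm (Ak k x - A x))"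
    and LB': "norm (Zk k x - Z' x) \<le> B * (norm (trunc (sk (r k) x) - \<zeta> x) + norm (Ak k x - A x))" for k x
  proof -
    let ?a = "trunc (sk (r k) x) - \<zeta> x" and ?b = "Ak k x - A x"
    have "indicator U x * c k x - \<zeta>' x = \<theta> x * ?a" unfolding cU by (simp add: c_def \<zeta>'_def algebra_simps)
    then have "norm (indicator U x * c k x - \<zeta>' x) = \<bar>\<theta> x\<bar> * norm ?a" by (simp add: abs_mult)
    also have "\<dots> \<le> B * norm ?a" by (intro mult_right_mono B) simp
    also have "\<dots> \<le> B * (norm ?a + norm ?b)" using B(1) by (intro mult_left_mono) auto
    finally show "norm (indicator U x * c k x - \<zeta>' x) \<le> B * (norm ?a + norm ?b)" .
    have "Zk k x - Z' x = \<theta> x *\<^sub>R ?b + ?a *\<^sub>R E x" by (simp add: Zk_def Z'_def algebra_simps)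
    then have "norm (Zk k x - Z' x) \<le> \<bar>\<theta> x\<bar> * norm ?b + norm ?a * norm (E x)"
      using norm_triangle_ineq[of "\<theta> x *\<^sub>R ?b" "?a *\<^sub>R E x"] by simp
    also have "\<dots> \<le> B * norm ?b + norm ?a * B" by (intro add_mono mult_right_mono mult_left_mono B) auto
    finally show "norm (Zk k x - Z' x) \<le> B * (norm ?a + norm ?b)" by (simp add: algebra_simps)
  qed
  have lims: "(\<lambda>k. \<integral>x. (norm (trunc (sk (r k) x) - \<zeta> x))\<^sup>2 \<partial>lborel) \<longlonglongrightarrow> 0"
    "(\<lambda>k. \<integral>x. (norm (Ak k x - A x))\<^sup>2 \<partial>lborel) \<longlonglongrightarrow> 0"
    using r(2,3) by (simp_all add: \<zeta>_def A_def Ak_def)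
  have m: "(\<lambda>x. trunc (sk (r k) x) - \<zeta> x) \<in> borel_measurable borel" "(\<lambda>x. Ak k x - A x) \<in> borel_measurable borel"
    "(\<lambda>x. indicator U x * c k x - \<zeta>' x) \<in> borel_measurable borel" "(\<lambda>x. Zk k x - Z' x) \<in> borel_measurable borel" for k
    using wgD(1,2)[OF Wd] wgD(1,2)[OF wg_diff[OF Wc WZ]] by auto
  have i: "integrable lborel (\<lambda>x. (norm (trunc (sk (r k) x) - \<zeta> x))\<^sup>2)" "integrable lborel (\<lambda>x. (norm (Ak k x - A x))\<^sup>2)" for k
    using wgD(3,4)[OF Wd[of k]] by simp_all
  have "(\<lambda>k. \<integral>x. (norm (indicator U x * c k x - \<zeta>' x))\<^sup>2 \<partial>lborel) \<longlonglongrightarrow> 0"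
    by (rule L2_combination_tendsto[where B = B, OF m(1) m(2) m(3) i(1) i(2) LB lims])
  then have L1: "(\<lambda>k. \<integral>x. (indicator U x * c k x - \<zeta>' x)\<^sup>2 \<partial>lborel) \<longlonglongrightarrow> 0" by simp
  have L2: "(\<lambda>k. \<integral>x. (norm (Zk k x - Z' x))\<^sup>2 \<partial>lborel) \<longlonglongrightarrow> 0"
    by (rule L2_combination_tendsto[where B = B, OF m(1) m(2) m(4) i(1) i(2) LB' lims])
  have eq: "AE x in lborel. \<zeta>' x = \<zeta> x \<and> Z' x = A x"
    using off
  proof eventually_elim
    case (elim x)
    show ?case
    proof (cases "x \<in> K")
      case False
      then have "\<zeta> x = 0" "A x = 0" using elim by (auto simp: \<zeta>_def A_def trunc_nonpos trunc'_nonpos)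
      then show ?thesis by (simp add: \<zeta>'_def Z'_def)
    qed (use \<theta>(3) in \<open>simp add: \<zeta>'_def Z'_def\<close>)
  qed
  have "(\<integral>x. G0 x \<bullet> Z' x \<partial>lborel) \<le> 0"
  proof (rule first_variation[OF U(1,2) min W uAE tr r(1) WZ cc Wc L1 L2])
    show "\<bar>c k x\<bar> \<le> \<bar>w (r k) x - g x\<bar>" if "x \<in> frontier U" for k x
    proof -
      have "x \<notin> U" using that U(1) by (simp add: frontier_def interior_open)
      then show ?thesis by (simp add: c_def \<theta>U)
    qed
    fix t :: real assume t: "0 \<le> t" "t \<le> 1"
    show "AE x in lborel. x \<in> U \<longrightarrow> \<phi> x \<le> u0 x - t * \<zeta>' x \<and> u0 x - t * \<zeta>' x \<le> \<psi> x"
      using obs AE_shift[OF obs, of h] eq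
    proof eventually_elim
      case (elim x)
      show ?case
      proof
        assume x: "x \<in> U"
        have z: "0 \<le> t * \<zeta>' x" "t * \<zeta>' x \<le> \<zeta> x"
          using elim t trunc_nonneg[of "s x"] by (auto simp: \<zeta>_def mult_left_le_one_le)
        have zs: "\<zeta> x \<le> max 0 (s x)" unfolding \<zeta>_def by (rule trunc_le)
        \<comment> \<open>Where s is positive, u0 x - \<zeta> x is at least u0 (x + h) + L
          \<bar>h\<bar>, which lies above \<phi> (x + h) + L \<bar>h\<bar> and so above \<phi>
          x.\<close>
        have "\<phi> x \<le> u0 x - \<zeta> x"
        proof (cases "0 < s x")
          case True
          then have xD: "x \<in> D" by (cases "x \<in> D") (simp_all add: s)
          then have xh: "x + h \<in> U" by (simp add: D)
          have "\<phi> x - \<phi> (x + h) \<le> L * norm h" using \<phi>[OF x xh] by simp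
          moreover have "\<phi> (x + h) \<le> u0 (x + h)" using elim xh by simp
          moreover have "\<zeta> x \<le> u0 x - u0 (x + h) - L * norm h" using zs True xD by (simp add: s)
          ultimately show ?thesis by linarith
        next
          case False
          then have "\<zeta> x = 0" by (simp add: \<zeta>_def trunc_nonpos)
          then show ?thesis using elim x by simp
        qed
        then show "\<phi> x \<le> u0 x - t * \<zeta>' x \<and> u0 x - t * \<zeta>' x \<le> \<psi> x" using z elim x by auto
      qed
    qed
  qed
  moreover have "(\<integral>x. G0 x \<bullet> Z' x \<partial>lborel) = (\<integral>x. G0 x \<bullet> A x \<partial>lborel)"
    by (rule integral_cong_AE) (use eq wgD(2)[OF WZ] wgD(2)[OF WA] wgD(2)[OF W] in auto)
  ultimately show "(\<integral>x. G0 x \<bullet> (trunc' (s x) *\<^sub>R S x) \<partial>lborel) \<le> 0" by (simp add: A_def)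
  obtain R where R: "\<forall>x. x \<notin> cball 0 R \<longrightarrow> \<zeta> x = 0 \<and> A x = 0" using wgD(7)[OF WA] by blast
  have "wg UNIV \<zeta> A"
    by (rule wg_AE_cong[OF WZu wgD(1,2)[OF WA]]) (use eq R in auto)
  then show "wg UNIV (\<lambda>x. trunc (s x)) (\<lambda>x. trunc' (s x) *\<^sub>R S x)" by (simp add: \<zeta>_def A_def)
qed

text \<open>Raising comes from \<open>minimizer_minus\<close> with the shift \<open>- h\<close>; its
  field at \<open>x + h\<close> is the field of the lowering at \<open>x\<close>. After translating
  the integral, both inequalities involve the same \<open>A\<close>, and their sum pairs it with
  \<open>S\<close>.\<close>

lemma translation_bound:
  fixes U :: "'a::euclidean_space set" and h :: 'a and u0 :: "'a \<Rightarrow> real" and G0 :: "'a \<Rightarrow> 'a"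
  assumes U: "open U" "bounded U" "U \<noteq> {}" and min: "minimizer U g \<phi> \<psi> u"
    and W: "wg U u0 G0" and uAE: "AE x in lborel. x \<in> U \<longrightarrow> u x = u0 x"
    and bdry: "AE x in lborel. x \<in> U \<longrightarrow> (\<forall>p\<in>frontier U. \<bar>u0 x - g p\<bar> \<le> C * norm (x - p))"
    and C: "0 \<le> C" and L: "3 * C \<le> L"
    and \<phi>: "\<And>x y. x \<in> U \<Longrightarrow> y \<in> U \<Longrightarrow> \<bar>\<phi> x - \<phi> y\<bar> \<le> L * norm (x - y)"
    and \<psi>: "\<And>x y. x \<in> U \<Longrightarrow> y \<in> U \<Longrightarrow> \<bar>\<psi> x - \<psi> y\<bar> \<le> L * norm (x - y)"
  shows "AE x in lborel. x \<in> U \<and> x + h \<in> U \<longrightarrow> u0 x - u0 (x + h) \<le> L * norm h"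
proof (cases "h = 0")
  case False
  define D where "D = {x \<in> U. x + h \<in> U}"
  define s where "s = (\<lambda>x. indicator D x * (u0 x - u0 (x + h) - L * norm h))"
  define S where "S = (\<lambda>x. indicator D x *\<^sub>R (G0 x - G0 (x + h)))"
  define A where "A = (\<lambda>x. trunc' (s x) *\<^sub>R S x)"
  note V = translation_variation[OF U min W uAE bdry C L \<phi> False D_def s_def S_def, folded A_def]
  have Wm: "wg U (\<lambda>x. - u0 x) (\<lambda>x. - G0 x)" using wg_scale[OF W, of "-1"] by simp
  have AEm: "AE x in lborel. x \<in> U \<longrightarrow> - u x = - u0 x" using uAE by eventually_elim simp
  have bm: "AE x in lborel. x \<in> U \<longrightarrow> (\<forall>p\<in>frontier U. \<bar>- u0 x - - g p\<bar> \<le> C * norm (x - p))"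
    using bdry by eventually_elim (simp add: abs_minus_commute)
  have \<psi>m: "\<bar>- \<psi> x - - \<psi> y\<bar> \<le> L * norm (x - y)" if "x \<in> U" "y \<in> U" for x y
    using \<psi>[OF that] by (simp add: abs_minus_commute)
  have hm: "- h \<noteq> 0" using False by simp
  define D' where "D' = {x \<in> U. x + - h \<in> U}"
  define s' where "s' = (\<lambda>x. indicator D' x * (- u0 x - - u0 (x + - h) - L * norm (- h)))"
  define S' where "S' = (\<lambda>x. indicator D' x *\<^sub>R (- G0 x - - G0 (x + - h)))"
  note V' = translation_variation[OF U minimizer_minus[OF U(1,2) min] Wm AEm bm C L \<psi>m hm D'_def s'_def S'_def]
  have ind: "indicator D' (x + h) = (indicator D x :: real)" for x by (auto simp: D_def D'_def indicator_def)
  have s': "s' (x + h) = s x" for x unfolding s'_def s_def ind by (simp add: algebra_simps)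
  have S': "S' (x + h) = S x" for x unfolding S'_def S_def ind by (simp add: algebra_simps)
  have "(\<lambda>x. - G0 x \<bullet> (trunc' (s' x) *\<^sub>R S' x)) \<in> borel_measurable borel"
    using wgD(2)[OF V'(1)] wgD(2)[OF W] by measurable
  from integral_shift[OF this, where x = h] V'(2)
  have neg: "(\<integral>x. - (G0 (x + h) \<bullet> A x) \<partial>lborel) \<le> 0" by (simp add: s' S' A_def)
  have V2: "(\<integral>x. G0 x \<bullet> A x \<partial>lborel) \<le> 0" using V(2) by (simp add: A_def)
  note Wh = wg_translate[OF W, of h]
  note i = integrable_inner_squares[OF wgD(2)[OF W] wgD(2)[OF V(1)] wgD(4)[OF W] wgD(4)[OF V(1)]]
    integrable_inner_squares[OF wgD(2)[OF Wh] wgD(2)[OF V(1)] wgD(4)[OF Wh] wgD(4)[OF V(1)]]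
  have SA: "S x \<bullet> A x = G0 x \<bullet> A x - G0 (x + h) \<bullet> A x" for x
    by (cases "x \<in> D") (simp_all add: A_def S_def inner_diff_left right_diff_distrib)
  have "integrable lborel (\<lambda>x. S x \<bullet> A x)" unfolding SA using i by simp
  moreover have "(\<integral>x. S x \<bullet> A x \<partial>lborel) \<le> 0"
    unfolding SA using i neg V2 by simp
  ultimately have "AE x in lborel. s x \<le> 0"
    using trunc_grad_zero[of s S] V(1) unfolding A_def by blast
  then show ?thesis by eventually_elim (auto simp: s_def D_def)
qed simp

subsection \<open>The boundary estimate\<close>

text \<open>Comparison with the barrier at \<open>p\<close> holds off a null set depending on
  \<open>p\<close>. It is applied on a countable dense set of boundary points, and continuity of
  \<open>g\<close> extends the bound to all of them with one null set; for this the constant of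
  \<open>barrier_exists\<close> has to be uniform in \<open>p\<close>.\<close>

lemma boundary_upper_bound:
  fixes U :: "'a::euclidean_space set"
  assumes dim: "2 \<le> DIM('a)" and U: "open U" "bounded U" "smooth_boundary U" and min: "minimizer U g \<phi> \<psi> u"
    and W: "wg U u0 G0" and uAE: "AE x in lborel. x \<in> U \<longrightarrow> u x = u0 x"
    and \<phi>: "\<phi> \<in> C01 U" and g: "g \<in> C11 U" and \<phi>g: "\<And>x. x \<in> frontier U \<Longrightarrow> \<phi> x \<le> g x"
  shows "\<exists>C\<ge>0. AE x in lborel. x \<in> U \<longrightarrow> (\<forall>p\<in>frontier U. u0 x \<le> g p + C * norm (x - p))"
proof -
  obtain C where C: "C \<ge> 0" "\<forall>p\<in>frontier U. \<exists>w D. superharmonic_on U w D \<and> (\<forall>x\<in>U. \<phi> x \<le> w x) \<and>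
    (\<forall>x\<in>frontier U. g x \<le> w x) \<and> (\<forall>x\<in>U. w x \<le> g p + C * norm (x - p))"
    using barrier_exists[OF U \<phi> g \<phi>g] by blast
  have each: "AE x in lborel. x \<in> U \<longrightarrow> u0 x \<le> g p + C * norm (x - p)" if p: "p \<in> frontier U" for p
  proof -
    from bspec[OF C(2) p] obtain w D where w: "superharmonic_on U w D" "\<forall>x\<in>U. \<phi> x \<le> w x" "\<forall>x\<in>frontier U. g x \<le> w x"
      "\<forall>x\<in>U. w x \<le> g p + C * norm (x - p)" by (elim exE conjE) (rule that)
    have "AE x in lborel. x \<in> U \<longrightarrow> u0 x \<le> w x"
      using w(2,3) by (intro comparison[OF dim U min W uAE w(1)]) auto
    then show ?thesis by eventually_elim (use w(4) in force)
  qed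
  obtain T where T: "countable T" "T \<subseteq> frontier U" "frontier U \<subseteq> closure T" using separable by blast
  have gc: "continuous_on (closure U) g" using g unfolding C11_def by blast
  have "AE x in lborel. \<forall>p\<in>T. x \<in> U \<longrightarrow> u0 x \<le> g p + C * norm (x - p)"
    using each T by (intro AE_ball_countable') auto
  then have "AE x in lborel. x \<in> U \<longrightarrow> (\<forall>p\<in>frontier U. u0 x \<le> g p + C * norm (x - p))"
  proof eventually_elim
    case (elim x)
    show ?case
    proof (intro impI ballI)
      fix p assume x: "x \<in> U" and p: "p \<in> frontier U"
      from subsetD[OF T(3) p] obtain q where q: "\<forall>n. q n \<in> T" "q \<longlonglongrightarrow> p" unfolding closure_sequential by blast
      have "q n \<in> closure U" for n using q(1) T(2) by (auto simp: frontier_def)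
      then have "(\<lambda>n. g (q n)) \<longlonglongrightarrow> g p"
        by (intro continuous_on_tendsto_compose[OF gc q(2)]) (use p in \<open>auto simp: frontier_def\<close>)
      then have "(\<lambda>n. g (q n) + C * norm (x - q n)) \<longlonglongrightarrow> g p + C * norm (x - p)"
        by (intro tendsto_intros q(2))
      then show "u0 x \<le> g p + C * norm (x - p)"
        by (rule LIMSEQ_le_const) (use elim q(1) x in auto)
    qed
  qed
  then show ?thesis using C(1) by blast
qed

subsection \<open>Lipschitz representatives\<close>

text \<open>A translation writes both mollifications with the same weights, so their difference is
  an average of differences of \<open>v\<close> for the single shift \<open>y - x\<close>, whose
  null set does not affect the integral.\<close>

lemma conv_moll_diff_le:
  fixes v :: "'a::euclidean_space \<Rightarrow> real"
  assumes v: "integrable lborel v"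
    and AE: "\<And>h. AE x in lborel. x \<in> U \<and> x + h \<in> U \<longrightarrow> v x - v (x + h) \<le> L * norm h"
    and r: "ball x r \<subseteq> U" "ball y r \<subseteq> U" "1 / (real k + 1) \<le> r"
  shows "conv (moll k) v x - conv (moll k) v y \<le> L * norm (x - y)"
proof -
  define h where "h = y - x"
  have [measurable]: "v \<in> borel_measurable borel" using v by simp
  have "conv (moll k) v y = (\<integral>w. moll k (x - w) *\<^sub>R v (w + h) \<partial>lborel)"
    unfolding conv_def by (subst integral_shift[where x = h, symmetric]) (simp_all add: h_def algebra_simps)
  then have "conv (moll k) v x - conv (moll k) v y = (\<integral>w. moll k (x - w) *\<^sub>R (v w - v (w + h)) \<partial>lborel)"
    unfolding conv_def using conv_moll_integrable[OF v, of k x] conv_moll_integrable[OF integrable_shift[OF v, of h], of k x]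
    by (simp add: algebra_simps)
  also have "\<dots> \<le> (\<integral>w. moll k (x - w) * (L * norm h) \<partial>lborel)"
  proof (rule integral_mono_AE)
    show "integrable lborel (\<lambda>w. moll k (x - w) *\<^sub>R (v w - v (w + h)))"
      by (intro conv_moll_integrable Bochner_Integration.integrable_diff v integrable_shift)
    show "integrable lborel (\<lambda>w. moll k (x - w) * (L * norm h))" using moll_integrable_reflect[of k x] by simp
    show "AE w in lborel. moll k (x - w) *\<^sub>R (v w - v (w + h)) \<le> moll k (x - w) * (L * norm h)"
      using AE[of h]
    proof eventually_elim
      case (elim w)
      show ?case
      proof (cases "1 / (real k + 1) \<le> norm (x - w)")
        case True
        then show ?thesis by (simp add: moll_zero)
      next
        case False
        then have "w \<in> ball x r" "w + h \<in> ball y r" using r(3) by (auto simp: dist_norm h_def algebra_simps)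
        then have "v w - v (w + h) \<le> L * norm h" using elim r(1,2) by blast
        then show ?thesis by (simp add: mult_left_mono moll_nonneg)
      qed
    qed
  qed
  also have "\<dots> = L * norm (x - y)" using moll_integral_reflect[of k x] by (simp add: h_def norm_minus_commute)
  finally show ?thesis .
qed

text \<open>A ball around a point of \<open>U\<close> that missed the set would meet
  \<open>U\<close> in a nonempty open null set.\<close>

lemma AE_dense:
  fixes U :: "'a::euclidean_space set"
  assumes U: "open U" and AE: "AE x in lborel. P x"
  shows "U \<subseteq> closure {x \<in> U. P x}"
proof
  fix x assume x: "x \<in> U"
  show "x \<in> closure {x \<in> U. P x}" unfolding closure_approachable
  proof (intro allI impI)
    fix e :: real assume e: "0 < e"
    show "\<exists>y\<in>{x \<in> U. P x}. dist y x < e"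
    proof (rule ccontr)
      assume no: "\<not> ?thesis"
      have "AE y in lborel. y \<notin> U \<inter> ball x e" using AE by eventually_elim (use no in \<open>auto simp: dist_commute\<close>)
      then have "U \<inter> ball x e \<in> null_sets lborel" using U by (subst AE_iff_null_sets) auto
      then have "negligible (U \<inter> ball x e)" by (simp add: negligible_iff_null_sets null_sets_completionI)
      moreover have "open (U \<inter> ball x e)" "U \<inter> ball x e \<noteq> {}" using U x e by (auto intro: exI[of _ x])
      ultimately show False using open_not_negligible by blast
    qed
  qed
qed

text \<open>The null set in the hypothesis depends on \<open>h\<close>, so values of
  \<open>v\<close> cannot be compared pair by pair. Mollifications satisfy the bound at all points
  well inside \<open>U\<close>; it passes to the set \<open>E\<close> where they converge to
  \<open>v\<close>, which is dense in \<open>U\<close>, and from there to the closure by Lipschitz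
  extension.\<close>

lemma lipschitz_representative:
  fixes v :: "'a::euclidean_space \<Rightarrow> real"
  assumes U: "open U" and v: "integrable lborel v" and L: "0 \<le> L"
    and AE: "\<And>h. AE x in lborel. x \<in> U \<and> x + h \<in> U \<longrightarrow> v x - v (x + h) \<le> L * norm h"
  shows "\<exists>v'. L-lipschitz_on (closure U) v' \<and> (AE x in lborel. x \<in> U \<longrightarrow> v x = v' x)"
proof -
  obtain r where r: "strict_mono r" and conv: "AE x in lborel. (\<lambda>k. conv (moll (r k)) v x) \<longlonglongrightarrow> v x"
    using conv_moll_AE[OF v] by blast
  define E where "E = {x \<in> U. (\<lambda>k. conv (moll (r k)) v x) \<longlonglongrightarrow> v x}"
  have le: "v x - v y \<le> L * norm (x - y)" if "x \<in> E" "y \<in> E" for x y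
  proof -
    obtain a where "a > 0" "ball x a \<subseteq> U" using \<open>x \<in> E\<close> openE[OF U, of x] by (auto simp: E_def)
    moreover obtain b where "b > 0" "ball y b \<subseteq> U" using \<open>y \<in> E\<close> openE[OF U, of y] by (auto simp: E_def)
    ultimately have ab: "min a b > 0" "ball x (min a b) \<subseteq> U" "ball y (min a b) \<subseteq> U" by auto
    have "\<forall>\<^sub>F k in sequentially. conv (moll k) v x - conv (moll k) v y \<le> L * norm (x - y)"
      using eventually_moll_radius[OF ab(1)] by eventually_elim (rule conv_moll_diff_le[OF v AE ab(2,3)])
    from eventually_subseq[OF r this]
    have ev: "\<forall>\<^sub>F k in sequentially. conv (moll (r k)) v x - conv (moll (r k)) v y \<le> L * norm (x - y)" .
    have "(\<lambda>k. conv (moll (r k)) v x - conv (moll (r k)) v y) \<longlonglongrightarrow> v x - v y"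
      using that by (intro tendsto_diff) (auto simp: E_def)
    from LIMSEQ_le_const2[OF this] ev show ?thesis by (simp add: eventually_sequentially)
  qed
  have "L-lipschitz_on E v"
  proof (rule lipschitz_onI[OF _ L])
    show "dist (v x) (v y) \<le> L * dist x y" if "x \<in> E" "y \<in> E" for x y
      using le[OF that] le[OF that(2,1)] by (simp add: dist_norm norm_minus_commute abs_le_iff)
  qed
  from lipschitz_extend_closure[OF this]
  obtain v' where v': "L-lipschitz_on (closure E) v'" "\<And>x. x \<in> E \<Longrightarrow> v' x = v x" by blast
  have "U \<subseteq> closure E" unfolding E_def by (rule AE_dense[OF U conv])
  then have "closure U \<subseteq> closure E" by (simp add: closure_minimal)
  then have "L-lipschitz_on (closure U) v'" using lipschitz_on_subset[OF v'(1)] by blast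
  moreover have "AE x in lborel. x \<in> U \<longrightarrow> v x = v' x" using conv by eventually_elim (simp add: E_def v'(2))
  ultimately show ?thesis by blast
qed

lemma C01_minus: "f \<in> C01 U \<Longrightarrow> (\<lambda>x. - f x) \<in> C01 U"
  by (simp add: C01_def)

lemma C11_minus:
  assumes "g \<in> C11 U"
  shows "(\<lambda>x. - g x) \<in> C11 U"
proof -
  obtain G L where "continuous_on (closure U) g" "\<forall>x\<in>U. GDERIV g x :> G x" "L-lipschitz_on (closure U) G"
    using assms unfolding C11_def by blast
  then have "continuous_on (closure U) (\<lambda>x. - g x)" "\<forall>x\<in>U. GDERIV (\<lambda>x. - g x) x :> - G x"
    "L-lipschitz_on (closure U) (\<lambda>x. - G x)"
    by (auto intro: continuous_intros GDERIV_minus)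
  then show ?thesis unfolding C11_def by (intro CollectI conjI exI)
qed

theorem mainTheorem3:
  fixes U :: "(real ^ 'n) set"
    and \<phi> \<psi> g u :: "real ^ 'n \<Rightarrow> real"
  assumes "CARD('n) \<ge> 2"
    and "smooth_bounded_domain U"
    and "\<phi> \<in> C01 U" and "\<psi> \<in> C01 U" and "g \<in> C11 U"
    and "\<forall>x\<in>U. \<phi> x \<le> \<psi> x"
    and "\<forall>x\<in>frontier U. \<phi> x \<le> g x \<and> g x \<le> \<psi> x"
    and "is_arg_min (energy U) (\<lambda>v. v \<in> admissible U g \<phi> \<psi>) u"
  shows "\<exists>u'\<in>C01 U. AE x in lebesgue_on U. u x = u' x"
proof -
  have dim: "2 \<le> DIM(real ^ 'n)" using assms(1) by simp
  have U: "open U" "bounded U" "smooth_boundary U" and ne: "U \<noteq> {}"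
    using assms(2) by (simp_all add: smooth_bounded_domain_def)
  have min: "minimizer U g \<phi> \<psi> u" using assms(8) by (simp add: minimizer_def)
  then have "u \<in> H1 U" by (simp add: minimizer_def is_arg_min_def admissible_def)
  then obtain u0 G0 where W: "wg U u0 G0" and uAE: "AE x in lborel. x \<in> U \<longrightarrow> u x = u0 x"
    using H1_wg[OF U(1,2)] by blast
  have Wm: "wg U (\<lambda>x. - u0 x) (\<lambda>x. - G0 x)" using wg_scale[OF W, of "-1"] by simp
  have AEm: "AE x in lborel. x \<in> U \<longrightarrow> - u x = - u0 x" using uAE by eventually_elim simp
  obtain C1 where C1: "0 \<le> C1" "AE x in lborel. x \<in> U \<longrightarrow> (\<forall>p\<in>frontier U. u0 x \<le> g p + C1 * norm (x - p))"
    using boundary_upper_bound[OF dim U min W uAE assms(3,5)] assms(7) by blast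
  \<comment> \<open>The lower bound at the boundary is the upper bound for \<open>- u\<close>, whose
    lower obstacle is \<open>- \<psi>\<close>.\<close>
  obtain C2 where C2: "0 \<le> C2" "AE x in lborel. x \<in> U \<longrightarrow> (\<forall>p\<in>frontier U. - u0 x \<le> - g p + C2 * norm (x - p))"
    using boundary_upper_bound[OF dim U minimizer_minus[OF U(1,2) min] Wm AEm C01_minus[OF assms(4)] C11_minus[OF assms(5)]]
      assms(7) by auto
  define C where "C = max C1 C2"
  have bdry: "AE x in lborel. x \<in> U \<longrightarrow> (\<forall>p\<in>frontier U. \<bar>u0 x - g p\<bar> \<le> C * norm (x - p))"
    using C1(2) C2(2)
  proof eventually_elim
    case (elim x)
    have "C1 * norm (x - p) \<le> C * norm (x - p)" "C2 * norm (x - p) \<le> C * norm (x - p)" for p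
      by (intro mult_right_mono; simp add: C_def)+
    then show ?case using elim by (smt (verit, best))
  qed
  obtain L\<phi> L\<psi> where Lip: "L\<phi>-lipschitz_on (closure U) \<phi>" "L\<psi>-lipschitz_on (closure U) \<psi>"
    using assms(3,4) unfolding C01_def by blast
  \<comment> \<open>One constant for the boundary margin and both obstacles, since lowering and
    raising must use the same truncated difference.\<close>
  define L where "L = max (3 * C) (max L\<phi> L\<psi>)"
  have C: "0 \<le> C" and L: "3 * C \<le> L" using C1(1) by (auto simp: C_def L_def)
  have lip: "\<bar>\<phi> x - \<phi> y\<bar> \<le> L * norm (x - y)" "\<bar>\<psi> x - \<psi> y\<bar> \<le> L * norm (x - y)" if "x \<in> U" "y \<in> U" for x y
  proof -
    have "L-lipschitz_on U \<phi>" "L-lipschitz_on U \<psi>"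
      using closure_subset[of U] by (auto intro: lipschitz_on_mono[OF Lip(1)] lipschitz_on_mono[OF Lip(2)] simp: L_def)
    from this[THEN lipschitz_onD, OF that]
    show "\<bar>\<phi> x - \<phi> y\<bar> \<le> L * norm (x - y)" "\<bar>\<psi> x - \<psi> y\<bar> \<le> L * norm (x - y)" by (simp_all add: dist_norm)
  qed
  obtain u' where u': "L-lipschitz_on (closure U) u'" "AE x in lborel. x \<in> U \<longrightarrow> u0 x = u' x"
    using lipschitz_representative[OF U(1) wg_integrable(1)[OF W] _ translation_bound[OF U(1,2) ne min W uAE bdry C L lip]] C L
    by auto
  have "AE x in lborel. x \<in> U \<longrightarrow> u x = u' x" using uAE u'(2) by eventually_elim simp
  then have "AE x in lebesgue_on U. u x = u' x" using U(1) by (subst AE_lebesgue_on) auto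
  then show ?thesis using u'(1) unfolding C01_def by blast
qed

end
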